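(* Let $A,\bar A,C,\bar C\in\mathbb{R}^{n\times n}$ and $B,\bar B,D,\bar D\in\mathbb{R}^{n\times m}$. (i) If the system $[A,\bar A,C,\bar C;B,\bar B,D,\bar D]$ is MF-$L^2$-stabilizable, then the controlled ODE system $[A+\bar A;B+\bar B]$ is stabilizable, i.e., there exists $\bar K\in\mathbb{R}^{m\times n}$ such that $$\sigma\big(A+\bar A+(B+\bar B)\bar K\big)\subseteq\mathbb{C}^-.$$ (ii) Suppose the controlled ODE system $[A+\bar A;B+\bar B]$ is stabilizable, and the controlled SDE system $[A,C;B,D]$ is $L^2$-stabilizable. Then the system $[A,\bar A,C,\bar C;B,\bar B,D,\bar D]$ is MF-$L^2$-stabilizable. (iii) Suppose that $C+\bar C+(D+\bar D)\bar K=0$ for some $\bar K\in\mathbb{R}^{m\times n}$ satisfying $\sigma\big(A+\bar A+(B+\bar B)\bar K\big)\subseteq\mathbb{C}^-$. Then the system $[A,\bar A,C,\bar C;B,\bar B,D,\bar D]$ is MF-$L^2$-stabilizable.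
   Context: $W(\cdot)$ is a one-dimensional standard Brownian motion on a complete filtered probability space, with its augmented natural filtration. $\sigma(M)$ denotes the spectrum of $M$ and $\mathbb{C}^-$ the open left half plane. $[A,\bar A,C,\bar C;B,\bar B,D,\bar D]$ denotes the controlled mean-field SDE $$dX(t)=\big\{AX(t)+\bar A\mathbb{E}[X(t)]+Bu(t)+\bar B\mathbb{E}[u(t)]\big\}dt+\big\{CX(t)+\bar C\mathbb{E}[X(t)]+Du(t)+\bar D\mathbb{E}[u(t)]\big\}dW(t),\quad t\ge0,\quad X(0)=x.$$ It is MF-$L^2$-stabilizable if there exists $(K,\bar K)\in\mathbb{R}^{m\times n}\times\mathbb{R}^{m\times n}$ such that for every $x\in\mathbb{R}^n$ the solution $X(\cdot)$ of $$dX=\big\{(A+BK)X+[\bar A+\bar B\bar K+B(\bar K-K)]\mathbb{E}[X]\big\}dt+\big\{(C+DK)X+[\bar C+\bar D\bar K+D(\bar K-K)]\mathbb{E}[X]\big\}dW,\quad X(0)=x,$$ together with $u(t)=K\{X(t)-\mathbb{E}[X(t)]\}+\bar K\mathbb{E}[X(t)]$, satisfies $\mathbb{E}\int_0^\infty(|X(t)|^2+|u(t)|^2)dt<\infty$. The controlled SDE system $[A,C;B,D]$ is $L^2$-stabilizable if there is $K\in\mathbb{R}^{m\times n}$ such that for every $x\in\mathbb{R}^n$ the solution of $dX=(A+BK)X\,dt+(C+DK)X\,dW$, $X(0)=x$, satisfies $\mathbb{E}\int_0^\infty(|X(t)|^2+|KX(t)|^2)dt<\infty$. *)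

theory Defs
  imports "HOL-Probability.Probability"
begin

section \<open>Stability of matrices and of controlled ODE systems\<close>

definition matrix_spectrum :: "real^'n^'n \<Rightarrow> complex set" where
  "matrix_spectrum A = {z. \<not> invertible (mat z - map_matrix complex_of_real A)}"

definition ode_stabilizable :: "real^'n^'n \<Rightarrow> real^'m^'n \<Rightarrow> bool" where
  "ode_stabilizable A B \<longleftrightarrow>
     (\<exists>K :: real^'n^'m. matrix_spectrum (A + B ** K) \<subseteq> {z. Re z < 0})"

section \<open>Brownian motion\<close>

text \<open>Processes are functions of a real time parameter and a sample point; only times
  \<open>t \<ge> 0\<close> are ever used.\<close>

definition augmented_filtration ::
    "'a measure \<Rightarrow> (real \<Rightarrow> 'a \<Rightarrow> real) \<Rightarrow> real \<Rightarrow> 'a measure" where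
  "augmented_filtration M W t =
     sigma (space M)
       ({W s -` S \<inter> space M | s S. 0 \<le> s \<and> s \<le> t \<and> S \<in> sets borel} \<union> null_sets M)"

locale standard_brownian_motion = prob_space M + complete_measure M
  for M :: "'a measure" +
  fixes W :: "real \<Rightarrow> 'a \<Rightarrow> real"
  assumes W_measurable: "0 \<le> t \<Longrightarrow> W t \<in> borel_measurable M"
    and W_zero: "AE \<omega> in M. W 0 \<omega> = 0"
    and W_continuous: "AE \<omega> in M. continuous_on {0..} (\<lambda>t. W t \<omega>)"
    and W_increment_normal: "0 \<le> s \<Longrightarrow> s < t \<Longrightarrow>
      distributed M lborel (\<lambda>\<omega>. W t \<omega> - W s \<omega>) (normal_density 0 (sqrt (t - s)))"
    and W_increment_indep: "0 \<le> s \<Longrightarrow> s < t \<Longrightarrow>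
      indep_set (sets (augmented_filtration M W s))
        {(\<lambda>\<omega>. W t \<omega> - W s \<omega>) -` S \<inter> space M | S. S \<in> sets borel}"

section \<open>The Ito integral of square-integrable integrands\<close>

text \<open>The simple process given by \<open>n\<close>, \<open>p\<close>, \<open>\<xi>\<close> has the value \<open>\<xi> i\<close> on the time interval
  \<open>(p i, p (i + 1)]\<close>, for \<open>i < n\<close>, and vanishes elsewhere.\<close>

definition simple_process_on ::
    "'a measure \<Rightarrow> (real \<Rightarrow> 'a \<Rightarrow> real) \<Rightarrow> real \<Rightarrow>
     nat \<Rightarrow> (nat \<Rightarrow> real) \<Rightarrow> (nat \<Rightarrow> 'a \<Rightarrow> 'b::euclidean_space) \<Rightarrow> bool" where
  "simple_process_on M W T n p \<xi> \<longleftrightarrow>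
     0 \<le> p 0 \<and> (\<forall>i<n. p i \<le> p (Suc i)) \<and> p n \<le> T \<and>
     (\<forall>i<n. \<xi> i \<in> borel_measurable (augmented_filtration M W (p i)) \<and>
            integrable M (\<lambda>\<omega>. (norm (\<xi> i \<omega>))\<^sup>2))"

definition simple_process ::
    "nat \<Rightarrow> (nat \<Rightarrow> real) \<Rightarrow> (nat \<Rightarrow> 'a \<Rightarrow> 'b::euclidean_space) \<Rightarrow> real \<Rightarrow> 'a \<Rightarrow> 'b" where
  "simple_process n p \<xi> t \<omega> = (\<Sum>i<n. indicator {p i<..p (Suc i)} t *\<^sub>R \<xi> i \<omega>)"

definition simple_ito_integral ::
    "(real \<Rightarrow> 'a \<Rightarrow> real) \<Rightarrow> nat \<Rightarrow> (nat \<Rightarrow> real) \<Rightarrow>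
     (nat \<Rightarrow> 'a \<Rightarrow> 'b::euclidean_space) \<Rightarrow> 'a \<Rightarrow> 'b" where
  "simple_ito_integral W n p \<xi> \<omega> = (\<Sum>i<n. (W (p (Suc i)) \<omega> - W (p i) \<omega>) *\<^sub>R \<xi> i \<omega>)"

definition mean_square_energy ::
    "'a measure \<Rightarrow> real set \<Rightarrow> (real \<Rightarrow> 'a \<Rightarrow> 'b::euclidean_space) \<Rightarrow> ennreal" where
  "mean_square_energy M I Z = (\<integral>\<^sup>+\<omega>. (\<integral>\<^sup>+t\<in>I. ennreal ((norm (Z t \<omega>))\<^sup>2) \<partial>lborel) \<partial>M)"

definition ito_integrand ::
    "'a measure \<Rightarrow> (real \<Rightarrow> 'a \<Rightarrow> real) \<Rightarrow> real \<Rightarrow> (real \<Rightarrow> 'a \<Rightarrow> 'b::euclidean_space) \<Rightarrow> bool" where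
  "ito_integrand M W T G \<longleftrightarrow>
     (\<lambda>(t, \<omega>). G t \<omega>) \<in> borel_measurable (restrict_space borel {0..T} \<Otimes>\<^sub>M M) \<and>
     (\<forall>t\<in>{0..T}. G t \<in> borel_measurable (augmented_filtration M W t)) \<and>
     mean_square_energy M {0..T} G < \<infinity>"

text \<open>\<open>Y\<close> is a version of the Ito integral of \<open>G\<close> against \<open>W\<close> over \<open>[0, T]\<close>, that is, the
  limit in mean square of the integrals of simple processes converging to \<open>G\<close>. By the Ito
  isometry this determines \<open>Y\<close> up to almost sure equality.\<close>

definition has_ito_integral ::
    "'a measure \<Rightarrow> (real \<Rightarrow> 'a \<Rightarrow> real) \<Rightarrow> real \<Rightarrow>
     (real \<Rightarrow> 'a \<Rightarrow> 'b::euclidean_space) \<Rightarrow> ('a \<Rightarrow> 'b) \<Rightarrow> bool" where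
  "has_ito_integral M W T G Y \<longleftrightarrow>
     ito_integrand M W T G \<and> Y \<in> borel_measurable M \<and>
     (\<exists>n p \<xi>. (\<forall>k. simple_process_on M W T (n k) (p k) (\<xi> k)) \<and>
        (\<lambda>k. mean_square_energy M {0..T}
               (\<lambda>t \<omega>. G t \<omega> - simple_process (n k) (p k) (\<xi> k) t \<omega>)) \<longlonglongrightarrow> 0 \<and>
        (\<lambda>k. \<integral>\<^sup>+\<omega>. ennreal ((norm (Y \<omega> - simple_ito_integral W (n k) (p k) (\<xi> k) \<omega>))\<^sup>2) \<partial>M)
               \<longlonglongrightarrow> 0)"

section \<open>Stochastic differential equations\<close>

text \<open>\<open>X\<close> is an adapted continuous process, square integrable on bounded time intervals, with
  \<open>dX = b dt + g dW\<close> and \<open>X(0) = x\<close>. For a stochastic differential equation, \<open>b\<close> and \<open>g\<close> are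
  the coefficients evaluated along \<open>X\<close>. Since \<open>X\<close> is continuous, requiring the
  integral equation almost surely for each fixed \<open>t\<close> is the same as requiring it almost
  surely for all \<open>t\<close> simultaneously (with a continuous version of the Ito integral).\<close>

definition ito_process ::
    "'a measure \<Rightarrow> (real \<Rightarrow> 'a \<Rightarrow> real) \<Rightarrow> 'b::euclidean_space \<Rightarrow>
     (real \<Rightarrow> 'a \<Rightarrow> 'b) \<Rightarrow> (real \<Rightarrow> 'a \<Rightarrow> 'b) \<Rightarrow> (real \<Rightarrow> 'a \<Rightarrow> 'b) \<Rightarrow> bool" where
  "ito_process M W x b g X \<longleftrightarrow>
     (\<forall>\<omega>\<in>space M. continuous_on {0..} (\<lambda>t. X t \<omega>)) \<and>
     (\<forall>t\<ge>0. X t \<in> borel_measurable (augmented_filtration M W t) \<and> integrable M (X t)) \<and>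
     (\<forall>T\<ge>0. mean_square_energy M {0..T} X < \<infinity>) \<and>
     (\<forall>t\<ge>0. (AE \<omega> in M. set_integrable lborel {0..t} (\<lambda>s. b s \<omega>)) \<and>
        has_ito_integral M W t g (\<lambda>\<omega>. X t \<omega> - x - (\<integral>s\<in>{0..t}. b s \<omega> \<partial>lborel)))"

definition infinite_horizon_cost ::
    "'a measure \<Rightarrow> (real \<Rightarrow> 'a \<Rightarrow> 'b::euclidean_space) \<Rightarrow>
     (real \<Rightarrow> 'a \<Rightarrow> 'c::euclidean_space) \<Rightarrow> ennreal" where
  "infinite_horizon_cost M X u =
     (\<integral>\<^sup>+\<omega>. (\<integral>\<^sup>+t\<in>{0..}. ennreal ((norm (X t \<omega>))\<^sup>2 + (norm (u t \<omega>))\<^sup>2) \<partial>lborel) \<partial>M)"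

definition sde_closed_loop ::
    "'a measure \<Rightarrow> (real \<Rightarrow> 'a \<Rightarrow> real) \<Rightarrow> real^'n^'n \<Rightarrow> real^'n^'n \<Rightarrow>
     real^'m^'n \<Rightarrow> real^'m^'n \<Rightarrow> real^'n^'m \<Rightarrow> real^'n \<Rightarrow> (real \<Rightarrow> 'a \<Rightarrow> real^'n) \<Rightarrow> bool" where
  "sde_closed_loop M W A C B D K x X \<longleftrightarrow>
     ito_process M W x
       (\<lambda>t \<omega>. (A + B ** K) *v X t \<omega>)
       (\<lambda>t \<omega>. (C + D ** K) *v X t \<omega>) X"

text \<open>The solution of the closed-loop equation is unique up to indistinguishability. In the two
  definitions of stabilizability, ``the solution satisfies \<open>P\<close>'' is rendered as: there is a
  solution, and every solution satisfies \<open>P\<close>.\<close>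

definition L2_stabilizable ::
    "'a measure \<Rightarrow> (real \<Rightarrow> 'a \<Rightarrow> real) \<Rightarrow> real^'n^'n \<Rightarrow> real^'n^'n \<Rightarrow>
     real^'m^'n \<Rightarrow> real^'m^'n \<Rightarrow> bool" where
  "L2_stabilizable M W A C B D \<longleftrightarrow>
     (\<exists>K :: real^'n^'m. \<forall>x.
        (\<exists>X. sde_closed_loop M W A C B D K x X) \<and>
        (\<forall>X. sde_closed_loop M W A C B D K x X \<longrightarrow>
           infinite_horizon_cost M X (\<lambda>t \<omega>. K *v X t \<omega>) < \<infinity>))"

text \<open>In the following, \<open>A'\<close>, \<open>K'\<close>, ... stand for the coefficients usually written with a bar,
  which act on the expectations.\<close>

definition mf_closed_loop ::
    "'a measure \<Rightarrow> (real \<Rightarrow> 'a \<Rightarrow> real) \<Rightarrow>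
     real^'n^'n \<Rightarrow> real^'n^'n \<Rightarrow> real^'n^'n \<Rightarrow> real^'n^'n \<Rightarrow>
     real^'m^'n \<Rightarrow> real^'m^'n \<Rightarrow> real^'m^'n \<Rightarrow> real^'m^'n \<Rightarrow>
     real^'n^'m \<Rightarrow> real^'n^'m \<Rightarrow> real^'n \<Rightarrow> (real \<Rightarrow> 'a \<Rightarrow> real^'n) \<Rightarrow> bool" where
  "mf_closed_loop M W A A' C C' B B' D D' K K' x X \<longleftrightarrow>
     ito_process M W x
       (\<lambda>t \<omega>. (A + B ** K) *v X t \<omega>
              + (A' + B' ** K' + B ** (K' - K)) *v integral\<^sup>L M (X t))
       (\<lambda>t \<omega>. (C + D ** K) *v X t \<omega>
              + (C' + D' ** K' + D ** (K' - K)) *v integral\<^sup>L M (X t)) X"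

definition mf_feedback_control ::
    "'a measure \<Rightarrow> real^'n^'m \<Rightarrow> real^'n^'m \<Rightarrow> (real \<Rightarrow> 'a \<Rightarrow> real^'n) \<Rightarrow>
     real \<Rightarrow> 'a \<Rightarrow> real^'m" where
  "mf_feedback_control M K K' X t \<omega> =
     K *v (X t \<omega> - integral\<^sup>L M (X t)) + K' *v integral\<^sup>L M (X t)"

definition MF_L2_stabilizable ::
    "'a measure \<Rightarrow> (real \<Rightarrow> 'a \<Rightarrow> real) \<Rightarrow>
     real^'n^'n \<Rightarrow> real^'n^'n \<Rightarrow> real^'n^'n \<Rightarrow> real^'n^'n \<Rightarrow>
     real^'m^'n \<Rightarrow> real^'m^'n \<Rightarrow> real^'m^'n \<Rightarrow> real^'m^'n \<Rightarrow> bool" where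
  "MF_L2_stabilizable M W A A' C C' B B' D D' \<longleftrightarrow>
     (\<exists>(K :: real^'n^'m) (K' :: real^'n^'m). \<forall>x.
        (\<exists>X. mf_closed_loop M W A A' C C' B B' D D' K K' x X) \<and>
        (\<forall>X. mf_closed_loop M W A A' C C' B B' D D' K K' x X \<longrightarrow>
           infinite_horizon_cost M X (mf_feedback_control M K K' X) < \<infinity>))"

end

theory Submission
  imports Defs "HOL-Computational_Algebra.Fundamental_Theorem_Algebra"
begin

text \<open>The mean \<open>m = E X\<close> of a closed-loop solution solves the linear equation
  \<open>m' = (A + A' + (B + B') K') m\<close>, and \<open>norm (m t)\<^sup>2 \<le> E (norm (X t))\<^sup>2\<close>; so a finite cost makes every
  solution of this equation square integrable, which forces the spectrum into the left half plane.
  Conversely, the fluctuation \<open>Y = X - m\<close> starts at 0 and solves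
  \<open>dY = (A + B K) Y dt + ((C + D K) Y + c) dW\<close> with \<open>c = (C + C' + (D + D') K') m\<close>, so that
  \<open>P = E Y Y\<^sup>T\<close> satisfies \<open>P' = L P + c c\<^sup>T\<close> with the Lyapunov operator \<open>L\<close> of \<open>A + B K\<close>, \<open>C + D K\<close>.
  If \<open>c = 0\<close>, then \<open>P = 0\<close>. If \<open>[A, C; B, D]\<close> is stabilized by \<open>K\<close>, the integrated covariances of its
  solutions invert \<open>L\<close> on symmetric matrices and yield a linear functional \<open>\<psi>\<close>, nonnegative on
  covariances, with \<open>\<psi> (L S) = - trace S\<close>; applied to the equation of \<open>P\<close> it bounds
  \<open>\<integral> E (norm Y)\<^sup>2\<close> by a multiple of \<open>\<integral> (norm m)\<^sup>2\<close>. The equations have solutions because the Euler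
  scheme on dyadic grids converges uniformly on compact time intervals almost surely.\<close>

section \<open>Square-integrable functions\<close>

text \<open>The Ito integral is given at each time separately, as a mean-square limit, so the
  stochastic calculus is reduced to second moments at fixed times. A solution is split as
  \<open>X = U + N\<close> into a drift part \<open>U\<close> with differentiable paths and an Ito
  integral \<open>N\<close>. The expected product of \<open>X\<close> with itself then comes from
  the ordinary product rule for \<open>U\<close>, the isometry for \<open>N\<close> and, in the
  cross terms, the orthogonality of future increments to the past. The mean-field equation contains
  the expectation of its own solution. Its mean must solve a closed linear equation, so that
  equation is solved first, its solution enters the stochastic equation as a known input, and it is
  identified afterwards with the mean of the solution obtained. In (ii) the hypothesis concerns a
  homogeneous equation, whereas the fluctuation carries a source. On covariances the source only
  adds an inhomogeneity to the same linear equation, and a linear functional built from the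
  homogeneous solutions tests the inhomogeneous one.\<close>

definition square_integrable :: "'x measure \<Rightarrow> ('x \<Rightarrow> 'b::euclidean_space) \<Rightarrow> bool" where
  "square_integrable N f \<longleftrightarrow> f \<in> borel_measurable N \<and> integrable N (\<lambda>x. (norm (f x))\<^sup>2)"

lemma square_integrableD[measurable_dest]: "square_integrable N f \<Longrightarrow> f \<in> borel_measurable N"
  by (simp add: square_integrable_def)

lemma square_integrable_sq: "square_integrable N f \<Longrightarrow> integrable N (\<lambda>x. (norm (f x))\<^sup>2)"
  by (simp add: square_integrable_def)

text \<open>Energies and costs are given in \<open>ennreal\<close>, whereas the estimates below
  compute with real integrals; this equivalence is the passage between the two.\<close>

lemma square_integrable_iff_nn_integral:
  "square_integrable N f \<longleftrightarrow>
     f \<in> borel_measurable N \<and> (\<integral>\<^sup>+x. ennreal ((norm (f x))\<^sup>2) \<partial>N) < \<infinity>"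
  by (auto simp: square_integrable_def integrable_iff_bounded)

lemma square_integrable_nn_integral:
  "square_integrable N f \<Longrightarrow>
     (\<integral>\<^sup>+x. ennreal ((norm (f x))\<^sup>2) \<partial>N) = ennreal (\<integral>x. (norm (f x))\<^sup>2 \<partial>N)"
  by (simp add: square_integrable_def nn_integral_eq_integral)

lemma square_integrable_bound:
  assumes "f \<in> borel_measurable N" "integrable N g" "\<And>x. x \<in> space N \<Longrightarrow> (norm (f x))\<^sup>2 \<le> g x"
  shows "square_integrable N f" "(\<integral>x. (norm (f x))\<^sup>2 \<partial>N) \<le> (\<integral>x. g x \<partial>N)"
proof -
  have i: "integrable N (\<lambda>x. (norm (f x))\<^sup>2)"
    using assms
    by (intro Bochner_Integration.integrable_bound[OF assms(2)]) (auto intro!: AE_I2 intro: order_trans[OF _ abs_ge_self])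
  then show "square_integrable N f" using assms by (simp add: square_integrable_def)
  show "(\<integral>x. (norm (f x))\<^sup>2 \<partial>N) \<le> (\<integral>x. g x \<partial>N)"
    using assms i by (intro integral_mono) auto
qed

lemma norm_add_sq_le: "(norm (x + y))\<^sup>2 \<le> 2 * (norm x)\<^sup>2 + 2 * (norm (y::'b::real_normed_vector))\<^sup>2"
proof -
  have "(norm (x + y))\<^sup>2 \<le> (norm x + norm y)\<^sup>2"
    by (intro power_mono norm_triangle_ineq) auto
  also have "\<dots> \<le> 2 * (norm x)\<^sup>2 + 2 * (norm y)\<^sup>2"
    using zero_le_power2[of "norm x - norm y"] by (simp add: power2_eq_square algebra_simps)
  finally show ?thesis .
qed

lemma square_integrable_add:
  assumes "square_integrable N f" "square_integrable N g"
  shows "square_integrable N (\<lambda>x. f x + g x)"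
    and "(\<integral>x. (norm (f x + g x))\<^sup>2 \<partial>N) \<le> 2 * (\<integral>x. (norm (f x))\<^sup>2 \<partial>N) + 2 * (\<integral>x. (norm (g x))\<^sup>2 \<partial>N)"
proof -
  have [measurable]: "f \<in> borel_measurable N" "g \<in> borel_measurable N"
    and [simp]: "integrable N (\<lambda>x. (norm (f x))\<^sup>2)" "integrable N (\<lambda>x. (norm (g x))\<^sup>2)"
    using assms by (auto simp: square_integrable_def)
  note * = square_integrable_bound[of "\<lambda>x. f x + g x" N "\<lambda>x. 2 * (norm (f x))\<^sup>2 + 2 * (norm (g x))\<^sup>2"]
  show "square_integrable N (\<lambda>x. f x + g x)"
    by (rule *(1)) (auto simp: norm_add_sq_le)
  show "(\<integral>x. (norm (f x + g x))\<^sup>2 \<partial>N) \<le> 2 * (\<integral>x. (norm (f x))\<^sup>2 \<partial>N) + 2 * (\<integral>x. (norm (g x))\<^sup>2 \<partial>N)"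
    using *(2) by (auto simp: norm_add_sq_le)
qed

lemma square_integrable_minus:
  "square_integrable N f \<Longrightarrow> square_integrable N (\<lambda>x. - f x)"
  by (auto simp: square_integrable_def)

lemma square_integrable_diff:
  assumes "square_integrable N f" "square_integrable N g"
  shows "square_integrable N (\<lambda>x. f x - g x)"
    and "(\<integral>x. (norm (f x - g x))\<^sup>2 \<partial>N) \<le> 2 * (\<integral>x. (norm (f x))\<^sup>2 \<partial>N) + 2 * (\<integral>x. (norm (g x))\<^sup>2 \<partial>N)"
  using square_integrable_add[OF assms(1) square_integrable_minus[OF assms(2)]] by auto

lemma square_integrable_bounded_linear:
  assumes "bounded_linear L" "square_integrable N f"
  shows "square_integrable N (\<lambda>x. L (f x))"
proof -
  interpret bounded_linear L by fact
  obtain K where K: "\<And>x. norm (L x) \<le> norm x * K" using bounded by blast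
  show ?thesis
  proof (rule square_integrable_bound(1)[where g="\<lambda>x. K\<^sup>2 * (norm (f x))\<^sup>2"])
    show "(\<lambda>x. L (f x)) \<in> borel_measurable N"
      using assms borel_measurable_continuous_onI[OF continuous_on[OF continuous_on_id]]
      by (auto simp: square_integrable_def intro: measurable_compose)
    show "integrable N (\<lambda>x. K\<^sup>2 * (norm (f x))\<^sup>2)" using assms by (auto simp: square_integrable_def)
    fix x show "(norm (L (f x)))\<^sup>2 \<le> K\<^sup>2 * (norm (f x))\<^sup>2"
      using power_mono[OF K[of "f x"], of 2] by (auto simp: power_mult_distrib mult.commute)
  qed
qed

lemma square_integrable_scaleR: "square_integrable N f \<Longrightarrow> square_integrable N (\<lambda>x. c *\<^sub>R f x)"
  by (rule square_integrable_bounded_linear[OF bounded_linear_scaleR_right])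

lemma square_integrable_zero: "square_integrable N (\<lambda>x. 0)"
  by (auto simp: square_integrable_def)

lemma square_integrable_sum:
  "(\<And>i. i \<in> I \<Longrightarrow> square_integrable N (f i)) \<Longrightarrow> square_integrable N (\<lambda>x. \<Sum>i\<in>I. f i x)"
  by (induction I rule: infinite_finite_induct) (auto intro: square_integrable_add square_integrable_zero)

lemma (in finite_measure) square_integrable_const: "square_integrable M (\<lambda>x. c)"
  by (auto simp: square_integrable_def)

lemma (in finite_measure) square_integrable_integrable:
  assumes "square_integrable M f" shows "integrable M f"
proof (rule Bochner_Integration.integrable_bound[of M "\<lambda>x. 1 + (norm (f x))\<^sup>2"])
  have "t \<le> 1 + t\<^sup>2" for t :: real using zero_le_power2[of "t - 1/2"] by (simp add: power2_eq_square algebra_simps)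
  then show "AE x in M. norm (f x) \<le> norm (1 + (norm (f x))\<^sup>2)" by (auto intro!: AE_I2)
qed (use assms in \<open>auto simp: square_integrable_def\<close>)

lemma square_integrable_cong_AE:
  assumes "square_integrable N f" "g \<in> borel_measurable N" "AE x in N. f x = g x"
  shows "square_integrable N g" "(\<integral>x. (norm (g x))\<^sup>2 \<partial>N) = (\<integral>x. (norm (f x))\<^sup>2 \<partial>N)"
proof -
  have [measurable]: "f \<in> borel_measurable N" "g \<in> borel_measurable N" using assms by (auto simp: square_integrable_def)
  have e: "AE x in N. (norm (f x))\<^sup>2 = (norm (g x))\<^sup>2" using assms(3) by eventually_elim auto
  show "square_integrable N g" using assms(1) integrable_cong_AE[OF _ _ e] by (auto simp: square_integrable_def)
  show "(\<integral>x. (norm (g x))\<^sup>2 \<partial>N) = (\<integral>x. (norm (f x))\<^sup>2 \<partial>N)"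
    by (rule sym, rule integral_cong_AE[OF _ _ e]) auto
qed

text \<open>Products are treated for an arbitrary bounded bilinear map. Its instances are scalar
  multiplication (for means), the inner product (for energies) and \<open>outer\<close> (for
  covariances).\<close>

lemma square_integrable_bilinear:
  assumes "bounded_bilinear \<beta>" "square_integrable N f" "square_integrable N g"
  shows "integrable N (\<lambda>x. \<beta> (f x) (g x) :: 'c::euclidean_space)"
proof -
  interpret bounded_bilinear \<beta> by fact
  obtain K where K: "K > 0" "\<And>x y. norm (\<beta> x y) \<le> norm x * norm y * K" using pos_bounded by blast
  have [measurable]: "f \<in> borel_measurable N" "g \<in> borel_measurable N" using assms by (auto simp: square_integrable_def)
  have [simp]: "integrable N (\<lambda>x. (norm (f x))\<^sup>2)" "integrable N (\<lambda>x. (norm (g x))\<^sup>2)"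
    using assms by (auto simp: square_integrable_def)
  have "continuous_on UNIV (\<lambda>x::_\<times>_. \<beta> (fst x) (snd x))"
    by (intro continuous_on continuous_intros)
  then have 1: "(\<lambda>x. \<beta> (f x) (g x)) \<in> borel_measurable N"
    by (rule borel_measurable_continuous_Pair[rotated 2]) auto
  show ?thesis
  proof (rule Bochner_Integration.integrable_bound[OF _ 1])
    show "integrable N (\<lambda>x. K * ((norm (f x))\<^sup>2 + (norm (g x))\<^sup>2))" by simp
    show "AE x in N. norm (\<beta> (f x) (g x)) \<le> norm (K * ((norm (f x))\<^sup>2 + (norm (g x))\<^sup>2))"
    proof (rule AE_I2)
      fix x
      have "norm (f x) * norm (g x) \<le> (norm (f x))\<^sup>2 + (norm (g x))\<^sup>2"
        using zero_le_power2[of "norm (f x) - norm (g x)"] mult_nonneg_nonneg[OF norm_ge_zero[of "f x"] norm_ge_zero[of "g x"]]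
        unfolding power2_diff by linarith
      then have "norm (f x) * norm (g x) * K \<le> K * ((norm (f x))\<^sup>2 + (norm (g x))\<^sup>2)"
        using K(1) by (simp add: mult.commute)
      then show "norm (\<beta> (f x) (g x)) \<le> norm (K * ((norm (f x))\<^sup>2 + (norm (g x))\<^sup>2))"
        using K(2)[of "f x" "g x"] by (auto intro: order_trans[OF _ abs_ge_self])
    qed
  qed
qed

text \<open>Discriminant argument: the integral of \<open>(t * norm f - norm g)\<^sup>2\<close> is a
  quadratic polynomial in \<open>t\<close> without negative values.\<close>

lemma Cauchy_Schwarz_integral:
  assumes "square_integrable N f" "square_integrable N g"
  shows "(\<integral>x. norm (f x) * norm (g x) \<partial>N) \<le> sqrt (\<integral>x. (norm (f x))\<^sup>2 \<partial>N) * sqrt (\<integral>x. (norm (g x))\<^sup>2 \<partial>N)"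
proof -
  let ?A = "\<integral>x. (norm (f x))\<^sup>2 \<partial>N" and ?B = "\<integral>x. (norm (g x))\<^sup>2 \<partial>N" and ?C = "\<integral>x. norm (f x) * norm (g x) \<partial>N"
  have f: "square_integrable N (\<lambda>x. norm (f x))" "square_integrable N (\<lambda>x. norm (g x))"
    using assms by (auto simp: square_integrable_def)
  have i: "integrable N (\<lambda>x. (norm (f x))\<^sup>2)" "integrable N (\<lambda>x. (norm (g x))\<^sup>2)" 
    "integrable N (\<lambda>x. norm (f x) * norm (g x))"
    using assms square_integrable_bilinear[OF bounded_bilinear_mult f] by (auto simp: square_integrable_def)
  have q: "0 \<le> ?A * t\<^sup>2 - 2 * ?C * t + ?B" for t
  proof -
    have "0 \<le> (\<integral>x. (t * norm (f x) - norm (g x))\<^sup>2 \<partial>N)" by (rule integral_nonneg_AE) auto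
    also have "(\<integral>x. (t * norm (f x) - norm (g x))\<^sup>2 \<partial>N)
       = (\<integral>x. t\<^sup>2 * (norm (f x))\<^sup>2 - (2 * t) * (norm (f x) * norm (g x)) + (norm (g x))\<^sup>2 \<partial>N)"
      by (intro Bochner_Integration.integral_cong) (auto simp: power2_eq_square algebra_simps)
    also have "\<dots> = t\<^sup>2 * ?A - (2 * t) * ?C + ?B" using i by simp
    finally show ?thesis by (simp add: algebra_simps)
  qed
  have "?A \<ge> 0" "?B \<ge> 0" "?C \<ge> 0" by (auto intro!: integral_nonneg_AE)
  have "?C\<^sup>2 \<le> ?A * ?B"
  proof (cases "?A = 0")
    case True
    have "?C = 0"
    proof (rule ccontr)
      assume "?C \<noteq> 0"
      \<comment> \<open>The degenerate quadratic is \<open>?B - 2 * ?C * t\<close>; this value of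
        \<open>t\<close> makes it negative.\<close>
      then have "?A * ((?B + 1) / ?C)\<^sup>2 - 2 * ?C * ((?B + 1) / ?C) + ?B = - ?B - 2"
        using True by (simp add: field_simps)
      then show False using q[of "(?B + 1) / ?C"] \<open>?B \<ge> 0\<close> by linarith
    qed
    then show ?thesis using True by simp
  next
    case False
    then have "?A > 0" using \<open>?A \<ge> 0\<close> by linarith
    \<comment> \<open>\<open>?C / ?A\<close> is the minimizer of the quadratic; the factor
      \<open>?A\<close> clears denominators.\<close>
    have "0 \<le> ?A * (?A * (?C / ?A)\<^sup>2 - 2 * ?C * (?C / ?A) + ?B)"
      using q[of "?C / ?A"] \<open>?A > 0\<close> by (intro mult_nonneg_nonneg) auto
    also have "\<dots> = ?A * ?B - ?C\<^sup>2" using \<open>?A > 0\<close> by (simp add: field_simps power2_eq_square)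
    finally show ?thesis by simp
  qed
  then have "sqrt (?C\<^sup>2) \<le> sqrt (?A * ?B)" by (rule real_sqrt_le_mono)
  then show ?thesis using \<open>?C \<ge> 0\<close> by (simp only: real_sqrt_mult real_sqrt_abs abs_of_nonneg)
qed

lemma norm_integral_bilinear_le:
  fixes \<beta> :: "'b::euclidean_space \<Rightarrow> 'd::euclidean_space \<Rightarrow> 'c::euclidean_space"
  assumes \<beta>: "bounded_bilinear \<beta>" and K: "K > 0" "\<And>x y. norm (\<beta> x y) \<le> norm x * norm y * K"
    and *: "square_integrable N f" "square_integrable N g"
  shows "norm (\<integral>x. \<beta> (f x) (g x) \<partial>N)
    \<le> K * (sqrt (\<integral>x. (norm (f x))\<^sup>2 \<partial>N) * sqrt (\<integral>x. (norm (g x))\<^sup>2 \<partial>N))"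
proof -
  have f: "square_integrable N (\<lambda>x. norm (f x))" "square_integrable N (\<lambda>x. norm (g x))"
    using * by (auto simp: square_integrable_def)
  have "norm (\<integral>x. \<beta> (f x) (g x) \<partial>N) \<le> (\<integral>x. K * (norm (f x) * norm (g x)) \<partial>N)"
    using square_integrable_bilinear[OF \<beta> *] square_integrable_bilinear[OF bounded_bilinear_mult f] K(2)
    by (intro order_trans[OF integral_norm_bound integral_mono]) (auto simp: mult.commute)
  also have "\<dots> \<le> K * (sqrt (\<integral>x. (norm (f x))\<^sup>2 \<partial>N) * sqrt (\<integral>x. (norm (g x))\<^sup>2 \<partial>N))"
    using K(1) Cauchy_Schwarz_integral[OF *] by simp
  finally show ?thesis .
qed

text \<open>Continuity of expected products with respect to mean-square convergence. Identities for
  Ito integrals are proved for step integrands and carried to the limit by this lemma.\<close>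

lemma tendsto_integral_bilinear:
  assumes \<beta>: "bounded_bilinear (\<beta> :: 'b::euclidean_space \<Rightarrow> 'd::euclidean_space \<Rightarrow> 'c::euclidean_space)"
    and f: "\<And>k. square_integrable N (f k)" "square_integrable N f0"
    and g: "\<And>k. square_integrable N (g k)" "square_integrable N g0"
    and cf: "(\<lambda>k. \<integral>x. (norm (f k x - f0 x))\<^sup>2 \<partial>N) \<longlonglongrightarrow> 0"
    and cg: "(\<lambda>k. \<integral>x. (norm (g k x - g0 x))\<^sup>2 \<partial>N) \<longlonglongrightarrow> 0"
  shows "(\<lambda>k. \<integral>x. \<beta> (f k x) (g k x) \<partial>N) \<longlonglongrightarrow> (\<integral>x. \<beta> (f0 x) (g0 x) \<partial>N)"
proof -
  interpret bounded_bilinear \<beta> by fact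
  obtain K where K: "K > 0" "\<And>x y. norm (\<beta> x y) \<le> norm x * norm y * K" using pos_bounded by blast
  note CS = norm_integral_bilinear_le[OF \<beta> K]
  let ?df = "\<lambda>k x. f k x - f0 x" and ?dg = "\<lambda>k x. g k x - g0 x"
  have d: "square_integrable N (?df k)" "square_integrable N (?dg k)" for k
    using f g by (auto intro: square_integrable_diff)
  let ?n = "\<lambda>h. sqrt (\<integral>x. (norm (h x))\<^sup>2 \<partial>N)"
  \<comment> \<open>The difference is expanded so that each summand contains a factor that tends to
    0 in mean square.\<close>
  have e: "(\<integral>x. \<beta> (f k x) (g k x) \<partial>N) - (\<integral>x. \<beta> (f0 x) (g0 x) \<partial>N) =
     (\<integral>x. \<beta> (?df k x) (?dg k x) \<partial>N) + (\<integral>x. \<beta> (?df k x) (g0 x) \<partial>N) + (\<integral>x. \<beta> (f0 x) (?dg k x) \<partial>N)" for k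
  proof -
    have i: "integrable N (\<lambda>x. \<beta> (f k x) (g k x))" "integrable N (\<lambda>x. \<beta> (f0 x) (g0 x))"
      "integrable N (\<lambda>x. \<beta> (?df k x) (?dg k x))" "integrable N (\<lambda>x. \<beta> (?df k x) (g0 x))"
      "integrable N (\<lambda>x. \<beta> (f0 x) (?dg k x))"
      by (rule square_integrable_bilinear[OF \<beta>]; rule d f g)+
    have "(\<integral>x. \<beta> (f k x) (g k x) \<partial>N) - (\<integral>x. \<beta> (f0 x) (g0 x) \<partial>N)
      = (\<integral>x. \<beta> (?df k x) (?dg k x) + \<beta> (?df k x) (g0 x) + \<beta> (f0 x) (?dg k x) \<partial>N)"
      unfolding Bochner_Integration.integral_diff[OF i(1,2), symmetric]
      by (intro Bochner_Integration.integral_cong) (auto simp: diff_left diff_right)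
    also have "\<dots> = (\<integral>x. \<beta> (?df k x) (?dg k x) \<partial>N) + (\<integral>x. \<beta> (?df k x) (g0 x) \<partial>N) + (\<integral>x. \<beta> (f0 x) (?dg k x) \<partial>N)"
      by (simp only: Bochner_Integration.integral_add i Bochner_Integration.integrable_add)
    finally show ?thesis .
  qed
  have "(\<lambda>k. (\<integral>x. \<beta> (f k x) (g k x) \<partial>N) - (\<integral>x. \<beta> (f0 x) (g0 x) \<partial>N)) \<longlonglongrightarrow> 0"
  proof (rule Lim_null_comparison)
    show "(\<lambda>k. K * (?n (?df k) * ?n (?dg k)) + K * (?n (?df k) * ?n g0) + K * (?n f0 * ?n (?dg k))) \<longlonglongrightarrow> 0"
    proof -
      have "(\<lambda>k. ?n (?df k)) \<longlonglongrightarrow> 0" "(\<lambda>k. ?n (?dg k)) \<longlonglongrightarrow> 0"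
        using tendsto_real_sqrt[OF cf] tendsto_real_sqrt[OF cg] by simp_all
      from tendsto_add[OF tendsto_add[OF tendsto_mult[OF tendsto_const tendsto_mult[OF this]]
            tendsto_mult[OF tendsto_const tendsto_mult[OF this(1) tendsto_const]]]
          tendsto_mult[OF tendsto_const tendsto_mult[OF tendsto_const this(2)]], of K K "?n g0" K "?n f0"]
      show ?thesis by simp
    qed
    show "\<forall>\<^sub>F k in sequentially. norm ((\<integral>x. \<beta> (f k x) (g k x) \<partial>N) - (\<integral>x. \<beta> (f0 x) (g0 x) \<partial>N))
      \<le> K * (?n (?df k) * ?n (?dg k)) + K * (?n (?df k) * ?n g0) + K * (?n f0 * ?n (?dg k))"
      unfolding e
    proof (intro always_eventually allI)
      fix k
      show "norm ((\<integral>x. \<beta> (?df k x) (?dg k x) \<partial>N) + (\<integral>x. \<beta> (?df k x) (g0 x) \<partial>N) + (\<integral>x. \<beta> (f0 x) (?dg k x) \<partial>N))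
        \<le> K * (?n (?df k) * ?n (?dg k)) + K * (?n (?df k) * ?n g0) + K * (?n f0 * ?n (?dg k))"
        using CS[OF d(1)[of k] d(2)[of k]] CS[OF d(1)[of k] g(2)] CS[OF f(2) d(2)[of k]]
        by (rule norm_triangle_mono[OF norm_triangle_mono])
    qed
  qed
  then show ?thesis by (rule LIM_zero_cancel)
qed

section \<open>Increments of Brownian motion\<close>

context standard_brownian_motion
begin

abbreviation F :: "real \<Rightarrow> 'a measure" where "F \<equiv> augmented_filtration M W"

lemma augmented_generators: "{W s -` S \<inter> space M | s S. 0 \<le> s \<and> s \<le> t \<and> S \<in> sets borel} \<union> null_sets M \<subseteq> sets M"
  using W_measurable by (auto intro: measurable_sets)

lemma sets_F: "sets (F t) = sigma_sets (space M)
   ({W s -` S \<inter> space M | s S. 0 \<le> s \<and> s \<le> t \<and> S \<in> sets borel} \<union> null_sets M)"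
  unfolding augmented_filtration_def
  using augmented_generators[of t] sets.sets_into_space by (intro sets_measure_of) blast

lemma space_F[simp]: "space (F t) = space M"
  unfolding augmented_filtration_def
  using augmented_generators[of t] sets.sets_into_space by (intro space_measure_of) blast

lemma subalgebra_F: "subalgebra M (F t)"
  unfolding subalgebra_def sets_F using sets.sigma_sets_subset[OF augmented_generators] by auto

lemma subalgebra_F_mono: "s \<le> t \<Longrightarrow> subalgebra (F t) (F s)"
  unfolding subalgebra_def sets_F by (auto intro!: sigma_sets_subseteq intro: order_trans)

lemma measurable_F_M: "f \<in> measurable (F t) N \<Longrightarrow> f \<in> measurable M N"
  using measurable_from_subalg[OF subalgebra_F] by blast

lemma measurable_F_mono: "f \<in> measurable (F s) N \<Longrightarrow> s \<le> t \<Longrightarrow> f \<in> measurable (F t) N"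
  using measurable_from_subalg[OF subalgebra_F_mono] by blast

text \<open>Because of the augmentation, exceptional null sets are events of every
  \<open>F t\<close>. A process can therefore be redefined on such a set and stay adapted.\<close>

lemma null_sets_F: "N \<in> null_sets M \<Longrightarrow> N \<in> sets (F t)"
  unfolding sets_F by auto

lemma W_measurable_F: "0 \<le> s \<Longrightarrow> s \<le> t \<Longrightarrow> W s \<in> borel_measurable (F t)"
  by (rule measurableI) (auto simp: sets_F)

lemma increment_moments:
  assumes "0 \<le> s" "s \<le> t"
  shows "integrable M (\<lambda>\<omega>. W t \<omega> - W s \<omega>)" "(\<integral>\<omega>. W t \<omega> - W s \<omega> \<partial>M) = 0"
    "integrable M (\<lambda>\<omega>. (W t \<omega> - W s \<omega>)\<^sup>2)" "(\<integral>\<omega>. (W t \<omega> - W s \<omega>)\<^sup>2 \<partial>M) = t - s"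
proof -
  have "integrable M (\<lambda>\<omega>. W t \<omega> - W s \<omega>) \<and> (\<integral>\<omega>. W t \<omega> - W s \<omega> \<partial>M) = 0
    \<and> integrable M (\<lambda>\<omega>. (W t \<omega> - W s \<omega>)\<^sup>2) \<and> (\<integral>\<omega>. (W t \<omega> - W s \<omega>)\<^sup>2 \<partial>M) = t - s"
  \<comment> \<open>The increment has a normal density only for \<open>s < t\<close>; for
    \<open>s = t\<close> it vanishes and the claims are trivial.\<close>
  proof (cases "s = t")
    case False
    then have \<sigma>: "0 < sqrt (t - s)" using assms by simp
    note D = W_increment_normal[of s t] 
    have D: "distributed M lborel (\<lambda>\<omega>. W t \<omega> - W s \<omega>) (normal_density 0 (sqrt (t - s)))"
      using assms False by (intro W_increment_normal) auto
    have e: "(\<integral>\<omega>. W t \<omega> - W s \<omega> \<partial>M) = 0" by (rule normal_distributed_expectation[OF \<sigma> D])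
    have v: "(\<integral>\<omega>. (W t \<omega> - W s \<omega>)\<^sup>2 \<partial>M) = t - s"
      using normal_distributed_variance[OF \<sigma> D] assms unfolding e by simp
    have 1: "integrable M (\<lambda>\<omega>. W t \<omega> - W s \<omega>)"
      using integrable_normal_moment[OF \<sigma>, of 0 1] distributed_integrable[OF D, of "\<lambda>x. x"] by simp
    have 2: "integrable M (\<lambda>\<omega>. (W t \<omega> - W s \<omega>)\<^sup>2)"
      using integrable_normal_moment[OF \<sigma>, of 0 2] distributed_integrable[OF D, of "\<lambda>x. x\<^sup>2"] by simp
    show ?thesis using e v 1 2 by blast
  qed auto
  then show "integrable M (\<lambda>\<omega>. W t \<omega> - W s \<omega>)" "(\<integral>\<omega>. W t \<omega> - W s \<omega> \<partial>M) = 0"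
    "integrable M (\<lambda>\<omega>. (W t \<omega> - W s \<omega>)\<^sup>2)" "(\<integral>\<omega>. (W t \<omega> - W s \<omega>)\<^sup>2 \<partial>M) = t - s"
    by blast+
qed

lemma indep_var_increment:
  fixes \<xi> :: "'a \<Rightarrow> real"
  assumes "0 \<le> s" "s < t" "\<xi> \<in> borel_measurable (F s)"
  shows "indep_var borel \<xi> borel (\<lambda>\<omega>. W t \<omega> - W s \<omega>)"
proof -
  have \<xi>: "\<xi> \<in> borel_measurable M" using assms by (auto intro: measurable_F_M)
  have [measurable]: "W t \<in> borel_measurable M" "W s \<in> borel_measurable M" using assms by (auto intro: W_measurable)
  let ?B = "{(\<lambda>\<omega>. W t \<omega> - W s \<omega>) -` S \<inter> space M | S. S \<in> sets borel}"
  have *: "indep_set (sets (F s)) ?B" using assms by (intro W_increment_indep) auto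
  \<comment> \<open>The preimages of Borel sets already form a sigma-algebra, so on the side of the
    increment nothing has to be generated; on the side of \<open>\<xi>\<close> the generated
    sigma-algebra stays inside \<open>F s\<close>.\<close>
  have B: "sigma_sets (space M) ?B = ?B"
    by (rule sigma_sets_vimage_commute[of "\<lambda>\<omega>. W t \<omega> - W s \<omega>" "space M" UNIV "sets borel", simplified,
          unfolded sets.sigma_sets_eq[of borel, simplified], symmetric])
  have A: "sigma_sets (space M) {\<xi> -` A \<inter> space M |A. A \<in> sets borel} \<subseteq> sets (F s)"
    using measurable_sets[OF assms(3)] by (intro sets.sigma_sets_subset[of _ "F s", simplified]) auto
  have mono: "indep_set A' B" if "indep_set A B" "A' \<subseteq> A" for A A' B
    using that unfolding indep_sets2_eq by blast
  show ?thesis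
    unfolding indep_var_eq B using mono[OF * A] \<xi> by simp
qed

text \<open>The martingale property and the rule \<open>dW dW = dt\<close> in weighted form: a
  weight known at time \<open>s\<close> is independent of the increment and factors out of the
  expectation.\<close>

lemma increment_times:
  fixes \<xi> :: "'a \<Rightarrow> real"
  assumes "0 \<le> s" "s \<le> t" "\<xi> \<in> borel_measurable (F s)" "integrable M \<xi>"
  shows "integrable M (\<lambda>\<omega>. (W t \<omega> - W s \<omega>) * \<xi> \<omega>)" "(\<integral>\<omega>. (W t \<omega> - W s \<omega>) * \<xi> \<omega> \<partial>M) = 0"
    "integrable M (\<lambda>\<omega>. (W t \<omega> - W s \<omega>)\<^sup>2 * \<xi> \<omega>)"
    "(\<integral>\<omega>. (W t \<omega> - W s \<omega>)\<^sup>2 * \<xi> \<omega> \<partial>M) = (t - s) * (\<integral>\<omega>. \<xi> \<omega> \<partial>M)"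
proof -
  have "integrable M (\<lambda>\<omega>. (W t \<omega> - W s \<omega>) * \<xi> \<omega>) \<and> (\<integral>\<omega>. (W t \<omega> - W s \<omega>) * \<xi> \<omega> \<partial>M) = 0
    \<and> integrable M (\<lambda>\<omega>. (W t \<omega> - W s \<omega>)\<^sup>2 * \<xi> \<omega>)
    \<and> (\<integral>\<omega>. (W t \<omega> - W s \<omega>)\<^sup>2 * \<xi> \<omega> \<partial>M) = (t - s) * (\<integral>\<omega>. \<xi> \<omega> \<partial>M)"
  proof (cases "s = t")
    case False
    note m = increment_moments[OF assms(1,2)]
    have i: "indep_var borel \<xi> borel (\<lambda>\<omega>. W t \<omega> - W s \<omega>)"
      using assms False by (intro indep_var_increment) auto
    have i2: "indep_var borel \<xi> borel (\<lambda>\<omega>. (W t \<omega> - W s \<omega>)\<^sup>2)"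
      using indep_var_compose[OF i, of "\<lambda>x. x" borel "\<lambda>x. x\<^sup>2" borel] by (simp add: comp_def)
    show ?thesis
      using indep_var_integrable[OF i assms(4) m(1)] indep_var_integrable[OF i2 assms(4) m(3)]
        indep_var_lebesgue_integral[OF i assms(4) m(1)] indep_var_lebesgue_integral[OF i2 assms(4) m(3)] m
      by (simp add: mult.commute)
  qed simp
  then show "integrable M (\<lambda>\<omega>. (W t \<omega> - W s \<omega>) * \<xi> \<omega>)" "(\<integral>\<omega>. (W t \<omega> - W s \<omega>) * \<xi> \<omega> \<partial>M) = 0"
    "integrable M (\<lambda>\<omega>. (W t \<omega> - W s \<omega>)\<^sup>2 * \<xi> \<omega>)"
    "(\<integral>\<omega>. (W t \<omega> - W s \<omega>)\<^sup>2 * \<xi> \<omega> \<partial>M) = (t - s) * (\<integral>\<omega>. \<xi> \<omega> \<partial>M)"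
    by blast+
qed

end

lemma integrable_euclidean_iff:
  fixes f :: "'x \<Rightarrow> 'b::euclidean_space"
  shows "integrable N f \<longleftrightarrow> (\<forall>i\<in>Basis. integrable N (\<lambda>x. f x \<bullet> i))"
proof
  assume "\<forall>i\<in>Basis. integrable N (\<lambda>x. f x \<bullet> i)"
  then have "integrable N (\<lambda>x. \<Sum>i\<in>Basis. (f x \<bullet> i) *\<^sub>R i)" by auto
  then show "integrable N f" by (simp add: euclidean_representation)
qed auto

context standard_brownian_motion
begin

lemma increment_scaleR:
  fixes \<xi> :: "'a \<Rightarrow> 'b::euclidean_space"
  assumes "0 \<le> s" "s \<le> t" and \<xi>: "\<xi> \<in> borel_measurable (F s)" "integrable M \<xi>"
  shows "integrable M (\<lambda>\<omega>. (W t \<omega> - W s \<omega>) *\<^sub>R \<xi> \<omega>)" "(\<integral>\<omega>. (W t \<omega> - W s \<omega>) *\<^sub>R \<xi> \<omega> \<partial>M) = 0"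
    "integrable M (\<lambda>\<omega>. (W t \<omega> - W s \<omega>)\<^sup>2 *\<^sub>R \<xi> \<omega>)"
    "(\<integral>\<omega>. (W t \<omega> - W s \<omega>)\<^sup>2 *\<^sub>R \<xi> \<omega> \<partial>M) = (t - s) *\<^sub>R (\<integral>\<omega>. \<xi> \<omega> \<partial>M)"
proof -
  have c: "(\<lambda>\<omega>. \<xi> \<omega> \<bullet> i) \<in> borel_measurable (F s)" "integrable M (\<lambda>\<omega>. \<xi> \<omega> \<bullet> i)" for i
    using \<xi> by (auto intro: borel_measurable_inner)
  note t = increment_times[OF assms(1,2) c]
  show 1: "integrable M (\<lambda>\<omega>. (W t \<omega> - W s \<omega>) *\<^sub>R \<xi> \<omega>)"
    and 2: "integrable M (\<lambda>\<omega>. (W t \<omega> - W s \<omega>)\<^sup>2 *\<^sub>R \<xi> \<omega>)"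
    using t(1,3) by (subst integrable_euclidean_iff; simp)+
  have "(\<integral>\<omega>. (W t \<omega> - W s \<omega>) *\<^sub>R \<xi> \<omega> \<partial>M) \<bullet> i = 0 \<bullet> i" for i
    using integral_inner_left[OF 1, of i] t(2)[of i] by simp
  then show "(\<integral>\<omega>. (W t \<omega> - W s \<omega>) *\<^sub>R \<xi> \<omega> \<partial>M) = 0" by (rule euclidean_eqI)
  have "(\<integral>\<omega>. (W t \<omega> - W s \<omega>)\<^sup>2 *\<^sub>R \<xi> \<omega> \<partial>M) \<bullet> i = ((t - s) *\<^sub>R (\<integral>\<omega>. \<xi> \<omega> \<partial>M)) \<bullet> i" for i
    using integral_inner_left[OF 2, of i] integral_inner_left[OF \<xi>(2), of i] t(4)[of i] by simp
  then show "(\<integral>\<omega>. (W t \<omega> - W s \<omega>)\<^sup>2 *\<^sub>R \<xi> \<omega> \<partial>M) = (t - s) *\<^sub>R (\<integral>\<omega>. \<xi> \<omega> \<partial>M)"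
    by (rule euclidean_eqI)
qed

text \<open>The isometry for a single block. In general a product of two square-integrable factors
  is only integrable; here independence of \<open>\<xi>\<close> and the increment makes it square
  integrable.\<close>

lemma increment_square_integrable:
  fixes \<xi> :: "'a \<Rightarrow> 'b::euclidean_space"
  assumes "0 \<le> s" "s \<le> t" and \<xi>: "\<xi> \<in> borel_measurable (F s)" "square_integrable M \<xi>"
  shows "square_integrable M (\<lambda>\<omega>. (W t \<omega> - W s \<omega>) *\<^sub>R \<xi> \<omega>)"
    "(\<integral>\<omega>. (norm ((W t \<omega> - W s \<omega>) *\<^sub>R \<xi> \<omega>))\<^sup>2 \<partial>M) = (t - s) * (\<integral>\<omega>. (norm (\<xi> \<omega>))\<^sup>2 \<partial>M)"
proof -
  have [measurable]: "W t \<in> borel_measurable M" "W s \<in> borel_measurable M" "\<xi> \<in> borel_measurable M"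
    using assms by (auto intro: W_measurable measurable_F_M)
  have "(\<lambda>\<omega>. (norm (\<xi> \<omega>))\<^sup>2) \<in> borel_measurable (F s)" "integrable M (\<lambda>\<omega>. (norm (\<xi> \<omega>))\<^sup>2)"
    using \<xi> by (auto simp: square_integrable_def)
  note t = increment_times(3,4)[OF assms(1,2) this]
  show "square_integrable M (\<lambda>\<omega>. (W t \<omega> - W s \<omega>) *\<^sub>R \<xi> \<omega>)"
    "(\<integral>\<omega>. (norm ((W t \<omega> - W s \<omega>) *\<^sub>R \<xi> \<omega>))\<^sup>2 \<partial>M) = (t - s) * (\<integral>\<omega>. (norm (\<xi> \<omega>))\<^sup>2 \<partial>M)"
    unfolding square_integrable_def using t by (simp_all add: power_mult_distrib)
qed

end

section \<open>The Ito isometry\<close>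

text \<open>Lebesgue measure on \<open>[0, T]\<close> as a finite measure in its own right, so that
  Fubini applies to \<open>time_measure T \<Otimes>\<^sub>M M\<close>. For \<open>T < 0\<close> its
  space is empty, which lets many statements do without a sign condition on
  \<open>T\<close>.\<close>

definition time_measure :: "real \<Rightarrow> real measure" where
  "time_measure T = restrict_space lborel {0..T}"

lemma space_time_measure[simp]: "space (time_measure T) = {0..T}"
  by (simp add: time_measure_def space_restrict_space)

lemma sets_time_measure[measurable_cong]: "sets (time_measure T) = sets (restrict_space borel {0..T})"
  by (simp add: time_measure_def sets_restrict_space)

lemma finite_measure_time_measure: "finite_measure (time_measure T)"
  by (rule finite_measureI) (simp add: time_measure_def emeasure_restrict_space space_restrict_space emeasure_lborel_Icc_eq)

lemma integral_time_measure:
  fixes f :: "real \<Rightarrow> 'b::{banach,second_countable_topology}"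
  shows "integral\<^sup>L (time_measure T) f = (\<integral>s\<in>{0..T}. f s \<partial>lborel)"
  by (simp add: time_measure_def integral_restrict_space set_lebesgue_integral_def)

lemma integrable_time_measure:
  fixes f :: "real \<Rightarrow> 'b::{banach,second_countable_topology}"
  shows "integrable (time_measure T) f \<longleftrightarrow> set_integrable lborel {0..T} f"
  by (simp add: time_measure_def integrable_restrict_space set_integrable_def)

lemma nn_integral_time_measure:
  "integral\<^sup>N (time_measure T) f = (\<integral>\<^sup>+s\<in>{0..T}. f s \<partial>lborel)"
  by (simp add: time_measure_def nn_integral_restrict_space)

lemma sigma_finite_time_measure: "sigma_finite_measure (time_measure T)"
  using finite_measure_time_measure by (rule finite_measure.axioms)

lemma measure_time_measure:
  "A \<in> sets borel \<Longrightarrow> A \<subseteq> {0..T} \<Longrightarrow> measure (time_measure T) A = measure lborel A"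
  by (simp add: time_measure_def measure_restrict_space)

lemma integral_product_scaleR:
  fixes f :: "'x \<Rightarrow> real" and g :: "'y \<Rightarrow> 'b::euclidean_space"
  assumes "sigma_finite_measure N1" "sigma_finite_measure N2" and fg: "integrable N1 f" "integrable N2 g"
  shows "integrable (N1 \<Otimes>\<^sub>M N2) (\<lambda>(x, y). f x *\<^sub>R g y)"
    "(\<integral>(x, y). f x *\<^sub>R g y \<partial>(N1 \<Otimes>\<^sub>M N2)) = integral\<^sup>L N1 f *\<^sub>R integral\<^sup>L N2 g"
proof -
  interpret N1: sigma_finite_measure N1 by fact
  interpret N2: sigma_finite_measure N2 by fact
  interpret pair_sigma_finite N1 N2 ..
  have [measurable]: "f \<in> borel_measurable N1" "g \<in> borel_measurable N2" using fg by auto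
  show 1: "integrable (N1 \<Otimes>\<^sub>M N2) (\<lambda>(x, y). f x *\<^sub>R g y)"
  proof (rule Fubini_integrable)
    have "(\<lambda>x. LINT y|N2. norm (case (x, y) of (x, y) \<Rightarrow> f x *\<^sub>R g y)) = (\<lambda>x. \<bar>f x\<bar> * (LINT y|N2. norm (g y)))"
      using fg by simp
    then show "integrable N1 (\<lambda>x. LINT y|N2. norm (case (x, y) of (x, y) \<Rightarrow> f x *\<^sub>R g y))"
      using fg by simp
  qed (use fg in auto)
  show "(\<integral>(x, y). f x *\<^sub>R g y \<partial>(N1 \<Otimes>\<^sub>M N2)) = integral\<^sup>L N1 f *\<^sub>R integral\<^sup>L N2 g"
    using integral_fst[OF 1] fg by simp
qed

section \<open>Covariances of block integrals\<close>

context standard_brownian_motion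
begin

lemma measurable_bilinear:
  assumes "bounded_bilinear (\<beta> :: 'b::euclidean_space \<Rightarrow> 'd::euclidean_space \<Rightarrow> 'c::euclidean_space)"
    "f \<in> borel_measurable N" "g \<in> borel_measurable N"
  shows "(\<lambda>x. \<beta> (f x) (g x)) \<in> borel_measurable N"
proof -
  interpret bounded_bilinear \<beta> by fact
  have "continuous_on UNIV (\<lambda>x::_\<times>_. \<beta> (fst x) (snd x))"
    by (intro continuous_on continuous_intros)
  then show ?thesis
    by (rule borel_measurable_continuous_Pair[rotated 2]) (use assms in auto)
qed

text \<open>Two increments with the same starting time \<open>c\<close>: the common part up to
  \<open>min b d\<close> contributes its variance, and what the longer one has in addition is a
  future increment with mean zero.\<close>

lemma increment_square_times:
  fixes \<zeta> :: "'a \<Rightarrow> 'b::euclidean_space"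
  assumes "0 \<le> c" "c \<le> b" "c \<le> d" and \<zeta>: "\<zeta> \<in> borel_measurable (F c)" "integrable M \<zeta>"
  shows "integrable M (\<lambda>\<omega>. ((W b \<omega> - W c \<omega>) * (W d \<omega> - W c \<omega>)) *\<^sub>R \<zeta> \<omega>)"
    "(\<integral>\<omega>. ((W b \<omega> - W c \<omega>) * (W d \<omega> - W c \<omega>)) *\<^sub>R \<zeta> \<omega> \<partial>M) = (min b d - c) *\<^sub>R (\<integral>\<omega>. \<zeta> \<omega> \<partial>M)"
proof -
  let ?e = "min b d" and ?f = "max b d"
  let ?\<zeta> = "\<lambda>\<omega>. (W ?e \<omega> - W c \<omega>) *\<^sub>R \<zeta> \<omega>"
  have ce: "0 \<le> c" "c \<le> ?e" "0 \<le> ?e" "?e \<le> ?f" using assms by auto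
  have [measurable]: "W ?e \<in> borel_measurable (F ?e)" "W c \<in> borel_measurable (F ?e)" "\<zeta> \<in> borel_measurable (F ?e)"
    using ce \<zeta> by (auto intro: W_measurable_F measurable_F_mono)
  have m: "?\<zeta> \<in> borel_measurable (F ?e)" by measurable
  note 1 = increment_scaleR(1,3,4)[OF ce(1,2) \<zeta>]
  note 2 = increment_scaleR(1,2)[OF ce(3,4) m 1(1)]
  have eq: "((W b \<omega> - W c \<omega>) * (W d \<omega> - W c \<omega>)) *\<^sub>R \<zeta> \<omega>
     = (W ?e \<omega> - W c \<omega>)\<^sup>2 *\<^sub>R \<zeta> \<omega> + (W ?f \<omega> - W ?e \<omega>) *\<^sub>R ?\<zeta> \<omega>" for \<omega>
  proof -
    have "(W b \<omega> - W c \<omega>) * (W d \<omega> - W c \<omega>)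
      = (W ?e \<omega> - W c \<omega>)\<^sup>2 + (W ?f \<omega> - W ?e \<omega>) * (W ?e \<omega> - W c \<omega>)"
      by (cases "b \<le> d") (simp_all add: power2_eq_square algebra_simps)
    then show ?thesis by (simp add: scaleR_left_distrib)
  qed
  show "integrable M (\<lambda>\<omega>. ((W b \<omega> - W c \<omega>) * (W d \<omega> - W c \<omega>)) *\<^sub>R \<zeta> \<omega>)"
    unfolding eq by (rule Bochner_Integration.integrable_add[OF 1(2) 2(1)])
  show "(\<integral>\<omega>. ((W b \<omega> - W c \<omega>) * (W d \<omega> - W c \<omega>)) *\<^sub>R \<zeta> \<omega> \<partial>M) = (min b d - c) *\<^sub>R (\<integral>\<omega>. \<zeta> \<omega> \<partial>M)"
    unfolding eq Bochner_Integration.integral_add[OF 1(2) 2(1)] 1(3) 2(2) by simp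
qed

lemma orthogonal_increment:
  assumes \<beta>: "bounded_bilinear (\<beta> :: 'b::euclidean_space \<Rightarrow> 'd::euclidean_space \<Rightarrow> 'c::euclidean_space)"
    and "0 \<le> c" "c \<le> d" "\<xi> \<in> borel_measurable (F c)" "square_integrable M \<xi>"
    "\<eta> \<in> borel_measurable (F c)" "square_integrable M \<eta>"
  shows "(\<integral>\<omega>. \<beta> (\<xi> \<omega>) ((W d \<omega> - W c \<omega>) *\<^sub>R \<eta> \<omega>) \<partial>M) = 0"
proof -
  interpret bounded_bilinear \<beta> by fact
  show ?thesis
    unfolding scaleR_right
    by (rule increment_scaleR(2)[OF assms(2,3) measurable_bilinear[OF \<beta> assms(4,6)] square_integrable_bilinear[OF \<beta> assms(5,7)]])
qed

text \<open>The first block is cut at time \<open>c\<close>, where the second one starts. Its part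
  before \<open>c\<close> is known at time \<open>c\<close>, hence orthogonal to the second block;
  only the overlap contributes, with length 0 if the blocks are disjoint.\<close>

lemma covariance_increments_ordered:
  assumes \<beta>: "bounded_bilinear (\<beta> :: 'b::euclidean_space \<Rightarrow> 'd::euclidean_space \<Rightarrow> 'c::euclidean_space)"
    and ab: "0 \<le> a" "a \<le> b" "\<xi> \<in> borel_measurable (F a)" "square_integrable M \<xi>"
    and cd: "0 \<le> c" "c \<le> d" "\<eta> \<in> borel_measurable (F c)" "square_integrable M \<eta>"
    and ac: "a \<le> c"
  shows "(\<integral>\<omega>. \<beta> ((W b \<omega> - W a \<omega>) *\<^sub>R \<xi> \<omega>) ((W d \<omega> - W c \<omega>) *\<^sub>R \<eta> \<omega>) \<partial>M)
    = max 0 (min b d - c) *\<^sub>R (\<integral>\<omega>. \<beta> (\<xi> \<omega>) (\<eta> \<omega>) \<partial>M)"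
proof -
  interpret bounded_bilinear \<beta> by fact
  have \<xi>c: "\<xi> \<in> borel_measurable (F c)" using ab ac by (auto intro: measurable_F_mono)
  have past: "(\<integral>\<omega>. \<beta> ((W e \<omega> - W a \<omega>) *\<^sub>R \<xi> \<omega>) ((W d \<omega> - W c \<omega>) *\<^sub>R \<eta> \<omega>) \<partial>M) = 0"
    if e: "a \<le> e" "e \<le> c" for e
  proof (rule orthogonal_increment[OF \<beta>])
    have "W e \<in> borel_measurable (F c)" "W a \<in> borel_measurable (F c)" using e ab by (auto intro: W_measurable_F)
    then show "(\<lambda>\<omega>. (W e \<omega> - W a \<omega>) *\<^sub>R \<xi> \<omega>) \<in> borel_measurable (F c)" using \<xi>c by measurable
    show "square_integrable M (\<lambda>\<omega>. (W e \<omega> - W a \<omega>) *\<^sub>R \<xi> \<omega>)"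
      using ab e by (intro increment_square_integrable) auto
  qed (use cd in auto)
  show ?thesis
  proof (cases "b \<le> c")
    case True then show ?thesis using past[of b] ab by simp
  next
    case False
    have L: "square_integrable M (\<lambda>\<omega>. (W c \<omega> - W a \<omega>) *\<^sub>R \<xi> \<omega>)"
        "square_integrable M (\<lambda>\<omega>. (W d \<omega> - W c \<omega>) *\<^sub>R \<eta> \<omega>)"
      using ab cd ac by (auto intro!: increment_square_integrable)
    have \<zeta>: "(\<lambda>\<omega>. \<beta> (\<xi> \<omega>) (\<eta> \<omega>)) \<in> borel_measurable (F c)" "integrable M (\<lambda>\<omega>. \<beta> (\<xi> \<omega>) (\<eta> \<omega>))"
      by (rule measurable_bilinear[OF \<beta> \<xi>c cd(3)], rule square_integrable_bilinear[OF \<beta> ab(4) cd(4)])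
    have "c \<le> b" using False by simp
    note q = increment_square_times[OF cd(1) this cd(2) \<zeta>]
    have "\<beta> ((W b \<omega> - W a \<omega>) *\<^sub>R \<xi> \<omega>) ((W d \<omega> - W c \<omega>) *\<^sub>R \<eta> \<omega>)
      = \<beta> ((W c \<omega> - W a \<omega>) *\<^sub>R \<xi> \<omega>) ((W d \<omega> - W c \<omega>) *\<^sub>R \<eta> \<omega>) + 
        ((W b \<omega> - W c \<omega>) * (W d \<omega> - W c \<omega>)) *\<^sub>R \<beta> (\<xi> \<omega>) (\<eta> \<omega>)" for \<omega>
      unfolding scaleR_left scaleR_right scaleR_scaleR scaleR_left_distrib[symmetric]
      by (simp add: algebra_simps)
    then show ?thesis
      using past[of c] ac q square_integrable_bilinear[OF \<beta> L] False cd
      by simp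
  qed
qed

text \<open>The length of the overlap is the time integral of the product of the two indicators, the
  form that the isometry needs. The case \<open>c < a\<close> is the ordered one for the flipped
  bilinear map.\<close>

lemma covariance_increments:
  assumes \<beta>: "bounded_bilinear (\<beta> :: 'b::euclidean_space \<Rightarrow> 'd::euclidean_space \<Rightarrow> 'c::euclidean_space)"
    and ab: "0 \<le> a" "a \<le> b" "\<xi> \<in> borel_measurable (F a)" "square_integrable M \<xi>"
    and cd: "0 \<le> c" "c \<le> d" "\<eta> \<in> borel_measurable (F c)" "square_integrable M \<eta>"
  shows "(\<integral>\<omega>. \<beta> ((W b \<omega> - W a \<omega>) *\<^sub>R \<xi> \<omega>) ((W d \<omega> - W c \<omega>) *\<^sub>R \<eta> \<omega>) \<partial>M)
    = measure lborel ({a<..b} \<inter> {c<..d}) *\<^sub>R (\<integral>\<omega>. \<beta> (\<xi> \<omega>) (\<eta> \<omega>) \<partial>M)"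
proof -
  have i: "{a<..b} \<inter> {c<..d} = {max a c<..min b d}" by auto
  have m: "measure lborel ({a<..b} \<inter> {c<..d}) = max 0 (min b d - max a c)"
    unfolding i by (cases "max a c \<le> min b d") auto
  show ?thesis
  proof (cases "a \<le> c")
    case True
    then show ?thesis using covariance_increments_ordered[OF \<beta> ab cd] m by (simp add: max_def)
  next
    case False
    then show ?thesis
      using covariance_increments_ordered[OF bounded_bilinear.flip[OF \<beta>] cd ab] m 
      by (simp add: max_def min.commute)
  qed
qed

text \<open>Unlike the intervals of a simple process, the blocks \<open>(a i, b i]\<close> may overlap; this makes
  differences of simple processes, and restrictions to a time interval, block families again.\<close>

definition block_family :: "'i set \<Rightarrow> ('i \<Rightarrow> real) \<Rightarrow> ('i \<Rightarrow> real) \<Rightarrow> ('i \<Rightarrow> 'a \<Rightarrow> 'b::euclidean_space) \<Rightarrow> bool" where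
  "block_family I a b \<xi> \<longleftrightarrow> finite I \<and>
     (\<forall>i\<in>I. 0 \<le> a i \<and> a i \<le> b i \<and> \<xi> i \<in> borel_measurable (F (a i)) \<and> square_integrable M (\<xi> i))"

definition block_integral :: "'i set \<Rightarrow> ('i \<Rightarrow> real) \<Rightarrow> ('i \<Rightarrow> real) \<Rightarrow> ('i \<Rightarrow> 'a \<Rightarrow> 'b::euclidean_space) \<Rightarrow> 'a \<Rightarrow> 'b" where
  "block_integral I a b \<xi> \<omega> = (\<Sum>i\<in>I. (W (b i) \<omega> - W (a i) \<omega>) *\<^sub>R \<xi> i \<omega>)"

definition block_process :: "'i set \<Rightarrow> ('i \<Rightarrow> real) \<Rightarrow> ('i \<Rightarrow> real) \<Rightarrow> ('i \<Rightarrow> 'a \<Rightarrow> 'b::euclidean_space) \<Rightarrow> real \<Rightarrow> 'a \<Rightarrow> 'b" where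
  "block_process I a b \<xi> s \<omega> = (\<Sum>i\<in>I. indicator {a i<..b i} s *\<^sub>R \<xi> i \<omega>)"

lemma square_integrable_block_integral:
  "block_family I a b \<xi> \<Longrightarrow> square_integrable M (block_integral I a b \<xi>)"
  unfolding block_integral_def block_family_def
  by (intro square_integrable_sum increment_square_integrable) auto

text \<open>Both sides are expanded into sums over pairs of blocks, and each pair is an instance of
  \<open>covariance_increments\<close>. All pairs count, since blocks may overlap.\<close>

lemma block_isometry:
  assumes \<beta>: "bounded_bilinear (\<beta> :: 'b::euclidean_space \<Rightarrow> 'd::euclidean_space \<Rightarrow> 'c::euclidean_space)"
    and 1: "block_family I a b \<xi>" "\<And>i. i \<in> I \<Longrightarrow> b i \<le> T"
    and 2: "block_family J c d \<eta>" "\<And>j. j \<in> J \<Longrightarrow> d j \<le> T"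
  shows "(\<integral>\<omega>. \<beta> (block_integral I a b \<xi> \<omega>) (block_integral J c d \<eta> \<omega>) \<partial>M)
    = (\<integral>(s, \<omega>). \<beta> (block_process I a b \<xi> s \<omega>) (block_process J c d \<eta> s \<omega>) \<partial>(time_measure T \<Otimes>\<^sub>M M))"
proof -
  interpret bounded_bilinear \<beta> by fact
  let ?A = "\<lambda>i j. {a i<..b i} \<inter> {c j<..d j}"
  have ij: "integrable (time_measure T \<Otimes>\<^sub>M M) (\<lambda>(s, \<omega>). indicator (?A i j) s *\<^sub>R \<beta> (\<xi> i \<omega>) (\<eta> j \<omega>))"
    "(\<integral>(s, \<omega>). indicator (?A i j) s *\<^sub>R \<beta> (\<xi> i \<omega>) (\<eta> j \<omega>) \<partial>(time_measure T \<Otimes>\<^sub>M M))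
      = measure lborel (?A i j) *\<^sub>R (\<integral>\<omega>. \<beta> (\<xi> i \<omega>) (\<eta> j \<omega>) \<partial>M)"
    if "i \<in> I" "j \<in> J" for i j
  proof -
    have A: "?A i j \<subseteq> {0..T}" using that 1 2 by (force simp: block_family_def)
    then have A': "?A i j \<in> sets (time_measure T)"
      by (auto simp: sets_time_measure sets_restrict_space)
    interpret T: finite_measure "time_measure T" by (rule finite_measure_time_measure)
    have i: "integrable (time_measure T) (indicator (?A i j) :: real \<Rightarrow> real)"
      "(\<integral>s. indicator (?A i j) s \<partial>time_measure T) = measure lborel (?A i j)"
    proof -
      show "integrable (time_measure T) (indicator (?A i j) :: real \<Rightarrow> real)"
        using A' by (simp add: T.emeasure_finite less_top[symmetric])
      have "(\<integral>s. indicator (?A i j) s \<partial>time_measure T) = measure (time_measure T) (?A i j \<inter> space (time_measure T))"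
        by (rule Bochner_Integration.integral_indicator)
      also have "?A i j \<inter> space (time_measure T) = ?A i j" using A by (simp only: space_time_measure Int_absorb2)
      also have "measure (time_measure T) (?A i j) = measure lborel (?A i j)"
        by (rule measure_time_measure[OF _ A]) simp
      finally show "(\<integral>s. indicator (?A i j) s \<partial>time_measure T) = measure lborel (?A i j)" .
    qed
    note * = integral_product_scaleR[OF sigma_finite_time_measure sigma_finite_measure_axioms i(1), 
        where g="\<lambda>\<omega>. \<beta> (\<xi> i \<omega>) (\<eta> j \<omega>)"]
    have "integrable M (\<lambda>\<omega>. \<beta> (\<xi> i \<omega>) (\<eta> j \<omega>))"
      using that 1 2 by (intro square_integrable_bilinear[OF \<beta>]) (auto simp: block_family_def)
    from *[OF this] i(2)
    show "integrable (time_measure T \<Otimes>\<^sub>M M) (\<lambda>(s, \<omega>). indicator (?A i j) s *\<^sub>R \<beta> (\<xi> i \<omega>) (\<eta> j \<omega>))"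
    "(\<integral>(s, \<omega>). indicator (?A i j) s *\<^sub>R \<beta> (\<xi> i \<omega>) (\<eta> j \<omega>) \<partial>(time_measure T \<Otimes>\<^sub>M M))
      = measure lborel (?A i j) *\<^sub>R (\<integral>\<omega>. \<beta> (\<xi> i \<omega>) (\<eta> j \<omega>) \<partial>M)"
      by auto
  qed
  have w: "square_integrable M (\<lambda>\<omega>. (W (b i) \<omega> - W (a i) \<omega>) *\<^sub>R \<xi> i \<omega>)" if "i \<in> I" for i
    using that 1 by (intro increment_square_integrable) (auto simp: block_family_def)
  have w': "square_integrable M (\<lambda>\<omega>. (W (d j) \<omega> - W (c j) \<omega>) *\<^sub>R \<eta> j \<omega>)" if "j \<in> J" for j
    using that 2 by (intro increment_square_integrable) (auto simp: block_family_def)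
  have "(\<integral>\<omega>. \<beta> (block_integral I a b \<xi> \<omega>) (block_integral J c d \<eta> \<omega>) \<partial>M)
    = (\<integral>\<omega>. (\<Sum>i\<in>I. \<Sum>j\<in>J. \<beta> ((W (b i) \<omega> - W (a i) \<omega>) *\<^sub>R \<xi> i \<omega>) ((W (d j) \<omega> - W (c j) \<omega>) *\<^sub>R \<eta> j \<omega>)) \<partial>M)"
    unfolding block_integral_def sum_left sum_right by (intro Bochner_Integration.integral_cong refl sum.swap)
  also have "\<dots> = (\<Sum>i\<in>I. \<Sum>j\<in>J. \<integral>\<omega>. \<beta> ((W (b i) \<omega> - W (a i) \<omega>) *\<^sub>R \<xi> i \<omega>) ((W (d j) \<omega> - W (c j) \<omega>) *\<^sub>R \<eta> j \<omega>) \<partial>M)"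
    using square_integrable_bilinear[OF \<beta> w w']
    by (subst Bochner_Integration.integral_sum) (auto intro!: sum.cong Bochner_Integration.integral_sum)
  also have "\<dots> = (\<Sum>i\<in>I. \<Sum>j\<in>J. measure lborel (?A i j) *\<^sub>R (\<integral>\<omega>. \<beta> (\<xi> i \<omega>) (\<eta> j \<omega>) \<partial>M))"
    using 1 2 by (intro sum.cong refl covariance_increments \<beta>) (auto simp: block_family_def)
  also have "\<dots> = (\<Sum>i\<in>I. \<Sum>j\<in>J. (\<integral>(s, \<omega>). indicator (?A i j) s *\<^sub>R \<beta> (\<xi> i \<omega>) (\<eta> j \<omega>) \<partial>(time_measure T \<Otimes>\<^sub>M M)))"
    by (intro sum.cong refl ij(2)[symmetric])
  also have "\<dots> = (\<integral>x. (\<Sum>i\<in>I. \<Sum>j\<in>J. case x of (s, \<omega>) \<Rightarrow> indicator (?A i j) s *\<^sub>R \<beta> (\<xi> i \<omega>) (\<eta> j \<omega>)) \<partial>(time_measure T \<Otimes>\<^sub>M M))"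
    using ij(1) by (subst Bochner_Integration.integral_sum) (auto intro!: sum.cong Bochner_Integration.integral_sum[symmetric] Bochner_Integration.integrable_sum)
  also have "\<dots> = (\<integral>(s, \<omega>). \<beta> (block_process I a b \<xi> s \<omega>) (block_process J c d \<eta> s \<omega>) \<partial>(time_measure T \<Otimes>\<^sub>M M))"
  proof (intro Bochner_Integration.integral_cong refl)
    fix x :: "real \<times> 'a"
    obtain s \<omega> where x: "x = (s, \<omega>)" by (cases x)
    show "(\<Sum>i\<in>I. \<Sum>j\<in>J. case x of (s, \<omega>) \<Rightarrow> indicator (?A i j) s *\<^sub>R \<beta> (\<xi> i \<omega>) (\<eta> j \<omega>))
      = (case x of (s, \<omega>) \<Rightarrow> \<beta> (block_process I a b \<xi> s \<omega>) (block_process J c d \<eta> s \<omega>))"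
      unfolding x block_process_def sum_left sum_right scaleR_left scaleR_right scaleR_scaleR prod.case indicator_inter_arith
      by (subst sum.swap) (simp add: scaleR_sum_right mult.commute)
  qed
  finally show ?thesis .
qed

lemma square_integrable_block_process:
  assumes "block_family I a b \<xi>"
  shows "square_integrable (time_measure T \<Otimes>\<^sub>M M) (\<lambda>(s, \<omega>). block_process I a b \<xi> s \<omega>)"
proof -
  interpret T: finite_measure "time_measure T" by (rule finite_measure_time_measure)
  have "square_integrable (time_measure T \<Otimes>\<^sub>M M) (\<lambda>(s, \<omega>). indicator {a i<..b i} s *\<^sub>R \<xi> i \<omega>)" if i: "i \<in> I" for i
  proof -
    have [measurable]: "\<xi> i \<in> borel_measurable M" and s: "square_integrable M (\<xi> i)"
      using assms i by (auto simp: block_family_def square_integrable_def)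
    have [measurable]: "(indicator {a i<..b i} :: real \<Rightarrow> real) \<in> borel_measurable (time_measure T)"
      by (simp add: time_measure_def measurable_restrict_space1)
    have "integrable (time_measure T) (\<lambda>s. (indicator {a i<..b i} s :: real)\<^sup>2)"
      by (rule T.integrable_const_bound[where B=1]) ((auto simp: indicator_def)[1], measurable)
    from integral_product_scaleR(1)[OF sigma_finite_time_measure sigma_finite_measure_axioms this square_integrable_sq[OF s]]
    show ?thesis
      unfolding square_integrable_def by (auto simp: split_beta' power_mult_distrib sets_time_measure cong: measurable_cong_sets)
  qed
  from square_integrable_sum[OF this, of I "\<lambda>i. i"]
  show ?thesis by (simp add: block_process_def split_beta')
qed

end

lemma measurable_time_measure_mono:
  assumes "s \<le> t" "f \<in> measurable (time_measure t \<Otimes>\<^sub>M N) K"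
  shows "f \<in> measurable (time_measure s \<Otimes>\<^sub>M N) K"
proof -
  have "(\<lambda>x. x) \<in> measurable (time_measure s) (time_measure t)"
  proof (rule measurableI)
    fix A assume "A \<in> sets (time_measure t)"
    then obtain B where B: "B \<in> sets borel" "A = {0..t} \<inter> B"
      by (auto simp: sets_time_measure sets_restrict_space)
    then have "(\<lambda>x. x) -` A \<inter> space (time_measure s) = {0..s} \<inter> B" using assms(1) by auto
    with B show "(\<lambda>x. x) -` A \<inter> space (time_measure s) \<in> sets (time_measure s)"
      by (simp add: sets_time_measure sets_restrict_space)
  qed (use assms(1) in auto)
  then have "(\<lambda>x. (fst x, snd x)) \<in> measurable (time_measure s \<Otimes>\<^sub>M N) (time_measure t \<Otimes>\<^sub>M N)"
    by (intro measurable_Pair) (auto intro: measurable_compose[OF measurable_fst])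
  from measurable_compose[OF this assms(2)] show ?thesis by simp
qed

section \<open>From step integrands to Ito integrals\<close>

context standard_brownian_motion
begin

lemma pair_sigma_finite_time: "pair_sigma_finite (time_measure T) M"
  by (intro pair_sigma_finite.intro sigma_finite_time_measure sigma_finite_measure_axioms)

text \<open>\<open>mean_square_energy\<close> integrates over time inside the expectation. Tonelli
  turns it into an integral over the product space, where integrands are treated like any other
  square-integrable function.\<close>

lemma mean_square_energy_eq:
  assumes "(\<lambda>(s, \<omega>). Z s \<omega>) \<in> borel_measurable (time_measure T \<Otimes>\<^sub>M M)"
  shows "mean_square_energy M {0..T} Z
    = (\<integral>\<^sup>+x. ennreal ((norm (case x of (s, \<omega>) \<Rightarrow> Z s \<omega>))\<^sup>2) \<partial>(time_measure T \<Otimes>\<^sub>M M))"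
proof -
  interpret pair_sigma_finite "time_measure T" M by (rule pair_sigma_finite_time)
  have "mean_square_energy M {0..T} Z = (\<integral>\<^sup>+\<omega>. (\<integral>\<^sup>+s. ennreal ((norm (Z s \<omega>))\<^sup>2) \<partial>time_measure T) \<partial>M)"
    by (simp add: mean_square_energy_def nn_integral_time_measure)
  also have "\<dots> = (\<integral>\<^sup>+x. (case x of (s, \<omega>) \<Rightarrow> ennreal ((norm (Z s \<omega>))\<^sup>2)) \<partial>(time_measure T \<Otimes>\<^sub>M M))"
    using assms by (subst nn_integral_snd[symmetric]) (simp_all add: split_beta')
  finally show ?thesis by (simp add: split_beta')
qed

lemma ito_integrand_iff:
  "ito_integrand M W T G \<longleftrightarrow> square_integrable (time_measure T \<Otimes>\<^sub>M M) (\<lambda>(s, \<omega>). G s \<omega>)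
     \<and> (\<forall>s\<in>{0..T}. G s \<in> borel_measurable (F s))"
proof -
  have "measurable (restrict_space borel {0..T} \<Otimes>\<^sub>M M) borel = measurable (time_measure T \<Otimes>\<^sub>M M) (borel :: 'b measure)"
    by (intro measurable_cong_sets sets_pair_measure_cong) (auto simp: sets_time_measure)
  then show ?thesis
    unfolding ito_integrand_def square_integrable_iff_nn_integral using mean_square_energy_eq[of G T] by auto
qed

lemma square_integrable_energy_mono:
  assumes "s \<le> t" "square_integrable (time_measure t \<Otimes>\<^sub>M M) (\<lambda>(s, \<omega>). Z s \<omega>)"
  shows "square_integrable (time_measure s \<Otimes>\<^sub>M M) (\<lambda>(s, \<omega>). Z s \<omega>)"
    "(\<integral>x. (norm (case x of (s, \<omega>) \<Rightarrow> Z s \<omega>))\<^sup>2 \<partial>(time_measure s \<Otimes>\<^sub>M M))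
      \<le> (\<integral>x. (norm (case x of (s, \<omega>) \<Rightarrow> Z s \<omega>))\<^sup>2 \<partial>(time_measure t \<Otimes>\<^sub>M M))"
proof -
  have t: "(\<lambda>(s, \<omega>). Z s \<omega>) \<in> borel_measurable (time_measure t \<Otimes>\<^sub>M M)"
    using assms by (simp add: square_integrable_def)
  note s = measurable_time_measure_mono[OF assms(1) this]
  have le: "mean_square_energy M {0..s} Z \<le> mean_square_energy M {0..t} Z"
    unfolding mean_square_energy_def using assms(1)
    by (intro nn_integral_mono mult_left_mono) (auto split: split_indicator)
  show si: "square_integrable (time_measure s \<Otimes>\<^sub>M M) (\<lambda>(s, \<omega>). Z s \<omega>)"
    using s le assms(2) unfolding square_integrable_iff_nn_integral mean_square_energy_eq[OF s] mean_square_energy_eq[OF t]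
    by auto
  show "(\<integral>x. (norm (case x of (s, \<omega>) \<Rightarrow> Z s \<omega>))\<^sup>2 \<partial>(time_measure s \<Otimes>\<^sub>M M))
      \<le> (\<integral>x. (norm (case x of (s, \<omega>) \<Rightarrow> Z s \<omega>))\<^sup>2 \<partial>(time_measure t \<Otimes>\<^sub>M M))"
    using le unfolding mean_square_energy_eq[OF s] mean_square_energy_eq[OF t]
      square_integrable_nn_integral[OF si] square_integrable_nn_integral[OF assms(2)]
    by (subst (asm) ennreal_le_iff) (auto intro: integral_nonneg_AE)
qed

lemma simple_process_on_block_family:
  assumes "simple_process_on M W T n p \<xi>"
  shows "block_family {..<n} p (\<lambda>i. p (Suc i)) \<xi>" "\<And>i. i < n \<Longrightarrow> p (Suc i) \<le> T"
proof -
  have p: "0 \<le> p 0" "\<And>i. i < n \<Longrightarrow> p i \<le> p (Suc i)" "p n \<le> T" and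
    \<xi>: "\<And>i. i < n \<Longrightarrow> \<xi> i \<in> borel_measurable (F (p i))" "\<And>i. i < n \<Longrightarrow> integrable M (\<lambda>\<omega>. (norm (\<xi> i \<omega>))\<^sup>2)"
    using assms by (auto simp: simple_process_on_def)
  have "i \<le> n \<Longrightarrow> 0 \<le> p i" for i
  proof (induction i)
    case (Suc i) then show ?case using p(2)[of i] by auto
  qed (use p in auto)
  moreover have "i \<le> n \<Longrightarrow> p i \<le> p n" for i
  proof (induction i rule: inc_induct)
    case (step i) then show ?case using p(2)[of i] by auto
  qed auto
  ultimately have p': "i < n \<Longrightarrow> 0 \<le> p i \<and> p (Suc i) \<le> T" for i
    using p(3) by (meson Suc_leI less_imp_le order_trans)
  then show "block_family {..<n} p (\<lambda>i. p (Suc i)) \<xi>"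
    using p(2) \<xi> measurable_F_M[OF \<xi>(1)] by (auto simp: block_family_def square_integrable_def)
  show "\<And>i. i < n \<Longrightarrow> p (Suc i) \<le> T" using p' by blast
qed

text \<open>The witnesses hidden in \<open>has_ito_integral\<close>, with real integrals in place of
  \<open>ennreal\<close> ones and block families in place of simple processes, so that the limit
  lemma for bilinear maps applies directly.\<close>

definition ito_blocks :: "real \<Rightarrow> (real \<Rightarrow> 'a \<Rightarrow> 'b::euclidean_space) \<Rightarrow> ('a \<Rightarrow> 'b) \<Rightarrow>
    (nat \<Rightarrow> nat) \<Rightarrow> (nat \<Rightarrow> nat \<Rightarrow> real) \<Rightarrow> (nat \<Rightarrow> nat \<Rightarrow> real) \<Rightarrow> (nat \<Rightarrow> nat \<Rightarrow> 'a \<Rightarrow> 'b) \<Rightarrow> bool" where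
  "ito_blocks T G Y n a b \<xi> \<longleftrightarrow>
     square_integrable M Y \<and> square_integrable (time_measure T \<Otimes>\<^sub>M M) (\<lambda>(s, \<omega>). G s \<omega>) \<and>
     (\<forall>k. block_family {..<n k} (a k) (b k) (\<xi> k) \<and> (\<forall>i<n k. b k i \<le> T)) \<and>
     (\<lambda>k. \<integral>x. (norm ((case x of (s, \<omega>) \<Rightarrow> block_process {..<n k} (a k) (b k) (\<xi> k) s \<omega>) - (case x of (s, \<omega>) \<Rightarrow> G s \<omega>)))\<^sup>2
       \<partial>(time_measure T \<Otimes>\<^sub>M M)) \<longlonglongrightarrow> 0 \<and>
     (\<lambda>k. \<integral>\<omega>. (norm (block_integral {..<n k} (a k) (b k) (\<xi> k) \<omega> - Y \<omega>))\<^sup>2 \<partial>M) \<longlonglongrightarrow> 0"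

lemma ito_blocksD:
  assumes "ito_blocks T G Y n a b \<xi>"
  shows "square_integrable M Y" "square_integrable (time_measure T \<Otimes>\<^sub>M M) (\<lambda>(s, \<omega>). G s \<omega>)"
    "\<And>k. block_family {..<n k} (a k) (b k) (\<xi> k)" "\<And>k i. i < n k \<Longrightarrow> b k i \<le> T" "\<And>k i. i \<in> {..<n k} \<Longrightarrow> b k i \<le> T"
    "(\<lambda>k. \<integral>x. (norm ((case x of (s, \<omega>) \<Rightarrow> block_process {..<n k} (a k) (b k) (\<xi> k) s \<omega>) - (case x of (s, \<omega>) \<Rightarrow> G s \<omega>)))\<^sup>2
       \<partial>(time_measure T \<Otimes>\<^sub>M M)) \<longlonglongrightarrow> 0"
    "(\<lambda>k. \<integral>\<omega>. (norm (block_integral {..<n k} (a k) (b k) (\<xi> k) \<omega> - Y \<omega>))\<^sup>2 \<partial>M) \<longlonglongrightarrow> 0"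
  using assms unfolding ito_blocks_def by blast+

lemma has_ito_integral_blocks:
  assumes "has_ito_integral M W T G Y"
  shows "\<exists>n a b \<xi>. ito_blocks T G Y n a b \<xi>"
proof -
  from assms obtain n p \<xi> where G: "ito_integrand M W T G" and Y: "Y \<in> borel_measurable M"
    and s: "\<And>k. simple_process_on M W T (n k) (p k) (\<xi> k)"
    and e: "(\<lambda>k. mean_square_energy M {0..T}
               (\<lambda>t \<omega>. G t \<omega> - simple_process (n k) (p k) (\<xi> k) t \<omega>)) \<longlonglongrightarrow> 0"
    and l: "(\<lambda>k. \<integral>\<^sup>+\<omega>. ennreal ((norm (Y \<omega> - simple_ito_integral W (n k) (p k) (\<xi> k) \<omega>))\<^sup>2) \<partial>M)
               \<longlonglongrightarrow> 0"
    by (auto simp: has_ito_integral_def)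
  let ?b = "\<lambda>k i. p k (Suc i)"
  note b = simple_process_on_block_family[OF s]
  have bp: "simple_process (n k) (p k) (\<xi> k) = block_process {..<n k} (p k) (?b k) (\<xi> k)" for k
    by (intro ext) (simp add: simple_process_def block_process_def)
  have bi: "simple_ito_integral W (n k) (p k) (\<xi> k) = block_integral {..<n k} (p k) (?b k) (\<xi> k)" for k
    by (intro ext) (simp add: simple_ito_integral_def block_integral_def)
  have sG: "square_integrable (time_measure T \<Otimes>\<^sub>M M) (\<lambda>(s, \<omega>). G s \<omega>)" using G ito_integrand_iff by auto
  note sb = square_integrable_block_integral[OF b(1)] square_integrable_block_process[OF b(1)]
  \<comment> \<open>\<open>has_ito_integral\<close> only asks \<open>Y\<close> to be measurable.
    Since the distances to the approximations tend to 0, \<open>Y\<close> has finite distance from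
    one square-integrable variable and is square integrable itself.\<close>
  have sY: "square_integrable M Y"
  proof -
    have "\<forall>\<^sub>F k in sequentially. (\<integral>\<^sup>+\<omega>. ennreal ((norm (Y \<omega> - simple_ito_integral W (n k) (p k) (\<xi> k) \<omega>))\<^sup>2) \<partial>M) < 1"
      by (rule order_tendstoD(2)[OF l]) simp
    then obtain k where k: "(\<integral>\<^sup>+\<omega>. ennreal ((norm (Y \<omega> - block_integral {..<n k} (p k) (?b k) (\<xi> k) \<omega>))\<^sup>2) \<partial>M) < 1"
      unfolding bi by (auto simp: eventually_sequentially)
    have "square_integrable M (\<lambda>\<omega>. Y \<omega> - block_integral {..<n k} (p k) (?b k) (\<xi> k) \<omega>)"
      unfolding square_integrable_iff_nn_integral
      using k Y square_integrableD[OF sb(1)] by (auto intro: order.strict_trans)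
    from square_integrable_add(1)[OF this sb(1)[of k]] show ?thesis by simp
  qed
  have 1: "(\<lambda>k. \<integral>\<omega>. (norm (block_integral {..<n k} (p k) (?b k) (\<xi> k) \<omega> - Y \<omega>))\<^sup>2 \<partial>M) \<longlonglongrightarrow> 0"
    using l unfolding bi square_integrable_nn_integral[OF square_integrable_diff(1)[OF sY sb(1)]]
    by (subst (asm) ennreal_tendsto_0_iff) (auto simp: norm_minus_commute intro: integral_nonneg_AE)
  have d: "square_integrable (time_measure T \<Otimes>\<^sub>M M) (\<lambda>(t, \<omega>). G t \<omega> - block_process {..<n k} (p k) (?b k) (\<xi> k) t \<omega>)" for k
    using square_integrable_diff(1)[OF sG sb(2)] by (simp add: split_beta')
  have 2: "(\<lambda>k. \<integral>x. (norm ((case x of (s, \<omega>) \<Rightarrow> block_process {..<n k} (p k) (?b k) (\<xi> k) s \<omega>) - (case x of (s, \<omega>) \<Rightarrow> G s \<omega>)))\<^sup>2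
       \<partial>(time_measure T \<Otimes>\<^sub>M M)) \<longlonglongrightarrow> 0"
    using e unfolding bp mean_square_energy_eq[OF square_integrableD[OF d]] square_integrable_nn_integral[OF d]
    by (subst (asm) ennreal_tendsto_0_iff) (auto simp: norm_minus_commute split_beta' intro: integral_nonneg_AE)
  have "ito_blocks T G Y n p ?b \<xi>"
    unfolding ito_blocks_def using sY sG b 1 2 by blast
  then show ?thesis by blast
qed

lemma has_ito_integral_square_integrable: "has_ito_integral M W T G Y \<Longrightarrow> square_integrable M Y"
  using has_ito_integral_blocks ito_blocksD(1) by blast

text \<open>For the inner product this is the usual isometry; for \<open>outer\<close> it yields the
  noise term in the equation of a covariance matrix.\<close>

theorem ito_isometry:
  assumes \<beta>: "bounded_bilinear (\<beta> :: 'b::euclidean_space \<Rightarrow> 'b \<Rightarrow> 'c::euclidean_space)"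
    and "has_ito_integral M W T G Y"
  shows "(\<integral>\<omega>. \<beta> (Y \<omega>) (Y \<omega>) \<partial>M) = (\<integral>(s, \<omega>). \<beta> (G s \<omega>) (G s \<omega>) \<partial>(time_measure T \<Otimes>\<^sub>M M))"
proof -
  obtain n a b \<xi> where B: "ito_blocks T G Y n a b \<xi>"
    using has_ito_integral_blocks[OF assms(2)] by blast
  note Y = ito_blocksD(1)[OF B] and G = ito_blocksD(2)[OF B] and b = ito_blocksD(3,5)[OF B] and c = ito_blocksD(6,7)[OF B]
  note sb = square_integrable_block_integral[OF b(1)] square_integrable_block_process[OF b(1)]
  have "(\<lambda>k. \<integral>\<omega>. \<beta> (block_integral {..<n k} (a k) (b k) (\<xi> k) \<omega>) (block_integral {..<n k} (a k) (b k) (\<xi> k) \<omega>) \<partial>M)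
     \<longlonglongrightarrow> (\<integral>\<omega>. \<beta> (Y \<omega>) (Y \<omega>) \<partial>M)"
    by (rule tendsto_integral_bilinear[OF \<beta> sb(1) Y sb(1) Y c(2) c(2)])
  moreover have "(\<integral>\<omega>. \<beta> (block_integral {..<n k} (a k) (b k) (\<xi> k) \<omega>) (block_integral {..<n k} (a k) (b k) (\<xi> k) \<omega>) \<partial>M)
    = (\<integral>x. \<beta> (case x of (s, \<omega>) \<Rightarrow> block_process {..<n k} (a k) (b k) (\<xi> k) s \<omega>)
            (case x of (s, \<omega>) \<Rightarrow> block_process {..<n k} (a k) (b k) (\<xi> k) s \<omega>) \<partial>(time_measure T \<Otimes>\<^sub>M M))" for k
  proof -
    have bk: "\<And>i. i \<in> {..<n k} \<Longrightarrow> b k i \<le> T" using b(2) by blast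
    show ?thesis using block_isometry[OF \<beta> b(1) bk b(1) bk] by (simp add: split_beta')
  qed
  moreover have "(\<lambda>k. \<integral>x. \<beta> (case x of (s, \<omega>) \<Rightarrow> block_process {..<n k} (a k) (b k) (\<xi> k) s \<omega>)
            (case x of (s, \<omega>) \<Rightarrow> block_process {..<n k} (a k) (b k) (\<xi> k) s \<omega>) \<partial>(time_measure T \<Otimes>\<^sub>M M))
     \<longlonglongrightarrow> (\<integral>x. \<beta> (case x of (s, \<omega>) \<Rightarrow> G s \<omega>) (case x of (s, \<omega>) \<Rightarrow> G s \<omega>) \<partial>(time_measure T \<Otimes>\<^sub>M M))"
    by (rule tendsto_integral_bilinear[OF \<beta> sb(2) G sb(2) G c(1) c(1)])
  ultimately show ?thesis by (simp add: LIMSEQ_unique split_beta')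
qed

text \<open>The two families may be indexed differently and live on unrelated grids. The square of
  the difference is therefore expanded, and the bilinear isometry is applied to each of the three
  products.\<close>

lemma block_isometry_diff:
  fixes \<xi> :: "'i \<Rightarrow> 'a \<Rightarrow> 'b::euclidean_space"
  assumes 1: "block_family I a b \<xi>" "\<And>i. i \<in> I \<Longrightarrow> b i \<le> T"
    and 2: "block_family J c d \<eta>" "\<And>j. j \<in> J \<Longrightarrow> d j \<le> T"
  shows "(\<integral>\<omega>. (norm (block_integral I a b \<xi> \<omega> - block_integral J c d \<eta> \<omega>))\<^sup>2 \<partial>M)
    = (\<integral>(s, \<omega>). (norm (block_process I a b \<xi> s \<omega> - block_process J c d \<eta> s \<omega>))\<^sup>2 \<partial>(time_measure T \<Otimes>\<^sub>M M))"
proof -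
  note inn = bounded_bilinear_inner
  note sb = square_integrable_block_integral[OF 1(1)] square_integrable_block_integral[OF 2(1)]
    square_integrable_block_process[OF 1(1), of T] square_integrable_block_process[OF 2(1), of T]
  have n: "(norm (x - y))\<^sup>2 = x \<bullet> x - 2 * (x \<bullet> y) + y \<bullet> y" for x y :: 'b
    by (simp add: power2_norm_eq_inner inner_diff inner_commute)
  note i = square_integrable_bilinear[OF inn sb(1) sb(1)] square_integrable_bilinear[OF inn sb(1) sb(2)] square_integrable_bilinear[OF inn sb(2) sb(2)]
  note j = square_integrable_bilinear[OF inn sb(3) sb(3), unfolded split_beta'] square_integrable_bilinear[OF inn sb(3) sb(4), unfolded split_beta'] square_integrable_bilinear[OF inn sb(4) sb(4), unfolded split_beta']
  show ?thesis
    unfolding n split_beta' using i j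
    by (simp add: block_isometry[OF inn 1 1, unfolded split_beta'] block_isometry[OF inn 2 2, unfolded split_beta'] block_isometry[OF inn 1 2, unfolded split_beta'])
qed

lemma ito_integral_mean:
  assumes "has_ito_integral M W T G (Y :: 'a \<Rightarrow> 'b::euclidean_space)"
  shows "(\<integral>\<omega>. Y \<omega> \<partial>M) = 0"
proof -
  obtain n a b \<xi> where B: "ito_blocks T G Y n a b \<xi>"
    using has_ito_integral_blocks[OF assms] by blast
  note Y = ito_blocksD(1)[OF B] and b = ito_blocksD(3,5)[OF B] and c = ito_blocksD(7)[OF B]
  note sb = square_integrable_block_integral[OF b(1)]
  \<comment> \<open>The expectation is written as a product with the constant 1, which brings it
    under the bilinear limit lemma.\<close>
  have "(\<lambda>k. \<integral>\<omega>. 1 *\<^sub>R block_integral {..<n k} (a k) (b k) (\<xi> k) \<omega> \<partial>M) \<longlonglongrightarrow> (\<integral>\<omega>. 1 *\<^sub>R Y \<omega> \<partial>M)"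
    by (rule tendsto_integral_bilinear[OF bounded_bilinear_scaleR square_integrable_const square_integrable_const sb Y _ c]) simp
  moreover have "(\<integral>\<omega>. block_integral {..<n k} (a k) (b k) (\<xi> k) \<omega> \<partial>M) = 0" for k
  proof -
    have "(\<integral>\<omega>. block_integral {..<n k} (a k) (b k) (\<xi> k) \<omega> \<partial>M)
      = (\<Sum>i<n k. \<integral>\<omega>. (W (b k i) \<omega> - W (a k i) \<omega>) *\<^sub>R \<xi> k i \<omega> \<partial>M)"
      unfolding block_integral_def using b(1)[of k]
      by (intro Bochner_Integration.integral_sum increment_scaleR) (auto simp: block_family_def intro: square_integrable_integrable)
    also have "\<dots> = 0"
      using b(1)[of k]
      by (intro sum.neutral ballI increment_scaleR) (auto simp: block_family_def intro: square_integrable_integrable)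
    finally show ?thesis .
  qed
  ultimately show ?thesis using LIMSEQ_unique[OF _ tendsto_const] by simp
qed

text \<open>Blocks that start after \<open>s\<close> have to be removed, because for them
  \<open>min (b i) s\<close> would lie before \<open>a i\<close>.\<close>

lemma block_family_past:
  "block_family I a b \<xi> \<Longrightarrow> 0 \<le> s \<Longrightarrow> block_family {i\<in>I. a i \<le> s} a (\<lambda>i. min (b i) s) \<xi>"
  by (auto simp: block_family_def)

text \<open>Here a block that ends before \<open>s\<close> becomes the empty block
  \<open>(s, s]\<close> and may stay. A later starting time keeps its coefficient
  measurable.\<close>

lemma block_family_future:
  "block_family I a b \<xi> \<Longrightarrow> 0 \<le> s \<Longrightarrow> block_family I (\<lambda>i. max (a i) s) (\<lambda>i. max (b i) s) \<xi>"
  by (auto simp: block_family_def intro: measurable_F_mono)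

lemma block_integral_split:
  assumes "block_family I a b \<xi>"
  shows "block_integral I a b \<xi> \<omega> = block_integral {i\<in>I. a i \<le> s} a (\<lambda>i. min (b i) s) \<xi> \<omega>
     + block_integral I (\<lambda>i. max (a i) s) (\<lambda>i. max (b i) s) \<xi> \<omega>"
proof -
  have f: "finite I" and ab: "\<And>i. i \<in> I \<Longrightarrow> a i \<le> b i" using assms by (auto simp: block_family_def)
  show ?thesis
    unfolding block_integral_def sum.inter_filter[OF f] sum.distrib[symmetric]
  proof (intro sum.cong refl)
    fix i assume "i \<in> I"
    from ab[OF this] show "(W (b i) \<omega> - W (a i) \<omega>) *\<^sub>R \<xi> i \<omega> =
      (if a i \<le> s then (W (min (b i) s) \<omega> - W (a i) \<omega>) *\<^sub>R \<xi> i \<omega> else 0) +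
      (W (max (b i) s) \<omega> - W (max (a i) s) \<omega>) *\<^sub>R \<xi> i \<omega>"
      by (auto simp: min_def max_def simp flip: scaleR_add_left)
  qed
qed

lemma block_process_past:
  assumes "finite I" "r \<le> s"
  shows "block_process {i\<in>I. a i \<le> s} a (\<lambda>i. min (b i) s) \<xi> r \<omega> = block_process I a b \<xi> r \<omega>"
  unfolding block_process_def sum.inter_filter[OF assms(1)]
  using assms(2) by (intro sum.cong refl) (auto simp: indicator_def)

lemma orthogonal_block_integral_future:
  assumes \<beta>: "bounded_bilinear (\<beta> :: 'd::euclidean_space \<Rightarrow> 'b::euclidean_space \<Rightarrow> 'c::euclidean_space)"
    and b: "block_family I a b \<xi>" "0 \<le> s"
    and \<zeta>: "\<zeta> \<in> borel_measurable (F s)" "square_integrable M \<zeta>"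
  shows "(\<integral>\<omega>. \<beta> (\<zeta> \<omega>) (block_integral I (\<lambda>i. max (a i) s) (\<lambda>i. max (b i) s) \<xi> \<omega>) \<partial>M) = 0"
proof -
  interpret bounded_bilinear \<beta> by fact
  have i: "square_integrable M (\<lambda>\<omega>. (W (max (b i) s) \<omega> - W (max (a i) s) \<omega>) *\<^sub>R \<xi> i \<omega>)" if "i \<in> I" for i
    using that b by (intro increment_square_integrable) (auto simp: block_family_def intro: measurable_F_mono)
  have "(\<integral>\<omega>. \<beta> (\<zeta> \<omega>) (block_integral I (\<lambda>i. max (a i) s) (\<lambda>i. max (b i) s) \<xi> \<omega>) \<partial>M)
    = (\<Sum>i\<in>I. \<integral>\<omega>. \<beta> (\<zeta> \<omega>) ((W (max (b i) s) \<omega> - W (max (a i) s) \<omega>) *\<^sub>R \<xi> i \<omega>) \<partial>M)"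
    unfolding block_integral_def sum_right
    by (intro Bochner_Integration.integral_sum square_integrable_bilinear[OF \<beta>] \<zeta> i)
  also have "\<dots> = 0"
    using b \<zeta> by (intro sum.neutral ballI orthogonal_increment[OF \<beta>]) (auto simp: block_family_def intro: measurable_F_mono)
  finally show ?thesis .
qed

text \<open>\<open>Y - Z\<close> is the integral over \<open>(s, t]\<close>, but \<open>Y\<close>
  and \<open>Z\<close> come with unrelated approximations. The approximation of \<open>Y\<close> is
  split at \<open>s\<close>: its later part \<open>Q k\<close> is orthogonal to
  \<open>\<zeta>\<close>, and by the isometry its earlier part \<open>P k\<close> is close in mean
  square to the approximation \<open>J k\<close> of \<open>Z\<close>, because on
  \<open>[0, s]\<close> both step integrands approximate the same \<open>G\<close>.\<close>

theorem ito_integral_orthogonal: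
  assumes \<beta>: "bounded_bilinear (\<beta> :: 'd::euclidean_space \<Rightarrow> 'b::euclidean_space \<Rightarrow> 'c::euclidean_space)"
    and st: "0 \<le> s" "s \<le> t"
    and Y: "has_ito_integral M W t G Y" and Z: "has_ito_integral M W s G Z"
    and \<zeta>: "\<zeta> \<in> borel_measurable (F s)" "square_integrable M \<zeta>"
  shows "(\<integral>\<omega>. \<beta> (\<zeta> \<omega>) (Y \<omega> - Z \<omega>) \<partial>M) = 0"
proof -
  interpret bounded_bilinear \<beta> by fact
  obtain n a b \<xi> where B: "ito_blocks t G Y n a b \<xi>"
    using has_ito_integral_blocks[OF Y] by blast
  obtain m c d \<eta> where D: "ito_blocks s G Z m c d \<eta>"
    using has_ito_integral_blocks[OF Z] by blast
  note Y = ito_blocksD(1)[OF B] and Gt = ito_blocksD(2)[OF B] and b = ito_blocksD(3,5)[OF B] and b' = ito_blocksD(6,7)[OF B]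
  note Z = ito_blocksD(1)[OF D] and G = ito_blocksD(2)[OF D] and d = ito_blocksD(3,5)[OF D] and d' = ito_blocksD(6,7)[OF D]
  define I where "I k = block_integral {..<n k} (a k) (b k) (\<xi> k)" for k
  define J where "J k = block_integral {..<m k} (c k) (d k) (\<eta> k)" for k
  define \<Phi> where "\<Phi> k = block_process {..<n k} (a k) (b k) (\<xi> k)" for k
  define \<Psi> where "\<Psi> k = block_process {..<m k} (c k) (d k) (\<eta> k)" for k
  define P where "P k = block_integral {i\<in>{..<n k}. a k i \<le> s} (a k) (\<lambda>i. min (b k i) s) (\<xi> k)" for k
  define Q where "Q k = block_integral {..<n k} (\<lambda>i. max (a k i) s) (\<lambda>i. max (b k i) s) (\<xi> k)" for k
  have sI: "square_integrable M (I k)" and sJ: "square_integrable M (J k)" and sP: "square_integrable M (P k)"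
    and sQ: "square_integrable M (Q k)" for k
    unfolding I_def J_def P_def Q_def
    by (intro square_integrable_block_integral b d block_family_past block_family_future st)+
  have IPQ: "I k \<omega> = P k \<omega> + Q k \<omega>" for k \<omega>
    unfolding I_def P_def Q_def by (rule block_integral_split[OF b(1)])
  have le: "(\<integral>\<omega>. (norm (P k \<omega> - J k \<omega>))\<^sup>2 \<partial>M) \<le>
    2 * (\<integral>x. (norm ((case x of (s, \<omega>) \<Rightarrow> \<Phi> k s \<omega>) - (case x of (s, \<omega>) \<Rightarrow> G s \<omega>)))\<^sup>2 \<partial>(time_measure t \<Otimes>\<^sub>M M)) +
    2 * (\<integral>x. (norm ((case x of (s, \<omega>) \<Rightarrow> \<Psi> k s \<omega>) - (case x of (s, \<omega>) \<Rightarrow> G s \<omega>)))\<^sup>2 \<partial>(time_measure s \<Otimes>\<^sub>M M))"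
    (is "?l k \<le> 2 * ?A k + 2 * ?B k") for k
  proof -
    have sd: "square_integrable (time_measure t \<Otimes>\<^sub>M M) (\<lambda>(s, \<omega>). \<Phi> k s \<omega> - G s \<omega>)"
      using square_integrable_diff(1)[OF square_integrable_block_process[OF b(1)[of k], of t] Gt]
      by (simp add: split_beta' \<Phi>_def)
    have sd': "square_integrable (time_measure s \<Otimes>\<^sub>M M) (\<lambda>(s, \<omega>). \<Psi> k s \<omega> - G s \<omega>)"
      using square_integrable_diff(1)[OF square_integrable_block_process[OF d(1)[of k], of s] G]
      by (simp add: split_beta' \<Psi>_def)
    note mono = square_integrable_energy_mono[OF st(2) sd]
    have "?l k = (\<integral>(r, \<omega>). (norm (block_process {i\<in>{..<n k}. a k i \<le> s} (a k) (\<lambda>i. min (b k i) s) (\<xi> k) r \<omega> - \<Psi> k r \<omega>))\<^sup>2 \<partial>(time_measure s \<Otimes>\<^sub>M M))"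
      unfolding P_def J_def \<Psi>_def using d(2) st
      by (intro block_isometry_diff block_family_past b d) auto
    \<comment> \<open>\<open>G\<close> is inserted between the two step processes; on
      \<open>[0, s]\<close> cutting the blocks at \<open>s\<close> does not change the
      process.\<close>
    also have "\<dots> = (\<integral>x. (norm ((case x of (s, \<omega>) \<Rightarrow> \<Phi> k s \<omega> - G s \<omega>) - (case x of (s, \<omega>) \<Rightarrow> \<Psi> k s \<omega> - G s \<omega>)))\<^sup>2 \<partial>(time_measure s \<Otimes>\<^sub>M M))"
      by (intro Bochner_Integration.integral_cong refl)
         (auto simp: \<Phi>_def space_pair_measure block_process_past[of "{..<n k}", simplified])
    also have "\<dots> \<le> 2 * (\<integral>x. (norm (case x of (s, \<omega>) \<Rightarrow> \<Phi> k s \<omega> - G s \<omega>))\<^sup>2 \<partial>(time_measure s \<Otimes>\<^sub>M M)) +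
      2 * (\<integral>x. (norm (case x of (s, \<omega>) \<Rightarrow> \<Psi> k s \<omega> - G s \<omega>))\<^sup>2 \<partial>(time_measure s \<Otimes>\<^sub>M M))"
      by (rule square_integrable_diff(2)[OF mono(1) sd'])
    also have "\<dots> \<le> 2 * ?A k + 2 * ?B k"
      using mono(2) by (simp add: split_beta')
    finally show ?thesis .
  qed
  have lim: "(\<lambda>k. 2 * ?A k + 2 * ?B k) \<longlonglongrightarrow> 0"
    using tendsto_add[OF tendsto_mult[OF tendsto_const b'(1)] tendsto_mult[OF tendsto_const d'(1)], of 2 2]
    unfolding \<Phi>_def \<Psi>_def by simp
  have "(\<lambda>k. ?l k) \<longlonglongrightarrow> 0"
  proof (rule Lim_null_comparison[OF always_eventually[OF allI] lim])
    fix k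
    have "0 \<le> ?l k" by (rule integral_nonneg_AE) simp
    then show "norm (?l k) \<le> 2 * ?A k + 2 * ?B k" using le[of k] by (simp only: real_norm_def abs_of_nonneg)
  qed
  then have PJ: "(\<lambda>k. (\<integral>\<omega>. (norm (P k \<omega> - J k \<omega> - 0))\<^sup>2 \<partial>M)) \<longlonglongrightarrow> 0" by simp
  have "(\<lambda>k. \<integral>\<omega>. \<beta> (\<zeta> \<omega>) (P k \<omega> - J k \<omega>) \<partial>M) \<longlonglongrightarrow> (\<integral>\<omega>. \<beta> (\<zeta> \<omega>) 0 \<partial>M)"
    by (rule tendsto_integral_bilinear[OF \<beta> \<zeta>(2) \<zeta>(2) square_integrable_diff(1)[OF sP sJ] square_integrable_zero _ PJ]) simp
  then have lim0: "(\<lambda>k. \<integral>\<omega>. \<beta> (\<zeta> \<omega>) (P k \<omega> - J k \<omega>) \<partial>M) \<longlonglongrightarrow> 0" by (simp add: zero_right)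
  have Q0: "(\<integral>\<omega>. \<beta> (\<zeta> \<omega>) (Q k \<omega>) \<partial>M) = 0" for k
    unfolding Q_def by (rule orthogonal_block_integral_future[OF \<beta> b(1) st(1) \<zeta>])
  have eq: "(\<integral>\<omega>. \<beta> (\<zeta> \<omega>) (P k \<omega> - J k \<omega>) \<partial>M) = (\<integral>\<omega>. \<beta> (\<zeta> \<omega>) (I k \<omega>) \<partial>M) - (\<integral>\<omega>. \<beta> (\<zeta> \<omega>) (J k \<omega>) \<partial>M)" for k
  proof -
    have "(\<integral>\<omega>. \<beta> (\<zeta> \<omega>) (I k \<omega>) \<partial>M) = (\<integral>\<omega>. \<beta> (\<zeta> \<omega>) (P k \<omega>) \<partial>M) + (\<integral>\<omega>. \<beta> (\<zeta> \<omega>) (Q k \<omega>) \<partial>M)"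
      unfolding IPQ add_right
      by (intro Bochner_Integration.integral_add square_integrable_bilinear[OF \<beta> \<zeta>(2)] sP sQ)
    moreover have "(\<integral>\<omega>. \<beta> (\<zeta> \<omega>) (P k \<omega> - J k \<omega>) \<partial>M) = (\<integral>\<omega>. \<beta> (\<zeta> \<omega>) (P k \<omega>) \<partial>M) - (\<integral>\<omega>. \<beta> (\<zeta> \<omega>) (J k \<omega>) \<partial>M)"
      unfolding diff_right
      by (intro Bochner_Integration.integral_diff square_integrable_bilinear[OF \<beta> \<zeta>(2)] sP sJ)
    ultimately show ?thesis using Q0[of k] by simp
  qed
  have "(\<lambda>k. \<integral>\<omega>. \<beta> (\<zeta> \<omega>) (I k \<omega>) \<partial>M) \<longlonglongrightarrow> (\<integral>\<omega>. \<beta> (\<zeta> \<omega>) (Y \<omega>) \<partial>M)"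
    unfolding I_def using sI
    by (intro tendsto_integral_bilinear[OF \<beta> \<zeta>(2) \<zeta>(2) _ Y _ b'(2)]) (simp_all add: I_def)
  moreover have "(\<lambda>k. \<integral>\<omega>. \<beta> (\<zeta> \<omega>) (J k \<omega>) \<partial>M) \<longlonglongrightarrow> (\<integral>\<omega>. \<beta> (\<zeta> \<omega>) (Z \<omega>) \<partial>M)"
    unfolding J_def using sJ
    by (intro tendsto_integral_bilinear[OF \<beta> \<zeta>(2) \<zeta>(2) _ Z _ d'(2)]) (simp_all add: J_def)
  ultimately have "(\<integral>\<omega>. \<beta> (\<zeta> \<omega>) (Y \<omega>) \<partial>M) - (\<integral>\<omega>. \<beta> (\<zeta> \<omega>) (Z \<omega>) \<partial>M) = 0"
    using lim0 unfolding eq by (intro LIMSEQ_unique[OF tendsto_diff])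
  then show ?thesis
    unfolding diff_right
    by (subst Bochner_Integration.integral_diff) (auto intro!: square_integrable_bilinear[OF \<beta> \<zeta>(2)] Y Z)
qed

end

section \<open>Second moments of Ito processes\<close>

lemma continuous_on_time_measure:
  fixes f :: "real \<Rightarrow> 'b::euclidean_space"
  assumes "continuous_on {0..} f"
  shows "integrable (time_measure T) f"
    and "t \<in> {0..T} \<Longrightarrow> ((\<lambda>t. \<integral>s. f s \<partial>time_measure t) has_vector_derivative f t) (at t within {0..T})"
    and "continuous_on {0..} (\<lambda>t. \<integral>s. f s \<partial>time_measure t)"
proof -
  have c: "continuous_on {0..t} f" for t using assms by (rule continuous_on_subset) auto
  show "integrable (time_measure T) f" for T
    unfolding integrable_time_measure by (rule borel_integrable_atLeastAtMost'[OF c])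
  have eq: "(\<integral>s. f s \<partial>time_measure t) = integral {0..t} f" for t
    unfolding integral_time_measure by (rule set_borel_integral_eq_integral(2)[OF borel_integrable_atLeastAtMost'[OF c]])
  show d: "((\<lambda>t. \<integral>s. f s \<partial>time_measure t) has_vector_derivative f t) (at t within {0..T})" if "t \<in> {0..T}" for t T
    unfolding eq by (rule integral_has_vector_derivative[OF c that])
  show "continuous_on {0..} (\<lambda>t. \<integral>s. f s \<partial>time_measure t)"
    unfolding continuous_on_eq_continuous_within
  proof
    fix t :: real assume t: "t \<in> {0..}"
    have "continuous (at t within {0..t+1}) (\<lambda>t. \<integral>s. f s \<partial>time_measure t)"
      using d[of t "t+1"] t by (auto intro: has_vector_derivative_continuous)
    moreover have "at t within {0..t+1} = at t within {0..}"
      using t by (intro at_within_nhd[of _ "{..<t+1}"]) auto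
    ultimately show "continuous (at t within {0..}) (\<lambda>t. \<integral>s. f s \<partial>time_measure t)" by simp
  qed
qed

lemma time_measure_FTC:
  fixes f :: "real \<Rightarrow> 'b::euclidean_space"
  assumes "0 \<le> T" "\<And>t. t \<in> {0..T} \<Longrightarrow> (g has_vector_derivative f t) (at t within {0..T})" "continuous_on {0..T} f"
  shows "(\<integral>s. f s \<partial>time_measure T) = g T - g 0"
  using integral_FTC_atLeastAtMost[of 0 T g f] assms
  by (simp add: integral_time_measure set_lebesgue_integral_def)

lemma time_measure_0:
  fixes f :: "real \<Rightarrow> 'b::euclidean_space"
  shows "(\<integral>s. f s \<partial>time_measure 0) = 0"
  unfolding integral_time_measure set_lebesgue_integral_def
proof (rule integral_eq_zero_AE)
  show "AE s in lborel. indicator {0..0} s *\<^sub>R f s = 0"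
    using AE_lborel_singleton[of "0::real"] by eventually_elim (auto simp: indicator_def)
qed

lemma norm_integral_time_measure_sq_le:
  fixes f :: "real \<Rightarrow> 'b::euclidean_space"
  assumes "square_integrable (time_measure T) f" "0 \<le> T"
  shows "(norm (\<integral>s. f s \<partial>time_measure T))\<^sup>2 \<le> T * (\<integral>s. (norm (f s))\<^sup>2 \<partial>time_measure T)"
proof -
  interpret finite_measure "time_measure T" by (rule finite_measure_time_measure)
  have m: "measure (time_measure T) {0..T} = T" using measure_time_measure[of "{0..T}" T] assms(2) by simp
  have "norm (\<integral>s. f s \<partial>time_measure T) \<le> (\<integral>s. norm (f s) \<partial>time_measure T)" by (rule integral_norm_bound)
  also have "\<dots> \<le> sqrt (\<integral>s. (norm (f s))\<^sup>2 \<partial>time_measure T) * sqrt T"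
    using Cauchy_Schwarz_integral[OF assms(1) square_integrable_const[of "1::real"]] m by simp
  finally have "(norm (\<integral>s. f s \<partial>time_measure T))\<^sup>2 \<le> (sqrt (\<integral>s. (norm (f s))\<^sup>2 \<partial>time_measure T) * sqrt T)\<^sup>2"
    by (rule power_mono) simp
  also have "\<dots> = T * (\<integral>s. (norm (f s))\<^sup>2 \<partial>time_measure T)"
    using assms(2) by (simp add: power_mult_distrib real_sqrt_pow2 integral_nonneg_AE)
  finally show ?thesis .
qed

text \<open>The time is rounded down to multiples of \<open>1 / Suc n\<close>. The rounded processes
  run through countably many random variables, hence are jointly measurable, and they converge
  pointwise by continuity of the paths.\<close>

lemma measurable_continuous_process:
  fixes X :: "real \<Rightarrow> 'x \<Rightarrow> 'b::euclidean_space"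
  assumes c: "\<And>\<omega>. \<omega> \<in> space N \<Longrightarrow> continuous_on {0..} (\<lambda>t. X t \<omega>)"
    and m: "\<And>t. 0 \<le> t \<Longrightarrow> X t \<in> borel_measurable N"
  shows "(\<lambda>(s, \<omega>). X s \<omega>) \<in> borel_measurable (time_measure T \<Otimes>\<^sub>M N)"
proof (rule borel_measurable_LIMSEQ_metric)
  let ?g = "\<lambda>n (x::real\<times>'x). nat \<lfloor>fst x * real (Suc n)\<rfloor>"
  let ?f = "\<lambda>n x. X (real (?g n x) / real (Suc n)) (snd x)"
  fix n
  show "?f n \<in> borel_measurable (time_measure T \<Otimes>\<^sub>M N)"
  proof (rule measurable_compose_countable[where f="\<lambda>i x. X (real i / real (Suc n)) (snd x)"])
    show "(\<lambda>x. X (real i / real (Suc n)) (snd x)) \<in> borel_measurable (time_measure T \<Otimes>\<^sub>M N)" for i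
      by (rule measurable_compose[OF measurable_snd m]) simp
    have [measurable]: "(fst :: real \<times> 'x \<Rightarrow> real) \<in> borel_measurable (time_measure T \<Otimes>\<^sub>M N)"
      by (rule measurable_compose[OF measurable_fst]) (simp add: time_measure_def measurable_restrict_space1)
    show "?g n \<in> (time_measure T \<Otimes>\<^sub>M N) \<rightarrow>\<^sub>M count_space UNIV" by measurable
  qed
next
  fix x assume x: "x \<in> space (time_measure T \<Otimes>\<^sub>M N)"
  then have s: "0 \<le> fst x" and w: "snd x \<in> space N" by (auto simp: space_pair_measure)
  let ?r = "\<lambda>n. real (nat \<lfloor>fst x * real (Suc n)\<rfloor>) / real (Suc n)"
  have b: "fst x - 1 / real (Suc n) \<le> ?r n" "?r n \<le> fst x" for n
  proof -
    let ?y = "fst x * real (Suc n)"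
    have "0 \<le> ?y" using s by simp
    then have "?y - 1 \<le> real (nat \<lfloor>?y\<rfloor>)" "real (nat \<lfloor>?y\<rfloor>) \<le> ?y" by linarith+
    from divide_right_mono[OF this(1), of "real (Suc n)"] divide_right_mono[OF this(2), of "real (Suc n)"]
    show "fst x - 1 / real (Suc n) \<le> ?r n" "?r n \<le> fst x" by (simp_all add: diff_divide_distrib)
  qed
  have "?r \<longlonglongrightarrow> fst x"
  proof (rule tendsto_sandwich)
    show "(\<lambda>n. fst x - 1 / real (Suc n)) \<longlonglongrightarrow> fst x"
      using tendsto_diff[OF tendsto_const LIMSEQ_inverse_real_of_nat, of "fst x"] by (simp add: inverse_eq_divide)
  qed (use b in auto)
  then show "(\<lambda>n. X (real (nat \<lfloor>fst x * real (Suc n)\<rfloor>) / real (Suc n)) (snd x)) \<longlonglongrightarrow> (case x of (s, \<omega>) \<Rightarrow> X s \<omega>)"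
    using continuous_on_tendsto_compose[OF c[OF w], of ?r "fst x" sequentially] s by (simp add: split_beta')
qed

section \<open>Expectations of products\<close>

context standard_brownian_motion
begin

text \<open>Square integrability is demanded twice: at each time, for products with Ito integrals at
  that time, and on the product with \<open>[0, T]\<close>, for Fubini.\<close>

definition continuous_process :: "(real \<Rightarrow> 'a \<Rightarrow> 'b::euclidean_space) \<Rightarrow> bool" where
  "continuous_process X \<longleftrightarrow> (\<forall>\<omega>\<in>space M. continuous_on {0..} (\<lambda>t. X t \<omega>)) \<and>
     (\<forall>t\<ge>0. X t \<in> borel_measurable (F t) \<and> square_integrable M (X t)) \<and>
     (\<forall>T. square_integrable (time_measure T \<Otimes>\<^sub>M M) (\<lambda>(s, \<omega>). X s \<omega>))"

lemma square_integrable_snd: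
  assumes "square_integrable M f"
  shows "square_integrable (time_measure T \<Otimes>\<^sub>M M) (\<lambda>x. f (snd x))"
    "(\<integral>x. (norm (f (snd x)))\<^sup>2 \<partial>(time_measure T \<Otimes>\<^sub>M M)) = measure (time_measure T) {0..T} * (\<integral>\<omega>. (norm (f \<omega>))\<^sup>2 \<partial>M)"
proof -
  interpret T: finite_measure "time_measure T" by (rule finite_measure_time_measure)
  have [measurable]: "f \<in> borel_measurable M" using assms by (simp add: square_integrable_def)
  have 1: "integrable (time_measure T) (\<lambda>x. 1 :: real)" by simp
  show "square_integrable (time_measure T \<Otimes>\<^sub>M M) (\<lambda>x. f (snd x))"
    "(\<integral>x. (norm (f (snd x)))\<^sup>2 \<partial>(time_measure T \<Otimes>\<^sub>M M)) = measure (time_measure T) {0..T} * (\<integral>\<omega>. (norm (f \<omega>))\<^sup>2 \<partial>M)"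
    using integral_product_scaleR[OF sigma_finite_time_measure sigma_finite_measure_axioms 1 square_integrable_sq[OF assms]]
    by (auto simp: square_integrable_def split_beta')
qed

lemma square_integrable_fst:
  assumes "square_integrable (time_measure T) f"
  shows "square_integrable (time_measure T \<Otimes>\<^sub>M M) (\<lambda>x. f (fst x))"
proof -
  interpret T: finite_measure "time_measure T" by (rule finite_measure_time_measure)
  have [measurable]: "f \<in> borel_measurable (time_measure T)" using assms by (simp add: square_integrable_def)
  have 1: "integrable M (\<lambda>x. 1 :: real)" by simp
  show "square_integrable (time_measure T \<Otimes>\<^sub>M M) (\<lambda>x. f (fst x))"
    using integral_product_scaleR[OF sigma_finite_time_measure sigma_finite_measure_axioms square_integrable_sq[OF assms] 1]
    by (auto simp: square_integrable_def split_beta')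
qed

lemma square_integrable_continuous:
  fixes f :: "real \<Rightarrow> 'b::euclidean_space"
  assumes "continuous_on {0..} f"
  shows "square_integrable (time_measure T) f"
  unfolding square_integrable_def
  using continuous_on_time_measure(1)[OF assms]
    continuous_on_time_measure(1)[OF continuous_on_power[OF continuous_on_norm[OF assms], of 2]]
  by auto

lemma continuous_process_deterministic:
  fixes f :: "real \<Rightarrow> 'b::euclidean_space"
  assumes "continuous_on {0..} f"
  shows "continuous_process (\<lambda>t \<omega>. f t)"
  using assms square_integrable_fst[OF square_integrable_continuous[OF assms]]
  by (auto simp: continuous_process_def square_integrable_const split_beta')

lemma continuous_process_add:
  "continuous_process X \<Longrightarrow> continuous_process Y \<Longrightarrow> continuous_process (\<lambda>t \<omega>. X t \<omega> + Y t \<omega>)"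
  using square_integrable_add(1)[of "_ \<Otimes>\<^sub>M M" "case_prod X" "case_prod Y"]
  unfolding continuous_process_def
  by (auto simp: split_beta' intro: continuous_on_add borel_measurable_add square_integrable_add(1))

lemma continuous_process_linear:
  assumes "bounded_linear L" "continuous_process X"
  shows "continuous_process (\<lambda>t \<omega>. L (X t \<omega>))"
  using assms(2) unfolding continuous_process_def
  by (auto intro!: bounded_linear.continuous_on[OF assms(1)] square_integrable_bounded_linear[OF assms(1)]
      measurable_compose[OF _ borel_measurable_continuous_onI[OF linear_continuous_on[OF assms(1)]]] 
      square_integrable_bounded_linear[OF assms(1), of "_ \<Otimes>\<^sub>M M" "case_prod X", simplified split_beta'] simp: split_beta')

lemma continuous_process_diff:
  assumes "continuous_process X" "continuous_process Y" shows "continuous_process (\<lambda>t \<omega>. X t \<omega> - Y t \<omega>)"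
  using continuous_process_add[OF assms(1) continuous_process_linear[OF bounded_linear_minus[OF bounded_linear_ident] assms(2)]] by simp

lemma continuous_process_integrand:
  "continuous_process X \<Longrightarrow> ito_integrand M W T X"
  by (auto simp: ito_integrand_iff continuous_process_def)

lemma time_integral_square_integrable:
  assumes b: "\<And>\<omega>. \<omega> \<in> space M \<Longrightarrow> continuous_on {0..} (\<lambda>t. b t \<omega>)" "\<And>T. square_integrable (time_measure T \<Otimes>\<^sub>M M) (\<lambda>(s, \<omega>). b s \<omega>)"
  defines "B \<equiv> \<lambda>t \<omega>. \<integral>s. b s \<omega> \<partial>time_measure t"
  shows "\<omega> \<in> space M \<Longrightarrow> continuous_on {0..} (\<lambda>t. B t \<omega>)"
    "0 \<le> t \<Longrightarrow> square_integrable M (B t)"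
    "square_integrable (time_measure T \<Otimes>\<^sub>M M) (\<lambda>(s, \<omega>). B s \<omega>)"
proof -
  show c: "\<omega> \<in> space M \<Longrightarrow> continuous_on {0..} (\<lambda>t. B t \<omega>)" for \<omega>
    unfolding B_def by (intro continuous_on_time_measure b)
  have bm[measurable]: "(\<lambda>(s, \<omega>). b s \<omega>) \<in> borel_measurable (time_measure T \<Otimes>\<^sub>M M)" for T
    using b(2) by (simp add: square_integrable_def)
  have m: "B t \<in> borel_measurable M" for t
  proof -
    interpret T: sigma_finite_measure "time_measure t" by (rule sigma_finite_time_measure)
    have "(\<lambda>(\<omega>, s). b s \<omega>) \<in> borel_measurable (M \<Otimes>\<^sub>M time_measure t)"
      using measurable_compose[OF measurable_pair_swap' bm[of t]] by (simp add: split_beta')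
    then show ?thesis unfolding B_def by (rule T.borel_measurable_lebesgue_integral)
  qed
  have jm: "(\<lambda>(s, \<omega>). B s \<omega>) \<in> borel_measurable (time_measure T \<Otimes>\<^sub>M M)" for T
    by (rule measurable_continuous_process[OF c m])
  \<comment> \<open>The Cauchy-Schwarz majorant of \<open>(norm (B t \<omega>))\<^sup>2\<close>,
    common to all \<open>t \<le> T\<close>. It settles both the fixed times and the product
    space.\<close>
  define E where "E T \<omega> = T * (\<integral>s. (norm (b s \<omega>))\<^sup>2 \<partial>time_measure T)" for T \<omega>
  have iE: "integrable M (E T)" for T
  proof -
    interpret P: pair_sigma_finite "time_measure T" M by (rule pair_sigma_finite_time)
    show ?thesis
      using P.integrable_snd[of "\<lambda>s \<omega>. (norm (b s \<omega>))\<^sup>2"] square_integrable_sq[OF b(2)[of T]]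
      unfolding E_def by (simp add: split_beta')
  qed
  have le: "(norm (B t \<omega>))\<^sup>2 \<le> E T \<omega>" if "0 \<le> t" "t \<le> T" "\<omega> \<in> space M" for t T \<omega>
  proof -
    have "(norm (B t \<omega>))\<^sup>2 \<le> t * (\<integral>s. (norm (b s \<omega>))\<^sup>2 \<partial>time_measure t)"
      unfolding B_def using that by (intro norm_integral_time_measure_sq_le square_integrable_continuous b) auto
    also have "\<dots> \<le> T * (\<integral>s. (norm (b s \<omega>))\<^sup>2 \<partial>time_measure T)"
    proof (intro mult_mono)
      have i: "set_integrable lborel {0..u} (\<lambda>s. (norm (b s \<omega>))\<^sup>2)" for u
        unfolding integrable_time_measure[symmetric]
        by (intro continuous_on_time_measure continuous_on_power continuous_on_norm b that)
      show "(\<integral>s. (norm (b s \<omega>))\<^sup>2 \<partial>time_measure t) \<le> (\<integral>s. (norm (b s \<omega>))\<^sup>2 \<partial>time_measure T)"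
        using i[of t] i[of T] that unfolding integral_time_measure set_lebesgue_integral_def set_integrable_def
        by (intro integral_mono) (auto split: split_indicator)
    qed (use that in \<open>auto intro!: integral_nonneg_AE\<close>)
    finally show ?thesis unfolding E_def .
  qed
  show "square_integrable M (B t)" if "0 \<le> t" for t
    using le[OF that order_refl] by (intro square_integrable_bound(1)[OF m iE])
  show "square_integrable (time_measure T \<Otimes>\<^sub>M M) (\<lambda>(s, \<omega>). B s \<omega>)"
  proof (rule square_integrable_bound(1)[OF jm])
    interpret T: finite_measure "time_measure T" by (rule finite_measure_time_measure)
    show "integrable (time_measure T \<Otimes>\<^sub>M M) (\<lambda>(s, \<omega>). 1 *\<^sub>R E T \<omega>)"
      by (intro integral_product_scaleR sigma_finite_time_measure sigma_finite_measure_axioms iE) simp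
    fix x assume "x \<in> space (time_measure T \<Otimes>\<^sub>M M)"
    then show "(norm (case x of (s, \<omega>) \<Rightarrow> B s \<omega>))\<^sup>2 \<le> (case x of (s, \<omega>) \<Rightarrow> 1 *\<^sub>R E T \<omega>)"
      using le by (auto simp: space_pair_measure)
  qed
qed

lemma continuous_processD:
  assumes "continuous_process X"
  shows "\<And>\<omega>. \<omega> \<in> space M \<Longrightarrow> continuous_on {0..} (\<lambda>t. X t \<omega>)" "\<And>t. 0 \<le> t \<Longrightarrow> X t \<in> borel_measurable (F t)"
    "\<And>t. 0 \<le> t \<Longrightarrow> square_integrable M (X t)" "\<And>T. square_integrable (time_measure T \<Otimes>\<^sub>M M) (\<lambda>(s, \<omega>). X s \<omega>)"
  using assms by (auto simp: continuous_process_def)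

lemma square_integrable_sample:
  assumes "square_integrable M f"
  shows "square_integrable (time_measure T \<Otimes>\<^sub>M M) (\<lambda>(s, \<omega>). f \<omega>)"
  using square_integrable_snd(1)[OF assms] by (simp add: split_beta')

lemma integral_bilinear_fst:
  assumes \<beta>: "bounded_bilinear (\<beta> :: 'b::euclidean_space \<Rightarrow> 'd::euclidean_space \<Rightarrow> 'c::euclidean_space)"
    and f: "square_integrable (time_measure T \<Otimes>\<^sub>M M) (\<lambda>(s, \<omega>). f s \<omega>)"
    and g: "square_integrable (time_measure T \<Otimes>\<^sub>M M) (\<lambda>(s, \<omega>). g s \<omega>)"
  shows "integrable (time_measure T) (\<lambda>s. \<integral>\<omega>. \<beta> (f s \<omega>) (g s \<omega>) \<partial>M)"
    "(\<integral>s. (\<integral>\<omega>. \<beta> (f s \<omega>) (g s \<omega>) \<partial>M) \<partial>time_measure T) = (\<integral>(s, \<omega>). \<beta> (f s \<omega>) (g s \<omega>) \<partial>(time_measure T \<Otimes>\<^sub>M M))"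
    "(\<integral>s. (\<integral>\<omega>. \<beta> (f s \<omega>) (g s \<omega>) \<partial>M) \<partial>time_measure T) = (\<integral>\<omega>. (\<integral>s. \<beta> (f s \<omega>) (g s \<omega>) \<partial>time_measure T) \<partial>M)"
proof -
  interpret P: pair_sigma_finite "time_measure T" M by (rule pair_sigma_finite_time)
  have i: "integrable (time_measure T \<Otimes>\<^sub>M M) (\<lambda>(s, \<omega>). \<beta> (f s \<omega>) (g s \<omega>))"
    using square_integrable_bilinear[OF \<beta> f g] by (simp add: split_beta')
  show "integrable (time_measure T) (\<lambda>s. \<integral>\<omega>. \<beta> (f s \<omega>) (g s \<omega>) \<partial>M)"
    "(\<integral>s. (\<integral>\<omega>. \<beta> (f s \<omega>) (g s \<omega>) \<partial>M) \<partial>time_measure T) = (\<integral>(s, \<omega>). \<beta> (f s \<omega>) (g s \<omega>) \<partial>(time_measure T \<Otimes>\<^sub>M M))"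
    using P.integrable_fst[OF i] P.integral_fst[OF i] by auto
  show "(\<integral>s. (\<integral>\<omega>. \<beta> (f s \<omega>) (g s \<omega>) \<partial>M) \<partial>time_measure T) = (\<integral>\<omega>. (\<integral>s. \<beta> (f s \<omega>) (g s \<omega>) \<partial>time_measure T) \<partial>M)"
    using P.Fubini_integral[OF i] by simp
qed

text \<open>After Fubini, \<open>b s\<close> is multiplied by \<open>N t\<close> with
  \<open>s \<le> t\<close>. The future increment \<open>N t - N s\<close> is orthogonal to
  \<open>b s\<close> and drops out, so the cross term is a time integral of expectations at one and
  the same time.\<close>

lemma drift_martingale_product:
  fixes \<beta> :: "'b::euclidean_space \<Rightarrow> 'b \<Rightarrow> 'c::euclidean_space"
  assumes \<beta>: "bounded_bilinear \<beta>" and b: "continuous_process b"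
    and N: "\<And>s. 0 \<le> s \<Longrightarrow> has_ito_integral M W s g (N s)" and t: "0 \<le> t"
  shows "(\<integral>\<omega>. \<beta> (x + (\<integral>s. b s \<omega> \<partial>time_measure t)) (N t \<omega>) \<partial>M) = (\<integral>s. (\<integral>\<omega>. \<beta> (b s \<omega>) (N s \<omega>) \<partial>M) \<partial>time_measure t)"
    "integrable (time_measure t) (\<lambda>s. \<integral>\<omega>. \<beta> (b s \<omega>) (N s \<omega>) \<partial>M)"
proof -
  interpret bounded_bilinear \<beta> by fact
  have bc: "\<And>\<omega>. \<omega> \<in> space M \<Longrightarrow> continuous_on {0..} (\<lambda>t. b t \<omega>)" "\<And>T. square_integrable (time_measure T \<Otimes>\<^sub>M M) (\<lambda>(s, \<omega>). b s \<omega>)"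
    and bF: "\<And>s. 0 \<le> s \<Longrightarrow> b s \<in> borel_measurable (F s)" "\<And>s. 0 \<le> s \<Longrightarrow> square_integrable M (b s)"
    using b by (auto simp: continuous_process_def)
  have sN: "square_integrable M (N s)" if "0 \<le> s" for s
    using has_ito_integral_square_integrable[OF N[OF that]] .
  note fst = integral_bilinear_fst[OF \<beta> bc(2) square_integrable_sample[OF sN[OF t]], of t]
  have s: "(\<integral>\<omega>. \<beta> (b s \<omega>) (N t \<omega>) \<partial>M) = (\<integral>\<omega>. \<beta> (b s \<omega>) (N s \<omega>) \<partial>M)" if "s \<in> {0..t}" for s
  proof -
    have s: "0 \<le> s" "s \<le> t" using that by auto
    have "(\<integral>\<omega>. \<beta> (b s \<omega>) (N t \<omega> - N s \<omega>) \<partial>M) = 0"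
      by (rule ito_integral_orthogonal[OF \<beta> s N[OF t] N[OF s(1)] bF[OF s(1)]])
    then show ?thesis
      unfolding diff_right
      using Bochner_Integration.integral_diff[OF square_integrable_bilinear[OF \<beta> bF(2)[OF s(1)] sN[OF t]]
          square_integrable_bilinear[OF \<beta> bF(2)[OF s(1)] sN[OF s(1)]]] by simp
  qed
  show "integrable (time_measure t) (\<lambda>s. \<integral>\<omega>. \<beta> (b s \<omega>) (N s \<omega>) \<partial>M)"
    using fst(1) s by (subst Bochner_Integration.integrable_cong[OF refl]) auto
  have "(\<integral>\<omega>. \<beta> (x + (\<integral>s. b s \<omega> \<partial>time_measure t)) (N t \<omega>) \<partial>M)
     = (\<integral>\<omega>. \<beta> x (N t \<omega>) \<partial>M) + (\<integral>\<omega>. \<beta> (\<integral>s. b s \<omega> \<partial>time_measure t) (N t \<omega>) \<partial>M)"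
    unfolding add_left
    by (intro Bochner_Integration.integral_add square_integrable_bilinear[OF \<beta>] square_integrable_const sN t
         time_integral_square_integrable(2)[OF continuous_processD(1,4)[OF b]])
  also have "(\<integral>\<omega>. \<beta> x (N t \<omega>) \<partial>M) = \<beta> x (\<integral>\<omega>. N t \<omega> \<partial>M)"
    by (intro integral_bounded_linear bounded_linear_right square_integrable_integrable sN t)
  also have "\<dots> = 0" using ito_integral_mean[OF N[OF t]] by (simp add: zero_right)
  also have "(\<integral>\<omega>. \<beta> (\<integral>s. b s \<omega> \<partial>time_measure t) (N t \<omega>) \<partial>M) = (\<integral>\<omega>. (\<integral>s. \<beta> (b s \<omega>) (N t \<omega>) \<partial>time_measure t) \<partial>M)"
    using bc(1) continuous_on_time_measure(1)
    by (intro Bochner_Integration.integral_cong refl integral_bounded_linear[symmetric] bounded_linear_left) auto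
  also have "\<dots> = (\<integral>s. (\<integral>\<omega>. \<beta> (b s \<omega>) (N s \<omega>) \<partial>M) \<partial>time_measure t)"
    unfolding fst(3)[symmetric] by (rule Bochner_Integration.integral_cong[OF refl]) (use s in auto)
  finally show "(\<integral>\<omega>. \<beta> (x + (\<integral>s. b s \<omega> \<partial>time_measure t)) (N t \<omega>) \<partial>M) = (\<integral>s. (\<integral>\<omega>. \<beta> (b s \<omega>) (N s \<omega>) \<partial>M) \<partial>time_measure t)"
    by simp
qed

text \<open>The paths of \<open>U\<close> are continuously differentiable, so this is the classical
  product rule on each path, followed by Fubini.\<close>

lemma drift_product:
  fixes \<beta> :: "'b::euclidean_space \<Rightarrow> 'b \<Rightarrow> 'c::euclidean_space" and b :: "real \<Rightarrow> 'a \<Rightarrow> 'b" and x :: 'b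
  assumes \<beta>: "bounded_bilinear \<beta>" and b: "continuous_process b" and t: "0 \<le> t"
  defines "U \<equiv> \<lambda>t \<omega>. x + (\<integral>s. b s \<omega> \<partial>time_measure t)"
  shows "(\<integral>\<omega>. \<beta> (U t \<omega>) (U t \<omega>) \<partial>M) = \<beta> x x + (\<integral>s. (\<integral>\<omega>. \<beta> (b s \<omega>) (U s \<omega>) \<partial>M) \<partial>time_measure t)
      + (\<integral>s. (\<integral>\<omega>. \<beta> (U s \<omega>) (b s \<omega>) \<partial>M) \<partial>time_measure t)"
    "square_integrable M (U t)" "square_integrable (time_measure T \<Otimes>\<^sub>M M) (\<lambda>(s, \<omega>). U s \<omega>)"
proof -
  interpret bounded_bilinear \<beta> by fact
  have bc: "\<And>\<omega>. \<omega> \<in> space M \<Longrightarrow> continuous_on {0..} (\<lambda>t. b t \<omega>)" "\<And>T. square_integrable (time_measure T \<Otimes>\<^sub>M M) (\<lambda>(s, \<omega>). b s \<omega>)"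
    using b by (auto simp: continuous_process_def)
  note U = time_integral_square_integrable[OF continuous_processD(1,4)[OF b]]
  have Uc: "continuous_on {0..} (\<lambda>t. U t \<omega>)" if "\<omega> \<in> space M" for \<omega>
    unfolding U_def by (intro continuous_intros U that)
  show sU: "square_integrable M (U t)"
    unfolding U_def by (intro square_integrable_add(1) square_integrable_const U t)
  show sUT: "square_integrable (time_measure T \<Otimes>\<^sub>M M) (\<lambda>(s, \<omega>). U s \<omega>)" for T
    using square_integrable_add(1)[OF square_integrable_snd(1)[OF square_integrable_const] U(3)]
    by (simp add: U_def split_beta')
  note f1 = integral_bilinear_fst[OF \<beta> bc(2) sUT, of t] and f2 = integral_bilinear_fst[OF \<beta> sUT bc(2), of t]
  have path: "\<beta> (U t \<omega>) (U t \<omega>) = \<beta> x x + ((\<integral>s. \<beta> (b s \<omega>) (U s \<omega>) \<partial>time_measure t) + (\<integral>s. \<beta> (U s \<omega>) (b s \<omega>) \<partial>time_measure t))"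
    if w: "\<omega> \<in> space M" for \<omega>
  proof -
    have d: "((\<lambda>t. U t \<omega>) has_vector_derivative b s \<omega>) (at s within {0..t})" if "s \<in> {0..t}" for s
      unfolding U_def using continuous_on_time_measure(2)[OF bc(1)[OF w] that]
      by (auto intro!: derivative_eq_intros)
    have c: "continuous_on {0..} (\<lambda>s. \<beta> (b s \<omega>) (U s \<omega>))" "continuous_on {0..} (\<lambda>s. \<beta> (U s \<omega>) (b s \<omega>))"
      by (intro continuous_on bc Uc w)+
    have "(\<integral>s. \<beta> (U s \<omega>) (b s \<omega>) + \<beta> (b s \<omega>) (U s \<omega>) \<partial>time_measure t) = \<beta> (U t \<omega>) (U t \<omega>) - \<beta> (U 0 \<omega>) (U 0 \<omega>)"
      using t
    proof (rule time_measure_FTC)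
      show "continuous_on {0..t} (\<lambda>s. \<beta> (U s \<omega>) (b s \<omega>) + \<beta> (b s \<omega>) (U s \<omega>))"
        using c by (intro continuous_on_subset[OF continuous_on_add[OF c(2,1)]]) auto
    qed (intro has_vector_derivative d)
    moreover have "U 0 \<omega> = x" by (simp add: U_def time_measure_0)
    ultimately show ?thesis
      using Bochner_Integration.integral_add[OF continuous_on_time_measure(1)[OF c(2)] continuous_on_time_measure(1)[OF c(1)], of t]
      by (simp add: algebra_simps)
  qed
  interpret P: pair_sigma_finite "time_measure t" M by (rule pair_sigma_finite_time)
  have i: "integrable M (\<lambda>\<omega>. \<integral>s. \<beta> (b s \<omega>) (U s \<omega>) \<partial>time_measure t)" "integrable M (\<lambda>\<omega>. \<integral>s. \<beta> (U s \<omega>) (b s \<omega>) \<partial>time_measure t)"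
    using P.integrable_snd[of "\<lambda>s \<omega>. \<beta> (b s \<omega>) (U s \<omega>)"] P.integrable_snd[of "\<lambda>s \<omega>. \<beta> (U s \<omega>) (b s \<omega>)"]
      square_integrable_bilinear[OF \<beta> bc(2) sUT, of t] square_integrable_bilinear[OF \<beta> sUT bc(2), of t]
    by (simp_all add: split_beta')
  have "(\<integral>\<omega>. \<beta> (U t \<omega>) (U t \<omega>) \<partial>M)
    = (\<integral>\<omega>. \<beta> x x + ((\<integral>s. \<beta> (b s \<omega>) (U s \<omega>) \<partial>time_measure t) + (\<integral>s. \<beta> (U s \<omega>) (b s \<omega>) \<partial>time_measure t)) \<partial>M)"
    by (intro Bochner_Integration.integral_cong refl path)
  also have "\<dots> = \<beta> x x + ((\<integral>s. (\<integral>\<omega>. \<beta> (b s \<omega>) (U s \<omega>) \<partial>M) \<partial>time_measure t)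
      + (\<integral>s. (\<integral>\<omega>. \<beta> (U s \<omega>) (b s \<omega>) \<partial>M) \<partial>time_measure t))"
    using i by (simp add: f1(3) f2(3) prob_space)
  finally show "(\<integral>\<omega>. \<beta> (U t \<omega>) (U t \<omega>) \<partial>M) = \<beta> x x + (\<integral>s. (\<integral>\<omega>. \<beta> (b s \<omega>) (U s \<omega>) \<partial>M) \<partial>time_measure t)
      + (\<integral>s. (\<integral>\<omega>. \<beta> (U s \<omega>) (b s \<omega>) \<partial>M) \<partial>time_measure t)" by simp
qed

text \<open>The product rule for Ito processes in expectation; the correction term with
  \<open>g\<close> comes from the isometry. The equation of \<open>X\<close> is assumed almost
  surely at each fixed time, which suffices because every term is an expectation at a fixed
  time.\<close>

theorem ito_product_expectation:
  fixes \<beta> :: "'b::euclidean_space \<Rightarrow> 'b \<Rightarrow> 'c::euclidean_space"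
  assumes \<beta>: "bounded_bilinear \<beta>" and b: "continuous_process b"
    and N: "\<And>s. 0 \<le> s \<Longrightarrow> has_ito_integral M W s g (N s)"
    and X: "\<And>s. 0 \<le> s \<Longrightarrow> X s \<in> borel_measurable M"
      "\<And>s. 0 \<le> s \<Longrightarrow> AE \<omega> in M. X s \<omega> = x + (\<integral>r. b r \<omega> \<partial>time_measure s) + N s \<omega>"
    and t: "0 \<le> t"
  defines "R \<equiv> \<lambda>s. (\<integral>\<omega>. \<beta> (b s \<omega>) (X s \<omega>) \<partial>M) + (\<integral>\<omega>. \<beta> (X s \<omega>) (b s \<omega>) \<partial>M) + (\<integral>\<omega>. \<beta> (g s \<omega>) (g s \<omega>) \<partial>M)"
  shows "(\<integral>\<omega>. \<beta> (X t \<omega>) (X t \<omega>) \<partial>M) = \<beta> x x + (\<integral>s. R s \<partial>time_measure t)" "integrable (time_measure t) R"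
proof -
  interpret bounded_bilinear \<beta> by fact
  define U where "U t \<omega> = x + (\<integral>s. b s \<omega> \<partial>time_measure t)" for t \<omega>
  have bF: "\<And>s. 0 \<le> s \<Longrightarrow> square_integrable M (b s)" "square_integrable (time_measure t \<Otimes>\<^sub>M M) (\<lambda>(s, \<omega>). b s \<omega>)"
    using b by (auto simp: continuous_process_def)
  have sN: "square_integrable M (N s)" if "0 \<le> s" for s
    using has_ito_integral_square_integrable[OF N[OF that]] .
  note dU = drift_product[OF \<beta> b, where x=x, folded U_def]
  have U: "\<And>s. 0 \<le> s \<Longrightarrow> square_integrable M (U s)" "square_integrable (time_measure t \<Otimes>\<^sub>M M) (\<lambda>(s, \<omega>). U s \<omega>)"
    using dU(2,3)[OF _] t by auto
  note mU = drift_martingale_product(1)[OF \<beta> b N t, where x=x, folded U_def] drift_martingale_product(2)[OF \<beta> b N t]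
  note mU' = drift_martingale_product(1)[OF flip b N t, where x=x, folded U_def] drift_martingale_product(2)[OF flip b N t]
  have i1: "integrable (time_measure t) (\<lambda>s. \<integral>\<omega>. \<beta> (b s \<omega>) (U s \<omega>) \<partial>M)"
    and i2: "integrable (time_measure t) (\<lambda>s. \<integral>\<omega>. \<beta> (U s \<omega>) (b s \<omega>) \<partial>M)"
    by (intro integral_bilinear_fst[OF \<beta>] bF U)+
  have sX: "square_integrable M (X s)" and XU: "AE \<omega> in M. X s \<omega> = U s \<omega> + N s \<omega>" if "0 \<le> s" for s
  proof -
    show 1: "AE \<omega> in M. X s \<omega> = U s \<omega> + N s \<omega>" using X(2)[OF that] by (simp add: U_def)
    show "square_integrable M (X s)"
      by (rule square_integrable_cong_AE(1)[OF square_integrable_add(1)[OF U(1)[OF that] sN[OF that]] X(1)[OF that]])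
        (use 1 in eventually_elim, simp)
  qed
  \<comment> \<open>Stated for all bilinear maps \<open>\<gamma>\<close>, so that the flipped map
    splits the first argument as well.\<close>
  have split1: "(\<integral>\<omega>. \<gamma> (Z \<omega>) (X s \<omega>) \<partial>M) = (\<integral>\<omega>. \<gamma> (Z \<omega>) (U s \<omega>) \<partial>M) + (\<integral>\<omega>. \<gamma> (Z \<omega>) (N s \<omega>) \<partial>M)"
    if "0 \<le> s" "square_integrable M Z" "bounded_bilinear \<gamma>" for s and Z and \<gamma> :: "'b \<Rightarrow> 'b \<Rightarrow> 'c"
  proof -
    have m: "integrable M (\<lambda>\<omega>. \<gamma> (Z \<omega>) (X s \<omega>))" "integrable M (\<lambda>\<omega>. \<gamma> (Z \<omega>) (U s \<omega>))" "integrable M (\<lambda>\<omega>. \<gamma> (Z \<omega>) (N s \<omega>))"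
      using that sX U(1) sN by (auto intro!: square_integrable_bilinear[OF that(3)])
    have "(\<integral>\<omega>. \<gamma> (Z \<omega>) (X s \<omega>) \<partial>M) = (\<integral>\<omega>. \<gamma> (Z \<omega>) (U s \<omega>) + \<gamma> (Z \<omega>) (N s \<omega>) \<partial>M)"
    proof (rule integral_cong_AE)
      show "AE \<omega> in M. \<gamma> (Z \<omega>) (X s \<omega>) = \<gamma> (Z \<omega>) (U s \<omega>) + \<gamma> (Z \<omega>) (N s \<omega>)"
        using XU[OF that(1)] by eventually_elim (simp add: bounded_bilinear.add_right[OF that(3)])
    qed (use m in auto)
    then show ?thesis using m by simp
  qed
  note split2 = split1[OF _ _ flip]
  have XX: "(\<integral>\<omega>. \<beta> (X t \<omega>) (X t \<omega>) \<partial>M) = (\<integral>\<omega>. \<beta> (U t \<omega>) (U t \<omega>) \<partial>M) + (\<integral>\<omega>. \<beta> (N t \<omega>) (U t \<omega>) \<partial>M) 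
     + ((\<integral>\<omega>. \<beta> (U t \<omega>) (N t \<omega>) \<partial>M) + (\<integral>\<omega>. \<beta> (N t \<omega>) (N t \<omega>) \<partial>M))"
    using split1[OF t sX[OF t] \<beta>] split2[OF t U(1)[OF t]] split2[OF t sN[OF t]] by simp
  have NN: "(\<integral>\<omega>. \<beta> (N t \<omega>) (N t \<omega>) \<partial>M) = (\<integral>s. (\<integral>\<omega>. \<beta> (g s \<omega>) (g s \<omega>) \<partial>M) \<partial>time_measure t)"
    and i3: "integrable (time_measure t) (\<lambda>s. \<integral>\<omega>. \<beta> (g s \<omega>) (g s \<omega>) \<partial>M)"
  proof -
    have g: "square_integrable (time_measure t \<Otimes>\<^sub>M M) (\<lambda>(s, \<omega>). g s \<omega>)"
      using N[OF t] by (simp add: has_ito_integral_def ito_integrand_iff)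
    show "(\<integral>\<omega>. \<beta> (N t \<omega>) (N t \<omega>) \<partial>M) = (\<integral>s. (\<integral>\<omega>. \<beta> (g s \<omega>) (g s \<omega>) \<partial>M) \<partial>time_measure t)"
      using ito_isometry[OF \<beta> N[OF t]] integral_bilinear_fst(2)[OF \<beta> g g] by simp
    show "integrable (time_measure t) (\<lambda>s. \<integral>\<omega>. \<beta> (g s \<omega>) (g s \<omega>) \<partial>M)"
      by (rule integral_bilinear_fst(1)[OF \<beta> g g])
  qed
  have 1: "(\<integral>\<omega>. \<beta> (X t \<omega>) (X t \<omega>) \<partial>M) = \<beta> x x
    + ((\<integral>s. (\<integral>\<omega>. \<beta> (b s \<omega>) (U s \<omega>) \<partial>M) \<partial>time_measure t) + (\<integral>s. (\<integral>\<omega>. \<beta> (b s \<omega>) (N s \<omega>) \<partial>M) \<partial>time_measure t)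
    + ((\<integral>s. (\<integral>\<omega>. \<beta> (U s \<omega>) (b s \<omega>) \<partial>M) \<partial>time_measure t) + (\<integral>s. (\<integral>\<omega>. \<beta> (N s \<omega>) (b s \<omega>) \<partial>M) \<partial>time_measure t))
    + (\<integral>s. (\<integral>\<omega>. \<beta> (g s \<omega>) (g s \<omega>) \<partial>M) \<partial>time_measure t))"
    unfolding XX NN using dU(1)[OF t] mU(1) mU'(1) by (simp add: algebra_simps)
  have R: "R s = ((\<integral>\<omega>. \<beta> (b s \<omega>) (U s \<omega>) \<partial>M) + (\<integral>\<omega>. \<beta> (b s \<omega>) (N s \<omega>) \<partial>M))
    + ((\<integral>\<omega>. \<beta> (U s \<omega>) (b s \<omega>) \<partial>M) + (\<integral>\<omega>. \<beta> (N s \<omega>) (b s \<omega>) \<partial>M))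
    + (\<integral>\<omega>. \<beta> (g s \<omega>) (g s \<omega>) \<partial>M)" if "s \<in> {0..t}" for s
    unfolding R_def using split1[OF _ bF(1) \<beta>, of s] split2[OF _ bF(1), of s] that by simp
  note i = Bochner_Integration.integrable_add[OF Bochner_Integration.integrable_add[OF
      Bochner_Integration.integrable_add[OF i1 mU(2)] Bochner_Integration.integrable_add[OF i2 mU'(2)]] i3]
  show "integrable (time_measure t) R"
    using i R by (subst Bochner_Integration.integrable_cong[OF refl]) auto
  have "(\<integral>s. R s \<partial>time_measure t) = (\<integral>s. ((\<integral>\<omega>. \<beta> (b s \<omega>) (U s \<omega>) \<partial>M) + (\<integral>\<omega>. \<beta> (b s \<omega>) (N s \<omega>) \<partial>M))
    + ((\<integral>\<omega>. \<beta> (U s \<omega>) (b s \<omega>) \<partial>M) + (\<integral>\<omega>. \<beta> (N s \<omega>) (b s \<omega>) \<partial>M))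
    + (\<integral>\<omega>. \<beta> (g s \<omega>) (g s \<omega>) \<partial>M) \<partial>time_measure t)"
    by (intro Bochner_Integration.integral_cong refl R) simp
  then show "(\<integral>\<omega>. \<beta> (X t \<omega>) (X t \<omega>) \<partial>M) = \<beta> x x + (\<integral>s. R s \<partial>time_measure t)"
    unfolding 1 using i1 i2 i3 mU(2) mU'(2) by simp
qed

lemma ito_process_mean:
  assumes X: "ito_process M W x b g X" and b: "integrable (time_measure t \<Otimes>\<^sub>M M) (\<lambda>(s, \<omega>). b s \<omega>)" and t: "0 \<le> t"
  shows "(\<integral>\<omega>. X t \<omega> \<partial>M) = x + (\<integral>s. (\<integral>\<omega>. b s \<omega> \<partial>M) \<partial>time_measure t)"
proof -
  interpret P: pair_sigma_finite "time_measure t" M by (rule pair_sigma_finite_time)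
  let ?B = "\<lambda>\<omega>. \<integral>s. b s \<omega> \<partial>time_measure t"
  have N: "has_ito_integral M W t g (\<lambda>\<omega>. X t \<omega> - x - ?B \<omega>)" and Xi: "integrable M (X t)"
    using X t unfolding ito_process_def integral_time_measure by blast+
  have B: "integrable M ?B" by (rule P.integrable_snd[OF b])
  have "0 = (\<integral>\<omega>. X t \<omega> - x - ?B \<omega> \<partial>M)" by (rule ito_integral_mean[OF N, symmetric])
  also have "\<dots> = (\<integral>\<omega>. X t \<omega> \<partial>M) - x - (\<integral>\<omega>. ?B \<omega> \<partial>M)" using B Xi by (simp add: prob_space)
  also have "(\<integral>\<omega>. ?B \<omega> \<partial>M) = (\<integral>s. (\<integral>\<omega>. b s \<omega> \<partial>M) \<partial>time_measure t)" by (rule P.Fubini_integral[OF b])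
  finally show ?thesis by (simp add: algebra_simps)
qed

section \<open>The Euler scheme\<close>

text \<open>Decomposition by the first index \<open>j\<close> at which \<open>norm (S j)\<close>
  reaches \<open>c\<close>. The events \<open>A j\<close> are disjoint and known at time
  \<open>\<tau> j\<close>, so \<open>orth\<close> compares the energy of \<open>S j\<close> with
  that of \<open>Z\<close> on each of them. The martingale property enters only as this
  orthogonality of \<open>Z - S j\<close> to \<open>S j\<close> cut off by past events.\<close>

lemma Kolmogorov_maximal_inequality:
  fixes S :: "nat \<Rightarrow> 'a \<Rightarrow> 'b::euclidean_space"
  assumes S: "\<And>j. S j \<in> borel_measurable (F (\<tau> j))" "\<And>j. square_integrable M (S j)" 
    and \<tau>: "mono \<tau>"
    and Z: "square_integrable M Z" and "0 < c"
    and orth: "\<And>j A. j \<le> r \<Longrightarrow> A \<in> sets (F (\<tau> j)) \<Longrightarrow> (\<integral>\<omega>. (indicator A \<omega> *\<^sub>R S j \<omega>) \<bullet> (Z \<omega> - S j \<omega>) \<partial>M) = 0"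
  shows "{\<omega>\<in>space M. \<exists>j\<le>r. c \<le> norm (S j \<omega>)} \<in> sets M"
    "c\<^sup>2 * prob {\<omega>\<in>space M. \<exists>j\<le>r. c \<le> norm (S j \<omega>)} \<le> (\<integral>\<omega>. (norm (Z \<omega>))\<^sup>2 \<partial>M)"
proof -
  define A where "A j = {\<omega>\<in>space M. c \<le> norm (S j \<omega>) \<and> (\<forall>i<j. norm (S i \<omega>) < c)}" for j
  have AF: "A j \<in> sets (F (\<tau> j))" for j
  proof -
    have *: "{\<omega>\<in>space (F (\<tau> j)). norm (S i \<omega>) < c} \<in> sets (F (\<tau> j))"
      "{\<omega>\<in>space (F (\<tau> j)). c \<le> norm (S i \<omega>)} \<in> sets (F (\<tau> j))" if "i \<le> j" for i
    proof -
      have [measurable]: "S i \<in> borel_measurable (F (\<tau> j))"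
        using S(1)[of i] monoD[OF \<tau> that] by (rule measurable_F_mono)
      show "{\<omega>\<in>space (F (\<tau> j)). norm (S i \<omega>) < c} \<in> sets (F (\<tau> j))"
        "{\<omega>\<in>space (F (\<tau> j)). c \<le> norm (S i \<omega>)} \<in> sets (F (\<tau> j))" by measurable
    qed
    have "{\<omega>\<in>space (F (\<tau> j)). c \<le> norm (S j \<omega>) \<and> (\<forall>i\<in>{..<j}. norm (S i \<omega>) < c)} \<in> sets (F (\<tau> j))"
      by (intro sets.sets_Collect_conj sets.sets_Collect_finite_All *) auto
    then show ?thesis by (simp add: A_def Ball_def)
  qed
  then have AM[measurable]: "A j \<in> sets M" for j using subalgebra_F by (auto simp: subalgebra_def)
  have U: "{\<omega>\<in>space M. \<exists>j\<le>r. c \<le> norm (S j \<omega>)} = (\<Union>j\<in>{..r}. A j)"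
  proof (safe)
    fix \<omega> j assume w: "\<omega> \<in> space M" "j \<le> r" "c \<le> norm (S j \<omega>)"
    obtain i where i: "c \<le> norm (S i \<omega>)" "\<forall>i'<i. \<not> c \<le> norm (S i' \<omega>)"
      using w(3) exists_least_iff[of "\<lambda>i. c \<le> norm (S i \<omega>)"] by auto
    moreover have "i \<le> j" using i(2) w(3) not_less by blast
    ultimately have "c \<le> norm (S i \<omega>)" "i \<le> j" "\<forall>i'<i. norm (S i' \<omega>) < c" by (auto simp: not_le)
    then show "\<omega> \<in> (\<Union>j\<in>{..r}. A j)" using w by (auto simp: A_def intro!: bexI[of _ i])
  qed (auto simp: A_def)
  show "{\<omega>\<in>space M. \<exists>j\<le>r. c \<le> norm (S j \<omega>)} \<in> sets M" unfolding U by auto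
  have "A i \<inter> A j = {}" if "i < j" for i j
    using that by (force simp: A_def)
  then have disj: "disjoint_family_on A {..r}"
    unfolding disjoint_family_on_def by (metis inf_commute linorder_neqE_nat)
  have iZ: "integrable M (\<lambda>\<omega>. (norm (Z \<omega>))\<^sup>2)" and iS: "integrable M (\<lambda>\<omega>. (norm (S j \<omega>))\<^sup>2)" for j
    using Z S(2) by (auto simp: square_integrable_def)
  have step: "c\<^sup>2 * prob (A j) \<le> (\<integral>\<omega>. indicator (A j) \<omega> * (norm (Z \<omega>))\<^sup>2 \<partial>M)" if "j \<le> r" for j
  proof -
    have sI: "square_integrable M (\<lambda>\<omega>. indicator (A j) \<omega> *\<^sub>R S j \<omega>)"
      using S(2)[of j] by (intro square_integrable_bound(1)[OF _ iS[of j]]) (auto simp: indicator_def square_integrable_def)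
    have i: "integrable M (\<lambda>\<omega>. (indicator (A j) \<omega> *\<^sub>R S j \<omega>) \<bullet> (Z \<omega> - S j \<omega>))"
      by (intro square_integrable_bilinear[OF bounded_bilinear_inner sI] square_integrable_diff(1) Z S)
    have "c\<^sup>2 * prob (A j) = (\<integral>\<omega>. indicator (A j) \<omega> * c\<^sup>2 \<partial>M)" by (simp add: mult.commute)
    also have "\<dots> \<le> (\<integral>\<omega>. indicator (A j) \<omega> * (norm (S j \<omega>))\<^sup>2 \<partial>M)"
    proof (rule integral_mono)
      show "integrable M (\<lambda>\<omega>. indicator (A j) \<omega> * c\<^sup>2)" "integrable M (\<lambda>\<omega>. indicator (A j) \<omega> * (norm (S j \<omega>))\<^sup>2)"
        using integrable_mult_indicator[OF AM, of "\<lambda>_. c\<^sup>2" j] integrable_mult_indicator[OF AM iS[of j], of j] by simp_all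
      show "indicator (A j) \<omega> * c\<^sup>2 \<le> indicator (A j) \<omega> * (norm (S j \<omega>))\<^sup>2" for \<omega>
        using \<open>0 < c\<close> by (auto simp: indicator_def A_def intro!: power_mono)
    qed
    \<comment> \<open>The added inner product has integral 0. Together with
      \<open>(norm (S j \<omega>))\<^sup>2\<close> it equals
      \<open>(norm (Z \<omega>))\<^sup>2\<close> up to the square of \<open>Z - S j\<close>, which
      is dropped next.\<close>
    also have "\<dots> = (\<integral>\<omega>. indicator (A j) \<omega> * (norm (S j \<omega>))\<^sup>2 + 2 * ((indicator (A j) \<omega> *\<^sub>R S j \<omega>) \<bullet> (Z \<omega> - S j \<omega>)) \<partial>M)"
      using orth[OF that AF] i integrable_real_mult_indicator[OF AM iS[of j]] by (simp add: mult.commute)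
    also have "\<dots> \<le> (\<integral>\<omega>. indicator (A j) \<omega> * (norm (Z \<omega>))\<^sup>2 \<partial>M)"
    proof (intro integral_mono)
      fix \<omega>
      have "(norm (Z \<omega>))\<^sup>2 = (norm (S j \<omega>))\<^sup>2 + 2 * (S j \<omega> \<bullet> (Z \<omega> - S j \<omega>)) + (norm (Z \<omega> - S j \<omega>))\<^sup>2"
        by (simp add: power2_norm_eq_inner inner_diff inner_commute)
      then show "indicator (A j) \<omega> * (norm (S j \<omega>))\<^sup>2 + 2 * ((indicator (A j) \<omega> *\<^sub>R S j \<omega>) \<bullet> (Z \<omega> - S j \<omega>)) \<le> indicator (A j) \<omega> * (norm (Z \<omega>))\<^sup>2"
        by (auto simp: indicator_def)
    qed (use i iZ integrable_real_mult_indicator[OF AM iS[of j]] integrable_real_mult_indicator[OF AM iZ] in \<open>simp_all add: mult.commute\<close>)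
    finally show ?thesis .
  qed
  have "c\<^sup>2 * prob (\<Union>j\<in>{..r}. A j) = (\<Sum>j\<le>r. c\<^sup>2 * prob (A j))"
    using disj by (subst finite_measure_finite_Union) (auto simp: sum_distrib_left)
  also have "\<dots> \<le> (\<Sum>j\<le>r. \<integral>\<omega>. indicator (A j) \<omega> * (norm (Z \<omega>))\<^sup>2 \<partial>M)"
    by (intro sum_mono step) auto
  also have "\<dots> = (\<integral>\<omega>. (\<Sum>j\<le>r. indicator (A j) \<omega> * (norm (Z \<omega>))\<^sup>2) \<partial>M)"
    using integrable_real_mult_indicator[OF AM iZ] by (intro Bochner_Integration.integral_sum[symmetric]) (simp add: mult.commute)
  also have "\<dots> \<le> (\<integral>\<omega>. (norm (Z \<omega>))\<^sup>2 \<partial>M)"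
  proof (intro integral_mono iZ Bochner_Integration.integrable_sum)
    fix \<omega>
    have "(\<Sum>j\<le>r. indicator (A j) \<omega>) = (indicator (\<Union>j\<in>{..r}. A j) \<omega> :: real)"
      using disj by (simp add: indicator_UN_disjoint)
    then have "(\<Sum>j\<le>r. indicator (A j) \<omega>) \<le> (1 :: real)" by (simp add: indicator_def)
    then show "(\<Sum>j\<le>r. indicator (A j) \<omega> * (norm (Z \<omega>))\<^sup>2) \<le> (norm (Z \<omega>))\<^sup>2"
      unfolding sum_distrib_right[symmetric] by (simp add: mult_left_le_one_le sum_nonneg)
  qed (use integrable_real_mult_indicator[OF AM iZ] in \<open>simp add: mult.commute\<close>)
  finally show "c\<^sup>2 * prob {\<omega>\<in>space M. \<exists>j\<le>r. c \<le> norm (S j \<omega>)} \<le> (\<integral>\<omega>. (norm (Z \<omega>))\<^sup>2 \<partial>M)"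
    unfolding U .
qed

text \<open>The Ito process with drift \<open>\<beta> j\<close> and diffusion \<open>\<gamma> j\<close> on the cell \<open>[j \<delta>, (j + 1) \<delta>]\<close> for \<open>j < n\<close>,
  stopped at time \<open>n \<delta>\<close>.\<close>

definition grid_process :: "real \<Rightarrow> nat \<Rightarrow> (nat \<Rightarrow> 'a \<Rightarrow> 'b::euclidean_space) \<Rightarrow> (nat \<Rightarrow> 'a \<Rightarrow> 'b) \<Rightarrow> real \<Rightarrow> 'a \<Rightarrow> 'b" where
  "grid_process \<delta> n \<beta> \<gamma> t \<omega> = (\<Sum>j<n. (min t (real (Suc j) * \<delta>) - min t (real j * \<delta>)) *\<^sub>R \<beta> j \<omega> +
     (W (min t (real (Suc j) * \<delta>)) \<omega> - W (min t (real j * \<delta>)) \<omega>) *\<^sub>R \<gamma> j \<omega>)"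

definition grid_adapted :: "real \<Rightarrow> nat \<Rightarrow> (nat \<Rightarrow> 'a \<Rightarrow> 'b::euclidean_space) \<Rightarrow> bool" where
  "grid_adapted \<delta> n \<beta> \<longleftrightarrow> (\<forall>j<n. \<beta> j \<in> borel_measurable (F (real j * \<delta>)) \<and> square_integrable M (\<beta> j))"

lemma continuous_on_grid_process:
  assumes "continuous_on {0..} (\<lambda>t. W t \<omega>)" "0 < \<delta>"
  shows "continuous_on {0..} (\<lambda>t. grid_process \<delta> n \<beta> \<gamma> t \<omega>)"
  unfolding grid_process_def
  using assms(2) by (intro continuous_intros continuous_on_compose2[OF assms(1)]) auto

text \<open>Clamping with \<open>min\<close> freezes the cells before \<open>k\<close> and
  annihilates those after it, so that between \<open>k \<delta>\<close> and \<open>t\<close> only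
  cell \<open>k\<close> contributes.\<close>

lemma grid_process_cell:
  assumes \<delta>: "0 < \<delta>" and k: "k < n" and t: "real k * \<delta> \<le> t" "t \<le> real (Suc k) * \<delta>"
  shows "grid_process \<delta> n \<beta> \<gamma> t \<omega> = grid_process \<delta> n \<beta> \<gamma> (real k * \<delta>) \<omega> + 
    (t - real k * \<delta>) *\<^sub>R \<beta> k \<omega> + (W t \<omega> - W (real k * \<delta>) \<omega>) *\<^sub>R \<gamma> k \<omega>"
proof -
  let ?f = "\<lambda>t j. (min t (real (Suc j) * \<delta>) - min t (real j * \<delta>)) *\<^sub>R \<beta> j \<omega> +
     (W (min t (real (Suc j) * \<delta>)) \<omega> - W (min t (real j * \<delta>)) \<omega>) *\<^sub>R \<gamma> j \<omega>"
  have "?f t j = ?f (real k * \<delta>) j + (if j = k then (t - real k * \<delta>) *\<^sub>R \<beta> k \<omega> + (W t \<omega> - W (real k * \<delta>) \<omega>) *\<^sub>R \<gamma> k \<omega> else 0)" for j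
  proof -
    consider "j < k" | "j = k" | "k < j" by linarith
    then show ?thesis
    proof cases
      case 1
      then have "real (Suc j) * \<delta> \<le> real k * \<delta>" "real j * \<delta> \<le> real k * \<delta>" using \<delta> by (auto intro!: mult_right_mono)
      moreover from this have "real (Suc j) * \<delta> \<le> t" "real j * \<delta> \<le> t" using t by linarith+
      ultimately show ?thesis using 1 by (simp add: min_absorb2 del: of_nat_Suc)
    next
      case 2
      moreover have "real k * \<delta> \<le> real (Suc k) * \<delta>" using \<delta> by (auto intro!: mult_right_mono)
      ultimately show ?thesis using t by (simp add: min_absorb1 min_absorb2 del: of_nat_Suc)
    next
      case 3
      then have "real (Suc k) * \<delta> \<le> real j * \<delta>" "real j * \<delta> \<le> real (Suc j) * \<delta>" using \<delta> by (auto intro!: mult_right_mono)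
      moreover from this have "t \<le> real (Suc j) * \<delta>" "t \<le> real j * \<delta>" "real k * \<delta> \<le> real (Suc j) * \<delta>" "real k * \<delta> \<le> real j * \<delta>"
        using t by linarith+
      ultimately show ?thesis using 3 by (simp add: min_absorb1 del: of_nat_Suc)
    qed
  qed
  then show ?thesis using k by (simp add: grid_process_def sum.distrib)
qed

lemma grid_process_0: "0 < \<delta> \<Longrightarrow> grid_process \<delta> n \<beta> \<gamma> 0 \<omega> = 0"
  by (simp add: grid_process_def min_def)

lemma grid_process_extend:
  assumes "0 < \<delta>" "n \<le> n'" "t \<le> real n * \<delta>"
  shows "grid_process \<delta> n' \<beta> \<gamma> t \<omega> = grid_process \<delta> n \<beta> \<gamma> t \<omega>"
  unfolding grid_process_def
proof (rule sum.mono_neutral_right)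
  show "\<forall>i\<in>{..<n'} - {..<n}. (min t (real (Suc i) * \<delta>) - min t (real i * \<delta>)) *\<^sub>R \<beta> i \<omega> +
       (W (min t (real (Suc i) * \<delta>)) \<omega> - W (min t (real i * \<delta>)) \<omega>) *\<^sub>R \<gamma> i \<omega> = 0"
  proof
    fix i assume "i \<in> {..<n'} - {..<n}"
    then have "real n * \<delta> \<le> real i * \<delta>" "real n * \<delta> \<le> real (Suc i) * \<delta>" using assms(1) by (auto intro!: mult_right_mono)
    then show "(min t (real (Suc i) * \<delta>) - min t (real i * \<delta>)) *\<^sub>R \<beta> i \<omega> +
       (W (min t (real (Suc i) * \<delta>)) \<omega> - W (min t (real i * \<delta>)) \<omega>) *\<^sub>R \<gamma> i \<omega> = 0"
      using assms(3) by (simp add: min_absorb1)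
  qed
qed (use assms(2) in auto)

lemma grid_process_adapted:
  assumes \<delta>: "0 < \<delta>" and \<beta>: "grid_adapted \<delta> n \<beta>" and \<gamma>: "grid_adapted \<delta> n \<gamma>" and t: "0 \<le> t"
  shows "grid_process \<delta> n \<beta> \<gamma> t \<in> borel_measurable (F t)" "square_integrable M (grid_process \<delta> n \<beta> \<gamma> t)"
proof -
  let ?f = "\<lambda>j \<omega>. (min t (real (Suc j) * \<delta>) - min t (real j * \<delta>)) *\<^sub>R \<beta> j \<omega> +
     (W (min t (real (Suc j) * \<delta>)) \<omega> - W (min t (real j * \<delta>)) \<omega>) *\<^sub>R \<gamma> j \<omega>"
  have f: "?f j \<in> borel_measurable (F t) \<and> square_integrable M (?f j)" if j: "j < n" for j
  proof (cases "real j * \<delta> \<le> t")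
    case True
    have \<beta>j: "\<beta> j \<in> borel_measurable (F (real j * \<delta>))" "square_integrable M (\<beta> j)"
      and \<gamma>j: "\<gamma> j \<in> borel_measurable (F (real j * \<delta>))" "square_integrable M (\<gamma> j)"
      using \<beta> \<gamma> j by (auto simp: grid_adapted_def)
    have le: "real j * \<delta> \<le> real (Suc j) * \<delta>" "0 \<le> real j * \<delta>" "0 \<le> real (Suc j) * \<delta>" using \<delta> by (auto intro!: mult_right_mono)
    have [measurable]: "\<beta> j \<in> borel_measurable (F t)" "\<gamma> j \<in> borel_measurable (F t)"
      "W (min t (real (Suc j) * \<delta>)) \<in> borel_measurable (F t)" "W (min t (real j * \<delta>)) \<in> borel_measurable (F t)"
      using measurable_F_mono[OF \<beta>j(1) True] measurable_F_mono[OF \<gamma>j(1) True] t le by (auto intro!: W_measurable_F)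
    have "square_integrable M (\<lambda>\<omega>. (W (min t (real (Suc j) * \<delta>)) \<omega> - W (min t (real j * \<delta>)) \<omega>) *\<^sub>R \<gamma> j \<omega>)"
    proof (rule increment_square_integrable)
      show "0 \<le> min t (real j * \<delta>)" using t le by simp
      show "min t (real j * \<delta>) \<le> min t (real (Suc j) * \<delta>)" using le by (intro min.mono) auto
      show "\<gamma> j \<in> borel_measurable (F (min t (real j * \<delta>)))" using \<gamma>j True by (simp add: min_absorb2)
    qed (rule \<gamma>j)
    then have "square_integrable M (?f j)"
      by (intro square_integrable_add(1) square_integrable_scaleR \<beta>j)
    moreover have "?f j \<in> borel_measurable (F t)" by measurable
    ultimately show ?thesis by blast
  next
    case False
    moreover have "real j * \<delta> \<le> real (Suc j) * \<delta>" using \<delta> by (auto intro!: mult_right_mono)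
    ultimately have "?f j = (\<lambda>\<omega>. 0)" by (simp add: min_absorb1)
    then show ?thesis using square_integrable_zero by simp
  qed
  show "grid_process \<delta> n \<beta> \<gamma> t \<in> borel_measurable (F t)"
    unfolding grid_process_def[abs_def] using f by (intro borel_measurable_sum) auto
  show "square_integrable M (grid_process \<delta> n \<beta> \<gamma> t)"
    unfolding grid_process_def[abs_def] using f by (intro square_integrable_sum) auto
qed

text \<open>Pythagoras: the noise term is orthogonal to everything known at time
  \<open>s\<close>.\<close>

lemma martingale_step_energy:
  fixes V :: "'a \<Rightarrow> 'b::euclidean_space"
  assumes "0 \<le> s" "s \<le> t" and V: "V \<in> borel_measurable (F s)" "square_integrable M V"
    and \<gamma>: "\<gamma> \<in> borel_measurable (F s)" "square_integrable M \<gamma>"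
  shows "(\<integral>\<omega>. (norm (V \<omega> + (W t \<omega> - W s \<omega>) *\<^sub>R \<gamma> \<omega>))\<^sup>2 \<partial>M) = (\<integral>\<omega>. (norm (V \<omega>))\<^sup>2 \<partial>M) + (t - s) * (\<integral>\<omega>. (norm (\<gamma> \<omega>))\<^sup>2 \<partial>M)"
proof -
  let ?G = "\<lambda>\<omega>. (W t \<omega> - W s \<omega>) *\<^sub>R \<gamma> \<omega>"
  note G = increment_square_integrable[OF assms(1,2) \<gamma>]
  have i: "integrable M (\<lambda>\<omega>. V \<omega> \<bullet> ?G \<omega>)" by (rule square_integrable_bilinear[OF bounded_bilinear_inner V(2) G(1)])
  have "(norm (v + g))\<^sup>2 = (norm v)\<^sup>2 + 2 * (v \<bullet> g) + (norm g)\<^sup>2" for v g :: 'b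
    by (simp add: power2_norm_eq_inner inner_add inner_commute)
  then show ?thesis
    using i square_integrable_sq[OF G(1)] square_integrable_sq[OF V(2)] G(2)
      orthogonal_increment[OF bounded_bilinear_inner assms(1,2) V \<gamma>]
    by (simp del: norm_scaleR)
qed

text \<open>The factor \<open>1 + \<delta>\<close>, in place of a fixed constant such as 2, keeps
  the product over about \<open>1 / \<delta>\<close> steps bounded.\<close>

lemma norm_add_scaled_sq_le:
  assumes "0 < \<delta>" "\<delta> \<le> 1"
  shows "(norm (v + \<delta> *\<^sub>R w))\<^sup>2 \<le> (1 + \<delta>) * (norm v)\<^sup>2 + 2 * \<delta> * (norm (w::'b::real_inner))\<^sup>2"
proof -
  have "(norm (v + \<delta> *\<^sub>R w))\<^sup>2 = (norm v)\<^sup>2 + \<delta> * (2 * (v \<bullet> w)) + \<delta> * (\<delta> * (norm w)\<^sup>2)"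
    by (simp add: power2_norm_eq_inner inner_add inner_commute algebra_simps)
  moreover have "2 * (v \<bullet> w) \<le> (norm v)\<^sup>2 + (norm w)\<^sup>2"
    using inner_ge_zero[of "v - w"] by (simp add: power2_norm_eq_inner inner_diff inner_commute)
  moreover have "\<delta> * (norm w)\<^sup>2 \<le> (norm w)\<^sup>2" using assms by (simp add: mult_left_le_one_le)
  ultimately have "(norm (v + \<delta> *\<^sub>R w))\<^sup>2 \<le> (norm v)\<^sup>2 + \<delta> * ((norm v)\<^sup>2 + (norm w)\<^sup>2) + \<delta> * (norm w)\<^sup>2"
    using assms by (simp add: add_mono mult_left_mono)
  then show ?thesis by (simp add: algebra_simps)
qed

lemma euler_step_energy:
  fixes V :: "'a \<Rightarrow> 'b::euclidean_space"
  assumes "0 \<le> s" "0 < \<delta>" "\<delta> \<le> 1" and V: "V \<in> borel_measurable (F s)" "square_integrable M V"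
    and \<beta>: "\<beta> \<in> borel_measurable (F s)" "square_integrable M \<beta>"
    and \<gamma>: "\<gamma> \<in> borel_measurable (F s)" "square_integrable M \<gamma>"
  shows "(\<integral>\<omega>. (norm (V \<omega> + \<delta> *\<^sub>R \<beta> \<omega> + (W (s + \<delta>) \<omega> - W s \<omega>) *\<^sub>R \<gamma> \<omega>))\<^sup>2 \<partial>M)
    \<le> (1 + \<delta>) * (\<integral>\<omega>. (norm (V \<omega>))\<^sup>2 \<partial>M) + 2 * \<delta> * (\<integral>\<omega>. (norm (\<beta> \<omega>))\<^sup>2 \<partial>M) + \<delta> * (\<integral>\<omega>. (norm (\<gamma> \<omega>))\<^sup>2 \<partial>M)"
proof -
  have m: "(\<lambda>\<omega>. V \<omega> + \<delta> *\<^sub>R \<beta> \<omega>) \<in> borel_measurable (F s)" "square_integrable M (\<lambda>\<omega>. V \<omega> + \<delta> *\<^sub>R \<beta> \<omega>)"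
    using V \<beta> by (auto intro!: square_integrable_add(1) square_integrable_scaleR)
  have "(\<integral>\<omega>. (norm (V \<omega> + \<delta> *\<^sub>R \<beta> \<omega>))\<^sup>2 \<partial>M) \<le> (\<integral>\<omega>. (1 + \<delta>) * (norm (V \<omega>))\<^sup>2 + 2 * \<delta> * (norm (\<beta> \<omega>))\<^sup>2 \<partial>M)"
    using square_integrable_sq[OF m(2)] square_integrable_sq[OF V(2)] square_integrable_sq[OF \<beta>(2)] assms(2,3)
    by (intro integral_mono norm_add_scaled_sq_le) auto
  also have "\<dots> = (1 + \<delta>) * (\<integral>\<omega>. (norm (V \<omega>))\<^sup>2 \<partial>M) + 2 * \<delta> * (\<integral>\<omega>. (norm (\<beta> \<omega>))\<^sup>2 \<partial>M)"
    using square_integrable_sq[OF V(2)] square_integrable_sq[OF \<beta>(2)] by simp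
  finally show ?thesis
    using martingale_step_energy[OF assms(1) _ m \<gamma>, of "s + \<delta>"] assms(2) by simp
qed

lemma grid_increment_energy:
  fixes \<beta> :: "'a \<Rightarrow> 'b::euclidean_space"
  assumes "0 \<le> s" "0 \<le> \<epsilon>" "\<epsilon> \<le> \<delta>"
    and \<beta>: "\<beta> \<in> borel_measurable (F s)" "square_integrable M \<beta>"
    and \<gamma>: "\<gamma> \<in> borel_measurable (F s)" "square_integrable M \<gamma>"
  shows "(\<integral>\<omega>. (norm (\<epsilon> *\<^sub>R \<beta> \<omega> + (W (s + \<epsilon>) \<omega> - W s \<omega>) *\<^sub>R \<gamma> \<omega>))\<^sup>2 \<partial>M)
    \<le> \<delta>\<^sup>2 * (\<integral>\<omega>. (norm (\<beta> \<omega>))\<^sup>2 \<partial>M) + \<delta> * (\<integral>\<omega>. (norm (\<gamma> \<omega>))\<^sup>2 \<partial>M)"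
proof -
  have m: "(\<lambda>\<omega>. \<epsilon> *\<^sub>R \<beta> \<omega>) \<in> borel_measurable (F s)" "square_integrable M (\<lambda>\<omega>. \<epsilon> *\<^sub>R \<beta> \<omega>)"
    using \<beta> by (auto intro!: square_integrable_scaleR)
  have "(\<integral>\<omega>. (norm (\<epsilon> *\<^sub>R \<beta> \<omega> + (W (s + \<epsilon>) \<omega> - W s \<omega>) *\<^sub>R \<gamma> \<omega>))\<^sup>2 \<partial>M)
    = \<epsilon>\<^sup>2 * (\<integral>\<omega>. (norm (\<beta> \<omega>))\<^sup>2 \<partial>M) + \<epsilon> * (\<integral>\<omega>. (norm (\<gamma> \<omega>))\<^sup>2 \<partial>M)"
    using martingale_step_energy[OF assms(1) _ m \<gamma>, of "s + \<epsilon>"] assms(2) by (simp add: power_mult_distrib)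
  also have "\<dots> \<le> \<delta>\<^sup>2 * (\<integral>\<omega>. (norm (\<beta> \<omega>))\<^sup>2 \<partial>M) + \<delta> * (\<integral>\<omega>. (norm (\<gamma> \<omega>))\<^sup>2 \<partial>M)"
    using assms(2,3) by (intro add_mono mult_right_mono power_mono integral_nonneg_AE) auto
  finally show ?thesis .
qed

text \<open>What happens after time \<open>t\<close> is an integral over the parts of the cells
  beyond \<open>t\<close>, to which \<open>orthogonal_block_integral_future\<close> applies.\<close>

lemma grid_martingale_split:
  fixes \<gamma> :: "nat \<Rightarrow> 'a \<Rightarrow> 'b::euclidean_space"
  assumes \<delta>: "0 < \<delta>" and \<gamma>: "grid_adapted \<delta> n \<gamma>" and t: "0 \<le> t" "t \<le> real n * \<delta>"
  shows "grid_process \<delta> n (\<lambda>j \<omega>. 0) \<gamma> (real n * \<delta>) \<omega> = grid_process \<delta> n (\<lambda>j \<omega>. 0) \<gamma> t \<omega> +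
    block_integral {..<n} (\<lambda>j. max (real j * \<delta>) t) (\<lambda>j. max (real (Suc j) * \<delta>) t) \<gamma> \<omega>"
  unfolding grid_process_def block_integral_def sum.distrib[symmetric]
proof (intro sum.cong refl)
  fix j assume "j \<in> {..<n}"
  then have "real j * \<delta> \<le> real n * \<delta>" "real (Suc j) * \<delta> \<le> real n * \<delta>" "real j * \<delta> \<le> real (Suc j) * \<delta>"
    using \<delta> by (auto intro!: mult_right_mono)
  then show "(min (real n * \<delta>) (real (Suc j) * \<delta>) - min (real n * \<delta>) (real j * \<delta>)) *\<^sub>R 0 +
         (W (min (real n * \<delta>) (real (Suc j) * \<delta>)) \<omega> - W (min (real n * \<delta>) (real j * \<delta>)) \<omega>) *\<^sub>R \<gamma> j \<omega> =
         (min t (real (Suc j) * \<delta>) - min t (real j * \<delta>)) *\<^sub>R 0 +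
         (W (min t (real (Suc j) * \<delta>)) \<omega> - W (min t (real j * \<delta>)) \<omega>) *\<^sub>R \<gamma> j \<omega> +
         (W (max (real (Suc j) * \<delta>) t) \<omega> - W (max (real j * \<delta>) t) \<omega>) *\<^sub>R \<gamma> j \<omega>"
    by (simp add: min_absorb2 scaleR_left_distrib[symmetric]) (auto simp: min_def max_def)
qed

lemma grid_block_family:
  "0 < \<delta> \<Longrightarrow> grid_adapted \<delta> n \<gamma> \<Longrightarrow> block_family {..<n} (\<lambda>j. real j * \<delta>) (\<lambda>j. real (Suc j) * \<delta>) \<gamma>"
  by (auto simp: grid_adapted_def block_family_def intro!: mult_right_mono)

lemma grid_martingale_energy:
  fixes \<gamma> :: "nat \<Rightarrow> 'a \<Rightarrow> 'b::euclidean_space"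
  assumes \<delta>: "0 < \<delta>" and \<gamma>: "grid_adapted \<delta> n \<gamma>"
  shows "k \<le> n \<Longrightarrow> (\<integral>\<omega>. (norm (grid_process \<delta> n (\<lambda>j \<omega>. 0) \<gamma> (real k * \<delta>) \<omega>))\<^sup>2 \<partial>M) = (\<Sum>j<k. \<delta> * (\<integral>\<omega>. (norm (\<gamma> j \<omega>))\<^sup>2 \<partial>M))"
proof (induction k)
  case 0 then show ?case using \<delta> by (simp add: grid_process_0)
next
  case (Suc k)
  have z: "grid_adapted \<delta> n (\<lambda>j \<omega>. 0 :: 'b)" by (simp add: grid_adapted_def square_integrable_zero)
  have le: "real k * \<delta> \<le> real (Suc k) * \<delta>" "0 \<le> real k * \<delta>" using \<delta> by (auto intro!: mult_right_mono)
  have [simp]: "real (Suc k) * \<delta> - real k * \<delta> = \<delta>" by (simp add: algebra_simps)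
  have "grid_process \<delta> n (\<lambda>j \<omega>. 0) \<gamma> (real (Suc k) * \<delta>) \<omega> = grid_process \<delta> n (\<lambda>j \<omega>. 0) \<gamma> (real k * \<delta>) \<omega> +
     (W (real (Suc k) * \<delta>) \<omega> - W (real k * \<delta>) \<omega>) *\<^sub>R \<gamma> k \<omega>" for \<omega>
    using grid_process_cell[OF \<delta>, of k n "real (Suc k) * \<delta>" "\<lambda>j \<omega>. 0"] Suc.prems le by (simp del: of_nat_Suc)
  moreover have "\<gamma> k \<in> borel_measurable (F (real k * \<delta>))" "square_integrable M (\<gamma> k)" using \<gamma> Suc.prems by (auto simp: grid_adapted_def)
  ultimately show ?case
    using martingale_step_energy[OF le(2,1) grid_process_adapted[OF \<delta> z \<gamma> le(2)]] Suc by (simp del: of_nat_Suc)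
qed

text \<open>The discrete inequality is applied on the grids of mesh \<open>T / 2 ^ l\<close>, which
  are unrelated to \<open>\<delta>\<close>. Its bound does not depend on \<open>l\<close> and the
  exceptional events increase with \<open>l\<close>, so it survives the limit; continuity of the
  paths extends the estimate from these times to all of \<open>[0, T]\<close>.\<close>

lemma grid_martingale_maximal:
  fixes \<gamma> :: "nat \<Rightarrow> 'a \<Rightarrow> 'b::euclidean_space"
  assumes \<delta>: "0 < \<delta>" and \<gamma>: "grid_adapted \<delta> n \<gamma>" and c: "0 < c"
  defines "N \<equiv> grid_process \<delta> n (\<lambda>j \<omega>. 0) \<gamma>" and "T \<equiv> real n * \<delta>"
  shows "\<exists>E\<in>sets M. c\<^sup>2 * prob E \<le> (\<Sum>j<n. \<delta> * (\<integral>\<omega>. (norm (\<gamma> j \<omega>))\<^sup>2 \<partial>M)) \<and>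
    (\<forall>\<omega>\<in>space M - E. continuous_on {0..} (\<lambda>t. W t \<omega>) \<longrightarrow> (\<forall>t\<in>{0..T}. norm (N t \<omega>) \<le> c))"
proof -
  have T: "0 \<le> T" using \<delta> by (simp add: T_def)
  have z: "grid_adapted \<delta> n (\<lambda>j \<omega>. 0 :: 'b)" by (simp add: grid_adapted_def square_integrable_zero)
  note ad = grid_process_adapted[OF \<delta> z \<gamma>, folded N_def]
  \<comment> \<open>The \<open>min\<close> keeps indices beyond \<open>2 ^ l\<close> inside
    \<open>[0, T]\<close>: the maximal inequality is stated for a sequence over all
    \<open>j\<close>.\<close>
  define \<tau> where "\<tau> l j = min T (real j * (T / 2 ^ l))" for l j :: nat
  have \<tau>: "0 \<le> \<tau> l j" "\<tau> l j \<le> T" "mono (\<tau> l)" for l j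
  proof -
    show "mono (\<tau> l)" unfolding \<tau>_def using T by (intro monoI min.mono mult_right_mono order_refl) auto
  qed (use T in \<open>auto simp: \<tau>_def\<close>)
  define E where "E l = {\<omega>\<in>space M. \<exists>j\<le>2^l. c \<le> norm (N (\<tau> l j) \<omega>)}" for l
  have E: "E l \<in> sets M" "c\<^sup>2 * prob (E l) \<le> (\<Sum>j<n. \<delta> * (\<integral>\<omega>. (norm (\<gamma> j \<omega>))\<^sup>2 \<partial>M))" for l
  proof -
    have orth: "(\<integral>\<omega>. (indicator A \<omega> *\<^sub>R N (\<tau> l j) \<omega>) \<bullet> (N T \<omega> - N (\<tau> l j) \<omega>) \<partial>M) = 0" if A: "A \<in> sets (F (\<tau> l j))" for j A
    proof -
      note adj = ad[OF \<tau>(1), of l j]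
      have m: "(\<lambda>\<omega>. indicator A \<omega> *\<^sub>R N (\<tau> l j) \<omega>) \<in> borel_measurable (F (\<tau> l j))" using adj(1) A by measurable
      have s: "square_integrable M (\<lambda>\<omega>. indicator A \<omega> *\<^sub>R N (\<tau> l j) \<omega>)"
        using measurable_F_M[OF m] square_integrable_sq[OF adj(2)]
        by (intro square_integrable_bound(1)[where g="\<lambda>\<omega>. (norm (N (\<tau> l j) \<omega>))\<^sup>2"]) (auto simp: indicator_def)
      have "N T \<omega> - N (\<tau> l j) \<omega> = block_integral {..<n} (\<lambda>i. max (real i * \<delta>) (\<tau> l j)) (\<lambda>i. max (real (Suc i) * \<delta>) (\<tau> l j)) \<gamma> \<omega>" for \<omega>
        unfolding N_def T_def grid_martingale_split[OF \<delta> \<gamma> \<tau>(1)[of l j] \<tau>(2)[of l j, unfolded T_def], of \<omega>] by simp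
      then show ?thesis
        using orthogonal_block_integral_future[OF bounded_bilinear_inner grid_block_family[OF \<delta> \<gamma>] \<tau>(1)[of l j] m s]
        by (simp only:)
    qed
    have "square_integrable M (N T)" by (rule ad(2)[OF T])
    note K = Kolmogorov_maximal_inequality[where S="\<lambda>j. N (\<tau> l j)" and \<tau>="\<tau> l" and r="2^l", OF ad[OF \<tau>(1)] \<tau>(3) this c orth]
    show "E l \<in> sets M" unfolding E_def by (rule K(1))
    show "c\<^sup>2 * prob (E l) \<le> (\<Sum>j<n. \<delta> * (\<integral>\<omega>. (norm (\<gamma> j \<omega>))\<^sup>2 \<partial>M))"
      unfolding E_def using K(2) unfolding N_def T_def grid_martingale_energy[OF \<delta> \<gamma> order_refl] .
  qed
  have inc: "incseq E"
  proof (rule incseq_SucI, rule subsetI)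
    fix l \<omega> assume "\<omega> \<in> E l"
    then obtain j where j: "\<omega> \<in> space M" "j \<le> 2^l" "c \<le> norm (N (\<tau> l j) \<omega>)" by (auto simp: E_def)
    have "\<tau> (Suc l) (2 * j) = \<tau> l j" by (simp add: \<tau>_def)
    then show "\<omega> \<in> E (Suc l)" using j by (auto simp: E_def intro!: exI[of _ "2 * j"])
  qed
  have "(\<lambda>l. prob (E l)) \<longlonglongrightarrow> prob (\<Union>l. E l)"
    using E(1) inc by (intro finite_Lim_measure_incseq) auto
  then have "(\<lambda>l. c\<^sup>2 * prob (E l)) \<longlonglongrightarrow> c\<^sup>2 * prob (\<Union>l. E l)" by (intro tendsto_intros)
  then have "c\<^sup>2 * prob (\<Union>l. E l) \<le> (\<Sum>j<n. \<delta> * (\<integral>\<omega>. (norm (\<gamma> j \<omega>))\<^sup>2 \<partial>M))"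
    by (rule LIMSEQ_le_const2) (use E(2) in auto)
  moreover have "norm (N t \<omega>) \<le> c" if w: "\<omega> \<in> space M - (\<Union>l. E l)" "continuous_on {0..} (\<lambda>t. W t \<omega>)" and t: "t \<in> {0..T}" for \<omega> t
  proof (cases "T = 0")
    case True
    then have "N t \<omega> = 0" using t \<delta> by (simp add: N_def grid_process_0)
    then show ?thesis using c by simp
  next
    case False
    then have T0: "0 < T" using T by simp
    \<comment> \<open>Index of the grid time of level \<open>l\<close> obtained by rounding
      \<open>t\<close> down; these times converge to \<open>t\<close>.\<close>
    define j where "j l = nat \<lfloor>t * 2 ^ l / T\<rfloor>" for l :: nat
    have jr: "t * 2 ^ l / T - 1 \<le> real (j l)" "real (j l) \<le> t * 2 ^ l / T" for l
    proof -
      have "0 \<le> t * 2 ^ l / T" using t T0 by simp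
      then show "t * 2 ^ l / T - 1 \<le> real (j l)" "real (j l) \<le> t * 2 ^ l / T" unfolding j_def by linarith+
    qed
    have le: "real (j l) * (T / 2 ^ l) \<le> t" "t - T * (1/2) ^ l \<le> real (j l) * (T / 2 ^ l)" for l
    proof -
      have e: "t * 2 ^ l / T * (T / 2 ^ l) = t" "(t * 2 ^ l / T - 1) * (T / 2 ^ l) = t - T / 2 ^ l" "T * (1/2) ^ l = T / 2 ^ l"
        using T0 by (simp_all add: power_one_over field_simps)
      have p: "0 \<le> T / 2 ^ l" using T0 by simp
      show "real (j l) * (T / 2 ^ l) \<le> t" "t - T * (1/2) ^ l \<le> real (j l) * (T / 2 ^ l)"
        using mult_right_mono[OF jr(1)[of l] p] mult_right_mono[OF jr(2)[of l] p] unfolding e by auto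
    qed
    have jl: "j l \<le> 2 ^ l" for l
    proof -
      have "t * 2 ^ l / T \<le> 2 ^ l" using t T0 by (simp add: divide_le_eq)
      from order_trans[OF jr(2) this] have "real (j l) \<le> real (2 ^ l)" by (simp only: of_nat_power of_nat_numeral)
      then show ?thesis by (rule of_nat_le_iff[THEN iffD1])
    qed
    have \<tau>j: "\<tau> l (j l) = real (j l) * (T / 2 ^ l)" for l unfolding \<tau>_def using le(1)[of l] t by auto
    have lim: "(\<lambda>l. \<tau> l (j l)) \<longlonglongrightarrow> t"
    proof (rule tendsto_sandwich)
      show "(\<lambda>l. t - T * (1/2) ^ l) \<longlonglongrightarrow> t"
        using tendsto_diff[OF tendsto_const tendsto_mult[OF tendsto_const LIMSEQ_power_zero[of "1/2::real"]], of t T] by simp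
    qed (use le \<tau>j in auto)
    have "(\<lambda>l. N (\<tau> l (j l)) \<omega>) \<longlonglongrightarrow> N t \<omega>"
      using continuous_on_tendsto_compose[OF continuous_on_grid_process[OF w(2) \<delta>] lim] t \<tau>(1) by (simp add: N_def)
    then have "(\<lambda>l. norm (N (\<tau> l (j l)) \<omega>)) \<longlonglongrightarrow> norm (N t \<omega>)" by (rule tendsto_norm)
    moreover have "norm (N (\<tau> l (j l)) \<omega>) \<le> c" for l
      using w(1) jl[of l] by (force simp: E_def)
    ultimately show ?thesis by (intro LIMSEQ_le_const2) auto
  qed
  ultimately show ?thesis using E(1) by (intro bexI[of _ "\<Union>l. E l"]) auto
qed

text \<open>Drift and noise are each allowed the size \<open>c\<close>. The drift part is at all
  times at most \<open>D \<omega>\<close>, and Cauchy-Schwarz with Chebyshev bounds the probability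
  of a large \<open>D\<close> by \<open>T\<^sup>2 * K / c\<^sup>2\<close>; the martingale part
  accounts for \<open>T * K / c\<^sup>2\<close>.\<close>

lemma grid_process_maximal:
  fixes \<beta> \<gamma> :: "nat \<Rightarrow> 'a \<Rightarrow> 'b::euclidean_space"
  assumes \<delta>: "0 < \<delta>" and \<beta>: "grid_adapted \<delta> n \<beta>" and \<gamma>: "grid_adapted \<delta> n \<gamma>" and c: "0 < c"
    and K: "\<And>j. j < n \<Longrightarrow> (\<integral>\<omega>. (norm (\<beta> j \<omega>))\<^sup>2 \<partial>M) \<le> K" "\<And>j. j < n \<Longrightarrow> (\<integral>\<omega>. (norm (\<gamma> j \<omega>))\<^sup>2 \<partial>M) \<le> K"
  defines "T \<equiv> real n * \<delta>"
  shows "\<exists>E\<in>sets M. prob E \<le> (T\<^sup>2 + T) * K / c\<^sup>2 \<and>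
    (\<forall>\<omega>\<in>space M - E. continuous_on {0..} (\<lambda>t. W t \<omega>) \<longrightarrow> (\<forall>t\<in>{0..T}. norm (grid_process \<delta> n \<beta> \<gamma> t \<omega>) \<le> 2 * c))"
proof -
  obtain E where E: "E \<in> sets M" "c\<^sup>2 * prob E \<le> (\<Sum>j<n. \<delta> * (\<integral>\<omega>. (norm (\<gamma> j \<omega>))\<^sup>2 \<partial>M))"
    "\<And>\<omega> t. \<omega> \<in> space M - E \<Longrightarrow> continuous_on {0..} (\<lambda>t. W t \<omega>) \<Longrightarrow> t \<in> {0..T} \<Longrightarrow> norm (grid_process \<delta> n (\<lambda>j \<omega>. 0) \<gamma> t \<omega>) \<le> c"
    using grid_martingale_maximal[OF \<delta> \<gamma> c] unfolding T_def by blast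
  define D where "D \<omega> = (\<Sum>j<n. \<delta> * norm (\<beta> j \<omega>))" for \<omega>
  define Q where "Q \<omega> = (\<Sum>j<n. (norm (\<beta> j \<omega>))\<^sup>2)" for \<omega>
  have iQ: "integrable M Q" unfolding Q_def using \<beta> by (intro Bochner_Integration.integrable_sum) (auto simp: grid_adapted_def square_integrable_def)
  have [measurable]: "\<beta> j \<in> borel_measurable M" if "j < n" for j using that \<beta> by (auto simp: grid_adapted_def square_integrable_def)
  have Dm[measurable]: "D \<in> borel_measurable M" unfolding D_def by measurable
  have DQ: "(D \<omega>)\<^sup>2 \<le> T * \<delta> * Q \<omega>" for \<omega>
  proof -
    have "(D \<omega>)\<^sup>2 \<le> (\<Sum>j<n. \<delta>\<^sup>2) * (\<Sum>j<n. (norm (\<beta> j \<omega>))\<^sup>2)"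
      unfolding D_def by (rule Cauchy_Schwarz_ineq_sum)
    then show ?thesis by (simp add: T_def Q_def power2_eq_square mult.assoc)
  qed
  define E' where "E' = {\<omega>\<in>space M. c\<^sup>2 \<le> T * \<delta> * Q \<omega>}"
  have Qm[measurable]: "Q \<in> borel_measurable M" using iQ by auto
  have E'm: "E' \<in> sets M" unfolding E'_def by measurable
  have Q0: "0 \<le> T * \<delta> * Q \<omega>" for \<omega> using \<delta> by (auto simp: T_def Q_def intro!: mult_nonneg_nonneg sum_nonneg)
  have "c\<^sup>2 * prob E' = (\<integral>\<omega>. indicator E' \<omega> * c\<^sup>2 \<partial>M)" using E'm by (simp add: mult.commute)
  also have "\<dots> \<le> (\<integral>\<omega>. T * \<delta> * Q \<omega> \<partial>M)"
  proof (rule integral_mono)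
    show "integrable M (\<lambda>\<omega>. indicator E' \<omega> * c\<^sup>2)" 
      using integrable_mult_indicator[OF E'm, of "\<lambda>_. c\<^sup>2"] by simp
    show "indicator E' \<omega> * c\<^sup>2 \<le> T * \<delta> * Q \<omega>" for \<omega>
      using Q0[of \<omega>] by (auto simp: indicator_def E'_def)
  qed (use iQ in simp)
  also have "\<dots> = T * \<delta> * (\<Sum>j<n. \<integral>\<omega>. (norm (\<beta> j \<omega>))\<^sup>2 \<partial>M)"
    unfolding Q_def using \<beta> by (subst Bochner_Integration.integral_mult_right_zero, subst Bochner_Integration.integral_sum) (auto simp: grid_adapted_def square_integrable_def)
  also have "\<dots> \<le> T * \<delta> * (\<Sum>j<n. K)"
    using \<delta> by (intro mult_left_mono sum_mono K) (auto simp: T_def)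
  also have "\<dots> = T\<^sup>2 * K" by (simp add: T_def power2_eq_square)
  finally have 1: "c\<^sup>2 * prob E' \<le> T\<^sup>2 * K" .
  have "c\<^sup>2 * prob E \<le> (\<Sum>j<n. \<delta> * K)" using E(2) \<delta> K by (intro order_trans[OF E(2)] sum_mono mult_left_mono) auto
  also have "\<dots> = T * K" by (simp add: T_def)
  finally have 2: "c\<^sup>2 * prob E \<le> T * K" .
  have "prob (E \<union> E') \<le> prob E + prob E'" using E(1) E'm by (rule measure_Un_le)
  then have "c\<^sup>2 * prob (E \<union> E') \<le> c\<^sup>2 * (prob E + prob E')" by (intro mult_left_mono) auto
  also have "\<dots> \<le> (T\<^sup>2 + T) * K" using 1 2 by (simp add: algebra_simps)
  finally have 3: "prob (E \<union> E') \<le> (T\<^sup>2 + T) * K / c\<^sup>2" using c by (simp add: pos_le_divide_eq mult.commute)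
  have "norm (grid_process \<delta> n \<beta> \<gamma> t \<omega>) \<le> 2 * c" if w: "\<omega> \<in> space M - (E \<union> E')" "continuous_on {0..} (\<lambda>t. W t \<omega>)" and t: "t \<in> {0..T}" for \<omega> t
  proof -
    let ?S = "\<Sum>j<n. (min t (real (Suc j) * \<delta>) - min t (real j * \<delta>)) *\<^sub>R \<beta> j \<omega>"
    have "grid_process \<delta> n \<beta> \<gamma> t \<omega> = ?S + grid_process \<delta> n (\<lambda>j \<omega>. 0) \<gamma> t \<omega>"
      by (simp add: grid_process_def sum.distrib)
    moreover have "norm (grid_process \<delta> n (\<lambda>j \<omega>. 0) \<gamma> t \<omega>) \<le> c" using E(3)[of \<omega> t] w t by auto
    moreover have "norm ?S \<le> D \<omega>"
      unfolding D_def
    proof (rule sum_norm_le)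
      fix j
      have "real (Suc j) * \<delta> = real j * \<delta> + \<delta>" by (simp add: algebra_simps)
      then have "\<bar>min t (real (Suc j) * \<delta>) - min t (real j * \<delta>)\<bar> \<le> \<delta>" using \<delta> by (auto simp: min_def)
      then show "norm ((min t (real (Suc j) * \<delta>) - min t (real j * \<delta>)) *\<^sub>R \<beta> j \<omega>) \<le> \<delta> * norm (\<beta> j \<omega>)"
        by (simp add: mult_right_mono)
    qed
    moreover have "D \<omega> \<le> c"
    proof -
      have "(D \<omega>)\<^sup>2 < c\<^sup>2" using DQ[of \<omega>] w by (auto simp: E'_def)
      then show ?thesis using c by (simp add: power2_less_imp_less less_imp_le)
    qed
    ultimately show ?thesis using norm_triangle_ineq[of ?S "grid_process \<delta> n (\<lambda>j \<omega>. 0) \<gamma> t \<omega>"] by simp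
  qed
  then show ?thesis using 3 E(1) E'm by (intro bexI[of _ "E \<union> E'"]) auto
qed

end

text \<open>Adding \<open>d / c\<close> to \<open>e\<close> makes the recursion purely
  multiplicative, and \<open>1 + c * \<delta> \<le> exp (c * \<delta>)\<close>.\<close>

lemma discrete_Gronwall:
  fixes e :: "nat \<Rightarrow> real"
  assumes step: "\<And>j. j < n \<Longrightarrow> e (Suc j) \<le> (1 + c * \<delta>) * e j + d * \<delta>"
    and "0 < c" "0 \<le> d" "0 < \<delta>" "0 \<le> e 0" and "j \<le> n"
  shows "e j \<le> (e 0 + d / c) * exp (c * (real j * \<delta>))"
proof -
  have "j \<le> n \<Longrightarrow> e j + d / c \<le> (1 + c * \<delta>) ^ j * (e 0 + d / c)"
  proof (induction j)
    case (Suc j)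
    have "e (Suc j) + d / c \<le> (1 + c * \<delta>) * (e j + d / c)"
      using step[of j] Suc.prems \<open>0 < c\<close> by (simp add: algebra_simps)
    also have "\<dots> \<le> (1 + c * \<delta>) * ((1 + c * \<delta>) ^ j * (e 0 + d / c))"
      using Suc assms by (intro mult_left_mono) auto
    finally show ?case by (simp add: mult_ac)
  qed simp
  with \<open>j \<le> n\<close> have "e j + d / c \<le> (1 + c * \<delta>) ^ j * (e 0 + d / c)" by simp
  also have "\<dots> \<le> exp (c * \<delta>) ^ j * (e 0 + d / c)"
    using assms by (intro mult_right_mono power_mono) (auto intro: exp_ge_add_one_self)
  also have "exp (c * \<delta>) ^ j = exp (c * (real j * \<delta>))" by (simp add: exp_of_nat_mult[symmetric] mult_ac)
  finally have "e j + d / c \<le> (e 0 + d / c) * exp (c * (real j * \<delta>))" by (simp only: mult.commute)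
  moreover have "0 \<le> d / c" using assms by simp
  ultimately show ?thesis by linarith
qed

section \<open>Grid refinement and Euler approximations of Lipschitz equations\<close>

context standard_brownian_motion
begin

text \<open>A process on a coarse grid is one on the finer grid whose coefficients stay constant
  over \<open>r\<close> consecutive cells. This brings approximations of different levels to a
  common grid, where they can be subtracted.\<close>

lemma grid_process_refine:
  assumes r: "0 < r" and \<delta>: "\<delta> = real r * \<epsilon>"
  shows "grid_process \<delta> n \<beta> \<gamma> t \<omega> = grid_process \<epsilon> (n * r) (\<lambda>j. \<beta> (j div r)) (\<lambda>j. \<gamma> (j div r)) t \<omega>"
proof -
  let ?f = "\<lambda>j. (min t (real (Suc j) * \<epsilon>) - min t (real j * \<epsilon>)) *\<^sub>R \<beta> (j div r) \<omega> +
     (W (min t (real (Suc j) * \<epsilon>)) \<omega> - W (min t (real j * \<epsilon>)) \<omega>) *\<^sub>R \<gamma> (j div r) \<omega>"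
  have "(\<Sum>j<n * r. ?f j) = (\<Sum>m<n. sum ?f {m * r..<m * r + r})"
    by (rule sum.nat_group[symmetric])
  also have "\<dots> = (\<Sum>m<n. (min t (real (Suc m) * \<delta>) - min t (real m * \<delta>)) *\<^sub>R \<beta> m \<omega> +
     (W (min t (real (Suc m) * \<delta>)) \<omega> - W (min t (real m * \<delta>)) \<omega>) *\<^sub>R \<gamma> m \<omega>)"
  proof (intro sum.cong refl)
    fix m
    have e: "real (m * r) * \<epsilon> = real m * \<delta>" "real (m * r + r) * \<epsilon> = real (Suc m) * \<delta>" by (simp_all add: \<delta> algebra_simps)
    have d: "j div r = m" if "j \<in> {m * r..<m * r + r}" for j
      using that by (intro div_nat_eqI) (auto simp: mult.commute)
    have "sum ?f {m * r..<m * r + r} = (\<Sum>j=m * r..<m * r + r. (min t (real (Suc j) * \<epsilon>) - min t (real j * \<epsilon>)) *\<^sub>R \<beta> m \<omega> +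
     (W (min t (real (Suc j) * \<epsilon>)) \<omega> - W (min t (real j * \<epsilon>)) \<omega>) *\<^sub>R \<gamma> m \<omega>)"
      by (intro sum.cong refl) (simp only: d)
    also have "\<dots> = (\<Sum>j=m * r..<m * r + r. min t (real (Suc j) * \<epsilon>) - min t (real j * \<epsilon>)) *\<^sub>R \<beta> m \<omega> +
     (\<Sum>j=m * r..<m * r + r. W (min t (real (Suc j) * \<epsilon>)) \<omega> - W (min t (real j * \<epsilon>)) \<omega>) *\<^sub>R \<gamma> m \<omega>"
      unfolding sum.distrib scaleR_left.sum ..
    also have "(\<Sum>j=m * r..<m * r + r. min t (real (Suc j) * \<epsilon>) - min t (real j * \<epsilon>)) = min t (real (Suc m) * \<delta>) - min t (real m * \<delta>)"
      unfolding e[symmetric] by (rule sum_Suc_diff') simp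
    also have "(\<Sum>j=m * r..<m * r + r. W (min t (real (Suc j) * \<epsilon>)) \<omega> - W (min t (real j * \<epsilon>)) \<omega>) = W (min t (real (Suc m) * \<delta>)) \<omega> - W (min t (real m * \<delta>)) \<omega>"
      unfolding e[symmetric] by (rule sum_Suc_diff') simp
    finally show "sum ?f {m * r..<m * r + r} = (min t (real (Suc m) * \<delta>) - min t (real m * \<delta>)) *\<^sub>R \<beta> m \<omega> +
     (W (min t (real (Suc m) * \<delta>)) \<omega> - W (min t (real m * \<delta>)) \<omega>) *\<^sub>R \<gamma> m \<omega>" .
  qed
  finally show ?thesis by (simp add: grid_process_def)
qed

lemma grid_process_diff:
  "grid_process \<delta> n \<beta> \<gamma> t \<omega> - grid_process \<delta> n \<beta>' \<gamma>' t \<omega>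
    = grid_process \<delta> n (\<lambda>j \<omega>. \<beta> j \<omega> - \<beta>' j \<omega>) (\<lambda>j \<omega>. \<gamma> j \<omega> - \<gamma>' j \<omega>) t \<omega>"
  by (simp add: grid_process_def sum_subtractf[symmetric] algebra_simps)

end

text \<open>The coefficients are Lipschitz in time as well, with a constant depending on the
  horizon. The Euler scheme freezes the time argument at the left end of a cell, and in the
  application time enters through the mean, which is shown to be Lipschitz on bounded
  intervals.\<close>

locale lipschitz_sde = standard_brownian_motion M W for M :: "'a measure" and W +
  fixes b g :: "real \<Rightarrow> 'b::euclidean_space \<Rightarrow> 'b" and x :: 'b
  assumes lipschitz: "\<And>T. \<exists>L. \<forall>s\<in>{0..T}. \<forall>t\<in>{0..T}. \<forall>y z.
    norm (b s y - b t z) \<le> L * (\<bar>s - t\<bar> + norm (y - z)) \<and> norm (g s y - g t z) \<le> L * (\<bar>s - t\<bar> + norm (y - z))"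
begin

definition lip_on :: "real \<Rightarrow> real \<Rightarrow> (real \<Rightarrow> 'b \<Rightarrow> 'b) \<Rightarrow> bool" where
  "lip_on T L f \<longleftrightarrow> 0 \<le> L \<and> (\<forall>s\<in>{0..T}. \<forall>t\<in>{0..T}. \<forall>y z. norm (f s y - f t z) \<le> L * (\<bar>s - t\<bar> + norm (y - z)))"

lemma lipschitz_bg: obtains L where "lip_on T L b" "lip_on T L g"
proof -
  from lipschitz[of T] obtain L where L: "\<And>s t y z. s \<in> {0..T} \<Longrightarrow> t \<in> {0..T} \<Longrightarrow>
    norm (b s y - b t z) \<le> L * (\<bar>s - t\<bar> + norm (y - z)) \<and> norm (g s y - g t z) \<le> L * (\<bar>s - t\<bar> + norm (y - z))" by blast
  have "L * (\<bar>s - t\<bar> + norm (y - z)) \<le> max 0 L * (\<bar>s - t\<bar> + norm (y - z))" for s t and y z :: 'b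
    by (intro mult_right_mono) auto
  then have "lip_on T (max 0 L) b" "lip_on T (max 0 L) g" unfolding lip_on_def using L order_trans by (auto, blast+)
  then show ?thesis by (rule that)
qed

lemma lip_onD:
  "lip_on T L f \<Longrightarrow> s \<in> {0..T} \<Longrightarrow> t \<in> {0..T} \<Longrightarrow> norm (f s y - f t z) \<le> L * (\<bar>s - t\<bar> + norm (y - z))"
  unfolding lip_on_def by blast

lemma lip_on_continuous:
  assumes "\<And>T. \<exists>L. lip_on T L f" and X: "continuous_on {0..} X"
  shows "continuous_on {0..} (\<lambda>t. f t (X t))"
proof -
  have "continuous_on {0..<T} (\<lambda>t. f t (X t))" for T
  proof -
    obtain L where L: "lip_on T L f" using assms(1) by blast
    have c: "continuous_on {0..<T} X" using X by (rule continuous_on_subset) auto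
    show ?thesis
      unfolding continuous_on_def
    proof
      fix t assume t: "t \<in> {0..<T}"
      have X': "(X \<longlongrightarrow> X t) (at t within {0..<T})" using c t by (auto simp: continuous_on_def)
      have "((\<lambda>s. L * (\<bar>s - t\<bar> + norm (X s - X t))) \<longlongrightarrow> L * (\<bar>t - t\<bar> + norm (X t - X t))) (at t within {0..<T})"
        by (intro tendsto_intros X')
      then have lim: "((\<lambda>s. L * (\<bar>s - t\<bar> + norm (X s - X t))) \<longlongrightarrow> 0) (at t within {0..<T})" by simp
      have le: "norm (f s (X s) - f t (X t)) \<le> L * (\<bar>s - t\<bar> + norm (X s - X t))" if "s \<in> {0..<T}" for s
        using L t that unfolding lip_on_def by auto
      have "((\<lambda>s. f s (X s) - f t (X t)) \<longlongrightarrow> 0) (at t within {0..<T})"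
        by (rule Lim_null_comparison[OF _ lim]) (simp add: eventually_at_filter le)
      then show "((\<lambda>s. f s (X s)) \<longlongrightarrow> f t (X t)) (at t within {0..<T})" by (rule LIM_zero_cancel)
    qed
  qed note c = this
  show ?thesis
    unfolding continuous_on_eq_continuous_within
  proof
    fix t :: real assume t: "t \<in> {0..}"
    have "continuous (at t within {0..<t+1}) (\<lambda>t. f t (X t))"
      using c[of "t+1"] t by (auto simp: continuous_on_eq_continuous_within)
    moreover have "at t within {0..<t+1} = at t within {0..}"
      using t by (intro at_within_nhd[of _ "{..<t+1}"]) auto
    ultimately show "continuous (at t within {0..}) (\<lambda>t. f t (X t))" by simp
  qed
qed

lemma lip_on_measurable:
  assumes "lip_on T L f" "t \<in> {0..T}" "V \<in> borel_measurable N"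
  shows "(\<lambda>\<omega>. f t (V \<omega>)) \<in> borel_measurable N"
proof -
  have "L-lipschitz_on UNIV (f t)"
    using assms(1,2) by (intro lipschitz_onI) (auto simp: lip_on_def dist_norm dest!: bspec[of _ _ t])
  then have "continuous_on UNIV (f t)" by (rule lipschitz_on_continuous_on)
  then show ?thesis by (rule measurable_compose[OF assms(3) borel_measurable_continuous_onI])
qed

text \<open>The constant obtained by squaring
  \<open>norm (f t y) \<le> (norm (f 0 0) + L * T) + L * norm y\<close> with
  \<open>norm_add_sq_le\<close>.\<close>

definition growth :: "real \<Rightarrow> real \<Rightarrow> (real \<Rightarrow> 'b \<Rightarrow> 'b) \<Rightarrow> real" where
  "growth T L f = 2 * (norm (f 0 0) + L * T)\<^sup>2 + 2 * L\<^sup>2"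

lemma lip_on_growth:
  assumes L: "lip_on T L f" and t: "t \<in> {0..T}"
  shows "(norm (f t y))\<^sup>2 \<le> growth T L f * (1 + (norm y)\<^sup>2)"
proof -
  have L0: "0 \<le> L" using L by (simp add: lip_on_def)
  have "norm (f t y - f 0 0) \<le> L * (\<bar>t - 0\<bar> + norm (y - 0))" using t by (intro lip_onD[OF L]) auto
  then have "norm (f t y) \<le> norm (f 0 0) + L * (t + norm y)"
    using norm_triangle_ineq2[of "f t y" "f 0 0"] t by simp
  also have "\<dots> \<le> (norm (f 0 0) + L * T) + L * norm y" using L0 t by (simp add: distrib_left mult_left_mono)
  finally have "(norm (f t y))\<^sup>2 \<le> ((norm (f 0 0) + L * T) + L * norm y)\<^sup>2" by (intro power_mono) auto
  also have "\<dots> \<le> 2 * (norm (f 0 0) + L * T)\<^sup>2 + 2 * (L * norm y)\<^sup>2"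
    using norm_add_sq_le[of "norm (f 0 0) + L * T" "L * norm y"] by simp
  also have "\<dots> \<le> growth T L f * (1 + (norm y)\<^sup>2)"
    by (simp add: growth_def algebra_simps power_mult_distrib)
  finally show ?thesis .
qed

lemma growth_nonneg: "0 \<le> growth T L f" by (simp add: growth_def)

lemma lip_on_square_integrable:
  assumes L: "lip_on T L f" and t: "t \<in> {0..T}" and V: "square_integrable M V"
  shows "square_integrable M (\<lambda>\<omega>. f t (V \<omega>))"
    "(\<integral>\<omega>. (norm (f t (V \<omega>)))\<^sup>2 \<partial>M) \<le> growth T L f * (1 + (\<integral>\<omega>. (norm (V \<omega>))\<^sup>2 \<partial>M))"
proof -
  have Vm: "V \<in> borel_measurable M" and i: "integrable M (\<lambda>\<omega>. (norm (V \<omega>))\<^sup>2)" using V by (auto simp: square_integrable_def)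
  note sb = square_integrable_bound[where f="\<lambda>\<omega>. f t (V \<omega>)" and g="\<lambda>\<omega>. growth T L f * (1 + (norm (V \<omega>))\<^sup>2)" and N=M,
      OF lip_on_measurable[OF L t Vm] _ lip_on_growth[OF L t]]
  show "square_integrable M (\<lambda>\<omega>. f t (V \<omega>))" by (rule sb(1)) (use i in simp)
  show "(\<integral>\<omega>. (norm (f t (V \<omega>)))\<^sup>2 \<partial>M) \<le> growth T L f * (1 + (\<integral>\<omega>. (norm (V \<omega>))\<^sup>2 \<partial>M))"
    using sb(2) i by (simp add: prob_space)
qed

text \<open>The time shift enters to the first power only, because
  \<open>\<epsilon>\<^sup>2 \<le> \<epsilon>\<close>. That is the order of the other mean-square
  errors of the scheme.\<close>

lemma lip_on_diff_energy:
  assumes L: "lip_on T L f" and s: "s \<in> {0..T}" and t: "t \<in> {0..T}" "\<bar>s - t\<bar> \<le> \<epsilon>" "\<epsilon> \<le> 1"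
    and V: "square_integrable M V" and V': "square_integrable M V'"
    and le: "(\<integral>\<omega>. (norm (V \<omega> - V' \<omega>))\<^sup>2 \<partial>M) \<le> D"
  shows "square_integrable M (\<lambda>\<omega>. f s (V \<omega>) - f t (V' \<omega>))"
    "(\<integral>\<omega>. (norm (f s (V \<omega>) - f t (V' \<omega>)))\<^sup>2 \<partial>M) \<le> 2 * L\<^sup>2 * (\<epsilon> + D)"
proof -
  note d = square_integrable_diff(1)[OF lip_on_square_integrable(1)[OF L s V] lip_on_square_integrable(1)[OF L t(1) V']]
  show "square_integrable M (\<lambda>\<omega>. f s (V \<omega>) - f t (V' \<omega>))" by (rule d)
  have i: "integrable M (\<lambda>\<omega>. (norm (V \<omega> - V' \<omega>))\<^sup>2)" using square_integrable_sq[OF square_integrable_diff(1)[OF V V']] .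
  have \<epsilon>: "\<epsilon>\<^sup>2 \<le> \<epsilon>" "0 \<le> \<epsilon>" using t by (auto simp: power2_eq_square intro: mult_left_le)
  have "(\<integral>\<omega>. (norm (f s (V \<omega>) - f t (V' \<omega>)))\<^sup>2 \<partial>M) \<le> (\<integral>\<omega>. 2 * L\<^sup>2 * (\<epsilon> + (norm (V \<omega> - V' \<omega>))\<^sup>2) \<partial>M)"
  proof (rule integral_mono)
    fix \<omega>
    have L0: "0 \<le> L" using L by (simp add: lip_on_def)
    have "norm (f s (V \<omega>) - f t (V' \<omega>)) \<le> L * (\<bar>s - t\<bar> + norm (V \<omega> - V' \<omega>))"
      using L s t unfolding lip_on_def by blast
    also have "\<dots> \<le> L * (\<epsilon> + norm (V \<omega> - V' \<omega>))" using L0 t by (intro mult_left_mono) auto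
    finally have "(norm (f s (V \<omega>) - f t (V' \<omega>)))\<^sup>2 \<le> (L * (\<epsilon> + norm (V \<omega> - V' \<omega>)))\<^sup>2" by (intro power_mono) auto
    also have "\<dots> \<le> L\<^sup>2 * (2 * \<epsilon>\<^sup>2 + 2 * (norm (V \<omega> - V' \<omega>))\<^sup>2)"
      unfolding power_mult_distrib using norm_add_sq_le[of \<epsilon> "norm (V \<omega> - V' \<omega>)"] by (intro mult_left_mono) auto
    also have "\<dots> \<le> L\<^sup>2 * (2 * \<epsilon> + 2 * (norm (V \<omega> - V' \<omega>))\<^sup>2)" using \<epsilon> by (intro mult_left_mono) auto
    finally show "(norm (f s (V \<omega>) - f t (V' \<omega>)))\<^sup>2 \<le> 2 * L\<^sup>2 * (\<epsilon> + (norm (V \<omega> - V' \<omega>))\<^sup>2)" by (simp add: algebra_simps)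
  qed (use i square_integrable_sq[OF d] in auto)
  also have "\<dots> = 2 * L\<^sup>2 * (\<epsilon> + (\<integral>\<omega>. (norm (V \<omega> - V' \<omega>))\<^sup>2 \<partial>M))" using i by (simp add: prob_space)
  also have "\<dots> \<le> 2 * L\<^sup>2 * (\<epsilon> + D)" using le by (intro mult_left_mono) auto
  finally show "(\<integral>\<omega>. (norm (f s (V \<omega>) - f t (V' \<omega>)))\<^sup>2 \<partial>M) \<le> 2 * L\<^sup>2 * (\<epsilon> + D)" .
qed

text \<open>Powers of 2 make every grid a refinement of all coarser ones, so that any two levels can
  be compared on the finer of them.\<close>

definition mesh :: "nat \<Rightarrow> real" where "mesh k = 1 / 2 ^ k"

lemma mesh[simp]: "0 < mesh k" "mesh k \<le> 1" by (simp_all add: mesh_def)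

lemma mesh_nonneg[simp]: "0 \<le> mesh k" by (simp add: mesh_def)

primrec euler :: "nat \<Rightarrow> nat \<Rightarrow> 'a \<Rightarrow> 'b" where
  "euler k 0 \<omega> = x"
| "euler k (Suc i) \<omega> = euler k i \<omega> + mesh k *\<^sub>R b (real i * mesh k) (euler k i \<omega>) +
     (W (real (Suc i) * mesh k) \<omega> - W (real i * mesh k) \<omega>) *\<^sub>R g (real i * mesh k) (euler k i \<omega>)"

definition drift :: "nat \<Rightarrow> nat \<Rightarrow> 'a \<Rightarrow> 'b" where "drift k i \<omega> = b (real i * mesh k) (euler k i \<omega>)"
definition diffusion :: "nat \<Rightarrow> nat \<Rightarrow> 'a \<Rightarrow> 'b" where "diffusion k i \<omega> = g (real i * mesh k) (euler k i \<omega>)"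

lemma euler_adapted: "euler k i \<in> borel_measurable (F (real i * mesh k)) \<and> square_integrable M (euler k i)"
  and drift_adapted: "drift k i \<in> borel_measurable (F (real i * mesh k)) \<and> square_integrable M (drift k i)"
  and diffusion_adapted: "diffusion k i \<in> borel_measurable (F (real i * mesh k)) \<and> square_integrable M (diffusion k i)"
proof -
  have d: "drift k i \<in> borel_measurable (F (real i * mesh k)) \<and> square_integrable M (drift k i)
    \<and> diffusion k i \<in> borel_measurable (F (real i * mesh k)) \<and> square_integrable M (diffusion k i)"
    if "euler k i \<in> borel_measurable (F (real i * mesh k)) \<and> square_integrable M (euler k i)" for i
  proof -
    obtain L where L: "lip_on (real i * mesh k) L b" "lip_on (real i * mesh k) L g" by (rule lipschitz_bg)
    have t: "real i * mesh k \<in> {0..real i * mesh k}" by simp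
    show ?thesis
      unfolding drift_def[abs_def] diffusion_def[abs_def]
      using that lip_on_measurable[OF L(1) t] lip_on_measurable[OF L(2) t] lip_on_square_integrable(1)[OF L(1) t] lip_on_square_integrable(1)[OF L(2) t]
      by blast
  qed
  have e: "euler k i \<in> borel_measurable (F (real i * mesh k)) \<and> square_integrable M (euler k i)" for i
  proof (induction i)
    case 0
    have "euler k 0 = (\<lambda>\<omega>. x)" by (intro ext) simp
    then show ?case by (simp add: square_integrable_const)
  next
    case (Suc i)
    have le: "0 \<le> real i * mesh k" "real i * mesh k \<le> real (Suc i) * mesh k" "0 \<le> real (Suc i) * mesh k" by (auto intro!: mult_right_mono)
    note di = d[OF Suc]
    have [measurable]: "euler k i \<in> borel_measurable (F (real (Suc i) * mesh k))" "drift k i \<in> borel_measurable (F (real (Suc i) * mesh k))"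
      "diffusion k i \<in> borel_measurable (F (real (Suc i) * mesh k))"
      "W (real (Suc i) * mesh k) \<in> borel_measurable (F (real (Suc i) * mesh k))" "W (real i * mesh k) \<in> borel_measurable (F (real (Suc i) * mesh k))"
      using di Suc le by (auto intro: measurable_F_mono W_measurable_F)
    have eq: "euler k (Suc i) = (\<lambda>\<omega>. euler k i \<omega> + mesh k *\<^sub>R drift k i \<omega> +
       (W (real (Suc i) * mesh k) \<omega> - W (real i * mesh k) \<omega>) *\<^sub>R diffusion k i \<omega>)"
      by (intro ext) (simp add: drift_def diffusion_def)
    have "square_integrable M (euler k (Suc i))"
      unfolding eq using di Suc
      by (intro square_integrable_add(1)[OF square_integrable_add(1)[OF _ square_integrable_scaleR] increment_square_integrable(1)[OF le(1,2)]]) blast+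
    moreover have "euler k (Suc i) \<in> borel_measurable (F (real (Suc i) * mesh k))" unfolding eq by measurable
    ultimately show ?case by blast
  qed
  show "euler k i \<in> borel_measurable (F (real i * mesh k)) \<and> square_integrable M (euler k i)" by (rule e)
  show "drift k i \<in> borel_measurable (F (real i * mesh k)) \<and> square_integrable M (drift k i)"
    "diffusion k i \<in> borel_measurable (F (real i * mesh k)) \<and> square_integrable M (diffusion k i)" using d[OF e] by auto
qed

lemma euler_Suc: "euler k (Suc i) \<omega> = euler k i \<omega> + mesh k *\<^sub>R drift k i \<omega> +
       (W (real (Suc i) * mesh k) \<omega> - W (real i * mesh k) \<omega>) *\<^sub>R diffusion k i \<omega>"
  by (simp add: drift_def diffusion_def)

lemma grid_adapted_coefficients: "grid_adapted (mesh k) n (drift k)" "grid_adapted (mesh k) n (diffusion k)"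
  using drift_adapted diffusion_adapted by (auto simp: grid_adapted_def)

text \<open>Interpolation of \<open>euler k\<close> on \<open>[0, T]\<close>, through the Brownian path itself rather than
  linearly inside the cells.\<close>

definition scheme :: "nat \<Rightarrow> nat \<Rightarrow> real \<Rightarrow> 'a \<Rightarrow> 'b" where
  "scheme T k t \<omega> = x + grid_process (mesh k) (T * 2 ^ k) (drift k) (diffusion k) t \<omega>"

lemma scheme_adapted:
  assumes "0 \<le> t"
  shows "scheme T k t \<in> borel_measurable (F t)" "square_integrable M (scheme T k t)"
  using grid_process_adapted[OF _ grid_adapted_coefficients assms, of k "T * 2 ^ k"]
  unfolding scheme_def[abs_def] by (auto intro!: square_integrable_add(1) square_integrable_const borel_measurable_add)

text \<open>At grid times the interpolation agrees with the Euler recursion, by induction over the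
  cells; inside a cell only the coefficients of that cell act.\<close>

lemma scheme_cell:
  assumes "i < T * 2 ^ k" "real i * mesh k \<le> t" "t \<le> real (Suc i) * mesh k"
  shows "scheme T k t \<omega> = euler k i \<omega> + (t - real i * mesh k) *\<^sub>R drift k i \<omega> + (W t \<omega> - W (real i * mesh k) \<omega>) *\<^sub>R diffusion k i \<omega>"
proof -
  have "i \<le> T * 2 ^ k \<Longrightarrow> scheme T k (real i * mesh k) \<omega> = euler k i \<omega>" for i
  proof (induction i)
    case (Suc i)
    have "scheme T k (real (Suc i) * mesh k) \<omega> = scheme T k (real i * mesh k) \<omega> + (real (Suc i) * mesh k - real i * mesh k) *\<^sub>R drift k i \<omega> + 
      (W (real (Suc i) * mesh k) \<omega> - W (real i * mesh k) \<omega>) *\<^sub>R diffusion k i \<omega>"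
      using Suc.prems grid_process_cell[of "mesh k" i "T * 2 ^ k" "real (Suc i) * mesh k"]
      by (simp add: scheme_def mult_right_mono del: of_nat_Suc)
    moreover have "real (Suc i) * mesh k - real i * mesh k = mesh k" by (simp add: algebra_simps)
    ultimately show ?case using Suc by (simp only: euler_Suc)
  qed (simp add: scheme_def grid_process_0)
  from this[of i] have "x + grid_process (mesh k) (T * 2 ^ k) (drift k) (diffusion k) (real i * mesh k) \<omega> = euler k i \<omega>"
    using assms(1) by (simp add: scheme_def)
  then show ?thesis
    unfolding scheme_def grid_process_cell[OF mesh(1) assms] by (simp only: add.assoc[symmetric])
qed

lemma scheme_extend:
  assumes "T \<le> T'" "t \<le> real T" shows "scheme T' k t \<omega> = scheme T k t \<omega>"
  unfolding scheme_def
  using assms by (subst grid_process_extend[of _ "T * 2 ^ k"]) (auto simp: mesh_def)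

lemma grid_time_le: "i \<le> T * 2 ^ k \<Longrightarrow> real i * mesh k \<in> {0..real T}"
proof -
  assume "i \<le> T * 2 ^ k"
  then have "real i \<le> real (T * 2 ^ k)" by (rule of_nat_mono)
  then have "real i \<le> real T * 2 ^ k" by simp
  then show ?thesis by (simp add: mesh_def divide_le_eq)
qed

lemma grid_cell_exists:
  assumes "0 \<le> t" "t \<le> real T" "0 < T"
  obtains i where "i < T * 2 ^ k" "real i * mesh k \<le> t" "t \<le> real (Suc i) * mesh k"
proof (cases "t = real T")
  \<comment> \<open>Rounding \<open>T\<close> down would give the index \<open>T * 2 ^ k\<close>,
    which is no cell of the grid; the right end point belongs to the last cell.\<close>
  case True
  have n: "Suc (T * 2 ^ k - 1) = T * 2 ^ k" using assms(3) by simp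
  have "real (T * 2 ^ k) * mesh k = real T" by (simp add: mesh_def)
  moreover have "real (T * 2 ^ k - 1) * mesh k \<le> real (T * 2 ^ k) * mesh k" by (intro mult_right_mono of_nat_mono) auto
  ultimately show ?thesis using True n assms(3) by (intro that[of "T * 2 ^ k - 1"]) (simp_all del: of_nat_Suc of_nat_mult)
next
  case False
  define i where "i = nat \<lfloor>t * 2 ^ k\<rfloor>"
  have "0 \<le> t * 2 ^ k" using assms by simp
  then have i: "real i \<le> t * 2 ^ k" "t * 2 ^ k \<le> real (Suc i)" unfolding i_def by linarith+
  have "real i < real (T * 2 ^ k)" using i(1) False assms by (intro order.strict_trans1[OF i(1)]) simp
  then have "i < T * 2 ^ k" by (rule of_nat_less_iff[THEN iffD1])
  moreover have "real i * mesh k \<le> t" "t \<le> real (Suc i) * mesh k"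
    using i by (simp_all add: mesh_def field_simps)
  ultimately show ?thesis by (rule that)
qed

text \<open>Gronwall for the second moment, uniformly in the level. By linear growth one step adds
  at most \<open>3 * K * (1 + e)\<close> times the mesh: two parts from the drift and one from the
  diffusion.\<close>

lemma euler_moment_bound:
  "\<exists>C\<ge>0. \<forall>k. \<forall>i\<le>T * 2 ^ k. (\<integral>\<omega>. (norm (euler k i \<omega>))\<^sup>2 \<partial>M) \<le> C \<and>
     (\<integral>\<omega>. (norm (drift k i \<omega>))\<^sup>2 \<partial>M) \<le> C \<and> (\<integral>\<omega>. (norm (diffusion k i \<omega>))\<^sup>2 \<partial>M) \<le> C"
proof -
  obtain L where L: "lip_on (real T) L b" "lip_on (real T) L g" by (rule lipschitz_bg)
  define K where "K = growth (real T) L b + growth (real T) L g"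
  have K: "0 \<le> K" "growth (real T) L b \<le> K" "growth (real T) L g \<le> K" using growth_nonneg by (auto simp: K_def)
  define e where "e k i = (\<integral>\<omega>. (norm (euler k i \<omega>))\<^sup>2 \<partial>M)" for k i
  have e0: "0 \<le> e k i" for k i unfolding e_def by (rule integral_nonneg_AE) simp
  have co: "(\<integral>\<omega>. (norm (drift k i \<omega>))\<^sup>2 \<partial>M) \<le> K * (1 + e k i)" "(\<integral>\<omega>. (norm (diffusion k i \<omega>))\<^sup>2 \<partial>M) \<le> K * (1 + e k i)"
    if i: "i \<le> T * 2 ^ k" for k i
  proof -
    note t = grid_time_le[OF i]
    have eu: "square_integrable M (euler k i)" using euler_adapted by blast
    have "(\<integral>\<omega>. (norm (drift k i \<omega>))\<^sup>2 \<partial>M) \<le> growth (real T) L b * (1 + e k i)"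
      unfolding drift_def e_def by (rule lip_on_square_integrable(2)[OF L(1) t eu])
    also have "\<dots> \<le> K * (1 + e k i)" using K e0[of k i] by (intro mult_right_mono) auto
    finally show "(\<integral>\<omega>. (norm (drift k i \<omega>))\<^sup>2 \<partial>M) \<le> K * (1 + e k i)" .
    have "(\<integral>\<omega>. (norm (diffusion k i \<omega>))\<^sup>2 \<partial>M) \<le> growth (real T) L g * (1 + e k i)"
      unfolding diffusion_def e_def by (rule lip_on_square_integrable(2)[OF L(2) t eu])
    also have "\<dots> \<le> K * (1 + e k i)" using K e0[of k i] by (intro mult_right_mono) auto
    finally show "(\<integral>\<omega>. (norm (diffusion k i \<omega>))\<^sup>2 \<partial>M) \<le> K * (1 + e k i)" .
  qed
  \<comment> \<open>The summand 1 bounds the quotient \<open>3 * K / (1 + 3 * K)\<close> that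
    Gronwall produces.\<close>
  define C where "C = ((norm x)\<^sup>2 + 1) * exp ((1 + 3 * K) * real T)"
  have C0: "0 \<le> C" by (simp add: C_def)
  have eC: "e k i \<le> C" if i: "i \<le> T * 2 ^ k" for k i
  proof -
    have "e k i \<le> (e k 0 + 3 * K / (1 + 3 * K)) * exp ((1 + 3 * K) * (real i * mesh k))"
    proof (rule discrete_Gronwall[OF _ _ _ _ _ i])
      fix j assume j: "j < T * 2 ^ k"
      have le: "0 \<le> real j * mesh k" by simp
      have s: "real j * mesh k + mesh k = real (Suc j) * mesh k" by (simp add: algebra_simps)
      have ad: "euler k j \<in> borel_measurable (F (real j * mesh k))" "square_integrable M (euler k j)"
        "drift k j \<in> borel_measurable (F (real j * mesh k))" "square_integrable M (drift k j)"
        "diffusion k j \<in> borel_measurable (F (real j * mesh k))" "square_integrable M (diffusion k j)"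
        using euler_adapted drift_adapted diffusion_adapted by auto
      have "e k (Suc j) \<le> (1 + mesh k) * e k j + 2 * mesh k * (\<integral>\<omega>. (norm (drift k j \<omega>))\<^sup>2 \<partial>M) + mesh k * (\<integral>\<omega>. (norm (diffusion k j \<omega>))\<^sup>2 \<partial>M)"
        unfolding e_def euler_Suc by (rule euler_step_energy[OF le mesh[of k] ad, unfolded s])
      also have "\<dots> \<le> (1 + mesh k) * e k j + 2 * mesh k * (K * (1 + e k j)) + mesh k * (K * (1 + e k j))"
        using co[of j k] j by (intro add_mono mult_left_mono order_refl) auto
      also have "\<dots> = (1 + (1 + 3 * K) * mesh k) * e k j + 3 * K * mesh k" by (simp add: algebra_simps)
      finally show "e k (Suc j) \<le> (1 + (1 + 3 * K) * mesh k) * e k j + 3 * K * mesh k" .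
    qed (use K e0 in auto)
    also have "\<dots> \<le> C"
      unfolding C_def
    proof (intro mult_mono add_mono)
      show "e k 0 \<le> (norm x)\<^sup>2" by (simp add: e_def prob_space)
      show "exp ((1 + 3 * K) * (real i * mesh k)) \<le> exp ((1 + 3 * K) * real T)"
        using grid_time_le[OF i] K by (simp add: mult_left_mono)
    qed (use K in auto)
    finally show ?thesis .
  qed
  show ?thesis
  proof (intro exI[of _ "C + K * (1 + C)"] conjI allI impI)
    show "0 \<le> C + K * (1 + C)" using C0 K by simp
    fix k i assume i: "i \<le> T * 2 ^ k"
    have m: "K * (1 + e k i) \<le> K * (1 + C)" using eC[OF i] K by (intro mult_left_mono) auto
    show "(\<integral>\<omega>. (norm (euler k i \<omega>))\<^sup>2 \<partial>M) \<le> C + K * (1 + C)" using eC[OF i] K C0 unfolding e_def[symmetric]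
      by (intro order_trans[OF eC[OF i]]) simp
    show "(\<integral>\<omega>. (norm (drift k i \<omega>))\<^sup>2 \<partial>M) \<le> C + K * (1 + C)" "(\<integral>\<omega>. (norm (diffusion k i \<omega>))\<^sup>2 \<partial>M) \<le> C + K * (1 + C)"
      using co[OF i] m C0 by linarith+
  qed
qed

text \<open>Over one cell the Brownian increment has variance at most \<open>mesh k\<close>, which
  dominates the squared drift contribution of order \<open>(mesh k)\<^sup>2\<close>.\<close>

lemma scheme_cell_error:
  "\<exists>C\<ge>0. \<forall>k i t. i < T * 2 ^ k \<longrightarrow> real i * mesh k \<le> t \<longrightarrow> t \<le> real (Suc i) * mesh k \<longrightarrow>
     (\<integral>\<omega>. (norm (scheme T k t \<omega> - euler k i \<omega>))\<^sup>2 \<partial>M) \<le> C * mesh k"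
proof -
  obtain C where C: "0 \<le> C" "\<And>k i. i \<le> T * 2 ^ k \<Longrightarrow> (\<integral>\<omega>. (norm (drift k i \<omega>))\<^sup>2 \<partial>M) \<le> C \<and> (\<integral>\<omega>. (norm (diffusion k i \<omega>))\<^sup>2 \<partial>M) \<le> C"
    using euler_moment_bound[of T] by blast
  show ?thesis
  proof (intro exI[of _ "2 * C"] conjI allI impI)
    fix k i t assume i: "i < T * 2 ^ k" and t: "real i * mesh k \<le> t" "t \<le> real (Suc i) * mesh k"
    define \<epsilon> where "\<epsilon> = t - real i * mesh k"
    have \<epsilon>: "0 \<le> \<epsilon>" "\<epsilon> \<le> mesh k" "real i * mesh k + \<epsilon> = t" using t by (auto simp: \<epsilon>_def algebra_simps)
    have eq: "scheme T k t \<omega> - euler k i \<omega> = \<epsilon> *\<^sub>R drift k i \<omega> + (W t \<omega> - W (real i * mesh k) \<omega>) *\<^sub>R diffusion k i \<omega>" for \<omega>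
      unfolding scheme_cell[OF i t] by (simp add: \<epsilon>_def)
    have "(\<integral>\<omega>. (norm (scheme T k t \<omega> - euler k i \<omega>))\<^sup>2 \<partial>M) 
      \<le> (mesh k)\<^sup>2 * (\<integral>\<omega>. (norm (drift k i \<omega>))\<^sup>2 \<partial>M) + mesh k * (\<integral>\<omega>. (norm (diffusion k i \<omega>))\<^sup>2 \<partial>M)"
      unfolding eq using drift_adapted[of k i] diffusion_adapted[of k i]
      by (intro grid_increment_energy[of "real i * mesh k" \<epsilon> "mesh k", unfolded \<epsilon>(3)] \<epsilon>) auto
    also have "\<dots> \<le> mesh k * C + mesh k * C"
    proof (intro add_mono mult_mono)
      show "(mesh k)\<^sup>2 \<le> mesh k" by (simp add: power2_eq_square mult_left_le)
    qed (use C i in \<open>auto intro: integral_nonneg_AE\<close>)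
    finally show "(\<integral>\<omega>. (norm (scheme T k t \<omega> - euler k i \<omega>))\<^sup>2 \<partial>M) \<le> 2 * C * mesh k" by (simp add: algebra_simps)
  qed (use C in simp)
qed

lemma scheme_moment_bound:
  assumes "0 < T"
  shows "\<exists>C\<ge>0. \<forall>k. \<forall>t\<in>{0..real T}. (\<integral>\<omega>. (norm (scheme T k t \<omega>))\<^sup>2 \<partial>M) \<le> C"
proof -
  obtain C where C: "0 \<le> C" "\<And>k i. i \<le> T * 2 ^ k \<Longrightarrow> (\<integral>\<omega>. (norm (euler k i \<omega>))\<^sup>2 \<partial>M) \<le> C"
    using euler_moment_bound[of T] by blast
  obtain D where D: "0 \<le> D" "\<And>k i t. i < T * 2 ^ k \<Longrightarrow> real i * mesh k \<le> t \<Longrightarrow> t \<le> real (Suc i) * mesh k \<Longrightarrow>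
     (\<integral>\<omega>. (norm (scheme T k t \<omega> - euler k i \<omega>))\<^sup>2 \<partial>M) \<le> D * mesh k"
    using scheme_cell_error[of T] by blast
  show ?thesis
  proof (intro exI[of _ "2 * D + 2 * C"] conjI allI ballI)
    fix k t assume t: "t \<in> {0..real T}"
    obtain i where i: "i < T * 2 ^ k" "real i * mesh k \<le> t" "t \<le> real (Suc i) * mesh k"
      by (rule grid_cell_exists[of t T k]) (use t assms in auto)
    have s: "square_integrable M (\<lambda>\<omega>. scheme T k t \<omega> - euler k i \<omega>)" "square_integrable M (euler k i)"
      using scheme_adapted(2)[of t T k] euler_adapted t by (auto intro: square_integrable_diff)
    have "D * mesh k \<le> D" using D(1) by (simp add: mult_left_le)
    then show "(\<integral>\<omega>. (norm (scheme T k t \<omega>))\<^sup>2 \<partial>M) \<le> 2 * D + 2 * C"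
      using square_integrable_add(2)[OF s] D(2)[OF i] C(2)[of i k] i(1) by simp
  qed (use C D in simp)
qed

lemma mesh_refine: "k \<le> l \<Longrightarrow> mesh k = real (2 ^ (l - k)) * mesh l"
  by (simp add: mesh_def field_simps power_add[symmetric])

lemma scheme_refine:
  assumes "k \<le> l"
  shows "scheme T k t \<omega> = x + grid_process (mesh l) (T * 2 ^ l) (\<lambda>j. drift k (j div 2 ^ (l - k))) (\<lambda>j. diffusion k (j div 2 ^ (l - k))) t \<omega>"
proof -
  have [simp]: "T * 2 ^ k * 2 ^ (l - k) = T * 2 ^ l" using assms by (simp add: mult.assoc power_add[symmetric] del: mult_cancel1)
  show ?thesis
    unfolding scheme_def using grid_process_refine[OF _ mesh_refine[OF assms], of "T * 2 ^ k" "drift k" "diffusion k" t \<omega>] by simp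
qed

text \<open>\<open>j div 2 ^ (l - k)\<close> is the index of the cell of level \<open>k\<close> that
  contains cell \<open>j\<close> of level \<open>l\<close>.\<close>

lemma coarse_cell:
  assumes "k \<le> l" "j < T * 2 ^ l"
  defines "i \<equiv> j div 2 ^ (l - k)"
  shows "i < T * 2 ^ k" "real i * mesh k \<le> real j * mesh l" "real j * mesh l \<le> real (Suc i) * mesh k"
    "real (Suc j) * mesh l \<le> real (Suc i) * mesh k"
proof -
  let ?r = "2 ^ (l - k) :: nat"
  have r: "0 < ?r" "T * 2 ^ k * ?r = T * 2 ^ l" using assms(1) by (simp_all add: mult.assoc power_add[symmetric])
  show "i < T * 2 ^ k" unfolding i_def using assms(2) unfolding r(2)[symmetric] by (rule less_mult_imp_div_less)
  have 1: "i * ?r \<le> j" unfolding i_def by (rule div_times_less_eq_dividend)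
  have 2: "Suc j \<le> Suc i * ?r" unfolding i_def using dividend_less_div_times[OF r(1), of j] by simp
  have e: "real i * mesh k = real (i * ?r) * mesh l" "real (Suc i) * mesh k = real (Suc i * ?r) * mesh l"
    by (simp_all only: mesh_refine[OF assms(1)] of_nat_mult mult.assoc)
  show "real i * mesh k \<le> real j * mesh l" unfolding e using 1 by (intro mult_right_mono of_nat_mono) auto
  show 3: "real (Suc j) * mesh l \<le> real (Suc i) * mesh k" unfolding e using 2 by (intro mult_right_mono of_nat_mono) auto
  have "real j * mesh l \<le> real (Suc j) * mesh l" by (intro mult_right_mono) auto
  with 3 show "real j * mesh l \<le> real (Suc i) * mesh k" by linarith
qed

lemma refined_grid_adapted:
  assumes "k \<le> l"
  shows "grid_adapted (mesh l) (T * 2 ^ l) (\<lambda>j \<omega>. drift k (j div 2 ^ (l - k)) \<omega> - drift l j \<omega>)"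
    "grid_adapted (mesh l) (T * 2 ^ l) (\<lambda>j \<omega>. diffusion k (j div 2 ^ (l - k)) \<omega> - diffusion l j \<omega>)"
proof -
  have m: "drift k (j div 2 ^ (l - k)) \<in> borel_measurable (F (real j * mesh l))" "diffusion k (j div 2 ^ (l - k)) \<in> borel_measurable (F (real j * mesh l))"
    if "j < T * 2 ^ l" for j
    using measurable_F_mono[OF _ coarse_cell(2)[OF assms that]] drift_adapted diffusion_adapted by blast+
  show "grid_adapted (mesh l) (T * 2 ^ l) (\<lambda>j \<omega>. drift k (j div 2 ^ (l - k)) \<omega> - drift l j \<omega>)"
    "grid_adapted (mesh l) (T * 2 ^ l) (\<lambda>j \<omega>. diffusion k (j div 2 ^ (l - k)) \<omega> - diffusion l j \<omega>)"
    unfolding grid_adapted_def using m drift_adapted diffusion_adapted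
    by (auto intro!: borel_measurable_diff square_integrable_diff(1))
qed

lemma scheme_diff_grid:
  assumes "k \<le> l"
  shows "scheme T k t \<omega> - scheme T l t \<omega> = grid_process (mesh l) (T * 2 ^ l)
     (\<lambda>j \<omega>. drift k (j div 2 ^ (l - k)) \<omega> - drift l j \<omega>) (\<lambda>j \<omega>. diffusion k (j div 2 ^ (l - k)) \<omega> - diffusion l j \<omega>) t \<omega>"
  unfolding scheme_refine[OF assms] grid_process_diff[symmetric] by (simp add: scheme_def)

text \<open>The mean-square error is of order \<open>mesh k\<close>, uniformly in the finer level
  \<open>l\<close>. The coarse coefficients lag behind by at most \<open>mesh k\<close> in time and,
  in the state, by the current error \<open>e j\<close> plus the error inside a coarse cell. This
  bounds the coefficient errors by \<open>e j\<close> and \<open>mesh k\<close> and closes the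
  Gronwall recursion for \<open>e\<close>.\<close>

lemma coefficient_error:
  "\<exists>C\<ge>0. \<forall>k l. k \<le> l \<longrightarrow> (\<forall>j<T * 2 ^ l.
     (\<integral>\<omega>. (norm (scheme T k (real j * mesh l) \<omega> - scheme T l (real j * mesh l) \<omega>))\<^sup>2 \<partial>M) \<le> C * mesh k \<and>
     (\<integral>\<omega>. (norm (drift k (j div 2 ^ (l - k)) \<omega> - drift l j \<omega>))\<^sup>2 \<partial>M) \<le> C * mesh k \<and>
     (\<integral>\<omega>. (norm (diffusion k (j div 2 ^ (l - k)) \<omega> - diffusion l j \<omega>))\<^sup>2 \<partial>M) \<le> C * mesh k)"
proof -
  obtain L where L: "lip_on (real T) L b" "lip_on (real T) L g" by (rule lipschitz_bg)
  obtain K where K: "0 \<le> K" "\<And>k i t. i < T * 2 ^ k \<Longrightarrow> real i * mesh k \<le> t \<Longrightarrow> t \<le> real (Suc i) * mesh k \<Longrightarrow>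
     (\<integral>\<omega>. (norm (scheme T k t \<omega> - euler k i \<omega>))\<^sup>2 \<partial>M) \<le> K * mesh k"
    using scheme_cell_error[of T] by blast
  \<comment> \<open>In the bracket, \<open>1\<close> stems from the time shift, \<open>2 * K\<close>
    from the error inside a coarse cell, and \<open>2\<close> from the factor in front of
    \<open>e j\<close>.\<close>
  define D where "D = 2 * L\<^sup>2 * (1 + 2 * K + 2)"
  have D0: "0 \<le> D" using K(1) by (simp add: D_def)
  define G where "G = exp ((1 + 3 * D) * real T)"
  have G0: "0 \<le> G" by (simp add: G_def)
  have main: "(\<integral>\<omega>. (norm (scheme T k (real j * mesh l) \<omega> - scheme T l (real j * mesh l) \<omega>))\<^sup>2 \<partial>M) \<le> G * mesh k \<and>
     (\<integral>\<omega>. (norm (drift k (j div 2 ^ (l - k)) \<omega> - drift l j \<omega>))\<^sup>2 \<partial>M) \<le> D * (mesh k + G * mesh k) \<and>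
     (\<integral>\<omega>. (norm (diffusion k (j div 2 ^ (l - k)) \<omega> - diffusion l j \<omega>))\<^sup>2 \<partial>M) \<le> D * (mesh k + G * mesh k)"
    if kl: "k \<le> l" and jT: "j < T * 2 ^ l" for k l j
  proof -
    let ?V = "\<lambda>j \<omega>. scheme T k (real j * mesh l) \<omega> - scheme T l (real j * mesh l) \<omega>"
    let ?b = "\<lambda>j \<omega>. drift k (j div 2 ^ (l - k)) \<omega> - drift l j \<omega>"
    let ?g = "\<lambda>j \<omega>. diffusion k (j div 2 ^ (l - k)) \<omega> - diffusion l j \<omega>"
    define e where "e j = (\<integral>\<omega>. (norm (?V j \<omega>))\<^sup>2 \<partial>M)" for j
    have co: "(\<integral>\<omega>. (norm (?b j \<omega>))\<^sup>2 \<partial>M) \<le> D * (mesh k + e j) \<and> (\<integral>\<omega>. (norm (?g j \<omega>))\<^sup>2 \<partial>M) \<le> D * (mesh k + e j)"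
      if j: "j < T * 2 ^ l" for j
    proof -
      let ?i = "j div 2 ^ (l - k)" and ?t = "real j * mesh l"
      note cc = coarse_cell[OF kl j]
      have t0: "0 \<le> ?t" by simp
      have se: "scheme T l ?t \<omega> = euler l j \<omega>" for \<omega>
        using scheme_cell[OF j, of ?t] by (simp add: mult_right_mono)
      have sq: "square_integrable M (\<lambda>\<omega>. scheme T k ?t \<omega> - euler k ?i \<omega>)" "square_integrable M (?V j)"
        "square_integrable M (euler k ?i)" "square_integrable M (euler l j)"
        using scheme_adapted(2)[OF t0] euler_adapted by (auto intro!: square_integrable_diff)
      have "(\<integral>\<omega>. (norm (euler k ?i \<omega> - euler l j \<omega>))\<^sup>2 \<partial>M) = (\<integral>\<omega>. (norm (?V j \<omega> - (scheme T k ?t \<omega> - euler k ?i \<omega>)))\<^sup>2 \<partial>M)"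
        by (simp add: se)
      also have "\<dots> \<le> 2 * e j + 2 * (K * mesh k)"
        unfolding e_def using square_integrable_diff(2)[OF sq(2,1)] K(2)[OF cc(1-3)] by linarith
      finally have le: "(\<integral>\<omega>. (norm (euler k ?i \<omega> - euler l j \<omega>))\<^sup>2 \<partial>M) \<le> 2 * e j + 2 * (K * mesh k)" .
      have it: "real ?i * mesh k \<in> {0..real T}" "?t \<in> {0..real T}" using cc(1) j by (auto intro!: grid_time_le simp del: atLeastAtMost_iff)
      have d: "\<bar>real ?i * mesh k - ?t\<bar> \<le> mesh k" using cc(2,3) by (simp add: algebra_simps)
      have e0: "0 \<le> e j" unfolding e_def by (rule integral_nonneg_AE) simp
      have "2 * L\<^sup>2 * (mesh k + (2 * e j + 2 * (K * mesh k))) \<le> D * (mesh k + e j)"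
        unfolding D_def using K(1) e0 by (auto simp: algebra_simps intro!: add_mono)
      then show ?thesis
        unfolding drift_def diffusion_def
        using lip_on_diff_energy(2)[OF L(1) it d mesh(2) sq(3,4) le] lip_on_diff_energy(2)[OF L(2) it d mesh(2) sq(3,4) le] by linarith
    qed
    have eG: "e j \<le> G * mesh k" if j: "j \<le> T * 2 ^ l" for j
    proof -
      have "e j \<le> (e 0 + 3 * D * mesh k / (1 + 3 * D)) * exp ((1 + 3 * D) * (real j * mesh l))"
      proof (rule discrete_Gronwall[OF _ _ _ _ _ j])
        fix j assume j: "j < T * 2 ^ l"
        have le: "0 \<le> real j * mesh l" by simp
        have s: "real j * mesh l + mesh l = real (Suc j) * mesh l" "real (Suc j) * mesh l - real j * mesh l = mesh l" by (simp_all add: algebra_simps)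
        have ad: "?V j \<in> borel_measurable (F (real j * mesh l))" "square_integrable M (?V j)"
          "?b j \<in> borel_measurable (F (real j * mesh l))" "square_integrable M (?b j)"
          "?g j \<in> borel_measurable (F (real j * mesh l))" "square_integrable M (?g j)"
          using scheme_adapted[OF le] refined_grid_adapted[OF kl, of T] j
          by (auto simp: grid_adapted_def intro!: borel_measurable_diff square_integrable_diff(1))
        have V: "?V (Suc j) \<omega> = ?V j \<omega> + mesh l *\<^sub>R ?b j \<omega> + (W (real (Suc j) * mesh l) \<omega> - W (real j * mesh l) \<omega>) *\<^sub>R ?g j \<omega>" for \<omega>
          unfolding scheme_diff_grid[OF kl]
          by (subst grid_process_cell[OF _ j]) (auto simp: mult_right_mono s(2) simp del: of_nat_Suc)
        have "e (Suc j) \<le> (1 + mesh l) * e j + 2 * mesh l * (\<integral>\<omega>. (norm (?b j \<omega>))\<^sup>2 \<partial>M) + mesh l * (\<integral>\<omega>. (norm (?g j \<omega>))\<^sup>2 \<partial>M)"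
          unfolding e_def V by (rule euler_step_energy[OF le mesh[of l] ad, unfolded s])
        also have "\<dots> \<le> (1 + mesh l) * e j + 2 * mesh l * (D * (mesh k + e j)) + mesh l * (D * (mesh k + e j))"
          using co[OF j] by (intro add_mono mult_left_mono order_refl) auto
        also have "\<dots> = (1 + (1 + 3 * D) * mesh l) * e j + 3 * D * mesh k * mesh l" by (simp add: algebra_simps)
        finally show "e (Suc j) \<le> (1 + (1 + 3 * D) * mesh l) * e j + 3 * D * mesh k * mesh l" .
      qed (use D0 in \<open>auto simp: e_def intro!: integral_nonneg_AE\<close>)
      also have "e 0 = 0" by (simp add: e_def scheme_def grid_process_0)
      also have "(0 + 3 * D * mesh k / (1 + 3 * D)) * exp ((1 + 3 * D) * (real j * mesh l)) \<le> mesh k * G"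
        unfolding G_def
      proof (intro mult_mono)
        show "0 + 3 * D * mesh k / (1 + 3 * D) \<le> mesh k" using D0 by (simp add: divide_le_eq algebra_simps)
        show "exp ((1 + 3 * D) * (real j * mesh l)) \<le> exp ((1 + 3 * D) * real T)"
          using grid_time_le[OF j] D0 by (simp add: mult_left_mono)
      qed auto
      finally show ?thesis by (simp add: mult.commute)
    qed
    have "D * (mesh k + e j) \<le> D * (mesh k + G * mesh k)" using eG[of j] jT D0 by (intro mult_left_mono) auto
    with co[OF jT] eG[of j] jT show ?thesis unfolding e_def by auto
  qed
  show ?thesis
  proof (intro exI[of _ "G + D * (1 + G)"] conjI allI impI)
    show "0 \<le> G + D * (1 + G)" using G0 D0 by simp
    fix k l j assume kl: "k \<le> l" and j: "j < T * 2 ^ l"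
    have 1: "D * (mesh k + G * mesh k) = D * (1 + G) * mesh k" by (simp add: algebra_simps)
    have 2: "0 \<le> G * mesh k" "0 \<le> D * (1 + G) * mesh k" using G0 D0 by simp_all
    show "(\<integral>\<omega>. (norm (scheme T k (real j * mesh l) \<omega> - scheme T l (real j * mesh l) \<omega>))\<^sup>2 \<partial>M) \<le> (G + D * (1 + G)) * mesh k"
      "(\<integral>\<omega>. (norm (drift k (j div 2 ^ (l - k)) \<omega> - drift l j \<omega>))\<^sup>2 \<partial>M) \<le> (G + D * (1 + G)) * mesh k"
      "(\<integral>\<omega>. (norm (diffusion k (j div 2 ^ (l - k)) \<omega> - diffusion l j \<omega>))\<^sup>2 \<partial>M) \<le> (G + D * (1 + G)) * mesh k"
      using main[OF kl j] 2 unfolding 1 distrib_right[of G] by linarith+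
  qed
qed

lemma scheme_error:
  assumes "0 < T"
  shows "\<exists>C\<ge>0. \<forall>k l t. k \<le> l \<longrightarrow> t \<in> {0..real T} \<longrightarrow> (\<integral>\<omega>. (norm (scheme T k t \<omega> - scheme T l t \<omega>))\<^sup>2 \<partial>M) \<le> C * mesh k"
proof -
  obtain C where C: "0 \<le> C" "\<And>k l j. k \<le> l \<Longrightarrow> j < T * 2 ^ l \<Longrightarrow>
     (\<integral>\<omega>. (norm (scheme T k (real j * mesh l) \<omega> - scheme T l (real j * mesh l) \<omega>))\<^sup>2 \<partial>M) \<le> C * mesh k \<and>
     (\<integral>\<omega>. (norm (drift k (j div 2 ^ (l - k)) \<omega> - drift l j \<omega>))\<^sup>2 \<partial>M) \<le> C * mesh k \<and>
     (\<integral>\<omega>. (norm (diffusion k (j div 2 ^ (l - k)) \<omega> - diffusion l j \<omega>))\<^sup>2 \<partial>M) \<le> C * mesh k"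
    using coefficient_error[of T] by blast
  show ?thesis
  \<comment> \<open>The error at the preceding grid time contributes \<open>2 * C\<close>, and the
    two coefficient errors inside the cell contribute \<open>2 * (2 * C)\<close>.\<close>
  proof (intro exI[of _ "6 * C"] conjI allI impI)
    fix k l :: nat and t :: real assume kl: "k \<le> l" and t: "t \<in> {0..real T}"
    obtain j where j: "j < T * 2 ^ l" "real j * mesh l \<le> t" "t \<le> real (Suc j) * mesh l"
      by (rule grid_cell_exists[of t T l]) (use t assms in auto)
    let ?V = "\<lambda>\<omega>. scheme T k (real j * mesh l) \<omega> - scheme T l (real j * mesh l) \<omega>"
    let ?b = "\<lambda>\<omega>. drift k (j div 2 ^ (l - k)) \<omega> - drift l j \<omega>"
    let ?g = "\<lambda>\<omega>. diffusion k (j div 2 ^ (l - k)) \<omega> - diffusion l j \<omega>"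
    define \<epsilon> where "\<epsilon> = t - real j * mesh l"
    have \<epsilon>: "0 \<le> \<epsilon>" "\<epsilon> \<le> mesh l" "real j * mesh l + \<epsilon> = t" using j by (auto simp: \<epsilon>_def algebra_simps)
    let ?R = "\<lambda>\<omega>. \<epsilon> *\<^sub>R ?b \<omega> + (W t \<omega> - W (real j * mesh l) \<omega>) *\<^sub>R ?g \<omega>"
    have le: "0 \<le> real j * mesh l" by simp
    have ad: "?b \<in> borel_measurable (F (real j * mesh l))" "square_integrable M ?b"
          "?g \<in> borel_measurable (F (real j * mesh l))" "square_integrable M ?g"
          using refined_grid_adapted[OF kl, of T] j by (auto simp: grid_adapted_def)
    have V: "square_integrable M ?V" using scheme_adapted(2)[OF le] by (auto intro!: square_integrable_diff(1))
    have R: "square_integrable M ?R"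
      using ad j le by (intro square_integrable_add(1) square_integrable_scaleR increment_square_integrable(1)) auto
    have eq: "scheme T k t \<omega> - scheme T l t \<omega> = ?V \<omega> + ?R \<omega>" for \<omega>
      unfolding scheme_diff_grid[OF kl] by (subst grid_process_cell[OF _ j]) (auto simp: \<epsilon>_def)
    have "(\<integral>\<omega>. (norm (?R \<omega>))\<^sup>2 \<partial>M) \<le> (mesh l)\<^sup>2 * (\<integral>\<omega>. (norm (?b \<omega>))\<^sup>2 \<partial>M) + mesh l * (\<integral>\<omega>. (norm (?g \<omega>))\<^sup>2 \<partial>M)"
      using grid_increment_energy[OF le \<epsilon>(1,2) ad] unfolding \<epsilon>(3) .
    also have "\<dots> \<le> 1 * (C * mesh k) + 1 * (C * mesh k)"
      using C(2)[OF kl j(1)] C(1) by (intro add_mono mult_mono) (auto intro!: integral_nonneg_AE simp: power_le_one)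
    finally have "(\<integral>\<omega>. (norm (?R \<omega>))\<^sup>2 \<partial>M) \<le> 2 * (C * mesh k)" by simp
    moreover have "(\<integral>\<omega>. (norm (?V \<omega> + ?R \<omega>))\<^sup>2 \<partial>M) \<le> 2 * (\<integral>\<omega>. (norm (?V \<omega>))\<^sup>2 \<partial>M) + 2 * (\<integral>\<omega>. (norm (?R \<omega>))\<^sup>2 \<partial>M)"
      by (rule square_integrable_add(2)[OF V R])
    ultimately show "(\<integral>\<omega>. (norm (scheme T k t \<omega> - scheme T l t \<omega>))\<^sup>2 \<partial>M) \<le> 6 * C * mesh k"
      unfolding eq using C(2)[OF kl j(1)] by linarith
  qed (use C in simp)
qed

end

text \<open>Transfers moment bounds to an almost sure limit. Applied to differences of two levels,
  it also turns a bound between levels into a bound for the distance to the limit.\<close>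

lemma square_integrable_Fatou:
  fixes Y :: "nat \<Rightarrow> 'x \<Rightarrow> 'b::euclidean_space"
  assumes Y: "\<And>l. square_integrable N (Y l)" and Z: "Z \<in> borel_measurable N"
    and lim: "AE \<omega> in N. (\<lambda>l. Y l \<omega>) \<longlonglongrightarrow> Z \<omega>"
    and le: "\<And>l. (\<integral>\<omega>. (norm (Y l \<omega>))\<^sup>2 \<partial>N) \<le> c"
  shows "square_integrable N Z" "(\<integral>\<omega>. (norm (Z \<omega>))\<^sup>2 \<partial>N) \<le> c"
proof -
  have [measurable]: "\<And>l. Y l \<in> borel_measurable N" using Y by (auto simp: square_integrable_def)
  have "0 \<le> (\<integral>\<omega>. (norm (Y 0 \<omega>))\<^sup>2 \<partial>N)" by (rule integral_nonneg_AE) simp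
  then have c: "0 \<le> c" using le[of 0] by linarith
  have "(\<integral>\<^sup>+\<omega>. ennreal ((norm (Z \<omega>))\<^sup>2) \<partial>N) = (\<integral>\<^sup>+\<omega>. liminf (\<lambda>l. ennreal ((norm (Y l \<omega>))\<^sup>2)) \<partial>N)"
  proof (rule nn_integral_cong_AE)
    show "AE \<omega> in N. ennreal ((norm (Z \<omega>))\<^sup>2) = liminf (\<lambda>l. ennreal ((norm (Y l \<omega>))\<^sup>2))"
      using lim
    proof eventually_elim
      case (elim \<omega>)
      have "(\<lambda>l. ennreal ((norm (Y l \<omega>))\<^sup>2)) \<longlonglongrightarrow> ennreal ((norm (Z \<omega>))\<^sup>2)"
        by (intro tendsto_ennrealI tendsto_power tendsto_norm elim)
      then show ?case by (rule lim_imp_Liminf[OF trivial_limit_sequentially, symmetric])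
    qed
  qed
  also have "\<dots> \<le> liminf (\<lambda>l. \<integral>\<^sup>+\<omega>. ennreal ((norm (Y l \<omega>))\<^sup>2) \<partial>N)"
    by (rule nn_integral_liminf) simp
  also have "\<dots> \<le> ennreal c"
    unfolding square_integrable_nn_integral[OF Y]
    using le by (intro order_trans[OF Liminf_mono Liminf_const[THEN eq_refl]]) (auto intro!: always_eventually ennreal_leI)
  finally have 1: "(\<integral>\<^sup>+\<omega>. ennreal ((norm (Z \<omega>))\<^sup>2) \<partial>N) \<le> ennreal c" .
  then show si: "square_integrable N Z"
    unfolding square_integrable_iff_nn_integral using Z by (auto intro: order.strict_trans1)
  show "(\<integral>\<omega>. (norm (Z \<omega>))\<^sup>2 \<partial>N) \<le> c"
    using 1 c unfolding square_integrable_nn_integral[OF si] by simp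
qed

context standard_brownian_motion
begin

text \<open>Time 0 is excluded because simple processes vanish there, so that they cannot
  approximate an integrand at that time; as a set of times it is null.\<close>

lemma square_integrable_product:
  assumes Z: "(\<lambda>(s, \<omega>). Z s \<omega>) \<in> borel_measurable (time_measure T \<Otimes>\<^sub>M M)" and T: "0 \<le> T" and C: "0 \<le> C"
    and le: "\<And>s. s \<in> {0<..T} \<Longrightarrow> square_integrable M (Z s) \<and> (\<integral>\<omega>. (norm (Z s \<omega>))\<^sup>2 \<partial>M) \<le> C"
  shows "square_integrable (time_measure T \<Otimes>\<^sub>M M) (\<lambda>(s, \<omega>). Z s \<omega>)"
    "(\<integral>x. (norm (case x of (s, \<omega>) \<Rightarrow> Z s \<omega>))\<^sup>2 \<partial>(time_measure T \<Otimes>\<^sub>M M)) \<le> T * C"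
proof -
  have [measurable]: "(\<lambda>x. Z (fst x) (snd x)) \<in> borel_measurable (time_measure T \<Otimes>\<^sub>M M)" using Z by (simp add: split_beta')
  have ne: "AE s in time_measure T. s \<in> {0<..T}"
  proof -
    have "AE s in lborel. s \<in> {0..T} \<longrightarrow> s \<in> {0<..T}"
      using AE_lborel_singleton[of "0::real"] by eventually_elim auto
    then show ?thesis unfolding time_measure_def by (subst AE_restrict_space_iff) (simp, assumption)
  qed
  have "(\<integral>\<^sup>+x. ennreal ((norm (case x of (s, \<omega>) \<Rightarrow> Z s \<omega>))\<^sup>2) \<partial>(time_measure T \<Otimes>\<^sub>M M))
    = (\<integral>\<^sup>+s. (\<integral>\<^sup>+\<omega>. ennreal ((norm (Z s \<omega>))\<^sup>2) \<partial>M) \<partial>time_measure T)"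
    by (subst nn_integral_fst[symmetric]) (auto simp: split_beta')
  also have "\<dots> \<le> (\<integral>\<^sup>+s. ennreal C \<partial>time_measure T)"
  proof (rule nn_integral_mono_AE)
    show "AE s in time_measure T. (\<integral>\<^sup>+\<omega>. ennreal ((norm (Z s \<omega>))\<^sup>2) \<partial>M) \<le> ennreal C"
      using ne
    proof eventually_elim
      case (elim s)
      note l = le[OF elim]
      show ?case using l square_integrable_nn_integral[of M "Z s"] by (simp add: ennreal_leI)
    qed
  qed
  also have "\<dots> = ennreal (T * C)"
    using T C by (simp add: time_measure_def emeasure_restrict_space space_restrict_space ennreal_mult mult.commute)
  finally have 1: "(\<integral>\<^sup>+x. ennreal ((norm (case x of (s, \<omega>) \<Rightarrow> Z s \<omega>))\<^sup>2) \<partial>(time_measure T \<Otimes>\<^sub>M M)) \<le> ennreal (T * C)" .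
  then show si: "square_integrable (time_measure T \<Otimes>\<^sub>M M) (\<lambda>(s, \<omega>). Z s \<omega>)"
    unfolding square_integrable_iff_nn_integral using Z by (auto intro: order.strict_trans1)
  show "(\<integral>x. (norm (case x of (s, \<omega>) \<Rightarrow> Z s \<omega>))\<^sup>2 \<partial>(time_measure T \<Otimes>\<^sub>M M)) \<le> T * C"
    using 1 T C unfolding square_integrable_nn_integral[OF si] by simp
qed

end

context lipschitz_sde
begin

section \<open>Existence of solutions\<close>

text \<open>The scheme with a horizon chosen from \<open>t\<close>. By \<open>scheme_extend\<close>
  every sufficiently large horizon gives the same value, so one family serves all of
  \<open>[0, \<infinity>)\<close>.\<close>

definition approx :: "nat \<Rightarrow> real \<Rightarrow> 'a \<Rightarrow> 'b" where
  "approx k t = scheme (Suc (nat \<lceil>t\<rceil>)) k t"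

lemma approx_eq: "t \<le> real T \<Longrightarrow> approx k t \<omega> = scheme T k t \<omega>"
proof -
  assume t: "t \<le> real T"
  have "t \<le> real (Suc (nat \<lceil>t\<rceil>))" by linarith
  with t show ?thesis
    unfolding approx_def using scheme_extend[of T "Suc (nat \<lceil>t\<rceil>)" t] scheme_extend[of "Suc (nat \<lceil>t\<rceil>)" T t]
    by (cases "T \<le> Suc (nat \<lceil>t\<rceil>)") auto
qed

lemma approx_adapted: "0 \<le> t \<Longrightarrow> approx k t \<in> borel_measurable (F t)" "0 \<le> t \<Longrightarrow> square_integrable M (approx k t)"
  unfolding approx_def using scheme_adapted by auto

text \<open>Borel-Cantelli with threshold \<open>(3/4) ^ k\<close>: it is summable, so the
  telescoping series converges uniformly, while its square \<open>(9/16) ^ k\<close> decays more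
  slowly than the error \<open>mesh k = (1/2) ^ k\<close>. The exceptional probabilities are then at
  most a multiple of \<open>(8/9) ^ k\<close>.\<close>

lemma approx_uniform_AE:
  "AE \<omega> in M. uniformly_convergent_on {0..real T} (\<lambda>k t. approx k t \<omega>)"
proof -
  obtain C where C: "0 \<le> C" "\<And>k l j. k \<le> l \<Longrightarrow> j < T * 2 ^ l \<Longrightarrow>
     (\<integral>\<omega>. (norm (drift k (j div 2 ^ (l - k)) \<omega> - drift l j \<omega>))\<^sup>2 \<partial>M) \<le> C * mesh k \<and>
     (\<integral>\<omega>. (norm (diffusion k (j div 2 ^ (l - k)) \<omega> - diffusion l j \<omega>))\<^sup>2 \<partial>M) \<le> C * mesh k"
    using coefficient_error[of T] by blast
  have "\<exists>E\<in>sets M. prob E \<le> ((real T)\<^sup>2 + real T) * (C * mesh k) / ((3/4) ^ k)\<^sup>2 \<and>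
      (\<forall>\<omega>\<in>space M - E. continuous_on {0..} (\<lambda>t. W t \<omega>) \<longrightarrow> (\<forall>t\<in>{0..real T}. norm (scheme T k t \<omega> - scheme T (Suc k) t \<omega>) \<le> 2 * (3/4) ^ k))" for k
  proof -
    have kl: "k \<le> Suc k" by simp
    have T: "real (T * 2 ^ Suc k) * mesh (Suc k) = real T" by (simp add: mesh_def)
    show ?thesis
      unfolding scheme_diff_grid[OF kl]
      by (rule grid_process_maximal[OF _ refined_grid_adapted[OF kl, of T] _ C(2)[OF kl, THEN conjunct1] C(2)[OF kl, THEN conjunct2],
            where c="(3/4) ^ k", unfolded T]) auto
  qed
  then obtain E where E: "\<And>k. E k \<in> sets M" "\<And>k. prob (E k) \<le> ((real T)\<^sup>2 + real T) * (C * mesh k) / ((3/4) ^ k)\<^sup>2"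
    "\<And>k \<omega> t. \<omega> \<in> space M - E k \<Longrightarrow> continuous_on {0..} (\<lambda>t. W t \<omega>) \<Longrightarrow> t \<in> {0..real T} \<Longrightarrow>
        norm (scheme T k t \<omega> - scheme T (Suc k) t \<omega>) \<le> 2 * (3/4) ^ k"
    by metis
  have b: "((real T)\<^sup>2 + real T) * (C * mesh k) / ((3/4) ^ k)\<^sup>2 = (((real T)\<^sup>2 + real T) * C) * (8/9) ^ k" for k
  proof -
    have "mesh k = (1/2) ^ k" by (simp add: mesh_def power_one_over)
    moreover have "((3/4 :: real) ^ k)\<^sup>2 = (9/16) ^ k" by (simp add: power2_eq_square power_mult_distrib[symmetric])
    moreover have "(1/2 :: real) ^ k / (9/16) ^ k = (8/9) ^ k" by (simp add: power_divide[symmetric])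
    ultimately show ?thesis by (simp only: times_divide_eq_right[symmetric] mult.assoc)
  qed
  have "summable (\<lambda>k. prob (E k))"
  proof (rule summable_comparison_test)
    show "\<exists>N. \<forall>k\<ge>N. norm (prob (E k)) \<le> (((real T)\<^sup>2 + real T) * C) * (8/9) ^ k" using E(2) unfolding b by auto
  qed (intro summable_mult summable_geometric, simp)
  then have "AE \<omega> in M. \<forall>\<^sub>F k in sequentially. \<omega> \<in> space M - E k"
    by (intro borel_cantelli_AE1 E(1)) (auto simp: emeasure_finite less_top[symmetric])
  with W_continuous show ?thesis
  proof eventually_elim
    case (elim \<omega>)
    have "\<forall>\<^sub>F k in sequentially. \<forall>t\<in>{0..real T}. norm (approx (Suc k) t \<omega> - approx k t \<omega>) \<le> 2 * (3/4) ^ k"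
      using elim(2)
    proof eventually_elim
      case (elim k)
      show ?case using E(3)[OF elim \<open>continuous_on {0..} (\<lambda>t. W t \<omega>)\<close>] by (auto simp: approx_eq norm_minus_commute)
    qed
    from Weierstrass_m_test_ev[OF this] have "uniform_limit {0..real T} (\<lambda>n t. \<Sum>i<n. approx (Suc i) t \<omega> - approx i t \<omega>)
      (\<lambda>t. \<Sum>i. approx (Suc i) t \<omega> - approx i t \<omega>) sequentially"
      by (auto intro!: summable_mult summable_geometric)
    note U = uniform_limit_add[OF this uniform_limit_const[where c="\<lambda>t. approx 0 t \<omega>"]]
    have "(\<Sum>i<n. approx (Suc i) t \<omega> - approx i t \<omega>) + approx 0 t \<omega> = approx n t \<omega>" for n t
      using sum_lessThan_telescope[of "\<lambda>i. approx i t \<omega>" n] by simp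
    with U show ?case unfolding uniformly_convergent_on_def by auto
  qed
qed

definition good :: "'a set" where
  "good = {\<omega>\<in>space M. continuous_on {0..} (\<lambda>t. W t \<omega>) \<and> (\<forall>T::nat. uniformly_convergent_on {0..real T} (\<lambda>k t. approx k t \<omega>))}"

text \<open>Outside \<open>good\<close> the value is constant in time, because
  \<open>ito_process\<close> demands continuity of every path and not only of almost every
  one.\<close>

definition solution :: "real \<Rightarrow> 'a \<Rightarrow> 'b" where
  "solution t \<omega> = (if \<omega> \<in> good then lim (\<lambda>k. approx k t \<omega>) else x)"

lemma good_AE: "AE \<omega> in M. \<omega> \<in> good"
proof -
  have "AE \<omega> in M. \<forall>T::nat. uniformly_convergent_on {0..real T} (\<lambda>k t. approx k t \<omega>)"
    using approx_uniform_AE by (subst AE_all_countable) auto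
  with W_continuous AE_space show ?thesis by eventually_elim (simp add: good_def)
qed

text \<open>Completeness of \<open>M\<close> makes the complement measurable: it lies inside a null
  set.\<close>

lemma good_complement: "space M - good \<in> null_sets M"
proof -
  obtain N where N: "N \<in> null_sets M" "{\<omega>\<in>space M. \<omega> \<notin> good} \<subseteq> N"
    using good_AE unfolding eventually_ae_filter by auto
  then have "space M - good \<subseteq> N" by auto
  with N(1) show ?thesis using complete null_sets_subset by blast
qed

lemma good_sets: "good \<in> sets (F t)"
proof -
  have "space (F t) - (space M - good) \<in> sets (F t)" using null_sets_F[OF good_complement] by blast
  moreover have "space (F t) - (space M - good) = good" by (auto simp: good_def)
  ultimately show ?thesis by simp
qed

lemma solution_uniform_limit:
  assumes "\<omega> \<in> good"
  shows "uniform_limit {0..real T} (\<lambda>k t. approx k t \<omega>) (\<lambda>t. solution t \<omega>) sequentially"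
proof -
  have "uniformly_convergent_on {0..real T} (\<lambda>k t. approx k t \<omega>)" using assms by (simp add: good_def)
  then show ?thesis using assms by (simp add: uniformly_convergent_uniform_limit_iff solution_def)
qed

lemma approx_tendsto:
  assumes "\<omega> \<in> good" "0 \<le> t" shows "(\<lambda>k. approx k t \<omega>) \<longlonglongrightarrow> solution t \<omega>"
proof -
  have "t \<in> {0..real (nat \<lceil>t\<rceil>)}" using assms(2) by simp
  from tendsto_uniform_limitI[OF solution_uniform_limit[OF assms(1)] this] show ?thesis .
qed

lemma solution_continuous:
  assumes "\<omega> \<in> space M" shows "continuous_on {0..} (\<lambda>t. solution t \<omega>)"
proof (cases "\<omega> \<in> good")
  case True
  have W: "continuous_on {0..} (\<lambda>t. W t \<omega>)" using True by (simp add: good_def)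
  have c: "continuous_on {0..real T} (\<lambda>t. solution t \<omega>)" for T
  proof (rule uniform_limit_theorem[OF _ solution_uniform_limit[OF True]])
    show "\<forall>\<^sub>F k in sequentially. continuous_on {0..real T} (\<lambda>t. approx k t \<omega>)"
    proof (intro always_eventually allI)
      fix k
      have "continuous_on {0..} (\<lambda>t. scheme T k t \<omega>)"
        unfolding scheme_def by (intro continuous_intros continuous_on_grid_process W mesh)
      then have "continuous_on {0..real T} (\<lambda>t. scheme T k t \<omega>)" by (rule continuous_on_subset) auto
      then show "continuous_on {0..real T} (\<lambda>t. approx k t \<omega>)"
        by (subst continuous_on_cong[OF refl, of _ _ "\<lambda>t. scheme T k t \<omega>"]) (auto simp: approx_eq)
    qed
  qed simp
  show ?thesis
    unfolding continuous_on_eq_continuous_within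
  proof
    fix t :: real assume t: "t \<in> {0..}"
    \<comment> \<open>\<open>T\<close> has to exceed \<open>t\<close> strictly, so that
      \<open>[0, T]\<close> is a neighbourhood of \<open>t\<close> within
      \<open>[0, \<infinity>)\<close>.\<close>
    define T where "T = Suc (nat \<lceil>t\<rceil>)"
    have T: "t < real T" unfolding T_def by linarith
    have "continuous (at t within {0..real T}) (\<lambda>t. solution t \<omega>)"
      using c[of T] t T by (auto simp: continuous_on_eq_continuous_within)
    moreover have "at t within {0..real T} = at t within {0..}"
      using t T by (intro at_within_nhd[of _ "{..<real T}"]) auto
    ultimately show "continuous (at t within {0..}) (\<lambda>t. solution t \<omega>)" by simp
  qed
qed (simp add: solution_def)

lemma solution_adapted: "0 \<le> t \<Longrightarrow> solution t \<in> borel_measurable (F t)"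
  unfolding solution_def[abs_def]
proof (rule measurable_If_set)
  assume t: "0 \<le> t"
  show "(\<lambda>\<omega>. lim (\<lambda>k. approx k t \<omega>)) \<in> borel_measurable (F t)"
    by (rule borel_measurable_lim_metric) (rule approx_adapted(1)[OF t])
  have "good \<inter> space (F t) = good" by (auto simp: good_def)
  then show "good \<inter> space (F t) \<in> sets (F t)" using good_sets by simp
qed simp

lemma solution_error:
  assumes T: "0 < T"
  shows "\<exists>C\<ge>0. \<forall>t\<in>{0..real T}. square_integrable M (solution t) \<and> (\<integral>\<omega>. (norm (solution t \<omega>))\<^sup>2 \<partial>M) \<le> C \<and>
    (\<forall>k. (\<integral>\<omega>. (norm (scheme T k t \<omega> - solution t \<omega>))\<^sup>2 \<partial>M) \<le> C * mesh k)"
proof -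
  obtain C where C: "0 \<le> C" "\<And>k l t. k \<le> l \<Longrightarrow> t \<in> {0..real T} \<Longrightarrow> (\<integral>\<omega>. (norm (scheme T k t \<omega> - scheme T l t \<omega>))\<^sup>2 \<partial>M) \<le> C * mesh k"
    using scheme_error[OF T] by blast
  obtain D where D: "0 \<le> D" "\<And>k t. t \<in> {0..real T} \<Longrightarrow> (\<integral>\<omega>. (norm (scheme T k t \<omega>))\<^sup>2 \<partial>M) \<le> D"
    using scheme_moment_bound[OF T] by blast
  show ?thesis
  proof (intro exI[of _ "C + D"] conjI ballI allI)
    fix t assume t: "t \<in> {0..real T}"
    have s: "square_integrable M (scheme T k t)" for k using scheme_adapted(2) t by auto
    have m: "solution t \<in> borel_measurable M" using solution_adapted t by (auto intro: measurable_F_M)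
    have lim: "AE \<omega> in M. (\<lambda>k. scheme T k t \<omega>) \<longlonglongrightarrow> solution t \<omega>"
      using good_AE by eventually_elim (use approx_tendsto[of _ t] t in \<open>auto simp: approx_eq[of t T]\<close>)
    note F = square_integrable_Fatou[OF s m lim D(2)[OF t]]
    show "square_integrable M (solution t)" by (rule F(1))
    show "(\<integral>\<omega>. (norm (solution t \<omega>))\<^sup>2 \<partial>M) \<le> C + D" using F(2) C(1) by linarith
    fix k
    have "(\<integral>\<omega>. (norm (scheme T k t \<omega> - solution t \<omega>))\<^sup>2 \<partial>M) \<le> C * mesh k"
    \<comment> \<open>The coarse level \<open>k\<close> stays fixed while the finer level
      \<open>l + k\<close> tends to infinity.\<close>
    proof (rule square_integrable_Fatou(2)[of _ "\<lambda>l \<omega>. scheme T k t \<omega> - scheme T (l + k) t \<omega>"])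
      show "AE \<omega> in M. (\<lambda>l. scheme T k t \<omega> - scheme T (l + k) t \<omega>) \<longlonglongrightarrow> scheme T k t \<omega> - solution t \<omega>"
        using lim by eventually_elim (intro tendsto_diff tendsto_const LIMSEQ_ignore_initial_segment)
      show "(\<lambda>\<omega>. scheme T k t \<omega> - solution t \<omega>) \<in> borel_measurable M"
        using m square_integrableD[OF s] by (rule borel_measurable_diff[rotated])
      show "(\<integral>\<omega>. (norm (scheme T k t \<omega> - scheme T (l + k) t \<omega>))\<^sup>2 \<partial>M) \<le> C * mesh k" for l by (rule C(2)) (use t in auto)
    qed (intro square_integrable_diff(1) s)
    also have "\<dots> \<le> (C + D) * mesh k" using D(1) by (intro mult_right_mono) auto
    finally show "(\<integral>\<omega>. (norm (scheme T k t \<omega> - solution t \<omega>))\<^sup>2 \<partial>M) \<le> (C + D) * mesh k" .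
  qed (use C D in simp)
qed

lemma solution_process: "continuous_process solution"
  unfolding continuous_process_def
proof (intro conjI ballI allI impI)
  fix t :: real assume t: "0 \<le> t"
  define T where "T = Suc (nat \<lceil>t\<rceil>)"
  have T: "t \<in> {0..real T}" "0 < T" unfolding T_def using t by (auto, linarith)
  show "square_integrable M (solution t)" using solution_error[OF T(2)] T(1) by blast
next
  fix T :: real
  define T' where "T' = Suc (nat \<lceil>T\<rceil>)"
  have T': "T \<le> real T'" "0 < T'" unfolding T'_def by (linarith, simp)
  obtain C where C: "0 \<le> C" "\<And>t. t \<in> {0..real T'} \<Longrightarrow> square_integrable M (solution t) \<and> (\<integral>\<omega>. (norm (solution t \<omega>))\<^sup>2 \<partial>M) \<le> C"
    using solution_error[OF T'(2)] by blast
  have "square_integrable (time_measure (real T') \<Otimes>\<^sub>M M) (\<lambda>(s, \<omega>). solution s \<omega>)"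
    using C by (intro square_integrable_product measurable_continuous_process solution_continuous measurable_F_M[OF solution_adapted]) auto
  then show "square_integrable (time_measure T \<Otimes>\<^sub>M M) (\<lambda>(s, \<omega>). solution s \<omega>)"
    by (rule square_integrable_energy_mono(1)[OF T'(1)])
qed (use solution_continuous solution_adapted in auto)

lemma lip_on_process:
  assumes L: "\<And>T. \<exists>L. lip_on T L f" and X: "continuous_process X"
  shows "continuous_process (\<lambda>t \<omega>. f t (X t \<omega>))"
  unfolding continuous_process_def
proof (intro conjI ballI allI impI)
  have X': "\<And>\<omega>. \<omega> \<in> space M \<Longrightarrow> continuous_on {0..} (\<lambda>t. X t \<omega>)" "\<And>t. 0 \<le> t \<Longrightarrow> X t \<in> borel_measurable (F t)"
    "\<And>t. 0 \<le> t \<Longrightarrow> square_integrable M (X t)" "\<And>T. square_integrable (time_measure T \<Otimes>\<^sub>M M) (\<lambda>(s, \<omega>). X s \<omega>)"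
    using X by (auto simp: continuous_process_def)
  show c: "continuous_on {0..} (\<lambda>t. f t (X t \<omega>))" if "\<omega> \<in> space M" for \<omega>
    by (rule lip_on_continuous[OF L X'(1)[OF that]])
  show m: "(\<lambda>\<omega>. f t (X t \<omega>)) \<in> borel_measurable (F t)" if "0 \<le> t" for t
    using L[of t] lip_on_measurable[of t _ f t "X t" "F t"] X'(2)[OF that] that by auto
  show "square_integrable M (\<lambda>\<omega>. f t (X t \<omega>))" if "0 \<le> t" for t
    using L[of t] lip_on_square_integrable(1)[of t _ f t "X t"] X'(3)[OF that] that by auto
  fix T :: real
  obtain L where L: "lip_on T L f" using L by blast
  interpret T: finite_measure "time_measure T \<Otimes>\<^sub>M M"
    by (rule finite_measure_pair_measure[OF finite_measure_axioms finite_measure_time_measure]) 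
  show "square_integrable (time_measure T \<Otimes>\<^sub>M M) (\<lambda>(s, \<omega>). f s (X s \<omega>))"
  proof (rule square_integrable_bound(1))
    show "(\<lambda>(s, \<omega>). f s (X s \<omega>)) \<in> borel_measurable (time_measure T \<Otimes>\<^sub>M M)"
      by (rule measurable_continuous_process[OF c measurable_F_M[OF m]])
    show "integrable (time_measure T \<Otimes>\<^sub>M M) (\<lambda>x. growth T L f * (1 + (norm (case x of (s, \<omega>) \<Rightarrow> X s \<omega>))\<^sup>2))"
      using square_integrable_sq[OF X'(4)[of T]] by simp
    show "(norm (case x of (s, \<omega>) \<Rightarrow> f s (X s \<omega>)))\<^sup>2 \<le> growth T L f * (1 + (norm (case x of (s, \<omega>) \<Rightarrow> X s \<omega>))\<^sup>2)"
      if "x \<in> space (time_measure T \<Otimes>\<^sub>M M)" for x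
      using that lip_on_growth[OF L] by (auto simp: space_pair_measure)
  qed
qed

text \<open>Together with \<open>cell_point\<close> this is the grid of level \<open>k\<close> cut
  off at \<open>t\<close>: the last of these cells ends at \<open>t\<close> itself, as required of a
  simple process on \<open>[0, t]\<close>.\<close>

definition cell_count :: "nat \<Rightarrow> real \<Rightarrow> nat" where "cell_count k t = nat \<lceil>t * 2 ^ k\<rceil>"
definition cell_point :: "nat \<Rightarrow> real \<Rightarrow> nat \<Rightarrow> real" where "cell_point k t i = min t (real i * mesh k)"

lemma cell_point_simps:
  assumes t: "0 \<le> t"
  shows "i < cell_count k t \<Longrightarrow> real i * mesh k < t" "i < cell_count k t \<Longrightarrow> cell_point k t i = real i * mesh k"
    "cell_point k t (cell_count k t) = t" "t \<le> real (cell_count k t) * mesh k" "0 \<le> cell_point k t i" "cell_point k t i \<le> t"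
    "cell_point k t i \<le> cell_point k t (Suc i)"
proof -
  show 1: "real i * mesh k < t" if "i < cell_count k t"
  proof -
    have "real i < t * 2 ^ k" using that unfolding cell_count_def by linarith
    then show ?thesis by (simp add: mesh_def divide_less_eq)
  qed
  then show "cell_point k t i = real i * mesh k" if "i < cell_count k t" using that by (simp add: cell_point_def)
  have "t * 2 ^ k \<le> real (cell_count k t)" unfolding cell_count_def using t by linarith
  then show 2: "t \<le> real (cell_count k t) * mesh k" by (simp add: mesh_def le_divide_eq)
  then show "cell_point k t (cell_count k t) = t" by (simp add: cell_point_def)
  show "0 \<le> cell_point k t i" "cell_point k t i \<le> t" using t by (auto simp: cell_point_def)
  show "cell_point k t i \<le> cell_point k t (Suc i)" unfolding cell_point_def by (intro min.mono mult_right_mono) auto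
qed

lemma simple_process_on_cells:
  assumes t: "0 \<le> t" and \<xi>: "\<And>i. \<xi> i \<in> borel_measurable (F (real i * mesh k)) \<and> square_integrable M (\<xi> i)"
  shows "simple_process_on M W t (cell_count k t) (cell_point k t) \<xi>"
  unfolding simple_process_on_def
proof (intro conjI allI impI)
  note c = cell_point_simps[OF t]
  show "0 \<le> cell_point k t 0" by (rule c(5))
  show "cell_point k t i \<le> cell_point k t (Suc i)" for i by (rule c(7))
  show "cell_point k t (cell_count k t) \<le> t" using c(3) by simp
  show "\<xi> i \<in> borel_measurable (F (cell_point k t i))" if "i < cell_count k t" for i
    unfolding c(2)[OF that] using \<xi> by blast
  show "integrable M (\<lambda>\<omega>. (norm (\<xi> i \<omega>))\<^sup>2)" for i using \<xi> by (simp add: square_integrable_def)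
qed

lemma simple_process_cell:
  assumes t: "0 \<le> t" "t \<le> real T" and s: "s \<in> {0<..t}"
  obtains i where "i < T * 2 ^ k" "real i * mesh k \<le> s" "s \<le> real (Suc i) * mesh k"
    "\<forall>(\<xi> :: nat \<Rightarrow> 'a \<Rightarrow> 'b) \<omega>. simple_process (cell_count k t) (cell_point k t) \<xi> s \<omega> = \<xi> i \<omega>"
proof -
  \<comment> \<open>The cells of a simple process are open on the left. Rounding up and subtracting
    1 assigns a grid time to the cell that ends there; rounding down would assign it to the next
    one.\<close>
  define i where "i = nat (\<lceil>s * 2 ^ k\<rceil> - 1)"
  have "0 < s * 2 ^ k" using s by simp
  then have i: "real i < s * 2 ^ k" "s * 2 ^ k \<le> real (Suc i)" unfolding i_def by linarith+
  have ii: "real i * mesh k < s" "s \<le> real (Suc i) * mesh k" using i by (simp_all add: mesh_def field_simps)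
  have "s * 2 ^ k \<le> t * 2 ^ k" using s by simp
  then have n: "i < cell_count k t" using i unfolding cell_count_def by linarith
  have "t * 2 ^ k \<le> real T * 2 ^ k" using t by simp
  with i(1) \<open>s * 2 ^ k \<le> t * 2 ^ k\<close> have "real i < real T * 2 ^ k" by linarith
  then have "real i < real (T * 2 ^ k)" by simp
  then have iT: "i < T * 2 ^ k" by (rule of_nat_less_iff[THEN iffD1])
  have ind: "indicator {cell_point k t j<..cell_point k t (Suc j)} s = (if j = i then 1 else 0 :: real)" for j
  proof -
    consider "j < i" | "j = i" | "i < j" by linarith
    then show ?thesis
    proof cases
      case 1
      then have "real (Suc j) * mesh k \<le> real i * mesh k" by (intro mult_right_mono) auto
      then have "\<not> s \<le> real (Suc j) * mesh k" using ii by linarith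
      then show ?thesis using 1 by (auto simp: cell_point_def indicator_def simp del: of_nat_Suc)
    next
      case 2 then show ?thesis using ii s by (auto simp: cell_point_def indicator_def simp del: of_nat_Suc)
    next
      case 3
      then have "real (Suc i) * mesh k \<le> real j * mesh k" by (intro mult_right_mono) auto
      then have "s \<le> real j * mesh k" using ii by linarith
      then show ?thesis using 3 s by (auto simp: cell_point_def indicator_def simp del: of_nat_Suc)
    qed
  qed
  have "simple_process (cell_count k t) (cell_point k t) \<xi> s \<omega> = \<xi> i \<omega>" for \<xi> :: "nat \<Rightarrow> 'a \<Rightarrow> 'b" and \<omega>
    using n by (simp add: simple_process_def ind if_distrib[of "\<lambda>c. c *\<^sub>R _"] cong: if_cong)
  then show ?thesis using iT ii by (intro that[of i]) auto
qed

lemma integrand_error: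
  assumes T: "0 < T" and t: "0 \<le> t" "t \<le> real T" and L: "\<And>T. \<exists>L. lip_on T L f"
    and \<xi>: "\<And>k i. \<xi> k i = (\<lambda>\<omega>. f (real i * mesh k) (euler k i \<omega>))"
      "\<And>k i. \<xi> k i \<in> borel_measurable (F (real i * mesh k)) \<and> square_integrable M (\<xi> k i)"
  shows "\<exists>C\<ge>0. \<forall>k. square_integrable (time_measure t \<Otimes>\<^sub>M M) (\<lambda>(s, \<omega>). f s (solution s \<omega>) - simple_process (cell_count k t) (cell_point k t) (\<xi> k) s \<omega>) \<and>
    (\<integral>x. (norm (case x of (s, \<omega>) \<Rightarrow> f s (solution s \<omega>) - simple_process (cell_count k t) (cell_point k t) (\<xi> k) s \<omega>))\<^sup>2 \<partial>(time_measure t \<Otimes>\<^sub>M M)) \<le> C * mesh k"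
proof -
  obtain L where L': "lip_on (real T) L f" using L by blast
  obtain C where C: "0 \<le> C" "\<And>k s. s \<in> {0..real T} \<Longrightarrow> square_integrable M (solution s) \<and> (\<integral>\<omega>. (norm (scheme T k s \<omega> - solution s \<omega>))\<^sup>2 \<partial>M) \<le> C * mesh k"
    using solution_error[OF T] by blast
  obtain D where D: "0 \<le> D" "\<And>k i t. i < T * 2 ^ k \<Longrightarrow> real i * mesh k \<le> t \<Longrightarrow> t \<le> real (Suc i) * mesh k \<Longrightarrow>
     (\<integral>\<omega>. (norm (scheme T k t \<omega> - euler k i \<omega>))\<^sup>2 \<partial>M) \<le> D * mesh k"
    using scheme_cell_error[of T] by blast
  define E where "E = 2 * L\<^sup>2 * (1 + (2 * D + 2 * C))"
  have E0: "0 \<le> E" using C D by (simp add: E_def)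
  have *: "square_integrable (time_measure t \<Otimes>\<^sub>M M) (\<lambda>(s, \<omega>). f s (solution s \<omega>) - simple_process (cell_count k t) (cell_point k t) (\<xi> k) s \<omega>)"
    "(\<integral>x. (norm (case x of (s, \<omega>) \<Rightarrow> f s (solution s \<omega>) - simple_process (cell_count k t) (cell_point k t) (\<xi> k) s \<omega>))\<^sup>2 \<partial>(time_measure t \<Otimes>\<^sub>M M)) \<le> t * (E * mesh k)" for k
  proof -
    have p: "continuous_process (\<lambda>s \<omega>. f s (solution s \<omega>))" by (rule lip_on_process[OF L solution_process])
    then have m1: "(\<lambda>(s, \<omega>). f s (solution s \<omega>)) \<in> borel_measurable (time_measure t \<Otimes>\<^sub>M M)"
      by (auto simp: continuous_process_def square_integrable_def)
    have "simple_process (cell_count k t) (cell_point k t) (\<xi> k) = block_process {..<cell_count k t} (cell_point k t) (\<lambda>i. cell_point k t (Suc i)) (\<xi> k)"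
      by (intro ext) (simp add: simple_process_def block_process_def)
    then have m2: "(\<lambda>(s, \<omega>). simple_process (cell_count k t) (cell_point k t) (\<xi> k) s \<omega>) \<in> borel_measurable (time_measure t \<Otimes>\<^sub>M M)"
      using square_integrable_block_process[OF simple_process_on_block_family(1)[OF simple_process_on_cells[OF t(1) \<xi>(2)]]]
      by (simp add: square_integrable_def)
    have m: "(\<lambda>(s, \<omega>). f s (solution s \<omega>) - simple_process (cell_count k t) (cell_point k t) (\<xi> k) s \<omega>) \<in> borel_measurable (time_measure t \<Otimes>\<^sub>M M)"
      using borel_measurable_diff[OF m1 m2] by (simp add: split_beta')
    have le: "square_integrable M (\<lambda>\<omega>. f s (solution s \<omega>) - simple_process (cell_count k t) (cell_point k t) (\<xi> k) s \<omega>) \<and>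
      (\<integral>\<omega>. (norm (f s (solution s \<omega>) - simple_process (cell_count k t) (cell_point k t) (\<xi> k) s \<omega>))\<^sup>2 \<partial>M) \<le> E * mesh k" if s: "s \<in> {0<..t}" for s
    proof -
      obtain i where i: "i < T * 2 ^ k" "real i * mesh k \<le> s" "s \<le> real (Suc i) * mesh k"
        "\<forall>(\<xi> :: nat \<Rightarrow> 'a \<Rightarrow> 'b) \<omega>. simple_process (cell_count k t) (cell_point k t) \<xi> s \<omega> = \<xi> i \<omega>"
        by (rule simple_process_cell[OF t s, where k=k])
      have sT: "s \<in> {0..real T}" "0 \<le> s" using s t by auto
      have iT: "real i * mesh k \<in> {0..real T}" by (rule grid_time_le) (use i in simp)
      have d: "\<bar>s - real i * mesh k\<bar> \<le> mesh k" using i(2,3) by (simp add: algebra_simps)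
      have sq: "square_integrable M (solution s)" "square_integrable M (euler k i)" "square_integrable M (scheme T k s)"
        using C(2)[OF sT(1)] euler_adapted scheme_adapted(2)[OF sT(2)] by auto
      have "(\<integral>\<omega>. (norm (solution s \<omega> - euler k i \<omega>))\<^sup>2 \<partial>M) = (\<integral>\<omega>. (norm ((scheme T k s \<omega> - euler k i \<omega>) - (scheme T k s \<omega> - solution s \<omega>)))\<^sup>2 \<partial>M)"
        by simp
      also have "\<dots> \<le> 2 * (D * mesh k) + 2 * (C * mesh k)"
        using square_integrable_diff(2)[OF square_integrable_diff(1)[OF sq(3,2)] square_integrable_diff(1)[OF sq(3,1)]] C(2)[OF sT(1), of k] D(2)[OF i(1-3)] by linarith
      finally have dl: "(\<integral>\<omega>. (norm (solution s \<omega> - euler k i \<omega>))\<^sup>2 \<partial>M) \<le> 2 * (D * mesh k) + 2 * (C * mesh k)" .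
      have "2 * L\<^sup>2 * (mesh k + (2 * (D * mesh k) + 2 * (C * mesh k))) = E * mesh k" by (simp add: E_def algebra_simps)
      then show ?thesis
        using lip_on_diff_energy[OF L' sT(1) iT d mesh(2) sq(1,2) dl] by (simp add: i(4)[rule_format] \<xi>(1))
    qed
    note sp = square_integrable_product[OF m t(1) _ le]
    show "square_integrable (time_measure t \<Otimes>\<^sub>M M) (\<lambda>(s, \<omega>). f s (solution s \<omega>) - simple_process (cell_count k t) (cell_point k t) (\<xi> k) s \<omega>)"
    "(\<integral>x. (norm (case x of (s, \<omega>) \<Rightarrow> f s (solution s \<omega>) - simple_process (cell_count k t) (cell_point k t) (\<xi> k) s \<omega>))\<^sup>2 \<partial>(time_measure t \<Otimes>\<^sub>M M)) \<le> t * (E * mesh k)"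
      using sp E0 by simp_all
  qed
  show ?thesis using * E0 t(1) by (intro exI[of _ "t * E"]) (simp add: mult.assoc)
qed

lemma simple_process_time_integral:
  assumes t: "0 \<le> t"
  shows "square_integrable (time_measure t) (\<lambda>s. simple_process (cell_count k t) (cell_point k t) \<xi> s \<omega>)"
    "(\<integral>s. simple_process (cell_count k t) (cell_point k t) \<xi> s \<omega> \<partial>time_measure t)
      = (\<Sum>i<cell_count k t. (cell_point k t (Suc i) - cell_point k t i) *\<^sub>R (\<xi> i \<omega> :: 'b))"
proof -
  interpret T: finite_measure "time_measure t" by (rule finite_measure_time_measure)
  let ?A = "\<lambda>i. {cell_point k t i<..cell_point k t (Suc i)}"
  note c = cell_point_simps[OF t]
  have A: "?A i \<in> sets (time_measure t)" "?A i \<subseteq> {0..t}" for i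
  proof -
    show s: "?A i \<subseteq> {0..t}" using c(5)[of k i] c(6)[of k "Suc i"] by auto
    then show "?A i \<in> sets (time_measure t)" by (auto simp: sets_time_measure sets_restrict_space intro!: image_eqI[of _ _ "?A i"])
  qed
  have sq: "square_integrable (time_measure t) (\<lambda>s. indicator (?A i) s *\<^sub>R \<xi> i \<omega>)" for i
  proof (rule square_integrable_bound(1)[where g="\<lambda>s. (norm (\<xi> i \<omega>))\<^sup>2"])
    show "(\<lambda>s. indicator (?A i) s *\<^sub>R \<xi> i \<omega>) \<in> borel_measurable (time_measure t)"
      by (intro borel_measurable_scaleR borel_measurable_indicator A) simp
  qed (auto simp: indicator_def)
  then show "square_integrable (time_measure t) (\<lambda>s. simple_process (cell_count k t) (cell_point k t) \<xi> s \<omega>)"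
    unfolding simple_process_def by (intro square_integrable_sum)
  have "(\<integral>s. simple_process (cell_count k t) (cell_point k t) \<xi> s \<omega> \<partial>time_measure t) = (\<Sum>i<cell_count k t. \<integral>s. indicator (?A i) s *\<^sub>R \<xi> i \<omega> \<partial>time_measure t)"
    unfolding simple_process_def by (intro Bochner_Integration.integral_sum T.square_integrable_integrable sq)
  also have "\<dots> = (\<Sum>i<cell_count k t. (cell_point k t (Suc i) - cell_point k t i) *\<^sub>R \<xi> i \<omega>)"
  proof (rule sum.cong[OF refl])
    fix i
    have "(\<integral>s. indicator (?A i) s *\<^sub>R \<xi> i \<omega> \<partial>time_measure t) = measure (time_measure t) (?A i) *\<^sub>R \<xi> i \<omega>"
      using A by (simp add: Int_absorb2 less_top[symmetric] T.emeasure_finite)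
    also have "measure (time_measure t) (?A i) = cell_point k t (Suc i) - cell_point k t i"
      using measure_time_measure[OF _ A(2)[of i]] c(7)[of k i] by simp
    finally show "(\<integral>s. indicator (?A i) s *\<^sub>R \<xi> i \<omega> \<partial>time_measure t) = (cell_point k t (Suc i) - cell_point k t i) *\<^sub>R \<xi> i \<omega>" .
  qed
  finally show "(\<integral>s. simple_process (cell_count k t) (cell_point k t) \<xi> s \<omega> \<partial>time_measure t)
      = (\<Sum>i<cell_count k t. (cell_point k t (Suc i) - cell_point k t i) *\<^sub>R (\<xi> i \<omega> :: 'b))" .
qed

text \<open>Since the interpolation follows the Brownian path, the scheme satisfies an exact
  integral equation with step integrands. The equation of the limit is obtained from it term by
  term.\<close>

lemma scheme_as_integrals:
  assumes t: "0 \<le> t" "t \<le> real T"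
  shows "scheme T k t \<omega> = x + (\<integral>s. simple_process (cell_count k t) (cell_point k t) (drift k) s \<omega> \<partial>time_measure t)
    + simple_ito_integral W (cell_count k t) (cell_point k t) (diffusion k) \<omega>"
proof -
  have c: "cell_count k t \<le> T * 2 ^ k"
  proof -
    have "t * 2 ^ k \<le> real T * 2 ^ k" using t by simp
    then have "\<lceil>t * 2 ^ k\<rceil> \<le> int (T * 2 ^ k)" by (simp add: ceiling_le_iff)
    then show ?thesis unfolding cell_count_def by linarith
  qed
  have "grid_process (mesh k) (T * 2 ^ k) (drift k) (diffusion k) t \<omega> = grid_process (mesh k) (cell_count k t) (drift k) (diffusion k) t \<omega>"
    by (rule grid_process_extend[OF mesh(1) c cell_point_simps(4)[OF t(1)]])
  then show ?thesis
    unfolding scheme_def simple_process_time_integral(2)[OF t(1)]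
    by (simp add: grid_process_def simple_ito_integral_def cell_point_def sum.distrib del: of_nat_Suc)
qed

text \<open>The required approximations of the Ito integral are the integrals of
  \<open>diffusion k\<close>. The defect of these simple integrals is not estimated directly: by
  \<open>scheme_as_integrals\<close> it is the error of the scheme together with that of the drift
  integral, and both are of order \<open>mesh k\<close> in mean square.\<close>

theorem solution_ito_process:
  "ito_process M W x (\<lambda>t \<omega>. b t (solution t \<omega>)) (\<lambda>t \<omega>. g t (solution t \<omega>)) solution"
proof -
  have Lb: "\<exists>L. lip_on T L b" and Lg: "\<exists>L. lip_on T L g" for T using lipschitz_bg by metis+
  have pb: "continuous_process (\<lambda>t \<omega>. b t (solution t \<omega>))" and pg: "continuous_process (\<lambda>t \<omega>. g t (solution t \<omega>))"
    by (rule lip_on_process[OF Lb solution_process], rule lip_on_process[OF Lg solution_process])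
  have sol: "\<And>t. 0 \<le> t \<Longrightarrow> square_integrable M (solution t)" "\<And>T. square_integrable (time_measure T \<Otimes>\<^sub>M M) (\<lambda>(s, \<omega>). solution s \<omega>)"
    using solution_process by (auto simp: continuous_process_def)
  have bc: "continuous_on {0..} (\<lambda>t. b t (solution t \<omega>))" if "\<omega> \<in> space M" for \<omega>
    using pb that by (auto simp: continuous_process_def)
  have ito: "has_ito_integral M W t (\<lambda>t \<omega>. g t (solution t \<omega>)) (\<lambda>\<omega>. solution t \<omega> - x - (\<integral>s. b s (solution s \<omega>) \<partial>time_measure t))" if t: "0 \<le> t" for t
  proof -
    define T where "T = Suc (nat \<lceil>t\<rceil>)"
    have T: "t \<le> real T" "0 < T" unfolding T_def by (linarith, simp)
    let ?n = "\<lambda>k. cell_count k t" and ?p = "\<lambda>k. cell_point k t"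
    have sp: "simple_process_on M W t (?n k) (?p k) (diffusion k)" for k
      using diffusion_adapted by (intro simple_process_on_cells t) auto
    obtain C where C: "0 \<le> C" "\<And>k s. s \<in> {0..real T} \<Longrightarrow> (\<integral>\<omega>. (norm (scheme T k s \<omega> - solution s \<omega>))\<^sup>2 \<partial>M) \<le> C * mesh k"
      using solution_error[OF T(2)] by blast
    obtain Cb where Cb: "0 \<le> Cb" "\<And>k. square_integrable (time_measure t \<Otimes>\<^sub>M M) (\<lambda>(s, \<omega>). b s (solution s \<omega>) - simple_process (?n k) (?p k) (drift k) s \<omega>)"
      "\<And>k. (\<integral>x. (norm (case x of (s, \<omega>) \<Rightarrow> b s (solution s \<omega>) - simple_process (?n k) (?p k) (drift k) s \<omega>))\<^sup>2 \<partial>(time_measure t \<Otimes>\<^sub>M M)) \<le> Cb * mesh k"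
      using integrand_error[OF T(2) t T(1) Lb, of drift] drift_adapted by (auto simp: drift_def[abs_def])
    obtain Cg where Cg: "0 \<le> Cg" "\<And>k. square_integrable (time_measure t \<Otimes>\<^sub>M M) (\<lambda>(s, \<omega>). g s (solution s \<omega>) - simple_process (?n k) (?p k) (diffusion k) s \<omega>)"
      "\<And>k. (\<integral>x. (norm (case x of (s, \<omega>) \<Rightarrow> g s (solution s \<omega>) - simple_process (?n k) (?p k) (diffusion k) s \<omega>))\<^sup>2 \<partial>(time_measure t \<Otimes>\<^sub>M M)) \<le> Cg * mesh k"
      using integrand_error[OF T(2) t T(1) Lg, of diffusion] diffusion_adapted by (auto simp: diffusion_def[abs_def])
    have mesh0: "mesh \<longlonglongrightarrow> 0"
    proof -
      have "mesh = (\<lambda>k. (1/2) ^ k)" by (intro ext) (simp add: mesh_def power_one_over)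
      then show ?thesis using LIMSEQ_power_zero[of "1/2::real"] by simp
    qed
    have lim0: "(\<lambda>k. ennreal (c * mesh k)) \<longlonglongrightarrow> 0" for c
      using tendsto_ennrealI[OF tendsto_mult[OF tendsto_const mesh0, of c]] by simp
    let ?N = "\<lambda>\<omega>. solution t \<omega> - x - (\<integral>s. b s (solution s \<omega>) \<partial>time_measure t)"
    have sN: "square_integrable M ?N"
      by (intro square_integrable_diff(1) sol(1)[OF t] square_integrable_const time_integral_square_integrable(2)[OF continuous_processD(1,4)[OF pb] t])
    have energy: "(\<lambda>k. mean_square_energy M {0..t} (\<lambda>s \<omega>. g s (solution s \<omega>) - simple_process (?n k) (?p k) (diffusion k) s \<omega>)) \<longlonglongrightarrow> 0"
    proof (rule tendsto_sandwich[OF _ _ tendsto_const lim0[of Cg]])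
      show "\<forall>\<^sub>F k in sequentially. mean_square_energy M {0..t} (\<lambda>s \<omega>. g s (solution s \<omega>) - simple_process (?n k) (?p k) (diffusion k) s \<omega>) \<le> ennreal (Cg * mesh k)"
        unfolding mean_square_energy_eq[OF square_integrableD[OF Cg(2)]] square_integrable_nn_integral[OF Cg(2)]
        using Cg(3) by (intro always_eventually allI ennreal_leI)
    qed simp
    have limit: "(\<lambda>k. \<integral>\<^sup>+\<omega>. ennreal ((norm (?N \<omega> - simple_ito_integral W (?n k) (?p k) (diffusion k) \<omega>))\<^sup>2) \<partial>M) \<longlonglongrightarrow> 0"
    \<comment> \<open>\<open>C\<close> belongs to the error of the scheme and \<open>t * Cb\<close>
      to the drift integral, where Cauchy-Schwarz in time costs the factor \<open>t\<close>; the
      factors 2 come from the square of a sum.\<close>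
    proof (rule tendsto_sandwich[OF _ _ tendsto_const lim0[of "2 * C + 2 * (t * Cb)"]])
      show "\<forall>\<^sub>F k in sequentially. (\<integral>\<^sup>+\<omega>. ennreal ((norm (?N \<omega> - simple_ito_integral W (?n k) (?p k) (diffusion k) \<omega>))\<^sup>2) \<partial>M) \<le> ennreal ((2 * C + 2 * (t * Cb)) * mesh k)"
      proof (intro always_eventually allI)
        fix k
        let ?Z = "\<lambda>s \<omega>. b s (solution s \<omega>) - simple_process (?n k) (?p k) (drift k) s \<omega>"
        define I where "I \<omega> = (\<integral>s. ?Z s \<omega> \<partial>time_measure t)" for \<omega>
        interpret Tt: finite_measure "time_measure t" by (rule finite_measure_time_measure)
        interpret P: pair_sigma_finite "time_measure t" M by (rule pair_sigma_finite_time)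
        have sb: "square_integrable (time_measure t) (\<lambda>s. b s (solution s \<omega>))" if "\<omega> \<in> space M" for \<omega>
          by (rule square_integrable_continuous[OF bc[OF that]])
        note ss = simple_process_time_integral[OF t, of k]
        have eq: "?N \<omega> - simple_ito_integral W (?n k) (?p k) (diffusion k) \<omega> = - (scheme T k t \<omega> - solution t \<omega>) - I \<omega>" if "\<omega> \<in> space M" for \<omega>
          unfolding I_def scheme_as_integrals[OF t T(1)]
          using Bochner_Integration.integral_diff[OF Tt.square_integrable_integrable[OF sb[OF that]] Tt.square_integrable_integrable[OF ss(1)], of "drift k" \<omega>]
          by simp
        have e: "integrable (time_measure t \<Otimes>\<^sub>M M) (\<lambda>(s, \<omega>). (norm (?Z s \<omega>))\<^sup>2)"
          using square_integrable_sq[OF Cb(2)[of k]] by (simp add: split_beta')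
        have Im: "I \<in> borel_measurable M"
        proof -
          have "(\<lambda>(\<omega>, s). ?Z s \<omega>) \<in> borel_measurable (M \<Otimes>\<^sub>M time_measure t)"
            using measurable_compose[OF measurable_pair_swap' square_integrableD[OF Cb(2)[of k]]] by (simp add: split_beta')
          then show ?thesis unfolding I_def by (rule Tt.borel_measurable_lebesgue_integral)
        qed
        have Ile: "(norm (I \<omega>))\<^sup>2 \<le> t * (\<integral>s. (norm (?Z s \<omega>))\<^sup>2 \<partial>time_measure t)" if "\<omega> \<in> space M" for \<omega>
          unfolding I_def by (rule norm_integral_time_measure_sq_le[OF square_integrable_diff(1)[OF sb[OF that] ss(1)] t])
        have Ii: "integrable M (\<lambda>\<omega>. t * (\<integral>s. (norm (?Z s \<omega>))\<^sup>2 \<partial>time_measure t))"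
          using P.integrable_snd[OF e] by simp
        note I = square_integrable_bound[OF Im Ii Ile]
        have "(\<integral>\<omega>. t * (\<integral>s. (norm (?Z s \<omega>))\<^sup>2 \<partial>time_measure t) \<partial>M) \<le> t * (Cb * mesh k)"
          using P.integral_snd[OF e] Cb(3)[of k] t by (simp add: split_beta' mult_left_mono)
        with I(2) have I2: "(\<integral>\<omega>. (norm (I \<omega>))\<^sup>2 \<partial>M) \<le> t * (Cb * mesh k)" by linarith
        have S: "square_integrable M (\<lambda>\<omega>. scheme T k t \<omega> - solution t \<omega>)" by (intro square_integrable_diff(1) scheme_adapted(2) sol(1) t)
        note D = square_integrable_diff[OF square_integrable_minus[OF S] I(1)]
        have "(\<integral>\<^sup>+\<omega>. ennreal ((norm (?N \<omega> - simple_ito_integral W (?n k) (?p k) (diffusion k) \<omega>))\<^sup>2) \<partial>M)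
          = (\<integral>\<^sup>+\<omega>. ennreal ((norm (- (scheme T k t \<omega> - solution t \<omega>) - I \<omega>))\<^sup>2) \<partial>M)"
          by (rule nn_integral_cong) (simp only: eq)
        also have "\<dots> = ennreal (\<integral>\<omega>. (norm (- (scheme T k t \<omega> - solution t \<omega>) - I \<omega>))\<^sup>2 \<partial>M)"
          by (rule square_integrable_nn_integral[OF D(1)])
        also have "\<dots> \<le> ennreal ((2 * C + 2 * (t * Cb)) * mesh k)"
        proof (rule ennreal_leI)
          have "t \<in> {0..real T}" using t T by simp
          from C(2)[OF this, of k] D(2) I2
          have "(\<integral>\<omega>. (norm (- (scheme T k t \<omega> - solution t \<omega>) - I \<omega>))\<^sup>2 \<partial>M) \<le> 2 * (C * mesh k) + 2 * (t * (Cb * mesh k))"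
            unfolding norm_minus_cancel by linarith
          then show "(\<integral>\<omega>. (norm (- (scheme T k t \<omega> - solution t \<omega>) - I \<omega>))\<^sup>2 \<partial>M) \<le> (2 * C + 2 * (t * Cb)) * mesh k"
            by (simp add: algebra_simps)
        qed
        finally show "(\<integral>\<^sup>+\<omega>. ennreal ((norm (?N \<omega> - simple_ito_integral W (?n k) (?p k) (diffusion k) \<omega>))\<^sup>2) \<partial>M) \<le> ennreal ((2 * C + 2 * (t * Cb)) * mesh k)" .
      qed
    qed simp
    show ?thesis
      unfolding has_ito_integral_def
      by (intro conjI continuous_process_integrand[OF pg] square_integrableD[OF sN]
          exI[of _ ?n] exI[of _ ?p] exI[of _ diffusion] allI sp energy limit)
  qed
  have "mean_square_energy M {0..T} solution < \<infinity>" for T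
    using sol(2)[of T] unfolding square_integrable_iff_nn_integral by (auto simp: mean_square_energy_eq)
  moreover have "AE \<omega> in M. set_integrable lborel {0..t} (\<lambda>s. b s (solution s \<omega>))" for t
    using continuous_on_time_measure(1)[OF bc] by (auto simp: integrable_time_measure)
  ultimately show ?thesis
    unfolding ito_process_def
    using solution_continuous solution_adapted square_integrable_integrable[OF sol(1)] ito
    by (auto simp: integral_time_measure)
qed

text \<open>The drift of \<open>mf_closed_loop\<close> contains the expectation of the solution itself, and must be
  matched as a function on all of \<open>real\<close>, negative times included.\<close>

lemma solution_negative: "t < 0 \<Longrightarrow> solution t \<omega> = x"
proof -
  assume "t < 0"
  then have "min t (real j * mesh k) = t" for j k
    using order.strict_trans2[of t 0 "real j * mesh k"] by (simp add: min_absorb1)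
  then have "approx k t \<omega> = x" for k
    by (simp add: approx_def scheme_def grid_process_def del: of_nat_Suc)
  then show ?thesis by (simp add: solution_def)
qed

end

section \<open>Linear differential equations and spectra\<close>

text \<open>Derivatives are taken within \<open>[0, T]\<close>, one-sided at its ends, so the values
  at negative times play no part and integrals over \<open>time_measure T\<close> fit
  directly.\<close>

definition linear_ode :: "('v::euclidean_space \<Rightarrow> 'v) \<Rightarrow> (real \<Rightarrow> 'v) \<Rightarrow> bool" where
  "linear_ode f y \<longleftrightarrow> (\<forall>T. \<forall>t\<in>{0..T}. (y has_vector_derivative f (y t)) (at t within {0..T}))"

lemma linear_odeD: "linear_ode f y \<Longrightarrow> t \<in> {0..T} \<Longrightarrow> (y has_vector_derivative f (y t)) (at t within {0..T})"
  by (simp add: linear_ode_def)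

lemma continuous_on_nonnegI:
  fixes y :: "real \<Rightarrow> 'v::topological_space"
  assumes "\<And>T. continuous_on {0..T} y"
  shows "continuous_on {0..} y"
  unfolding continuous_on_eq_continuous_within
proof
  fix t :: real assume t: "t \<in> {0..}"
  have "continuous (at t within {0..t+1}) y"
    using assms[of "t+1"] t by (auto simp: continuous_on_eq_continuous_within)
  moreover have "at t within {0..t+1} = at t within {0..}"
    using t by (intro at_within_nhd[of _ "{..<t+1}"]) auto
  ultimately show "continuous (at t within {0..}) y" by simp
qed

lemma linear_ode_continuous: "linear_ode f y \<Longrightarrow> continuous_on {0..} y"
  by (intro continuous_on_nonnegI continuous_on_vector_derivative[where f'="\<lambda>t. f (y t)"] linear_odeD)

lemma linear_ode_compose:
  assumes "linear_ode f y" "bounded_linear L" "\<And>v. L (f v) = h (L v)"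
  shows "linear_ode h (\<lambda>t. L (y t))"
  unfolding linear_ode_def
proof (intro allI ballI)
  fix T t assume "t \<in> {0..T::real}"
  from bounded_linear.has_vector_derivative[OF assms(2) linear_odeD[OF assms(1) this]]
  show "((\<lambda>t. L (y t)) has_vector_derivative h (L (y t))) (at t within {0..T})" by (simp add: assms(3))
qed

lemma continuous_on_indefinite_integral:
  fixes h :: "real \<Rightarrow> 'v::euclidean_space"
  assumes "\<And>T. integrable (time_measure T) h"
  shows "continuous_on {0..} (\<lambda>t. \<integral>s. h s \<partial>time_measure t)"
proof (rule continuous_on_nonnegI)
  fix T
  have s: "set_integrable lborel {0..t} h" for t using assms[of t] by (simp add: integrable_time_measure)
  have "(\<lambda>t. \<integral>s. h s \<partial>time_measure t) = (\<lambda>t. integral {0..t} h)"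
    by (intro ext) (simp add: integral_time_measure set_borel_integral_eq_integral(2)[OF s])
  then show "continuous_on {0..T} (\<lambda>t. \<integral>s. h s \<partial>time_measure t)"
    using indefinite_integral_continuous_1[OF set_borel_integral_eq_integral(1)[OF s[of T]]] by (simp only:)
qed

text \<open>Bootstrapping: an integrable solution of the integral equation is continuous, and then
  the right-hand side is differentiable.\<close>

lemma linear_ode_from_integral:
  fixes y :: "real \<Rightarrow> 'v::euclidean_space"
  assumes f: "bounded_linear f" and eq: "\<And>t. 0 \<le> t \<Longrightarrow> y t = y0 + (\<integral>s. f (y s) \<partial>time_measure t)"
    and i: "\<And>T. integrable (time_measure T) (\<lambda>s. f (y s))"
  shows "linear_ode f y"
proof -
  have "continuous_on {0..} (\<lambda>t. y0 + (\<integral>s. f (y s) \<partial>time_measure t))"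
    by (intro continuous_intros continuous_on_indefinite_integral i)
  then have y: "continuous_on {0..} y" by (subst continuous_on_cong[OF refl]) (auto simp: eq)
  have c: "continuous_on {0..} (\<lambda>s. f (y s))" by (rule bounded_linear.continuous_on[OF f y])
  show ?thesis
    unfolding linear_ode_def
  proof (intro allI ballI)
    fix T t assume t: "t \<in> {0..T::real}"
    have "((\<lambda>t. y0 + (\<integral>s. f (y s) \<partial>time_measure t)) has_vector_derivative f (y t)) (at t within {0..T})"
      using continuous_on_time_measure(2)[OF c t] by (auto intro!: derivative_eq_intros)
    then show "(y has_vector_derivative f (y t)) (at t within {0..T})"
      by (rule has_vector_derivative_transform[OF t, rotated]) (simp add: eq)
  qed
qed

lemma norm_sq_has_vector_derivative:
  fixes y :: "real \<Rightarrow> 'v::euclidean_space"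
  assumes "(y has_vector_derivative d) (at t within S)"
  shows "((\<lambda>t. (norm (y t))\<^sup>2) has_vector_derivative 2 * (y t \<bullet> d)) (at t within S)"
  using bounded_bilinear.has_vector_derivative[OF bounded_bilinear_inner assms assms]
  by (simp add: power2_norm_eq_inner inner_commute)

lemma linear_ode_energy:
  fixes y :: "real \<Rightarrow> 'v::euclidean_space"
  assumes f: "bounded_linear f" and y: "linear_ode f y" and "0 \<le> T"
  shows "(\<integral>s. 2 * (y s \<bullet> f (y s)) \<partial>time_measure T) = (norm (y T))\<^sup>2 - (norm (y 0))\<^sup>2"
proof (rule time_measure_FTC[OF \<open>0 \<le> T\<close>])
  have "continuous_on {0..T} y" using linear_ode_continuous[OF y] by (rule continuous_on_subset) auto
  then show "continuous_on {0..T} (\<lambda>s. 2 * (y s \<bullet> f (y s)))"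
    by (intro continuous_intros bounded_linear.continuous_on[OF f])
qed (intro norm_sq_has_vector_derivative linear_odeD[OF y])

text \<open>If \<open>K\<close> bounds the norm of \<open>f\<close>, then
  \<open>exp (- 2 * K * t) * (norm (y t))\<^sup>2\<close> does not increase, and it starts at
  0.\<close>

lemma linear_ode_zero:
  fixes y :: "real \<Rightarrow> 'v::euclidean_space"
  assumes f: "bounded_linear f" and y: "linear_ode f y" and y0: "y 0 = 0" and T: "0 \<le> T"
  shows "y T = 0"
proof -
  obtain K where K: "\<And>v. norm (f v) \<le> norm v * K" using f bounded_linear.bounded by blast
  let ?v = "\<lambda>t. exp (- (2 * K) * t) *\<^sub>R (norm (y t))\<^sup>2"
  let ?d = "\<lambda>t. exp (- (2 * K) * t) *\<^sub>R (2 * (y t \<bullet> f (y t))) + (- (2 * K) * exp (- (2 * K) * t)) *\<^sub>R (norm (y t))\<^sup>2"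
  have c: "continuous_on {0..T} y" using linear_ode_continuous[OF y] by (rule continuous_on_subset) auto
  have "(\<integral>s. ?d s \<partial>time_measure T) = ?v T - ?v 0"
  proof (rule time_measure_FTC[OF T])
    fix t assume t: "t \<in> {0..T}"
    have "((\<lambda>t. exp (- (2 * K) * t)) has_real_derivative (- (2 * K) * exp (- (2 * K) * t))) (at t within {0..T})"
      by (auto intro!: derivative_eq_intros)
    from has_vector_derivative_scaleR[OF this norm_sq_has_vector_derivative[OF linear_odeD[OF y t]]]
    show "(?v has_vector_derivative ?d t) (at t within {0..T})" .
  qed (intro continuous_intros bounded_linear.continuous_on[OF f] c)
  moreover have "0 \<le> (\<integral>s. - ?d s \<partial>time_measure T)"
  proof (rule integral_nonneg_AE, rule AE_I2)
    fix s
    have "y s \<bullet> f (y s) \<le> norm (y s) * norm (f (y s))" by (rule norm_cauchy_schwarz)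
    also have "\<dots> \<le> norm (y s) * (norm (y s) * K)" by (intro mult_left_mono K) auto
    finally have "y s \<bullet> f (y s) \<le> K * (norm (y s))\<^sup>2" by (simp add: power2_eq_square mult_ac)
    then have "exp (- (2 * K) * s) * (2 * (y s \<bullet> f (y s))) \<le> exp (- (2 * K) * s) * (2 * (K * (norm (y s))\<^sup>2))"
      by (intro mult_left_mono) auto
    then show "0 \<le> - ?d s" by (simp add: algebra_simps)
  qed
  ultimately have "?v T \<le> 0" using y0 unfolding Bochner_Integration.integral_minus by simp
  then show ?thesis by (simp add: mult_le_0_iff)
qed

section \<open>Spectrum and square-integrable solutions\<close>

lemma mat_vector_mult: "mat c *v v = c *s (v :: 'a::comm_ring_1 ^'n)"
  by (simp add: vec_eq_iff matrix_vector_mult_def mat_def if_distrib[of "\<lambda>x. x * _"] cong: if_cong)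

text \<open>The inner product on \<open>complex^'n\<close> is the real one, so the imaginary part of
  \<open>c\<close> only rotates and contributes nothing.\<close>

lemma complex_vector_inner_smult: "v \<bullet> (c *s v) = Re c * (norm (v :: complex^'n))\<^sup>2"
proof -
  have "z \<bullet> (c * z) = Re c * (z \<bullet> z)" for z by (simp add: inner_complex_def algebra_simps)
  then show ?thesis by (simp add: power2_norm_eq_inner inner_vec_def sum_distrib_left)
qed

text \<open>The vector \<open>q(G) v\<close>, formed from iterates of \<open>G\<close> on
  \<open>v\<close>, so that matrix powers do not occur.\<close>

definition poly_apply :: "complex^'n^'n \<Rightarrow> complex poly \<Rightarrow> complex^'n \<Rightarrow> complex^'n" where
  "poly_apply G q v = (\<Sum>i\<le>degree q. coeff q i *s (((*v) G) ^^ i) v)"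

lemma poly_apply_extend:
  "degree q \<le> n \<Longrightarrow> poly_apply G q v = (\<Sum>i\<le>n. coeff q i *s (((*v) G) ^^ i) v)"
  unfolding poly_apply_def by (intro sum.mono_neutral_left) (auto simp: coeff_eq_0)

lemma matrix_funpow_linear:
  fixes G :: "complex^'n^'n"
  shows "(((*v) G) ^^ i) (u - c *s v) = (((*v) G) ^^ i) u - c *s (((*v) G) ^^ i) v"
  by (induction i) (auto simp: matrix_vector_mult_diff_distrib vector_scalar_commute)

text \<open>A linear factor is moved from the polynomial to the vector. This shortens the list of
  roots in the induction over them.\<close>

lemma poly_apply_root:
  "poly_apply G ([:-l, 1:] * q) v = poly_apply G q ((G - mat l) *v v)"
proof -
  let ?n = "Suc (degree q)" and ?G = "\<lambda>i. ((*v) G) ^^ i"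
  have d: "degree ([:-l, 1:] * q) \<le> ?n"
    by (rule order_trans[OF degree_mult_le]) simp
  have c: "coeff ([:-l, 1:] * q) i = (case i of 0 \<Rightarrow> 0 | Suc j \<Rightarrow> coeff q j) - l * coeff q i" for i
    by (simp add: coeff_pCons split: nat.split)
  have "poly_apply G ([:-l, 1:] * q) v = (\<Sum>i\<le>?n. coeff ([:-l, 1:] * q) i *s ?G i v)"
    by (rule poly_apply_extend[OF d])
  also have "\<dots> = (\<Sum>i\<le>?n. (case i of 0 \<Rightarrow> 0 | Suc j \<Rightarrow> coeff q j) *s ?G i v) - (\<Sum>i\<le>?n. (l * coeff q i) *s ?G i v)"
    unfolding c by (simp only: vector_sub_rdistrib sum_subtractf)
  also have "(\<Sum>i\<le>?n. (case i of 0 \<Rightarrow> 0 | Suc j \<Rightarrow> coeff q j) *s ?G i v) = (\<Sum>i\<le>degree q. coeff q i *s ?G (Suc i) v)"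
    by (subst sum.atMost_Suc_shift) simp
  also have "(\<Sum>i\<le>?n. (l * coeff q i) *s ?G i v) = (\<Sum>i\<le>degree q. (l * coeff q i) *s ?G i v)"
    by (simp add: coeff_eq_0)
  also have "(\<Sum>i\<le>degree q. coeff q i *s ?G (Suc i) v) - (\<Sum>i\<le>degree q. (l * coeff q i) *s ?G i v)
    = (\<Sum>i\<le>degree q. coeff q i *s ?G i (G *v v - l *s v))"
    unfolding sum_subtractf[symmetric] matrix_funpow_linear funpow_Suc_right comp_def
    by (intro sum.cong refl) (simp add: vector_ssub_ldistrib vector_smult_assoc mult.commute)
  finally show ?thesis
    by (simp add: poly_apply_def matrix_vector_mult_diff_rdistrib mat_vector_mult)
qed

text \<open>Dimension count: \<open>N + 1\<close> powers of \<open>G\<close> in a real vector space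
  of dimension \<open>N\<close> are linearly dependent, and a dependence relation is a
  polynomial.\<close>

lemma annihilating_polynomial:
  fixes G :: "complex^'n^'n"
  obtains q where "q \<noteq> 0" "\<And>v. poly_apply G q v = 0"
proof -
  define pw where "pw i = (((**) G) ^^ i) (mat 1)" for i
  have pw: "pw i *v v = (((*v) G) ^^ i) v" for i v
    by (induction i) (auto simp: pw_def matrix_vector_mul_assoc[symmetric])
  define N where "N = DIM(complex^'n^'n)"
  have "\<exists>c :: nat \<Rightarrow> real. (\<exists>i\<le>N. c i \<noteq> 0) \<and> (\<Sum>i\<le>N. c i *\<^sub>R pw i) = 0"
  \<comment> \<open>\<open>dependent\<close> speaks about a set of matrices. If two of the powers
    coincide, the relation is their difference.\<close>
  proof (cases "inj_on pw {..N}")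
    case True
    have "dependent (pw ` {..N})"
      using True by (intro dependent_biggerset) (simp_all add: card_image N_def)
    then obtain u where u: "\<exists>v\<in>pw ` {..N}. u v \<noteq> 0" "(\<Sum>v\<in>pw ` {..N}. u v *\<^sub>R v) = 0"
      by (subst (asm) real_vector.dependent_finite) auto
    then show ?thesis using True by (intro exI[of _ "\<lambda>i. u (pw i)"]) (auto simp: sum.reindex)
  next
    case False
    then obtain i j where ij: "i \<le> N" "j \<le> N" "i \<noteq> j" "pw i = pw j" by (auto simp: inj_on_def)
    define c :: "nat \<Rightarrow> real" where "c k = (if k = i then 1 else 0) - (if k = j then 1 else 0)" for k
    have "(\<Sum>k\<le>N. c k *\<^sub>R pw k) = (\<Sum>k\<le>N. if k = i then pw k else 0) - (\<Sum>k\<le>N. if k = j then pw k else 0)"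
      unfolding sum_subtractf[symmetric] c_def by (intro sum.cong) (auto simp: scaleR_diff_left)
    also have "\<dots> = 0" using ij by simp
    finally show ?thesis using ij by (intro exI[of _ c]) (auto simp: c_def intro!: exI[of _ i])
  qed
  then obtain c i0 where c: "i0 \<le> N" "c i0 \<noteq> 0" "(\<Sum>i\<le>N. c i *\<^sub>R pw i) = 0" by blast
  define q where "q = (\<Sum>i\<le>N. monom (complex_of_real (c i)) i)"
  have cq: "coeff q i = (if i \<le> N then complex_of_real (c i) else 0)" for i
    by (simp add: q_def coeff_sum)
  have "degree q \<le> N" by (rule degree_le) (simp add: cq)
  have "poly_apply G q v = 0" for v
  proof -
    have "poly_apply G q v = (\<Sum>i\<le>N. c i *\<^sub>R (pw i *v v))"
      unfolding poly_apply_extend[OF \<open>degree q \<le> N\<close>] pw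
      by (intro sum.cong refl) (simp add: cq vec_eq_iff complex_eq_iff)
    also have "\<dots> = (\<Sum>i\<le>N. c i *\<^sub>R pw i) *v v"
      by (simp add: vec_eq_iff matrix_vector_mult_def sum_distrib_right scaleR_sum_right sum.swap[of _ "{..N}"])
    finally show ?thesis by (simp add: c)
  qed
  moreover have "q \<noteq> 0" using c cq[of i0] by auto
  ultimately show ?thesis by (rule that[rotated])
qed

text \<open>Induction on the roots: \<open>w = (G - l) y\<close> is square integrable, and \<open>y\<close> is either \<open>(G - l)\<^sup>-\<^sup>1 w\<close>, or
  it solves \<open>y' = l y + w\<close> with \<open>Re l < 0\<close> and is controlled by an energy estimate.\<close>

lemma stable_chain_square_integrable:
  fixes G :: "complex^'n^'n"
  assumes stable: "\<And>l. \<not> invertible (mat l - G) \<Longrightarrow> Re l < 0"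
  shows "linear_ode ((*v) G) y \<Longrightarrow> (\<And>t. 0 \<le> t \<Longrightarrow> poly_apply G (\<Prod>l\<leftarrow>ls. [:-l, 1:]) (y t) = 0) \<Longrightarrow>
    \<exists>C. \<forall>T\<ge>0. (\<integral>s. (norm (y s))\<^sup>2 \<partial>time_measure T) \<le> C"
proof (induction ls arbitrary: y)
  case Nil
  then have "y t = 0" if "0 \<le> t" for t using that by (simp add: poly_apply_def)
  then have "(\<integral>s. (norm (y s))\<^sup>2 \<partial>time_measure T) = 0" for T
    by (subst Bochner_Integration.integral_cong[OF refl, of _ _ "\<lambda>_. 0"]) auto
  then show ?case by (intro exI[of _ 0]) simp
next
  case (Cons l ls)
  define w where "w t = (G - mat l) *v y t" for t
  note bl = matrix_vector_mul_bounded_linear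
  have w: "linear_ode ((*v) G) w"
    unfolding w_def
    by (rule linear_ode_compose[OF Cons.prems(1) bl])
       (simp add: matrix_vector_mult_diff_rdistrib matrix_vector_mult_diff_distrib mat_vector_mult vector_scalar_commute)
  have "poly_apply G (\<Prod>l\<leftarrow>ls. [:-l, 1:]) (w t) = 0" if "0 \<le> t" for t
    unfolding w_def poly_apply_root[symmetric] using Cons.prems(2)[OF that] by simp
  from Cons.IH[OF w this] obtain C where C: "\<And>T. 0 \<le> T \<Longrightarrow> (\<integral>s. (norm (w s))\<^sup>2 \<partial>time_measure T) \<le> C" by auto
  have ci: "integrable (time_measure T) (\<lambda>s. (norm (z s))\<^sup>2)" if "linear_ode ((*v) G) z" for z T
    using linear_ode_continuous[OF that] by (intro continuous_on_time_measure(1) continuous_intros)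
  show ?case
  proof (cases "invertible (mat l - G)")
    case True
    then obtain B where B: "B ** (mat l - G) = mat 1" using invertible_left_inverse by blast
    have y: "y t = - (B *v w t)" for t
    proof -
      have "w t = - ((mat l - G) *v y t)" by (simp add: w_def matrix_vector_mult_diff_rdistrib)
      then have "B *v w t = - (B *v ((mat l - G) *v y t))"
        using linear_neg[OF bounded_linear.linear[OF bl[of B]]] by simp
      then show ?thesis by (simp add: matrix_vector_mul_assoc B)
    qed
    obtain K where K: "\<And>v. norm (B *v v) \<le> norm v * K" using bl[of B] bounded_linear.bounded by blast
    have "(\<integral>s. (norm (y s))\<^sup>2 \<partial>time_measure T) \<le> K\<^sup>2 * C" if T: "0 \<le> T" for T
    proof -
      have "(\<integral>s. (norm (y s))\<^sup>2 \<partial>time_measure T) \<le> (\<integral>s. K\<^sup>2 * (norm (w s))\<^sup>2 \<partial>time_measure T)"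
      proof (rule integral_mono)
        show "(norm (y s))\<^sup>2 \<le> K\<^sup>2 * (norm (w s))\<^sup>2" for s
          using power_mono[OF K[of "w s"], of 2] by (simp add: y power_mult_distrib mult.commute)
      qed (use ci[OF Cons.prems(1)] ci[OF w] in auto)
      also have "\<dots> \<le> K\<^sup>2 * C" using C[OF T] by (simp add: mult_left_mono)
      finally show ?thesis .
    qed
    then show ?thesis by blast
  next
    case False
    define a where "a = - Re l"
    have a: "0 < a" using stable[OF False] by (simp add: a_def)
    have "(\<integral>s. (norm (y s))\<^sup>2 \<partial>time_measure T) \<le> ((norm (y 0))\<^sup>2 + C / a) / a" if T: "0 \<le> T" for T
    proof -
      have "- (norm (y 0))\<^sup>2 \<le> (\<integral>s. 2 * (y s \<bullet> (G *v y s)) \<partial>time_measure T)"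
        using linear_ode_energy[OF bl Cons.prems(1) T] by simp
      \<comment> \<open>Young's inequality with weight \<open>a\<close>: the term
        \<open>2 * (y \<bullet> w)\<close> uses up half of the dissipation
        \<open>2 * a * (norm y)\<^sup>2\<close>.\<close>
      also have "\<dots> \<le> (\<integral>s. (1 / a) * (norm (w s))\<^sup>2 - a * (norm (y s))\<^sup>2 \<partial>time_measure T)"
      proof (rule integral_mono)
        have "continuous_on {0..} (\<lambda>s. G *v y s)"
          by (rule bounded_linear.continuous_on[OF bl linear_ode_continuous[OF Cons.prems(1)]])
        then show "integrable (time_measure T) (\<lambda>s. 2 * (y s \<bullet> (G *v y s)))"
          using linear_ode_continuous[OF Cons.prems(1)] by (intro continuous_on_time_measure(1) continuous_intros)
        fix s
        have "G *v y s = l *s y s + w s" by (simp add: w_def matrix_vector_mult_diff_rdistrib mat_vector_mult)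
        then have 1: "2 * (y s \<bullet> (G *v y s)) = - 2 * a * (norm (y s))\<^sup>2 + 2 * (y s \<bullet> w s)"
          by (simp add: inner_add_right complex_vector_inner_smult a_def)
        have "0 \<le> (norm (a *\<^sub>R y s - w s))\<^sup>2" by simp
        also have "(norm (a *\<^sub>R y s - w s))\<^sup>2 = a * (a * (norm (y s))\<^sup>2 - 2 * (y s \<bullet> w s) + (1 / a) * (norm (w s))\<^sup>2)"
          using a by (simp add: power2_norm_eq_inner inner_diff inner_commute algebra_simps)
        finally have "0 \<le> a * (norm (y s))\<^sup>2 - 2 * (y s \<bullet> w s) + (1 / a) * (norm (w s))\<^sup>2"
          using a by (simp add: zero_le_mult_iff)
        then show "2 * (y s \<bullet> (G *v y s)) \<le> (1 / a) * (norm (w s))\<^sup>2 - a * (norm (y s))\<^sup>2"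
          unfolding 1 by linarith
      qed (use ci[OF Cons.prems(1)] ci[OF w] in simp)
      also have "\<dots> = (1 / a) * (\<integral>s. (norm (w s))\<^sup>2 \<partial>time_measure T) - a * (\<integral>s. (norm (y s))\<^sup>2 \<partial>time_measure T)"
        using ci[OF Cons.prems(1)] ci[OF w] by simp
      also have "\<dots> \<le> (1 / a) * C - a * (\<integral>s. (norm (y s))\<^sup>2 \<partial>time_measure T)"
        using C[OF T] a by (intro diff_right_mono mult_left_mono) auto
      finally have "a * (\<integral>s. (norm (y s))\<^sup>2 \<partial>time_measure T) \<le> (norm (y 0))\<^sup>2 + C / a" by simp
      then show ?thesis using a by (simp add: pos_le_divide_eq mult.commute)
    qed
    then show ?thesis by blast
  qed
qed

definition complexify :: "real^'n \<Rightarrow> complex^'n" where "complexify v = (\<chi> i. complex_of_real (v $ i))"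

lemma bounded_linear_complexify: "bounded_linear complexify"
  by (intro linear_conv_bounded_linear[THEN iffD1] linearI) (auto simp: complexify_def vec_eq_iff complex_eq_iff)

lemma norm_complexify: "norm (complexify v) = norm v"
  by (simp add: complexify_def norm_vec_def L2_set_def)

lemma complexify_mult: "complexify (A *v v) = map_matrix complex_of_real A *v complexify v"
  by (simp add: complexify_def vec_eq_iff matrix_vector_mult_def map_matrix_def)

text \<open>Complexification keeps norms and turns solutions into solutions, and over the complex
  numbers an annihilating polynomial splits into linear factors. Its roots need not be eigenvalues,
  which is why the induction over the roots also treats an invertible
  \<open>mat l - G\<close>.\<close>

theorem hurwitz_square_integrable:
  fixes A :: "real^'n^'n"
  assumes "matrix_spectrum A \<subseteq> {z. Re z < 0}" and y: "linear_ode ((*v) A) y"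
  shows "\<exists>C. \<forall>T\<ge>0. (\<integral>s. (norm (y s))\<^sup>2 \<partial>time_measure T) \<le> C"
proof -
  let ?G = "map_matrix complex_of_real A"
  have stable: "Re l < 0" if "\<not> invertible (mat l - ?G)" for l
    using assms(1) that by (auto simp: matrix_spectrum_def)
  have ode: "linear_ode ((*v) ?G) (\<lambda>t. complexify (y t))"
    by (rule linear_ode_compose[where L=complexify, OF y bounded_linear_complexify]) (rule complexify_mult)
  obtain q where q: "q \<noteq> 0" "\<And>v. poly_apply ?G q v = 0" using annihilating_polynomial[of ?G] by blast
  obtain R where R: "q = smult (lead_coeff q) (\<Prod>x\<in>#R. [:-x, 1:])"
    using alg_closed_imp_factorization[OF q(1)] by blast
  obtain ls where ls: "mset ls = R" using ex_mset by blast
  have "poly_apply ?G (\<Prod>l\<leftarrow>ls. [:-l, 1:]) v = 0" for v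
  proof -
    let ?p = "\<Prod>l\<leftarrow>ls. [:-l, 1:]"
    have "(\<Prod>x\<in>#R. [:-x, 1:]) = ?p" unfolding ls[symmetric] mset_map[symmetric] by (rule prod_mset_prod_list)
    with R have R': "q = smult (lead_coeff q) ?p" by (simp only:)
    have "poly_apply ?G q v = lead_coeff q *s poly_apply ?G ?p v"
    proof -
      have lc: "lead_coeff q \<noteq> 0" using q(1) by simp
      have d: "degree q = degree ?p" using arg_cong[OF R', of degree] lc by (simp only: degree_smult_eq if_False)
      have c: "coeff q i = lead_coeff q * coeff ?p i" for i using arg_cong[OF R', of "\<lambda>p. coeff p i"] by (simp only: coeff_smult)
      show ?thesis
        unfolding poly_apply_def d vec.scale_sum_right vector_smult_assoc
        by (intro sum.cong refl arg_cong2[where f="(*s)"] c[unfolded d])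
    qed
    then show ?thesis using q by (simp add: vec.scale_eq_0_iff)
  qed
  from stable_chain_square_integrable[OF stable ode this] show ?thesis by (simp add: norm_complexify)
qed

lemma left_eigenvector:
  fixes A :: "complex^'n^'n"
  assumes "\<not> invertible A"
  obtains w where "w \<noteq> 0" "\<And>v. (\<Sum>i\<in>UNIV. w $ i * (A *v v) $ i) = 0"
proof -
  have "\<not> (\<exists>B. B ** transpose A = mat 1)"
  proof
    assume "\<exists>B. B ** transpose A = mat 1"
    then obtain B where "B ** transpose A = mat 1" by blast
    then have "A ** transpose B = mat 1" by (metis matrix_transpose_mul transpose_mat transpose_transpose)
    then show False using assms matrix_left_right_inverse invertible_left_inverse by blast
  qed
  then obtain w where w: "transpose A *v w = 0" "w \<noteq> 0" unfolding matrix_left_invertible_ker by blast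
  have "(\<Sum>i\<in>UNIV. w $ i * (A *v v) $ i) = 0" for v
  proof -
    have "(\<Sum>i\<in>UNIV. w $ i * (A *v v) $ i) = (\<Sum>j\<in>UNIV. (transpose A *v w) $ j * v $ j)"
      unfolding matrix_vector_mult_def transpose_def vec_lambda_beta sum_distrib_left sum_distrib_right
      by (subst sum.swap) (intro sum.cong refl, simp add: mult_ac)
    then show ?thesis using w by simp
  qed
  with w(2) show ?thesis by (rule that)
qed

text \<open>Paired with a left eigenvector for \<open>z\<close>, a solution grows like \<open>exp (t z)\<close>.\<close>

theorem spectrum_of_square_integrable:
  fixes A :: "real^'n^'n"
  assumes "\<And>x. \<exists>y. linear_ode ((*v) A) y \<and> y 0 = x \<and> (\<exists>C. \<forall>T\<ge>0. (\<integral>s. (norm (y s))\<^sup>2 \<partial>time_measure T) \<le> C)"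
  shows "matrix_spectrum A \<subseteq> {z. Re z < 0}"
proof
  fix z assume "z \<in> matrix_spectrum A"
  then have "\<not> invertible (mat z - map_matrix complex_of_real A)" by (simp add: matrix_spectrum_def)
  then obtain w where w: "w \<noteq> 0" "\<And>v. (\<Sum>i\<in>UNIV. w $ i * ((mat z - map_matrix complex_of_real A) *v v) $ i) = 0"
    using left_eigenvector by blast
  obtain j where j: "w $ j \<noteq> 0" using w(1) by (auto simp: vec_eq_iff)
  define L where "L v = (\<Sum>i\<in>UNIV. w $ i * complexify v $ i)" for v :: "real^'n"
  have L: "bounded_linear L"
    unfolding L_def
    by (intro bounded_linear_sum bounded_linear_const_mult bounded_linear_compose[OF bounded_linear_vec_nth bounded_linear_complexify])
  have LA: "L (A *v v) = z * L v" for v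
  proof -
    have "0 = (\<Sum>i\<in>UNIV. w $ i * (z * complexify v $ i - complexify (A *v v) $ i))"
      using w(2)[of "complexify v"] by (simp add: matrix_vector_mult_diff_rdistrib mat_vector_mult complexify_mult)
    then show ?thesis by (simp add: L_def right_diff_distrib sum_subtractf sum_distrib_left mult_ac)
  qed
  \<comment> \<open>Starting at \<open>axis j 1\<close> makes the pairing with the left eigenvector
    equal to \<open>w $ j\<close>, which is not 0, at time 0.\<close>
  obtain y C where y: "linear_ode ((*v) A) y" "y 0 = axis j 1" and C: "\<And>T. 0 \<le> T \<Longrightarrow> (\<integral>s. (norm (y s))\<^sup>2 \<partial>time_measure T) \<le> C"
    using assms[of "axis j 1"] by blast
  have ode: "linear_ode (\<lambda>u. z * u) (\<lambda>t. L (y t))" by (rule linear_ode_compose[OF y(1) L LA])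
  have L0: "L (y 0) = w $ j"
    unfolding y L_def complexify_def by (simp add: axis_def if_distrib cong: if_cong)
  show "z \<in> {z. Re z < 0}"
  proof (rule ccontr)
    assume "z \<notin> {z. Re z < 0}"
    then have z: "0 \<le> Re z" by simp
    obtain K where K: "0 < K" "\<And>v. norm (L v) \<le> norm v * K" using bounded_linear.pos_bounded[OF L] by blast
    define \<epsilon> where "\<epsilon> = (norm (w $ j) / K)\<^sup>2"
    have \<epsilon>: "0 < \<epsilon>" using K j by (simp add: \<epsilon>_def)
    have low: "\<epsilon> \<le> (norm (y t))\<^sup>2" if t: "0 \<le> t" for t
    proof -
      have "0 \<le> (\<integral>s. 2 * (L (y s) \<bullet> (z * L (y s))) \<partial>time_measure t)"
        using z by (intro integral_nonneg_AE) (auto simp: inner_complex_def algebra_simps intro!: AE_I2 mult_nonneg_nonneg add_nonneg_nonneg)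
      then have "(norm (L (y 0)))\<^sup>2 \<le> (norm (L (y t)))\<^sup>2"
        using linear_ode_energy[OF bounded_linear_mult_right ode t] by linarith
      then have "norm (w $ j) \<le> norm (L (y t))" unfolding L0 by (rule power2_le_imp_le) simp
      also have "\<dots> \<le> norm (y t) * K" by (rule K)
      finally have "norm (w $ j) / K \<le> norm (y t)" using K by (simp add: pos_divide_le_eq)
      then show ?thesis unfolding \<epsilon>_def using K by (intro power_mono) auto
    qed
    have ci: "integrable (time_measure T) (\<lambda>s. (norm (y s))\<^sup>2)" for T
      using linear_ode_continuous[OF y(1)] by (intro continuous_on_time_measure(1) continuous_intros)
    have "T * \<epsilon> \<le> C" if T: "0 \<le> T" for T
    proof -
      interpret T: finite_measure "time_measure T" by (rule finite_measure_time_measure)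
      have "T * \<epsilon> = (\<integral>s. \<epsilon> \<partial>time_measure T)" using measure_time_measure[of "{0..T}" T] T by simp
      also have "\<dots> \<le> (\<integral>s. (norm (y s))\<^sup>2 \<partial>time_measure T)" using low ci by (intro integral_mono) auto
      also have "\<dots> \<le> C" by (rule C[OF T])
      finally show ?thesis .
    qed
    from this[of "(\<bar>C\<bar> + 1) / \<epsilon>"] show False using \<epsilon> by simp
  qed
qed

section \<open>The Lyapunov operator\<close>

definition outer :: "real^'n \<Rightarrow> real^'n \<Rightarrow> real^'n^'n" where "outer u v = (\<chi> i j. u $ i * v $ j)"

text \<open>For \<open>dX = A X dt + C X dW\<close> the matrix \<open>E X X\<^sup>T\<close> has this
  derivative: the first two terms come from the drift in either factor, the third from the
  isometry.\<close>

definition lyapunov :: "real^'n^'n \<Rightarrow> real^'n^'n \<Rightarrow> real^'n^'n \<Rightarrow> real^'n^'n" where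
  "lyapunov A C S = A ** S + S ** transpose A + C ** S ** transpose C"

lemma bounded_bilinear_outer: "bounded_bilinear outer"
  by (rule bilinear_conv_bounded_bilinear[THEN iffD1])
    (auto simp: bilinear_def outer_def vec_eq_iff algebra_simps intro!: linearI)

lemma outer_mult: "outer (A *v u) v = A ** outer u v" "outer u (A *v v) = outer u v ** transpose A"
  by (auto simp: outer_def vec_eq_iff matrix_vector_mult_def matrix_matrix_mult_def transpose_def
      sum_distrib_left sum_distrib_right mult_ac intro!: sum.cong)

lemma transpose_outer: "transpose (outer u u) = outer u u"
  by (simp add: outer_def transpose_def vec_eq_iff mult.commute)

lemma trace_outer: "trace (outer u u) = (norm u)\<^sup>2"
  by (simp add: trace_def outer_def power2_norm_eq_inner inner_vec_def)

lemma bounded_linear_matrix_mult: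
  fixes A :: "real^'n^'m"
  shows "bounded_linear (\<lambda>S :: real^'k^'n. A ** S)" "bounded_linear (\<lambda>S :: real^'m^'k. S ** A)"
  by (intro linear_conv_bounded_linear[THEN iffD1] linearI;
      simp add: vec_eq_iff matrix_matrix_mult_def distrib_left distrib_right sum.distrib sum_distrib_left mult_ac)+

lemma bounded_linear_transpose: "bounded_linear (transpose :: real^'n^'m \<Rightarrow> _)"
  by (intro linear_conv_bounded_linear[THEN iffD1] linearI) (auto simp: vec_eq_iff transpose_def)

lemma bounded_linear_trace: "bounded_linear (trace :: real^'n^'n \<Rightarrow> real)"
  by (intro linear_conv_bounded_linear[THEN iffD1] linearI) (auto simp: trace_def sum.distrib sum_distrib_left)

lemma bounded_linear_lyapunov: "bounded_linear (lyapunov A C)"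
  unfolding lyapunov_def[abs_def]
  by (intro bounded_linear_add bounded_linear_matrix_mult bounded_linear_compose[OF bounded_linear_matrix_mult(2) bounded_linear_matrix_mult(1)])

text \<open>Polarization: the symmetric part of \<open>outer u v\<close> is a combination of
  matrices \<open>outer w w\<close>, the remaining part is antisymmetric, and the products
  \<open>outer u v\<close> span all matrices.\<close>

lemma span_outer_antisymmetric:
  fixes V :: "(real^'n^'n) set"
  assumes V: "subspace V" and o: "\<And>u. outer u u \<in> V" and a: "\<And>S. transpose S = - S \<Longrightarrow> S \<in> V"
  shows "V = UNIV"
proof -
  have uv: "outer u v \<in> V" for u v
  proof -
    interpret bounded_bilinear outer by (rule bounded_bilinear_outer)
    have t: "transpose (outer u v - outer v u) = - (outer u v - outer v u)"
      by (simp add: outer_def transpose_def vec_eq_iff mult.commute)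
    have "outer u v = (1/2) *\<^sub>R (outer (u + v) (u + v) - outer u u - outer v v) + (1/2) *\<^sub>R (outer u v - outer v u)"
      by (simp add: add_left add_right algebra_simps flip: scaleR_add_left)
    also have "\<dots> \<in> V" by (intro subspace_add[OF V] subspace_scale[OF V] subspace_diff[OF V] o a t)
    finally show ?thesis .
  qed
  have "S \<in> V" for S
  proof -
    have "S = (\<Sum>i\<in>UNIV. outer (axis i 1) (S $ i))"
      by (simp add: vec_eq_iff outer_def axis_def if_distrib[of "\<lambda>x. x * _"] cong: if_cong)
    also have "\<dots> \<in> V" by (rule subspace_sum[OF V uv])
    finally show ?thesis .
  qed
  then show ?thesis by auto
qed

text \<open>Integrability makes the time integrals of \<open>P\<close> converge, so by the equation
  \<open>P t\<close> itself converges. An integrable function can only converge to 0, and the limit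
  of the equation is then the Lyapunov equation.\<close>

lemma lyapunov_limit:
  fixes P :: "real \<Rightarrow> real^'n^'n"
  assumes eq: "\<And>t. 0 \<le> t \<Longrightarrow> P t = S + (\<integral>s. lyapunov A C (P s) \<partial>time_measure t)"
    and i: "\<And>T. integrable (time_measure T) P"
    and c: "\<And>T. 0 \<le> T \<Longrightarrow> (\<integral>s. norm (P s) \<partial>time_measure T) \<le> c"
  shows "set_integrable lborel {0..} P" "lyapunov A C (\<integral>s\<in>{0..}. P s \<partial>lborel) = - S"
proof -
  note bl = bounded_linear_lyapunov[of A C]
  have eq': "P t = S + lyapunov A C (\<integral>s. P s \<partial>time_measure t)" if "0 \<le> t" for t
    using eq[OF that] integral_bounded_linear[OF bl i] by simp
  have cont: "continuous_on {0..} P"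
  proof -
    have "continuous_on {0..} (\<lambda>t. S + lyapunov A C (\<integral>s. P s \<partial>time_measure t))"
      by (intro continuous_intros bounded_linear.continuous_on[OF bl] continuous_on_indefinite_integral i)
    then show ?thesis by (subst continuous_on_cong[OF refl]) (auto simp: eq')
  qed
  have m: "(\<lambda>t. indicator {0..} t *\<^sub>R P t) \<in> borel_measurable lborel"
    using borel_measurable_continuous_on_indicator[OF _ cont] by simp
  have "(\<integral>\<^sup>+t. ennreal (norm (indicator {0..} t *\<^sub>R P t)) \<partial>lborel) \<le> ennreal c"
  proof -
    let ?f = "\<lambda>n t. ennreal (norm (indicator {0..real n} t *\<^sub>R P t))"
    have "(\<integral>\<^sup>+t. ennreal (norm (indicator {0..} t *\<^sub>R P t)) \<partial>lborel) = (\<integral>\<^sup>+t. (SUP n. ?f n t) \<partial>lborel)"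
    proof (intro nn_integral_cong antisym)
      fix t :: real
      obtain n :: nat where n: "t \<le> real n" using real_arch_simple by blast
      have "ennreal (norm (indicator {0..} t *\<^sub>R P t)) = ?f n t" using n by (auto simp: indicator_def)
      then show "ennreal (norm (indicator {0..} t *\<^sub>R P t)) \<le> (SUP n. ?f n t)" by (auto intro: SUP_upper2)
      show "(SUP n. ?f n t) \<le> ennreal (norm (indicator {0..} t *\<^sub>R P t))" by (intro SUP_least) (auto simp: indicator_def)
    qed
    also have "\<dots> = (SUP n. \<integral>\<^sup>+t. ?f n t \<partial>lborel)"
    proof (rule nn_integral_monotone_convergence_SUP)
      show "incseq ?f" by (intro incseq_SucI le_funI) (auto simp: indicator_def)
      fix n
      have "set_integrable lborel {0..real n} P" using i by (simp add: integrable_time_measure)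
      then show "?f n \<in> borel_measurable lborel" unfolding set_integrable_def
        by (rule measurable_compose[OF measurable_compose[OF borel_measurable_integrable borel_measurable_norm] measurable_ennreal])
    qed
    also have "\<dots> \<le> ennreal c"
    proof (rule SUP_least)
      fix n
      have s: "set_integrable lborel {0..real n} P" using i by (simp add: integrable_time_measure)
      have "(\<integral>\<^sup>+t. ?f n t \<partial>lborel) = ennreal (\<integral>t. norm (indicator {0..real n} t *\<^sub>R P t) \<partial>lborel)"
        by (rule nn_integral_eq_integral[OF integrable_norm[OF s[unfolded set_integrable_def]]]) simp
      also have "(\<integral>t. norm (indicator {0..real n} t *\<^sub>R P t) \<partial>lborel) = (\<integral>s. norm (P s) \<partial>time_measure (real n))"
        by (simp add: integral_time_measure set_lebesgue_integral_def)
      finally show "(\<integral>\<^sup>+t. ?f n t \<partial>lborel) \<le> ennreal c" using c[of "real n"] by (simp add: ennreal_leI)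
    qed
    finally show ?thesis .
  qed
  with m show si: "set_integrable lborel {0..} P"
    unfolding set_integrable_def by (intro integrableI_bounded) (auto intro: order.strict_trans1)
  let ?J = "\<integral>s\<in>{0..}. P s \<partial>lborel" and ?L = "S + lyapunov A C (\<integral>s\<in>{0..}. P s \<partial>lborel)"
  have "((\<lambda>t. \<integral>s. P s \<partial>time_measure t) \<longlongrightarrow> ?J) at_top"
  proof -
    have "((\<lambda>y. \<integral>s. indicator {..y} s *\<^sub>R (indicator {0..} s *\<^sub>R P s) \<partial>lborel) \<longlongrightarrow> ?J) at_top"
      unfolding set_lebesgue_integral_def
      by (rule tendsto_integral_at_top) (use si in \<open>auto simp: set_integrable_def\<close>)
    moreover have "(\<integral>s. indicator {..y} s *\<^sub>R (indicator {0..} s *\<^sub>R P s) \<partial>lborel) = (\<integral>s. P s \<partial>time_measure y)" for y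
      unfolding integral_time_measure set_lebesgue_integral_def
      by (intro Bochner_Integration.integral_cong) (auto simp: indicator_def)
    ultimately show ?thesis by simp
  qed
  then have "((\<lambda>t. S + lyapunov A C (\<integral>s. P s \<partial>time_measure t)) \<longlongrightarrow> ?L) at_top"
    by (intro tendsto_intros bounded_linear.tendsto[OF bl])
  then have lim: "(P \<longlongrightarrow> ?L) at_top"
    by (rule Lim_transform_eventually) (auto simp: eq'[symmetric] intro: eventually_mono[OF eventually_ge_at_top[of 0]])
  have "?L = 0"
  proof (rule ccontr)
    assume "?L \<noteq> 0"
    define \<epsilon> where "\<epsilon> = norm ?L / 2"
    have \<epsilon>: "0 < \<epsilon>" "\<epsilon> < norm ?L" using \<open>?L \<noteq> 0\<close> by (simp_all add: \<epsilon>_def)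
    have "\<forall>\<^sub>F t in at_top. \<epsilon> < norm (P t)" by (rule order_tendstoD(1)[OF tendsto_norm[OF lim] \<epsilon>(2)])
    then obtain T0 where T0: "\<And>t. T0 \<le> t \<Longrightarrow> \<epsilon> < norm (P t)" by (auto simp: eventually_at_top_linorder)
    define T1 where "T1 = max 0 T0"
    have "T * \<epsilon> \<le> c" if T: "0 \<le> T" for T
    proof -
      interpret T: finite_measure "time_measure (T1 + T)" by (rule finite_measure_time_measure)
      have A: "{T1..T1 + T} \<subseteq> {0..T1 + T}" by (auto simp: T1_def)
      then have A': "{T1..T1 + T} \<in> sets (time_measure (T1 + T))"
        by (auto simp: sets_time_measure sets_restrict_space intro!: image_eqI[of _ _ "{T1..T1 + T}"])
      have "T * \<epsilon> = (\<integral>s. indicator {T1..T1 + T} s * \<epsilon> \<partial>time_measure (T1 + T))"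
        using measure_time_measure[OF _ A] A' T A by (simp add: Int_absorb2 Int_absorb1)
      also have "\<dots> \<le> (\<integral>s. norm (P s) \<partial>time_measure (T1 + T))"
      proof (rule integral_mono)
        show "integrable (time_measure (T1 + T)) (\<lambda>s. indicator {T1..T1 + T} s * \<epsilon>)"
          using integrable_mult_indicator[OF A', of "\<lambda>_. \<epsilon>"] by simp
        show "indicator {T1..T1 + T} s * \<epsilon> \<le> norm (P s)" for s
          using T0[of s] by (auto simp: indicator_def T1_def)
      qed (use i in simp)
      also have "\<dots> \<le> c" using T by (intro c) (auto simp: T1_def)
      finally show ?thesis .
    qed
    from this[of "(\<bar>c\<bar> + 1) / \<epsilon>"] show False using \<epsilon> by simp
  qed
  then show "lyapunov A C ?J = - S" by (simp add: eq_neg_iff_add_eq_0 add.commute)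
qed

text \<open>Integrating \<open>P' = L P\<close> over time solves \<open>L J = - outer x x\<close>. Since the matrices \<open>outer x x\<close> span the
  symmetric ones, \<open>L\<close> is onto, hence invertible, there; it is extended by the identity on
  antisymmetric matrices to get an operator on the whole space.\<close>

theorem lyapunov_functional:
  fixes A C :: "real^'n^'n"
  assumes "\<And>x. \<exists>P c. (\<forall>t\<ge>0. P t = outer x x + (\<integral>s. lyapunov A C (P s) \<partial>time_measure t)) \<and>
     (\<forall>T. integrable (time_measure T) P) \<and> (\<forall>T\<ge>0. (\<integral>s. norm (P s) \<partial>time_measure T) \<le> c) \<and>
     (\<forall>t\<ge>0. transpose (P t) = P t \<and> 0 \<le> trace (P t))"
  obtains \<psi> where "bounded_linear \<psi>" "\<And>S. transpose S = S \<Longrightarrow> \<psi> (lyapunov A C S) = - trace S" "\<And>x. 0 \<le> \<psi> (outer x x)"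
proof -
  have J: "\<exists>J. lyapunov A C J = - outer x x \<and> transpose J = J \<and> 0 \<le> trace J" for x
  proof -
    obtain P c where P: "\<And>t. 0 \<le> t \<Longrightarrow> P t = outer x x + (\<integral>s. lyapunov A C (P s) \<partial>time_measure t)"
      "\<And>T. integrable (time_measure T) P" "\<And>T. 0 \<le> T \<Longrightarrow> (\<integral>s. norm (P s) \<partial>time_measure T) \<le> c"
      and s: "\<And>t. 0 \<le> t \<Longrightarrow> transpose (P t) = P t" "\<And>t. 0 \<le> t \<Longrightarrow> 0 \<le> trace (P t)"
      using assms[of x] by blast
    note L = lyapunov_limit[OF P]
    let ?J = "\<integral>s\<in>{0..}. P s \<partial>lborel"
    have i: "integrable lborel (\<lambda>s. indicator {0..} s *\<^sub>R P s)" using L(1) by (simp add: set_integrable_def)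
    have "transpose ?J = (\<integral>s. transpose (indicator {0..} s *\<^sub>R P s) \<partial>lborel)"
      unfolding set_lebesgue_integral_def by (rule integral_bounded_linear[OF bounded_linear_transpose i, symmetric])
    also have "\<dots> = ?J"
      unfolding set_lebesgue_integral_def using s(1)
      by (intro Bochner_Integration.integral_cong) (auto simp: indicator_def linear_0[OF bounded_linear.linear[OF bounded_linear_transpose]])
    finally have t: "transpose ?J = ?J" .
    have "trace ?J = (\<integral>s. trace (indicator {0..} s *\<^sub>R P s) \<partial>lborel)"
      unfolding set_lebesgue_integral_def by (rule integral_bounded_linear[OF bounded_linear_trace i, symmetric])
    also have "0 \<le> \<dots>"
      using s(2) by (intro integral_nonneg_AE AE_I2) (auto simp: indicator_def linear_0[OF bounded_linear.linear[OF bounded_linear_trace]])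
    finally have "0 \<le> trace ?J" .
    with L(2) t show ?thesis by blast
  qed
  define f where "f S = lyapunov A C ((1/2) *\<^sub>R (S + transpose S)) + (1/2) *\<^sub>R (S - transpose S)" for S
  note bt = bounded_linear_transpose
  have f: "linear f"
    unfolding f_def[abs_def]
    by (intro bounded_linear.linear bounded_linear_add bounded_linear_sub
        bounded_linear_compose[OF bounded_linear_lyapunov] bounded_linear_compose[OF bounded_linear_scaleR_right] bounded_linear_ident bt)
  have fs: "f S = lyapunov A C S" if "transpose S = S" for S using that by (simp add: f_def flip: scaleR_add_left scaleR_2)
  have "range f = UNIV"
  proof (rule span_outer_antisymmetric)
    show "subspace (range f)" using f by (intro linear_subspace_image) auto
    show "outer u u \<in> range f" for u
    proof -
      obtain J where J': "lyapunov A C J = - outer u u" "transpose J = J" using J by blast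
      then have "f (- J) = outer u u" using fs[OF J'(2)] linear_neg[OF f, of J] by simp
      then show ?thesis by (metis rangeI)
    qed
    show "S \<in> range f" if "transpose S = - S" for S
    proof -
      have "f S = S" using that
        by (simp add: f_def linear_0[OF bounded_linear.linear[OF bounded_linear_lyapunov]] flip: scaleR_add_left scaleR_2)
      then show ?thesis by (metis rangeI)
    qed
  qed
  then have "inj f" using linear_surjective_imp_injective[OF f] by simp
  then obtain g where g: "linear g" "g \<circ> f = id" using linear_injective_left_inverse[OF f] by blast
  \<comment> \<open>On symmetric matrices \<open>g\<close> inverts the Lyapunov operator, hence
    \<open>\<psi> (outer x x) = trace J\<close>. In the application this is the total energy of the
    solution started at \<open>x\<close>, whence its sign.\<close>
  define \<psi> where "\<psi> S = - trace (g S)" for S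
  have gf: "g (f S) = S" for S using g(2) by (metis comp_apply id_apply)
  show ?thesis
  proof (rule that)
    show "bounded_linear \<psi>"
      unfolding \<psi>_def[abs_def] using g(1)
      by (intro bounded_linear_minus bounded_linear_compose[OF bounded_linear_trace]) (simp add: linear_conv_bounded_linear)
    show "\<psi> (lyapunov A C S) = - trace S" if "transpose S = S" for S
      unfolding \<psi>_def fs[OF that, symmetric] gf ..
    show "0 \<le> \<psi> (outer x x)" for x
    proof -
      obtain J where J': "lyapunov A C J = - outer x x" "transpose J = J" "0 \<le> trace J" using J by blast
      then have "f (- J) = outer x x" using fs[OF J'(2)] linear_neg[OF f, of J] by simp
      then have "g (outer x x) = - J" using gf by metis
      then show ?thesis using J'(3) linear_neg[OF bounded_linear.linear[OF bounded_linear_trace], of J] by (simp add: \<psi>_def)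
    qed
  qed
qed

section \<open>Closed-loop equations\<close>

text \<open>The mean enters the stochastic equation as a time-dependent input, and the Euler scheme
  requires such an input to be Lipschitz on bounded intervals.\<close>

lemma linear_ode_lipschitz:
  fixes m :: "real \<Rightarrow> 'v::euclidean_space"
  assumes f: "bounded_linear f" and m: "linear_ode f m"
  shows "\<exists>B\<ge>0. \<forall>s\<in>{0..T}. \<forall>t\<in>{0..T}. norm (m s - m t) \<le> B * \<bar>s - t\<bar>"
proof -
  have "continuous_on {0..T} (\<lambda>t. f (m t))"
    using bounded_linear.continuous_on[OF f linear_ode_continuous[OF m]] by (rule continuous_on_subset) auto
  then have "bounded ((\<lambda>t. f (m t)) ` {0..T})" by (intro compact_imp_bounded compact_continuous_image) auto
  then obtain B where B: "0 < B" "\<And>t. t \<in> {0..T} \<Longrightarrow> norm (f (m t)) \<le> B" by (auto simp: bounded_pos)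
  have "norm (m s - m t) \<le> B * norm (s - t)" if "s \<in> {0..T}" "t \<in> {0..T}" for s t
  proof (rule differentiable_bound[of "{0..T}" m "\<lambda>t h. h *\<^sub>R f (m t)"])
    fix u assume u: "u \<in> {0..T}"
    show "(m has_derivative (\<lambda>h. h *\<^sub>R f (m u))) (at u within {0..T})"
      using linear_odeD[OF m u] by (simp add: has_vector_derivative_def)
    show "onorm (\<lambda>h. h *\<^sub>R f (m u)) \<le> B"
      by (rule onorm_bound) (use B u in \<open>auto simp: mult.commute[of B] intro!: mult_left_mono\<close>)
  qed (use that in auto)
  then show ?thesis using B(1) by (intro exI[of _ B]) auto
qed

lemma bounded_linear_bound:
  fixes L :: "'v::euclidean_space \<Rightarrow> 'w::euclidean_space"
  assumes "bounded_linear L"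
  obtains K where "0 < K" "\<And>v. norm (L v) \<le> K * norm v"
  using bounded_linear.pos_bounded[OF assms] by (metis mult.commute)

context standard_brownian_motion
begin

lemma lipschitz_sde_linear:
  fixes A C :: "real^'n^'n" and B D :: "real^'k^'n" and m :: "real \<Rightarrow> real^'k"
  assumes m: "\<And>T. \<exists>B\<ge>0. \<forall>s\<in>{0..T}. \<forall>t\<in>{0..T}. norm (m s - m t) \<le> B * \<bar>s - t\<bar>"
  shows "lipschitz_sde M W (\<lambda>t v. A *v v + B *v m t) (\<lambda>t v. C *v v + D *v m t)"
proof unfold_locales
  fix T
  note bl = matrix_vector_mul_bounded_linear
  obtain ka where ka: "0 < ka" "\<And>v. norm (A *v v) \<le> ka * norm v" using bounded_linear_bound[OF bl[of A]] by blast
  obtain kb where kb: "0 < kb" "\<And>v. norm (B *v v) \<le> kb * norm v" using bounded_linear_bound[OF bl[of B]] by blast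
  obtain kc where kc: "0 < kc" "\<And>v. norm (C *v v) \<le> kc * norm v" using bounded_linear_bound[OF bl[of C]] by blast
  obtain kd where kd: "0 < kd" "\<And>v. norm (D *v v) \<le> kd * norm v" using bounded_linear_bound[OF bl[of D]] by blast
  obtain Q where Q: "0 \<le> Q" "\<And>s t. s \<in> {0..T} \<Longrightarrow> t \<in> {0..T} \<Longrightarrow> norm (m s - m t) \<le> Q * \<bar>s - t\<bar>" using m[of T] by blast
  have gen: "norm ((A *v y + B *v m s) - (A *v z + B *v m t)) \<le> (ka + kb * Q) * (\<bar>s - t\<bar> + norm (y - z))"
    if k: "0 < ka" "\<And>v. norm (A *v v) \<le> ka * norm v" "0 < kb" "\<And>v. norm (B *v v) \<le> kb * norm v" and st: "s \<in> {0..T}" "t \<in> {0..T}"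
    for A :: "real^'n^'n" and B :: "real^'k^'n" and ka kb s t and y z :: "real^'n"
  proof -
    have "norm ((A *v y + B *v m s) - (A *v z + B *v m t)) = norm (A *v (y - z) + B *v (m s - m t))"
      by (simp add: matrix_vector_mult_diff_distrib algebra_simps)
    also have "\<dots> \<le> ka * norm (y - z) + kb * norm (m s - m t)"
      by (intro norm_triangle_mono k)
    also have "\<dots> \<le> ka * norm (y - z) + kb * (Q * \<bar>s - t\<bar>)"
      using k Q(2)[OF st] by (intro add_left_mono mult_left_mono) auto
    also have "\<dots> \<le> (ka + kb * Q) * (\<bar>s - t\<bar> + norm (y - z))"
      using k Q(1) by (simp add: algebra_simps)
    finally show ?thesis .
  qed
  have le: "(ka + kb * Q) * (\<bar>s - t\<bar> + norm (y - z)) \<le> (ka + kb * Q + (kc + kd * Q)) * (\<bar>s - t\<bar> + norm (y - z))"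
    "(kc + kd * Q) * (\<bar>s - t\<bar> + norm (y - z)) \<le> (ka + kb * Q + (kc + kd * Q)) * (\<bar>s - t\<bar> + norm (y - z))" for s t and y z :: "real^'n"
    using ka(1) kb(1) kc(1) kd(1) Q(1) by (auto intro!: mult_right_mono)
  show "\<exists>L. \<forall>s\<in>{0..T}. \<forall>t\<in>{0..T}. \<forall>y z.
    norm ((A *v y + B *v m s) - (A *v z + B *v m t)) \<le> L * (\<bar>s - t\<bar> + norm (y - z)) \<and>
    norm ((C *v y + D *v m s) - (C *v z + D *v m t)) \<le> L * (\<bar>s - t\<bar> + norm (y - z))"
    using order_trans[OF gen[OF ka kb] le(1)] order_trans[OF gen[OF kc kd] le(2)]
    by (intro exI[of _ "ka + kb * Q + (kc + kd * Q)"] ballI allI conjI)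
qed

lemma ito_process_square_integrable:
  assumes "ito_process M W x b g X"
  shows "square_integrable (time_measure T \<Otimes>\<^sub>M M) (\<lambda>(s, \<omega>). X s \<omega>)"
proof -
  have X: "\<And>\<omega>. \<omega> \<in> space M \<Longrightarrow> continuous_on {0..} (\<lambda>t. X t \<omega>)" "\<And>t. 0 \<le> t \<Longrightarrow> X t \<in> borel_measurable (F t)"
    "\<And>T. 0 \<le> T \<Longrightarrow> mean_square_energy M {0..T} X < \<infinity>"
    using assms by (auto simp: ito_process_def)
  have m: "(\<lambda>(s, \<omega>). X s \<omega>) \<in> borel_measurable (time_measure T \<Otimes>\<^sub>M M)" for T
    by (rule measurable_continuous_process[OF X(1) measurable_F_M[OF X(2)]])
  \<comment> \<open>\<open>ito_process\<close> bounds the energy for nonnegative horizons; a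
    negative \<open>T\<close> is covered by monotonicity from 0.\<close>
  have "square_integrable (time_measure (max 0 T) \<Otimes>\<^sub>M M) (\<lambda>(s, \<omega>). X s \<omega>)"
    using m[of "max 0 T"] X(3)[of "max 0 T"] unfolding square_integrable_iff_nn_integral mean_square_energy_eq[OF m] by auto
  then show ?thesis by (rule square_integrable_energy_mono(1)[rotated]) simp
qed

lemma finite_measure_product: "finite_measure (time_measure T \<Otimes>\<^sub>M M)"
  by (rule finite_measure_pair_measure[OF finite_measure_axioms finite_measure_time_measure])

lemma ito_process_mean_integrable:
  assumes "ito_process M W x b g X"
  shows "integrable (time_measure T \<Otimes>\<^sub>M M) (\<lambda>(s, \<omega>). X s \<omega>)" "integrable (time_measure T) (\<lambda>s. \<integral>\<omega>. X s \<omega> \<partial>M)"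
proof -
  interpret P: pair_sigma_finite "time_measure T" M by (rule pair_sigma_finite_time)
  show 1: "integrable (time_measure T \<Otimes>\<^sub>M M) (\<lambda>(s, \<omega>). X s \<omega>)"
    by (rule finite_measure.square_integrable_integrable[OF finite_measure_product ito_process_square_integrable[OF assms]])
  show "integrable (time_measure T) (\<lambda>s. \<integral>\<omega>. X s \<omega> \<partial>M)" by (rule P.integrable_fst[OF 1])
qed

text \<open>Only integrability is asked of \<open>m\<close>: in \<open>mean_linear_ode\<close> it is
  the mean of \<open>X\<close>, whose continuity is a consequence of this equation.\<close>

lemma affine_drift_mean:
  fixes A :: "real^'n^'n" and B :: "real^'k^'n"
  assumes X: "ito_process M W x (\<lambda>t \<omega>. A *v X t \<omega> + B *v m t) g X"
    and m: "\<And>T. integrable (time_measure T) m" and t: "0 \<le> t"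
  shows "(\<integral>\<omega>. X t \<omega> \<partial>M) = x + (\<integral>s. A *v (\<integral>\<omega>. X s \<omega> \<partial>M) + B *v m s \<partial>time_measure t)"
proof -
  note bl = matrix_vector_mul_bounded_linear
  have 1: "integrable M (\<lambda>\<omega>. 1 :: real)" by simp
  note Xi = ito_process_mean_integrable[OF X]
  have B: "integrable (time_measure T) (\<lambda>s. B *v m s)" for T by (rule integrable_bounded_linear[OF bl m])
  interpret P: pair_sigma_finite "time_measure t" M by (rule pair_sigma_finite_time)
  have Bp: "integrable (time_measure t \<Otimes>\<^sub>M M) (\<lambda>x. B *v m (fst x))"
  proof -
    have [measurable]: "(\<lambda>s. B *v m s) \<in> borel_measurable (time_measure t)" using B by auto
    show ?thesis
    proof (rule P.Fubini_integrable)
      show "integrable (time_measure t) (\<lambda>s. LINT \<omega>|M. norm (B *v m (fst (s, \<omega>))))" using B by (simp add: prob_space)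
    qed auto
  qed
  have "integrable (time_measure t \<Otimes>\<^sub>M M) (\<lambda>(s, \<omega>). A *v X s \<omega> + B *v m s)"
    using Bochner_Integration.integrable_add[OF integrable_bounded_linear[OF bl[of A] Xi(1)[of t]] Bp] by (simp add: split_beta')
  from ito_process_mean[OF X this t]
  have "(\<integral>\<omega>. X t \<omega> \<partial>M) = x + (\<integral>s. (\<integral>\<omega>. A *v X s \<omega> + B *v m s \<partial>M) \<partial>time_measure t)" .
  also have "(\<integral>s. (\<integral>\<omega>. A *v X s \<omega> + B *v m s \<partial>M) \<partial>time_measure t) = (\<integral>s. A *v (\<integral>\<omega>. X s \<omega> \<partial>M) + B *v m s \<partial>time_measure t)"
  proof (rule Bochner_Integration.integral_cong[OF refl])
    fix s assume "s \<in> space (time_measure t)"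
    then have "integrable M (X s)" using X by (auto simp: ito_process_def)
    then show "(\<integral>\<omega>. A *v X s \<omega> + B *v m s \<partial>M) = A *v (\<integral>\<omega>. X s \<omega> \<partial>M) + B *v m s"
      using integral_bounded_linear[OF bl[of A], of M "X s"] integrable_bounded_linear[OF bl[of A], of M "X s"] by (simp add: prob_space)
  qed
  finally show ?thesis .
qed

lemma mean_linear_ode:
  fixes A B :: "real^'n^'n"
  assumes X: "ito_process M W x (\<lambda>t \<omega>. A *v X t \<omega> + B *v integral\<^sup>L M (X t)) g X"
  shows "linear_ode ((*v) (A + B)) (\<lambda>t. integral\<^sup>L M (X t))" "integral\<^sup>L M (X 0) = x"
proof -
  let ?m = "\<lambda>t. integral\<^sup>L M (X t)"
  have i: "integrable (time_measure T) ?m" for T using ito_process_mean_integrable(2)[OF X] by simp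
  have eq: "?m t = x + (\<integral>s. (A + B) *v ?m s \<partial>time_measure t)" if "0 \<le> t" for t
    using affine_drift_mean[OF X i that] by (simp add: matrix_vector_mult_add_rdistrib)
  show "linear_ode ((*v) (A + B)) ?m"
    by (rule linear_ode_from_integral[OF matrix_vector_mul_bounded_linear eq integrable_bounded_linear[OF matrix_vector_mul_bounded_linear i]])
  show "?m 0 = x" using eq[of 0] by (simp add: time_measure_0)
qed

text \<open>The mean of the solution of the stochastic equation with this drift and zero diffusion;
  the Euler scheme thus also provides the solutions of linear differential equations.\<close>

lemma linear_ode_exists:
  fixes A :: "real^'n^'n"
  shows "\<exists>m. linear_ode ((*v) A) m \<and> m 0 = x"
proof -
  interpret S: lipschitz_sde M W "\<lambda>t v. A *v v + (0 :: real^'n^'n) *v 0" "\<lambda>t v. (0 :: real^'n^'n) *v v + (0 :: real^'n^'n) *v 0" x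
    by (rule lipschitz_sde_linear) auto
  have "ito_process M W x (\<lambda>t \<omega>. A *v S.solution t \<omega> + (0 :: real^'n^'n) *v integral\<^sup>L M (S.solution t)) (\<lambda>t \<omega>. 0 *v S.solution t \<omega> + (0 :: real^'n^'n) *v 0) S.solution"
    using S.solution_ito_process by simp
  from mean_linear_ode[OF this] show ?thesis by auto
qed

text \<open>Decoupling: the equation that the mean has to satisfy is solved first, and its solution
  is used as an input. The mean of the resulting process and the input then satisfy the same affine
  equation, so their difference solves \<open>y' = (A + B K) y\<close> with initial value 0.\<close>

lemma mf_closed_loop_exists:
  fixes A A' C C' :: "real^'n^'n" and B B' D D' :: "real^'m^'n"
  shows "\<exists>X. mf_closed_loop M W A A' C C' B B' D D' K K' x X"
proof -
  let ?A = "A + B ** K" and ?B = "A' + B' ** K' + B ** (K' - K)"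
    and ?C = "C + D ** K" and ?D = "C' + D' ** K' + D ** (K' - K)"
  note bl = matrix_vector_mul_bounded_linear
  obtain m where m: "linear_ode ((*v) (?A + ?B)) m" "m 0 = x" using linear_ode_exists by blast
  \<comment> \<open>The constant \<open>x\<close> at negative times is the mean of
    \<open>solution\<close> there, so the two functions agree on all of \<open>real\<close>.\<close>
  define m' where "m' t = (if t < 0 then x else m t)" for t
  interpret S: lipschitz_sde M W "\<lambda>t v. ?A *v v + ?B *v m' t" "\<lambda>t v. ?C *v v + ?D *v m' t" x
  proof (rule lipschitz_sde_linear)
    fix T show "\<exists>B\<ge>0. \<forall>s\<in>{0..T}. \<forall>t\<in>{0..T}. norm (m' s - m' t) \<le> B * \<bar>s - t\<bar>"
      using linear_ode_lipschitz[OF bl m(1), of T] by (simp add: m'_def)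
  qed
  note X = S.solution_ito_process
  have mc: "continuous_on {0..} m" by (rule linear_ode_continuous[OF m(1)])
  have m'c: "continuous_on {0..} m'" using mc by (subst continuous_on_cong[OF refl, of _ _ m]) (auto simp: m'_def)
  note m'i = continuous_on_time_measure(1)[OF m'c]
  let ?\<mu> = "\<lambda>t. integral\<^sup>L M (S.solution t)"
  note \<mu>i = ito_process_mean_integrable(2)[OF X]
  have \<mu>: "?\<mu> t = x + (\<integral>s. ?A *v ?\<mu> s + ?B *v m' s \<partial>time_measure t)" if "0 \<le> t" for t
    by (rule affine_drift_mean[OF X m'i that])
  have mm: "m t = x + (\<integral>s. (?A + ?B) *v m s \<partial>time_measure t)" if t: "0 \<le> t" for t
  proof -
    have "(\<integral>s. (?A + ?B) *v m s \<partial>time_measure t) = m t - m 0"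
    proof (rule time_measure_FTC[OF t linear_odeD[OF m(1)]])
      show "continuous_on {0..t} (\<lambda>s. (?A + ?B) *v m s)"
        by (rule continuous_on_subset[OF bounded_linear.continuous_on[OF bl mc]]) auto
    qed
    then show ?thesis by (simp add: m(2))
  qed
  have diff: "?\<mu> t - m' t = 0 + (\<integral>s. ?A *v (?\<mu> s - m' s) \<partial>time_measure t)" if t: "0 \<le> t" for t
  proof -
    have "(\<integral>s. (?A + ?B) *v m s \<partial>time_measure t) = (\<integral>s. ?A *v m' s + ?B *v m' s \<partial>time_measure t)"
      by (intro Bochner_Integration.integral_cong refl) (auto simp: m'_def matrix_vector_mult_add_rdistrib)
    then have "?\<mu> t - m' t = (\<integral>s. ?A *v ?\<mu> s + ?B *v m' s \<partial>time_measure t) - (\<integral>s. ?A *v m' s + ?B *v m' s \<partial>time_measure t)"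
      using \<mu>[OF t] mm[OF t] t by (simp add: m'_def)
    also have "\<dots> = (\<integral>s. (?A *v ?\<mu> s + ?B *v m' s) - (?A *v m' s + ?B *v m' s) \<partial>time_measure t)"
      by (intro Bochner_Integration.integral_diff[symmetric] Bochner_Integration.integrable_add integrable_bounded_linear[OF bl] \<mu>i m'i)
    finally show ?thesis by (simp add: matrix_vector_mult_diff_distrib)
  qed
  have ode: "linear_ode ((*v) ?A) (\<lambda>t. ?\<mu> t - m' t)"
    by (rule linear_ode_from_integral[OF bl diff integrable_bounded_linear[OF bl Bochner_Integration.integrable_diff[OF \<mu>i m'i]]])
  have "m' t = ?\<mu> t" for t
  proof (cases "t < 0")
    case True
    then have "S.solution t = (\<lambda>\<omega>. x)" by (intro ext S.solution_negative)
    then show ?thesis unfolding m'_def using True by (simp add: prob_space)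
  next
    case False
    then have "0 \<le> t" by simp
    moreover have "?\<mu> 0 - m' 0 = 0" using diff[of 0] by (simp add: time_measure_0)
    ultimately have "?\<mu> t - m' t = 0" using linear_ode_zero[OF bl ode] by blast
    then show ?thesis by simp
  qed
  note eq = this
  define Z where "Z = S.solution"
  note eq = eq[folded Z_def]
  have "mf_closed_loop M W A A' C C' B B' D D' K K' x Z"
    using X[folded Z_def] unfolding mf_closed_loop_def eq .
  then show ?thesis by (intro exI)
qed

end

lemma matrix_mult_distrib:
  fixes A B :: "real^'n^'m" and C E :: "real^'k^'n"
  shows "(A + B) ** C = A ** C + B ** C" "A ** (C - E) = A ** C - A ** E"
  using linear_add[OF bounded_linear.linear[OF bounded_linear_matrix_mult(2)[of C]]]
    linear_diff[OF bounded_linear.linear[OF bounded_linear_matrix_mult(1)[of A]]] by blast+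

lemma norm_outer: "norm (outer u u) = (norm u)\<^sup>2"
proof -
  have "norm (outer u u $ i) = \<bar>u $ i\<bar> * norm u" for i
  proof -
    have "outer u u $ i = (u $ i) *\<^sub>R u" by (simp add: outer_def vec_eq_iff)
    then show ?thesis by simp
  qed
  then have "norm (outer u u) = L2_set (\<lambda>i. \<bar>u $ i\<bar> * norm u) UNIV" by (simp add: norm_vec_def)
  also have "\<dots> = L2_set (\<lambda>i. norm (u $ i)) UNIV * norm u" by (simp add: L2_set_left_distrib)
  finally show ?thesis by (simp add: norm_vec_def power2_eq_square)
qed

section \<open>Energies and covariances of closed-loop solutions\<close>

context standard_brownian_motion
begin

lemma norm_expectation_sq_le:
  assumes "square_integrable M f"
  shows "(norm (integral\<^sup>L M f))\<^sup>2 \<le> (\<integral>\<omega>. (norm (f \<omega>))\<^sup>2 \<partial>M)"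
proof -
  have "norm (integral\<^sup>L M f) \<le> (\<integral>\<omega>. norm (f \<omega>) \<partial>M)" by (rule integral_norm_bound)
  also have "\<dots> \<le> sqrt (\<integral>\<omega>. (norm (f \<omega>))\<^sup>2 \<partial>M)"
    using Cauchy_Schwarz_integral[OF assms square_integrable_const[of "1::real"]] by (simp add: prob_space)
  finally have "(norm (integral\<^sup>L M f))\<^sup>2 \<le> (sqrt (\<integral>\<omega>. (norm (f \<omega>))\<^sup>2 \<partial>M))\<^sup>2" by (rule power_mono) simp
  then show ?thesis by (simp add: integral_nonneg_AE)
qed

lemma continuous_process_energy:
  assumes X: "continuous_process X"
  shows "integrable (time_measure T) (\<lambda>s. \<integral>\<omega>. (norm (X s \<omega>))\<^sup>2 \<partial>M)"
    "mean_square_energy M {0..T} X = ennreal (\<integral>s. (\<integral>\<omega>. (norm (X s \<omega>))\<^sup>2 \<partial>M) \<partial>time_measure T)"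
proof -
  note XD = continuous_processD[OF X]
  note ib = integral_bilinear_fst[OF bounded_bilinear_inner XD(4)[of T] XD(4)[of T]]
  show "integrable (time_measure T) (\<lambda>s. \<integral>\<omega>. (norm (X s \<omega>))\<^sup>2 \<partial>M)"
    using ib(1) by (simp add: power2_norm_eq_inner)
  show "mean_square_energy M {0..T} X = ennreal (\<integral>s. (\<integral>\<omega>. (norm (X s \<omega>))\<^sup>2 \<partial>M) \<partial>time_measure T)"
    unfolding mean_square_energy_eq[OF square_integrableD(1)[OF XD(4)[of T]]] square_integrable_nn_integral[OF XD(4)[of T]]
    using ib(2) by (simp add: power2_norm_eq_inner split_beta')
qed

text \<open>Monotone convergence from \<open>[0, n]\<close> to \<open>[0, \<infinity>)\<close>. The
  infinite time integral is a supremum of measurable functions of the sample point, which also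
  yields its measurability.\<close>

lemma horizon_energy:
  assumes X: "continuous_process X"
  shows "\<omega> \<in> space M \<Longrightarrow> (\<lambda>t. ennreal ((norm (X t \<omega>))\<^sup>2) * indicator {0..} t) \<in> borel_measurable lborel" (is "_ \<Longrightarrow> ?m1")
    "(\<lambda>\<omega>. \<integral>\<^sup>+t\<in>{0..}. ennreal ((norm (X t \<omega>))\<^sup>2) \<partial>lborel) \<in> borel_measurable M"
    "(\<And>T. 0 \<le> T \<Longrightarrow> (\<integral>s. (\<integral>\<omega>. (norm (X s \<omega>))\<^sup>2 \<partial>M) \<partial>time_measure T) \<le> c) \<Longrightarrow> mean_square_energy M {0..} X \<le> ennreal c"
proof -
  note XD = continuous_processD[OF X]
  have c: "(\<lambda>t. indicator A t *\<^sub>R (norm (X t \<omega>))\<^sup>2) \<in> borel_measurable lborel"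
    if "\<omega> \<in> space M" "A \<subseteq> {0..}" "A \<in> sets borel" for \<omega> A
    using borel_measurable_continuous_on_indicator[OF that(3) continuous_on_power[OF continuous_on_norm[OF continuous_on_subset[OF XD(1)[OF that(1)] that(2)]], of 2]] by simp
  have m: "(\<lambda>t. ennreal ((norm (X t \<omega>))\<^sup>2) * indicator A t) \<in> borel_measurable lborel"
    if "\<omega> \<in> space M" "A \<subseteq> {0..}" "A \<in> sets borel" for \<omega> A
  proof -
    have "(\<lambda>t. ennreal ((norm (X t \<omega>))\<^sup>2) * indicator A t) = (\<lambda>t. ennreal (indicator A t *\<^sub>R (norm (X t \<omega>))\<^sup>2))"
      by (auto simp: indicator_def)
    then show ?thesis using measurable_compose[OF c[OF that] measurable_ennreal] by simp
  qed
  show "\<omega> \<in> space M \<Longrightarrow> ?m1" by (rule m) auto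
  let ?f = "\<lambda>n \<omega>. \<integral>\<^sup>+s. ennreal ((norm (X s \<omega>))\<^sup>2) \<partial>time_measure (real n)"
  have lim: "(\<integral>\<^sup>+t\<in>{0..}. ennreal ((norm (X t \<omega>))\<^sup>2) \<partial>lborel) = (SUP n. ?f n \<omega>)" if \<omega>: "\<omega> \<in> space M" for \<omega>
  proof -
    let ?g = "\<lambda>n t. ennreal ((norm (X t \<omega>))\<^sup>2) * indicator {0..real n} t"
    have "(\<integral>\<^sup>+t\<in>{0..}. ennreal ((norm (X t \<omega>))\<^sup>2) \<partial>lborel) = (\<integral>\<^sup>+t. (SUP n. ?g n t) \<partial>lborel)"
    proof (intro nn_integral_cong antisym)
      fix t :: real
      obtain n :: nat where n: "t \<le> real n" using real_arch_simple by blast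
      have "ennreal ((norm (X t \<omega>))\<^sup>2) * indicator {0..} t = ?g n t" using n by (auto simp: indicator_def)
      then show "ennreal ((norm (X t \<omega>))\<^sup>2) * indicator {0..} t \<le> (SUP n. ?g n t)" by (auto intro: SUP_upper2)
      show "(SUP n. ?g n t) \<le> ennreal ((norm (X t \<omega>))\<^sup>2) * indicator {0..} t"
        by (intro SUP_least) (auto simp: indicator_def)
    qed
    also have "\<dots> = (SUP n. \<integral>\<^sup>+t. ?g n t \<partial>lborel)"
    proof (rule nn_integral_monotone_convergence_SUP)
      show "incseq ?g" by (intro incseq_SucI le_funI) (auto simp: indicator_def)
    qed (rule m[OF \<omega>], auto)
    finally show ?thesis by (simp add: nn_integral_time_measure)
  qed
  have mf: "?f n \<in> borel_measurable M" for n
  proof -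
    interpret pair_sigma_finite M "time_measure (real n)"
      using sigma_finite_time_measure by (simp add: pair_sigma_finite_def sigma_finite_measure_axioms)
    have "(\<lambda>p. case prod.swap p of (s, \<omega>) \<Rightarrow> X s \<omega>) \<in> borel_measurable (M \<Otimes>\<^sub>M time_measure (real n))"
      using measurable_compose[OF measurable_pair_swap' square_integrableD(1)[OF XD(4)[of "real n"]]] by (simp add: split_beta' prod.swap_def)
    then have [measurable]: "(\<lambda>p. X (snd p) (fst p)) \<in> borel_measurable (M \<Otimes>\<^sub>M time_measure (real n))"
      by (simp add: split_beta')
    show ?thesis by (rule M2.borel_measurable_nn_integral) (simp add: split_beta')
  qed
  have "(\<lambda>\<omega>. SUP n. ?f n \<omega>) \<in> borel_measurable M" using mf by simp
  then show "(\<lambda>\<omega>. \<integral>\<^sup>+t\<in>{0..}. ennreal ((norm (X t \<omega>))\<^sup>2) \<partial>lborel) \<in> borel_measurable M"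
    by (subst measurable_cong[OF lim])
  assume le: "\<And>T. 0 \<le> T \<Longrightarrow> (\<integral>s. (\<integral>\<omega>. (norm (X s \<omega>))\<^sup>2 \<partial>M) \<partial>time_measure T) \<le> c"
  have "mean_square_energy M {0..} X = (\<integral>\<^sup>+\<omega>. (SUP n. ?f n \<omega>) \<partial>M)"
    unfolding mean_square_energy_def by (rule nn_integral_cong[OF lim])
  also have "\<dots> = (SUP n. \<integral>\<^sup>+\<omega>. ?f n \<omega> \<partial>M)"
  proof (rule nn_integral_monotone_convergence_SUP[OF _ mf])
    show "incseq ?f"
      unfolding nn_integral_time_measure
      by (intro incseq_SucI le_funI nn_integral_mono) (auto simp: indicator_def)
  qed
  also have "\<dots> = (SUP n. mean_square_energy M {0..real n} X)"
    by (simp add: mean_square_energy_def nn_integral_time_measure)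
  also have "\<dots> \<le> ennreal c"
    unfolding continuous_process_energy(2)[OF X] by (intro SUP_least ennreal_leI le) simp
  finally show "mean_square_energy M {0..} X \<le> ennreal c" .
qed

lemma infinite_horizon_cost_finite:
  assumes X: "continuous_process X" and u: "continuous_process u"
    and c: "\<And>T. 0 \<le> T \<Longrightarrow> (\<integral>s. (\<integral>\<omega>. (norm (X s \<omega>))\<^sup>2 \<partial>M) \<partial>time_measure T) \<le> c"
    and d: "\<And>T. 0 \<le> T \<Longrightarrow> (\<integral>s. (\<integral>\<omega>. (norm (u s \<omega>))\<^sup>2 \<partial>M) \<partial>time_measure T) \<le> d"
  shows "infinite_horizon_cost M X u < \<infinity>"
proof -
  have "infinite_horizon_cost M X u
    = (\<integral>\<^sup>+\<omega>. (\<integral>\<^sup>+t\<in>{0..}. ennreal ((norm (X t \<omega>))\<^sup>2) \<partial>lborel) + (\<integral>\<^sup>+t\<in>{0..}. ennreal ((norm (u t \<omega>))\<^sup>2) \<partial>lborel) \<partial>M)"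
    unfolding infinite_horizon_cost_def
  proof (rule nn_integral_cong)
    fix \<omega> assume \<omega>: "\<omega> \<in> space M"
    show "(\<integral>\<^sup>+t\<in>{0..}. ennreal ((norm (X t \<omega>))\<^sup>2 + (norm (u t \<omega>))\<^sup>2) \<partial>lborel)
      = (\<integral>\<^sup>+t\<in>{0..}. ennreal ((norm (X t \<omega>))\<^sup>2) \<partial>lborel) + (\<integral>\<^sup>+t\<in>{0..}. ennreal ((norm (u t \<omega>))\<^sup>2) \<partial>lborel)"
      by (subst nn_integral_add[OF horizon_energy(1)[OF X \<omega>] horizon_energy(1)[OF u \<omega>], symmetric])
        (simp add: distrib_right)
  qed
  also have "\<dots> = mean_square_energy M {0..} X + mean_square_energy M {0..} u"
    unfolding mean_square_energy_def by (rule nn_integral_add[OF horizon_energy(2)[OF X] horizon_energy(2)[OF u]])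
  also have "\<dots> \<le> ennreal c + ennreal d" by (intro add_mono horizon_energy(3) X u c d)
  also have "\<dots> < \<infinity>" by simp
  finally show ?thesis .
qed

lemma infinite_horizon_cost_bound:
  assumes X: "continuous_process X" and c: "infinite_horizon_cost M X u < \<infinity>"
  shows "(\<integral>s. (\<integral>\<omega>. (norm (X s \<omega>))\<^sup>2 \<partial>M) \<partial>time_measure T) \<le> enn2real (infinite_horizon_cost M X u)"
proof -
  have "mean_square_energy M {0..T} X \<le> infinite_horizon_cost M X u"
    unfolding mean_square_energy_def infinite_horizon_cost_def
    by (intro nn_integral_mono mult_mono ennreal_leI) (auto simp: indicator_def)
  then have "enn2real (mean_square_energy M {0..T} X) \<le> enn2real (infinite_horizon_cost M X u)"
    using c by (intro enn2real_mono) auto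
  then show ?thesis unfolding continuous_process_energy(2)[OF X] by (simp add: integral_nonneg_AE)
qed

text \<open>At fixed times \<open>ito_process\<close> provides only integrability of
  \<open>X t\<close>. Square integrability follows from the equation, since the drift integral and
  the Ito integral have it.\<close>

lemma ito_process_continuous_process:
  assumes X: "ito_process M W x b g X"
    and b: "\<And>\<omega>. \<omega> \<in> space M \<Longrightarrow> continuous_on {0..} (\<lambda>t. b t \<omega>)" "\<And>T. square_integrable (time_measure T \<Otimes>\<^sub>M M) (\<lambda>(s, \<omega>). b s \<omega>)"
  shows "continuous_process X"
proof -
  have "square_integrable M (X t)" if t: "0 \<le> t" for t
  proof -
    have N: "has_ito_integral M W t g (\<lambda>\<omega>. X t \<omega> - x - (\<integral>s. b s \<omega> \<partial>time_measure t))"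
      using X t unfolding ito_process_def integral_time_measure by blast
    have "square_integrable M (\<lambda>\<omega>. (x + (\<integral>s. b s \<omega> \<partial>time_measure t)) + (X t \<omega> - x - (\<integral>s. b s \<omega> \<partial>time_measure t)))"
      by (intro square_integrable_add(1) square_integrable_const has_ito_integral_square_integrable[OF N]
        time_integral_square_integrable(2)[OF b t])
    then show ?thesis by simp
  qed
  then show ?thesis
    unfolding continuous_process_def using X ito_process_square_integrable[OF X] by (auto simp: ito_process_def)
qed

text \<open>\<open>orth\<close> removes the mixed terms between \<open>C *v Y s\<close> and
  \<open>c s\<close>: they are linear in the mean of \<open>Y s\<close>. It holds for the
  homogeneous equation, where \<open>c = 0\<close>, and for the fluctuation, which has mean
  zero.\<close>

lemma second_moment:
  fixes A C :: "real^'n^'n"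
  assumes Y: "continuous_process Y"
    and N: "\<And>s. 0 \<le> s \<Longrightarrow> has_ito_integral M W s (\<lambda>r \<omega>. C *v Y r \<omega> + c r) (N s)"
    and eq: "\<And>s. 0 \<le> s \<Longrightarrow> AE \<omega> in M. Y s \<omega> = y + (\<integral>r. A *v Y r \<omega> \<partial>time_measure s) + N s \<omega>"
    and orth: "\<And>s. 0 \<le> s \<Longrightarrow> integral\<^sup>L M (Y s) = 0 \<or> c s = 0"
  defines "P \<equiv> \<lambda>t. \<integral>\<omega>. outer (Y t \<omega>) (Y t \<omega>) \<partial>M"
  shows "0 \<le> t \<Longrightarrow> P t = outer y y + (\<integral>s. lyapunov A C (P s) + outer (c s) (c s) \<partial>time_measure t)"
    "integrable (time_measure T) P"
    "0 \<le> t \<Longrightarrow> trace (P t) = (\<integral>\<omega>. (norm (Y t \<omega>))\<^sup>2 \<partial>M)"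
    "0 \<le> t \<Longrightarrow> transpose (P t) = P t"
    "0 \<le> T \<Longrightarrow> (\<integral>s. norm (P s) \<partial>time_measure T) \<le> (\<integral>s. (\<integral>\<omega>. (norm (Y s \<omega>))\<^sup>2 \<partial>M) \<partial>time_measure T)"
proof -
  note bl = matrix_vector_mul_bounded_linear
  note bo = bounded_bilinear_outer
  interpret bounded_bilinear outer by (rule bo)
  note YD = continuous_processD[OF Y]
  have oi: "integrable M (\<lambda>\<omega>. outer (Y s \<omega>) (Y s \<omega>))" if "0 \<le> s" for s
    by (rule square_integrable_bilinear[OF bo YD(3)[OF that] YD(3)[OF that]])
  have Yi: "integrable M (Y s)" if "0 \<le> s" for s by (rule square_integrable_integrable[OF YD(3)[OF that]])
  show Pi: "integrable (time_measure T) P" for T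
    unfolding P_def by (rule integral_bilinear_fst(1)[OF bo YD(4) YD(4)])
  show "trace (P t) = (\<integral>\<omega>. (norm (Y t \<omega>))\<^sup>2 \<partial>M)" if t: "0 \<le> t" for t
    unfolding P_def integral_bounded_linear[OF bounded_linear_trace oi[OF t], symmetric] trace_outer ..
  show "transpose (P t) = P t" if t: "0 \<le> t" for t
    unfolding P_def integral_bounded_linear[OF bounded_linear_transpose oi[OF t], symmetric] transpose_outer ..
  show "(\<integral>s. norm (P s) \<partial>time_measure T) \<le> (\<integral>s. (\<integral>\<omega>. (norm (Y s \<omega>))\<^sup>2 \<partial>M) \<partial>time_measure T)" for T
  proof (rule integral_mono[OF integrable_norm[OF Pi] continuous_process_energy(1)[OF Y]])
    fix s
    have "norm (P s) \<le> (\<integral>\<omega>. norm (outer (Y s \<omega>) (Y s \<omega>)) \<partial>M)" unfolding P_def by (rule integral_norm_bound)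
    then show "norm (P s) \<le> (\<integral>\<omega>. (norm (Y s \<omega>))\<^sup>2 \<partial>M)" by (simp add: norm_outer)
  qed
  define R where "R s = (\<integral>\<omega>. outer (A *v Y s \<omega>) (Y s \<omega>) \<partial>M) + (\<integral>\<omega>. outer (Y s \<omega>) (A *v Y s \<omega>) \<partial>M)
    + (\<integral>\<omega>. outer (C *v Y s \<omega> + c s) (C *v Y s \<omega> + c s) \<partial>M)" for s
  have R: "R s = lyapunov A C (P s) + outer (c s) (c s)" if s: "0 \<le> s" for s
  proof -
    note ml = bounded_linear_matrix_mult
    have 1: "(\<integral>\<omega>. outer (A *v Y s \<omega>) (Y s \<omega>) \<partial>M) = A ** P s" "(\<integral>\<omega>. outer (Y s \<omega>) (A *v Y s \<omega>) \<partial>M) = P s ** transpose A"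
      unfolding outer_mult P_def by (rule integral_bounded_linear[OF ml(1) oi[OF s]], rule integral_bounded_linear[OF ml(2) oi[OF s]])
    have CC: "bounded_linear (\<lambda>S. C ** S ** transpose C)" by (rule bounded_linear_compose[OF ml(2) ml(1)])
    have expand: "outer (C *v Y s \<omega> + c s) (C *v Y s \<omega> + c s) = C ** outer (Y s \<omega>) (Y s \<omega>) ** transpose C
      + (outer (C *v Y s \<omega>) (c s) + outer (c s) (C *v Y s \<omega>)) + outer (c s) (c s)" for \<omega>
      by (simp add: add_left add_right outer_mult matrix_mul_assoc matrix_mult_distrib)
    have l: "bounded_linear (\<lambda>v. outer (C *v v) (c s) + outer (c s) (C *v v))"
      by (intro bounded_linear_add bounded_linear_compose[OF bounded_linear_left bl] bounded_linear_compose[OF bounded_linear_right bl])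
    have i2: "integrable M (\<lambda>\<omega>. outer (C *v Y s \<omega>) (c s) + outer (c s) (C *v Y s \<omega>))"
      by (rule integrable_bounded_linear[OF l Yi[OF s]])
    have i3: "integrable M (\<lambda>\<omega>. C ** outer (Y s \<omega>) (Y s \<omega>) ** transpose C)"
      by (rule integrable_bounded_linear[OF CC oi[OF s]])
    have "(\<integral>\<omega>. outer (C *v Y s \<omega> + c s) (C *v Y s \<omega> + c s) \<partial>M)
      = (\<integral>\<omega>. C ** outer (Y s \<omega>) (Y s \<omega>) ** transpose C \<partial>M)
       + (\<integral>\<omega>. outer (C *v Y s \<omega>) (c s) + outer (c s) (C *v Y s \<omega>) \<partial>M) + outer (c s) (c s)"
      unfolding expand
      using Bochner_Integration.integral_add[OF Bochner_Integration.integrable_add[OF i3 i2], of "\<lambda>_. outer (c s) (c s)"]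
        Bochner_Integration.integral_add[OF i3 i2] by (simp add: prob_space)
    also have "(\<integral>\<omega>. C ** outer (Y s \<omega>) (Y s \<omega>) ** transpose C \<partial>M) = C ** P s ** transpose C"
      unfolding P_def by (rule integral_bounded_linear[OF CC oi[OF s]])
    also have "(\<integral>\<omega>. outer (C *v Y s \<omega>) (c s) + outer (c s) (C *v Y s \<omega>) \<partial>M) = 0"
    proof -
      have "(\<integral>\<omega>. outer (C *v Y s \<omega>) (c s) + outer (c s) (C *v Y s \<omega>) \<partial>M)
        = outer (C *v integral\<^sup>L M (Y s)) (c s) + outer (c s) (C *v integral\<^sup>L M (Y s))"
        by (rule integral_bounded_linear[OF l Yi[OF s]])
      then show ?thesis using orth[OF s] by (auto simp: zero_left zero_right)
    qed
    finally show ?thesis by (simp add: R_def 1 lyapunov_def)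
  qed
  show "P t = outer y y + (\<integral>s. lyapunov A C (P s) + outer (c s) (c s) \<partial>time_measure t)" if t: "0 \<le> t"
  proof -
    have "P t = outer y y + (\<integral>s. R s \<partial>time_measure t)"
      unfolding P_def R_def
      by (rule ito_product_expectation(1)[OF bo continuous_process_linear[OF bl Y] N measurable_F_M[OF YD(2)] eq t])
    also have "(\<integral>s. R s \<partial>time_measure t) = (\<integral>s. lyapunov A C (P s) + outer (c s) (c s) \<partial>time_measure t)"
      by (rule Bochner_Integration.integral_cong[OF refl]) (simp add: R)
    finally show ?thesis .
  qed
qed

lemma affine_drift_continuous_process:
  fixes A :: "real^'n^'n" and B :: "real^'k^'n"
  assumes X: "ito_process M W x b g X" and b: "b = (\<lambda>t \<omega>. A *v X t \<omega> + B *v m t)" and m: "continuous_on {0..} m"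
  shows "continuous_process X"
proof (rule ito_process_continuous_process[OF X])
  note bl = matrix_vector_mul_bounded_linear
  show "continuous_on {0..} (\<lambda>t. b t \<omega>)" if "\<omega> \<in> space M" for \<omega>
    unfolding b using X that m
    by (intro continuous_on_add bounded_linear.continuous_on[OF bl]) (auto simp: ito_process_def)
  show "square_integrable (time_measure T \<Otimes>\<^sub>M M) (\<lambda>(s, \<omega>). b s \<omega>)" for T
    using square_integrable_add(1)[OF square_integrable_bounded_linear[OF bl[of A] ito_process_square_integrable[OF X, of T]]
        square_integrable_fst[OF square_integrable_continuous[OF bounded_linear.continuous_on[OF bl[of B] m]], of T]]
    unfolding b by (simp add: split_beta')
qed

text \<open>Puts the covariance of one stabilized solution into the form that
  \<open>lyapunov_functional\<close> assumes; its norm is controlled by the energy because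
  \<open>norm (outer u u) = (norm u)\<^sup>2\<close>.\<close>

lemma sde_second_moment:
  fixes A C :: "real^'n^'n"
  assumes X: "ito_process M W x (\<lambda>t \<omega>. A *v X t \<omega>) (\<lambda>t \<omega>. C *v X t \<omega>) X"
    and c: "infinite_horizon_cost M X u < \<infinity>"
  shows "\<exists>P c. (\<forall>t\<ge>0. P t = outer x x + (\<integral>s. lyapunov A C (P s) \<partial>time_measure t)) \<and>
     (\<forall>T. integrable (time_measure T) P) \<and> (\<forall>T\<ge>0. (\<integral>s. norm (P s) \<partial>time_measure T) \<le> c) \<and>
     (\<forall>t\<ge>0. transpose (P t) = P t \<and> 0 \<le> trace (P t))"
proof -
  have Xc: "continuous_process X"
    by (rule affine_drift_continuous_process[OF X, where A=A and B="0 :: real^'n^'n" and m="\<lambda>t. 0"]) auto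
  have N: "has_ito_integral M W s (\<lambda>r \<omega>. C *v X r \<omega> + (\<lambda>r. 0) r) (\<lambda>\<omega>. X s \<omega> - x - (\<integral>r. A *v X r \<omega> \<partial>time_measure s))"
    if "0 \<le> s" for s
    using X that unfolding ito_process_def integral_time_measure by simp
  have eq: "AE \<omega> in M. X s \<omega> = x + (\<integral>r. A *v X r \<omega> \<partial>time_measure s) + (X s \<omega> - x - (\<integral>r. A *v X r \<omega> \<partial>time_measure s))" for s
    by simp
  note sm = second_moment[where c="\<lambda>r. 0", OF Xc N eq]
  have o: "outer 0 0 = 0" by (simp add: outer_def vec_eq_iff)
  let ?P = "\<lambda>t. \<integral>\<omega>. outer (X t \<omega>) (X t \<omega>) \<partial>M"
  show ?thesis
  proof (intro exI conjI allI impI)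
    show "?P t = outer x x + (\<integral>s. lyapunov A C (?P s) \<partial>time_measure t)" if "0 \<le> t" for t
      by (rule sm(1)[unfolded o add_0_right]) (use that in auto)
    show "integrable (time_measure T) ?P" for T by (rule sm(2)) auto
    show "(\<integral>s. norm (?P s) \<partial>time_measure T) \<le> enn2real (infinite_horizon_cost M X u)" if "0 \<le> T" for T
      by (rule order_trans[OF sm(5) infinite_horizon_cost_bound[OF Xc c]]) (use that in auto)
    show "transpose (?P t) = ?P t" if "0 \<le> t" for t by (rule sm(4)) (use that in auto)
    show "0 \<le> trace (?P t)" if "0 \<le> t" for t
    proof -
      have "trace (?P t) = (\<integral>\<omega>. (norm (X t \<omega>))\<^sup>2 \<partial>M)" by (rule sm(3)) (use that in auto)
      then show ?thesis by (simp add: integral_nonneg_AE)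
    qed
  qed
qed

text \<open>In the sum of the two closed-loop coefficients \<open>K\<close> cancels:
  \<open>A + B K\<close> plus \<open>A' + B' K' + B (K' - K)\<close> is
  \<open>A + A' + (B + B') K'\<close>. Hence the gain of the mean is \<open>K'\<close> alone, and
  the gain of the fluctuation is \<open>K\<close> alone, apart from the source.\<close>

lemma mf_decomposition:
  fixes A A' C C' :: "real^'n^'n" and B B' D D' :: "real^'m^'n"
  assumes "mf_closed_loop M W A A' C C' B B' D D' K K' x X"
  defines "m \<equiv> \<lambda>t. integral\<^sup>L M (X t)" and "Y \<equiv> \<lambda>t \<omega>. X t \<omega> - integral\<^sup>L M (X t)"
  shows "linear_ode ((*v) (A + A' + (B + B') ** K')) m" "m 0 = x"
    "continuous_process X" "continuous_process Y"
    "\<exists>N. (\<forall>s\<ge>0. has_ito_integral M W s (\<lambda>r \<omega>. (C + D ** K) *v Y r \<omega> + (C + C' + (D + D') ** K') *v m r) (N s)) \<and>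
      (\<forall>s\<ge>0. AE \<omega> in M. Y s \<omega> = 0 + (\<integral>r. (A + B ** K) *v Y r \<omega> \<partial>time_measure s) + N s \<omega>)"
    "0 \<le> t \<Longrightarrow> integral\<^sup>L M (Y t) = 0"
proof -
  let ?A = "A + B ** K" and ?B = "A' + B' ** K' + B ** (K' - K)"
    and ?C = "C + D ** K" and ?D = "C' + D' ** K' + D ** (K' - K)"
  note bl = matrix_vector_mul_bounded_linear
  have X: "ito_process M W x (\<lambda>t \<omega>. ?A *v X t \<omega> + ?B *v m t) (\<lambda>t \<omega>. ?C *v X t \<omega> + ?D *v m t) X"
    using assms(1) by (simp add: mf_closed_loop_def m_def)
  have AB: "?A + ?B = A + A' + (B + B') ** K'" "?C + ?D = C + C' + (D + D') ** K'"
    by (simp_all add: matrix_mult_distrib)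
  note ode = mean_linear_ode[OF X[unfolded m_def], folded m_def]
  show m: "linear_ode ((*v) (A + A' + (B + B') ** K')) m" using ode(1) by (simp only: AB)
  show m0: "m 0 = x" unfolding m_def by (rule mean_linear_ode(2)[OF X[unfolded m_def]])
  note mc = linear_ode_continuous[OF m]
  show Xc: "continuous_process X" by (rule affine_drift_continuous_process[OF X refl mc])
  have Y: "Y = (\<lambda>t \<omega>. X t \<omega> - m t)" by (simp add: Y_def m_def)
  show Yc: "continuous_process Y"
    unfolding Y by (rule continuous_process_diff[OF Xc continuous_process_deterministic[OF mc]])
  let ?N = "\<lambda>s \<omega>. X s \<omega> - x - (\<integral>r. ?A *v X r \<omega> + ?B *v m r \<partial>time_measure s)"
  have "?C *v X r \<omega> + ?D *v m r = ?C *v Y r \<omega> + (C + C' + (D + D') ** K') *v m r" for r \<omega>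
    unfolding Y AB(2)[symmetric] by (simp only: matrix_vector_mult_diff_distrib matrix_vector_mult_add_rdistrib) simp
  then have N: "has_ito_integral M W s (\<lambda>r \<omega>. ?C *v Y r \<omega> + (C + C' + (D + D') ** K') *v m r) (?N s)" if "0 \<le> s" for s
    using X that unfolding ito_process_def integral_time_measure by simp
  have eq: "Y s \<omega> = 0 + (\<integral>r. ?A *v Y r \<omega> \<partial>time_measure s) + ?N s \<omega>" if s: "0 \<le> s" and \<omega>: "\<omega> \<in> space M" for s \<omega>
  proof -
    have Xi: "integrable (time_measure s) (\<lambda>r. ?A *v X r \<omega>)" 
      by (rule integrable_bounded_linear[OF bl continuous_on_time_measure(1)[OF continuous_processD(1)[OF Xc \<omega>]]])
    have mi: "integrable (time_measure s) (\<lambda>r. G *v m r)" for G :: "real^'n^'n"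
      by (rule integrable_bounded_linear[OF bl continuous_on_time_measure(1)[OF mc]])
    have 1: "(\<integral>r. ?A *v X r \<omega> + ?B *v m r \<partial>time_measure s)
      = (\<integral>r. ?A *v X r \<omega> \<partial>time_measure s) + (\<integral>r. ?B *v m r \<partial>time_measure s)"
      by (rule Bochner_Integration.integral_add[OF Xi mi])
    have 2: "(\<integral>r. ?A *v Y r \<omega> \<partial>time_measure s) = (\<integral>r. ?A *v X r \<omega> \<partial>time_measure s) - (\<integral>r. ?A *v m r \<partial>time_measure s)"
      unfolding Y matrix_vector_mult_diff_distrib by (rule Bochner_Integration.integral_diff[OF Xi mi])
    have 3: "(\<integral>r. (?A + ?B) *v m r \<partial>time_measure s) = (\<integral>r. ?A *v m r \<partial>time_measure s) + (\<integral>r. ?B *v m r \<partial>time_measure s)"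
      unfolding matrix_vector_mult_add_rdistrib[of ?A ?B] by (rule Bochner_Integration.integral_add[OF mi mi])
    have 4: "(\<integral>r. (?A + ?B) *v m r \<partial>time_measure s) = m s - m 0"
    proof (rule time_measure_FTC[OF s linear_odeD[OF ode(1)]])
      show "continuous_on {0..s} (\<lambda>r. (?A + ?B) *v m r)"
        by (rule continuous_on_subset[OF bounded_linear.continuous_on[OF bl mc]]) auto
    qed
    \<comment> \<open>The integrals are replaced by arbitrary vectors here; what remains is an
      identity of linear algebra.\<close>
    have "v - m s = 0 + J + (v - x - I)" if "I = a + b" "J = a - c" "d = c + b" "d = m s - m 0" for v I J a b c d :: "real^'n"
      using that m0 by (auto simp: algebra_simps)
    then show ?thesis using 1 2 3 4 unfolding Y by blast
  qed
  show "\<exists>N. (\<forall>s\<ge>0. has_ito_integral M W s (\<lambda>r \<omega>. ?C *v Y r \<omega> + (C + C' + (D + D') ** K') *v m r) (N s)) \<and>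
      (\<forall>s\<ge>0. AE \<omega> in M. Y s \<omega> = 0 + (\<integral>r. ?A *v Y r \<omega> \<partial>time_measure s) + N s \<omega>)"
    using N eq by (intro exI[of _ ?N] conjI allI impI AE_I2)
  show "integral\<^sup>L M (Y t) = 0" if "0 \<le> t"
    using X that unfolding Y_def by (simp add: ito_process_def prob_space)
qed

lemma mf_fluctuation_covariance:
  fixes A A' C C' :: "real^'n^'n" and B B' D D' :: "real^'m^'n"
  assumes X: "mf_closed_loop M W A A' C C' B B' D D' K K' x X"
  defines "Y \<equiv> \<lambda>t \<omega>. X t \<omega> - integral\<^sup>L M (X t)" and "c \<equiv> \<lambda>t. (C + C' + (D + D') ** K') *v integral\<^sup>L M (X t)"
  defines "P \<equiv> \<lambda>t. \<integral>\<omega>. outer (Y t \<omega>) (Y t \<omega>) \<partial>M"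
  shows "0 \<le> t \<Longrightarrow> P t = (\<integral>s. lyapunov (A + B ** K) (C + D ** K) (P s) + outer (c s) (c s) \<partial>time_measure t)"
    "integrable (time_measure T) P" "0 \<le> t \<Longrightarrow> trace (P t) = (\<integral>\<omega>. (norm (Y t \<omega>))\<^sup>2 \<partial>M)"
    "0 \<le> t \<Longrightarrow> transpose (P t) = P t"
proof -
  have Yc: "Y t \<omega> = X t \<omega> - integral\<^sup>L M (X t)" "c t = (C + C' + (D + D') ** K') *v integral\<^sup>L M (X t)" for t \<omega>
    by (simp_all add: Y_def c_def)
  note d = mf_decomposition[OF X, folded Yc]
  from d(5) obtain N where
    "(\<forall>s\<ge>0. has_ito_integral M W s (\<lambda>r \<omega>. (C + D ** K) *v Y r \<omega> + c r) (N s)) \<and>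
     (\<forall>s\<ge>0. AE \<omega> in M. Y s \<omega> = 0 + (\<integral>r. (A + B ** K) *v Y r \<omega> \<partial>time_measure s) + N s \<omega>)" ..
  note N = this[THEN conjunct1, rule_format] this[THEN conjunct2, rule_format]
  have o: "outer 0 0 = 0" by (simp add: outer_def vec_eq_iff)
  have P: "(\<integral>\<omega>. outer (Y t \<omega>) (Y t \<omega>) \<partial>M) = P t" for t by (simp add: P_def)
  note sm = second_moment[OF d(4) N disjI1[OF d(6)], unfolded P]
  show "0 \<le> t \<Longrightarrow> P t = (\<integral>s. lyapunov (A + B ** K) (C + D ** K) (P s) + outer (c s) (c s) \<partial>time_measure t)"
    by (rule sm(1)[unfolded o add_0_left])
  show "integrable (time_measure T) P" by (rule sm(2))
  show "0 \<le> t \<Longrightarrow> trace (P t) = (\<integral>\<omega>. (norm (Y t \<omega>))\<^sup>2 \<partial>M)" by (rule sm(3))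
  show "0 \<le> t \<Longrightarrow> transpose (P t) = P t" by (rule sm(4))
qed

lemma energy_bound_linear:
  fixes L :: "'b::euclidean_space \<Rightarrow> 'c::euclidean_space"
  assumes X: "continuous_process X" and L: "bounded_linear L"
    and c: "\<And>T. 0 \<le> T \<Longrightarrow> (\<integral>s. (\<integral>\<omega>. (norm (X s \<omega>))\<^sup>2 \<partial>M) \<partial>time_measure T) \<le> c"
  shows "\<exists>d. \<forall>T\<ge>0. (\<integral>s. (\<integral>\<omega>. (norm (L (X s \<omega>)))\<^sup>2 \<partial>M) \<partial>time_measure T) \<le> d"
proof -
  obtain k where k: "0 < k" "\<And>v. norm (L v) \<le> k * norm v" using bounded_linear_bound[OF L] by blast
  have LX: "continuous_process (\<lambda>t \<omega>. L (X t \<omega>))" by (rule continuous_process_linear[OF L X])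
  have "(\<integral>s. (\<integral>\<omega>. (norm (L (X s \<omega>)))\<^sup>2 \<partial>M) \<partial>time_measure T) \<le> k\<^sup>2 * c" if T: "0 \<le> T" for T
  proof -
    have "(\<integral>s. (\<integral>\<omega>. (norm (L (X s \<omega>)))\<^sup>2 \<partial>M) \<partial>time_measure T) \<le> (\<integral>s. k\<^sup>2 * (\<integral>\<omega>. (norm (X s \<omega>))\<^sup>2 \<partial>M) \<partial>time_measure T)"
    proof (rule integral_mono[OF continuous_process_energy(1)[OF LX]])
      show "integrable (time_measure T) (\<lambda>s. k\<^sup>2 * (\<integral>\<omega>. (norm (X s \<omega>))\<^sup>2 \<partial>M))"
        using continuous_process_energy(1)[OF X] by simp
      fix s assume "s \<in> space (time_measure T)"
      then have s: "0 \<le> s" by simp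
      have "(\<integral>\<omega>. (norm (L (X s \<omega>)))\<^sup>2 \<partial>M) \<le> (\<integral>\<omega>. k\<^sup>2 * (norm (X s \<omega>))\<^sup>2 \<partial>M)"
        using square_integrable_sq[OF continuous_processD(3)[OF LX s]] square_integrable_sq[OF continuous_processD(3)[OF X s]]
          power_mono[OF k(2) norm_ge_zero, of _ 2]
        by (intro integral_mono) (auto simp: power_mult_distrib)
      then show "(\<integral>\<omega>. (norm (L (X s \<omega>)))\<^sup>2 \<partial>M) \<le> k\<^sup>2 * (\<integral>\<omega>. (norm (X s \<omega>))\<^sup>2 \<partial>M)" by simp
    qed
    also have "\<dots> \<le> k\<^sup>2 * c" using c[OF T] by (simp add: mult_left_mono)
    finally show ?thesis .
  qed
  then show ?thesis by blast
qed

lemma energy_bound_add: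
  assumes X: "continuous_process X" and Z: "continuous_process Z"
    and c: "\<And>T. 0 \<le> T \<Longrightarrow> (\<integral>s. (\<integral>\<omega>. (norm (X s \<omega>))\<^sup>2 \<partial>M) \<partial>time_measure T) \<le> c"
    and d: "\<And>T. 0 \<le> T \<Longrightarrow> (\<integral>s. (\<integral>\<omega>. (norm (Z s \<omega>))\<^sup>2 \<partial>M) \<partial>time_measure T) \<le> d"
    and T: "0 \<le> T"
  shows "(\<integral>s. (\<integral>\<omega>. (norm (X s \<omega> + Z s \<omega>))\<^sup>2 \<partial>M) \<partial>time_measure T) \<le> 2 * c + 2 * d"
proof -
  note XZ = continuous_process_add[OF X Z]
  note i = continuous_process_energy(1)[OF X, of T] continuous_process_energy(1)[OF Z, of T]
  have "(\<integral>s. (\<integral>\<omega>. (norm (X s \<omega> + Z s \<omega>))\<^sup>2 \<partial>M) \<partial>time_measure T)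
    \<le> (\<integral>s. 2 * (\<integral>\<omega>. (norm (X s \<omega>))\<^sup>2 \<partial>M) + 2 * (\<integral>\<omega>. (norm (Z s \<omega>))\<^sup>2 \<partial>M) \<partial>time_measure T)"
  proof (rule integral_mono[OF continuous_process_energy(1)[OF XZ]])
    show "integrable (time_measure T) (\<lambda>s. 2 * (\<integral>\<omega>. (norm (X s \<omega>))\<^sup>2 \<partial>M) + 2 * (\<integral>\<omega>. (norm (Z s \<omega>))\<^sup>2 \<partial>M))" using i by simp
    fix s assume "s \<in> space (time_measure T)"
    then have "0 \<le> s" by simp
    then show "(\<integral>\<omega>. (norm (X s \<omega> + Z s \<omega>))\<^sup>2 \<partial>M) \<le> 2 * (\<integral>\<omega>. (norm (X s \<omega>))\<^sup>2 \<partial>M) + 2 * (\<integral>\<omega>. (norm (Z s \<omega>))\<^sup>2 \<partial>M)"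
      by (intro square_integrable_add(2) continuous_processD(3) X Z)
  qed
  also have "\<dots> \<le> 2 * c + 2 * d" using i c[OF T] d[OF T] by simp
  finally show ?thesis .
qed

lemma mf_cost_finite:
  fixes A A' C C' :: "real^'n^'n" and B B' D D' :: "real^'m^'n"
  assumes X: "mf_closed_loop M W A A' C C' B B' D D' K K' x X"
    and m: "\<And>T. 0 \<le> T \<Longrightarrow> (\<integral>s. (norm (integral\<^sup>L M (X s)))\<^sup>2 \<partial>time_measure T) \<le> c"
    and Y: "\<And>T. 0 \<le> T \<Longrightarrow> (\<integral>s. (\<integral>\<omega>. (norm (X s \<omega> - integral\<^sup>L M (X s)))\<^sup>2 \<partial>M) \<partial>time_measure T) \<le> d"
  shows "infinite_horizon_cost M X (mf_feedback_control M K K' X) < \<infinity>"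
proof -
  note bl = matrix_vector_mul_bounded_linear
  note dec = mf_decomposition[OF X]
  let ?m = "\<lambda>s \<omega>. integral\<^sup>L M (X s)" and ?Y = "\<lambda>s \<omega>. X s \<omega> - integral\<^sup>L M (X s)"
  have mp: "continuous_process ?m" by (rule continuous_process_deterministic[OF linear_ode_continuous[OF dec(1)]])
  have mb: "(\<integral>s. (\<integral>\<omega>. (norm (?m s \<omega>))\<^sup>2 \<partial>M) \<partial>time_measure T) \<le> c" if "0 \<le> T" for T
    using m[OF that] by (simp add: prob_space)
  obtain c' where c': "\<And>T. 0 \<le> T \<Longrightarrow> (\<integral>s. (\<integral>\<omega>. (norm (K' *v ?m s \<omega>))\<^sup>2 \<partial>M) \<partial>time_measure T) \<le> c'"
    using energy_bound_linear[OF mp bl[of K'] mb] by blast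
  obtain d' where d': "\<And>T. 0 \<le> T \<Longrightarrow> (\<integral>s. (\<integral>\<omega>. (norm (K *v ?Y s \<omega>))\<^sup>2 \<partial>M) \<partial>time_measure T) \<le> d'"
    using energy_bound_linear[OF dec(4) bl[of K] Y] by blast
  note lp = continuous_process_linear[OF bl[of K] dec(4)] continuous_process_linear[OF bl[of K'] mp]
  have u: "mf_feedback_control M K K' X = (\<lambda>s \<omega>. K *v ?Y s \<omega> + K' *v ?m s \<omega>)"
    by (simp add: fun_eq_iff mf_feedback_control_def)
  show ?thesis
    unfolding u
  proof (rule infinite_horizon_cost_finite[OF dec(3) continuous_process_add[OF lp]])
    show "(\<integral>s. (\<integral>\<omega>. (norm (X s \<omega>))\<^sup>2 \<partial>M) \<partial>time_measure T) \<le> 2 * d + 2 * c" if "0 \<le> T" for T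
      using energy_bound_add[OF dec(4) mp Y mb that] by simp
    show "(\<integral>s. (\<integral>\<omega>. (norm (K *v ?Y s \<omega> + K' *v ?m s \<omega>))\<^sup>2 \<partial>M) \<partial>time_measure T) \<le> 2 * d' + 2 * c'" if "0 \<le> T" for T
      by (rule energy_bound_add[OF lp d' c' that])
  qed
qed

section \<open>Necessary and sufficient conditions for mean-field stabilizability\<close>

text \<open>Since closed-loop solutions exist for every \<open>x\<close>, the means start at
  arbitrary points, as the spectral criterion demands.\<close>

lemma mf_stabilizable_imp_ode_stabilizable:
  fixes A A' C C' :: "real^'n^'n" and B B' D D' :: "real^'m^'n"
  assumes "MF_L2_stabilizable M W A A' C C' B B' D D'"
  shows "ode_stabilizable (A + A') (B + B')"
proof -
  obtain K K' :: "real^'n^'m" where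
    ex: "\<And>x. \<exists>X. mf_closed_loop M W A A' C C' B B' D D' K K' x X" and
    cost: "\<And>x X. mf_closed_loop M W A A' C C' B B' D D' K K' x X \<Longrightarrow> infinite_horizon_cost M X (mf_feedback_control M K K' X) < \<infinity>"
    using assms unfolding MF_L2_stabilizable_def by blast
  have "matrix_spectrum (A + A' + (B + B') ** K') \<subseteq> {z. Re z < 0}"
  proof (rule spectrum_of_square_integrable)
    fix x
    obtain X where X: "mf_closed_loop M W A A' C C' B B' D D' K K' x X" using ex by blast
    note d = mf_decomposition[OF X]
    note cost = cost[OF X]
    let ?m = "\<lambda>t. integral\<^sup>L M (X t)"
    have "(\<integral>s. (norm (?m s))\<^sup>2 \<partial>time_measure T) \<le> enn2real (infinite_horizon_cost M X (mf_feedback_control M K K' X))" for T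
    proof -
      have "(\<integral>s. (norm (?m s))\<^sup>2 \<partial>time_measure T) \<le> (\<integral>s. (\<integral>\<omega>. (norm (X s \<omega>))\<^sup>2 \<partial>M) \<partial>time_measure T)"
      proof (rule integral_mono[OF square_integrable_sq[OF square_integrable_continuous[OF linear_ode_continuous[OF d(1)]]] continuous_process_energy(1)[OF d(3)]])
        fix s assume "s \<in> space (time_measure T)"
        then show "(norm (?m s))\<^sup>2 \<le> (\<integral>\<omega>. (norm (X s \<omega>))\<^sup>2 \<partial>M)"
          by (intro norm_expectation_sq_le continuous_processD(3)[OF d(3)]) simp
      qed
      also have "\<dots> \<le> enn2real (infinite_horizon_cost M X (mf_feedback_control M K K' X))"
        by (rule infinite_horizon_cost_bound[OF d(3) cost])
      finally show ?thesis .
    qed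
    then show "\<exists>y. linear_ode ((*v) (A + A' + (B + B') ** K')) y \<and> y 0 = x \<and> (\<exists>C. \<forall>T\<ge>0. (\<integral>s. (norm (y s))\<^sup>2 \<partial>time_measure T) \<le> C)"
      using d(1,2) by (intro exI[of _ ?m]) blast
  qed
  then show ?thesis unfolding ode_stabilizable_def by blast
qed

text \<open>The common part of both sufficient conditions. Existence and the energy of the mean are
  settled by \<open>K'\<close>; what is left is to bound the energy of the fluctuation for a
  suitable \<open>K\<close>.\<close>

lemma mf_stabilizableI:
  fixes A A' C C' :: "real^'n^'n" and B B' D D' :: "real^'m^'n"
  assumes K': "matrix_spectrum (A + A' + (B + B') ** K') \<subseteq> {z. Re z < 0}"
    and Y: "\<And>x X c. mf_closed_loop M W A A' C C' B B' D D' K K' x X \<Longrightarrow>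
      (\<And>T. 0 \<le> T \<Longrightarrow> (\<integral>s. (norm (integral\<^sup>L M (X s)))\<^sup>2 \<partial>time_measure T) \<le> c) \<Longrightarrow>
      \<exists>d. \<forall>T\<ge>0. (\<integral>s. (\<integral>\<omega>. (norm (X s \<omega> - integral\<^sup>L M (X s)))\<^sup>2 \<partial>M) \<partial>time_measure T) \<le> d"
  shows "MF_L2_stabilizable M W A A' C C' B B' D D'"
  unfolding MF_L2_stabilizable_def
proof (rule exI[of _ K], rule exI[of _ K'], intro allI conjI impI mf_closed_loop_exists)
  fix x X assume X: "mf_closed_loop M W A A' C C' B B' D D' K K' x X"
  obtain c where c: "\<And>T. 0 \<le> T \<Longrightarrow> (\<integral>s. (norm (integral\<^sup>L M (X s)))\<^sup>2 \<partial>time_measure T) \<le> c"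
    using hurwitz_square_integrable[OF K' mf_decomposition(1)[OF X]] by blast
  obtain d where "\<And>T. 0 \<le> T \<Longrightarrow> (\<integral>s. (\<integral>\<omega>. (norm (X s \<omega> - integral\<^sup>L M (X s)))\<^sup>2 \<partial>M) \<partial>time_measure T) \<le> d"
    using Y[OF X c] by blast
  with mf_cost_finite[OF X c] show "infinite_horizon_cost M X (mf_feedback_control M K K' X) < \<infinity>" by blast
qed

lemma L2_stabilizable_lyapunov_functional:
  fixes A C :: "real^'n^'n" and B D :: "real^'m^'n"
  assumes "L2_stabilizable M W A C B D"
  obtains K :: "real^'n^'m" and \<psi> where "bounded_linear \<psi>"
    "\<And>S. transpose S = S \<Longrightarrow> \<psi> (lyapunov (A + B ** K) (C + D ** K) S) = - trace S" "\<And>x. 0 \<le> \<psi> (outer x x)"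
proof -
  obtain K :: "real^'n^'m" where K: "\<And>x. \<exists>X. sde_closed_loop M W A C B D K x X"
    "\<And>x X. sde_closed_loop M W A C B D K x X \<Longrightarrow> infinite_horizon_cost M X (\<lambda>t \<omega>. K *v X t \<omega>) < \<infinity>"
    using assms unfolding L2_stabilizable_def by blast
  have "\<exists>P c. (\<forall>t\<ge>0. P t = outer x x + (\<integral>s. lyapunov (A + B ** K) (C + D ** K) (P s) \<partial>time_measure t)) \<and>
     (\<forall>T. integrable (time_measure T) P) \<and> (\<forall>T\<ge>0. (\<integral>s. norm (P s) \<partial>time_measure T) \<le> c) \<and>
     (\<forall>t\<ge>0. transpose (P t) = P t \<and> 0 \<le> trace (P t))" for x
  proof -
    obtain X where X: "sde_closed_loop M W A C B D K x X" using K(1) by blast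
    show ?thesis by (rule sde_second_moment[OF X[unfolded sde_closed_loop_def] K(2)[OF X]])
  qed
  then show ?thesis
  proof (rule lyapunov_functional)
    fix \<psi> :: "real^'n^'n \<Rightarrow> real" assume \<psi>: "bounded_linear \<psi>"
      "\<And>S. transpose S = S \<Longrightarrow> \<psi> (lyapunov (A + B ** K) (C + D ** K) S) = - trace S" "\<And>x. 0 \<le> \<psi> (outer x x)"
    show ?thesis by (rule that[OF \<psi>])
  qed
qed

lemma mf_stabilizable_if_stabilizable:
  fixes A A' C C' :: "real^'n^'n" and B B' D D' :: "real^'m^'n"
  assumes "ode_stabilizable (A + A') (B + B')" "L2_stabilizable M W A C B D"
  shows "MF_L2_stabilizable M W A A' C C' B B' D D'"
proof -
  obtain K' :: "real^'n^'m" where K': "matrix_spectrum (A + A' + (B + B') ** K') \<subseteq> {z. Re z < 0}"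
    using assms(1) unfolding ode_stabilizable_def by blast
  show ?thesis
  proof (rule L2_stabilizable_lyapunov_functional[OF assms(2)], rule mf_stabilizableI[OF K'])
    fix K :: "real^'n^'m" and \<psi> :: "real^'n^'n \<Rightarrow> real" assume \<psi>: "bounded_linear \<psi>"
      "\<And>S. transpose S = S \<Longrightarrow> \<psi> (lyapunov (A + B ** K) (C + D ** K) S) = - trace S" "\<And>x. 0 \<le> \<psi> (outer x x)"
    fix x X k
    assume X: "mf_closed_loop M W A A' C C' B B' D D' K K' x X"
      and k: "\<And>T. 0 \<le> T \<Longrightarrow> (\<integral>s. (norm (integral\<^sup>L M (X s)))\<^sup>2 \<partial>time_measure T) \<le> k"
    let ?L = "C + C' + (D + D') ** K'"
    define c where "c t = ?L *v integral\<^sup>L M (X t)" for t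
    define Y where "Y t \<omega> = X t \<omega> - integral\<^sup>L M (X t)" for t \<omega>
    define P where "P t = (\<integral>\<omega>. outer (Y t \<omega>) (Y t \<omega>) \<partial>M)" for t
    note cov = mf_fluctuation_covariance[OF X, folded Y_def c_def, folded P_def]
    note d = mf_decomposition[OF X, folded Y_def]
    have cc: "continuous_on {0..} c"
      unfolding c_def by (rule bounded_linear.continuous_on[OF matrix_vector_mul_bounded_linear linear_ode_continuous[OF d(1)]])
    obtain q where q: "0 < q" "\<And>S. norm (\<psi> S) \<le> q * norm S" using bounded_linear_bound[OF \<psi>(1)] by blast
    obtain l where l: "0 < l" "\<And>v. norm (?L *v v) \<le> l * norm v"
      using bounded_linear_bound[OF matrix_vector_mul_bounded_linear[of ?L]] by blast
    \<comment> \<open>The constant is a product of three bounds: \<open>q\<close> for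
      \<open>\<psi>\<close>, \<open>l\<close> for the map from the mean to the source (squared), and
      \<open>k\<close> for the energy of the mean.\<close>
    have "(\<integral>s. (\<integral>\<omega>. (norm (Y s \<omega>))\<^sup>2 \<partial>M) \<partial>time_measure T) \<le> q * (l\<^sup>2 * k)" if T: "0 \<le> T" for T
    proof -
      note lyi = integrable_bounded_linear[OF bounded_linear_lyapunov cov(2)[of T]]
      have oc: "integrable (time_measure T) (\<lambda>s. outer (c s) (c s))"
        by (rule continuous_on_time_measure(1)[OF bounded_bilinear.continuous_on[OF bounded_bilinear_outer cc cc]])
      note i = Bochner_Integration.integrable_add[OF lyi oc]
      note \<psi>oc = integrable_bounded_linear[OF \<psi>(1) oc]
      note Yi = continuous_process_energy(1)[OF d(4), of T]
      \<comment> \<open>\<open>P T\<close> is an average of matrices \<open>outer v v\<close>, on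
        which \<open>\<psi>\<close> is nonnegative. Dropping this term leaves the energy of
        \<open>Y\<close> bounded by the contribution of the source.\<close>
      have P0: "0 \<le> \<psi> (P T)"
      proof -
        have "\<psi> (P T) = (\<integral>\<omega>. \<psi> (outer (Y T \<omega>) (Y T \<omega>)) \<partial>M)"
          unfolding P_def
          by (rule integral_bounded_linear[OF \<psi>(1), symmetric])
            (rule square_integrable_bilinear[OF bounded_bilinear_outer continuous_processD(3)[OF d(4) T] continuous_processD(3)[OF d(4) T]])
        then show ?thesis using \<psi>(3) by (simp add: integral_nonneg_AE)
      qed
      have "\<psi> (P T) = \<psi> (\<integral>s. lyapunov (A + B ** K) (C + D ** K) (P s) + outer (c s) (c s) \<partial>time_measure T)"
        using cov(1)[OF T] by simp
      also have "\<dots> = (\<integral>s. \<psi> (lyapunov (A + B ** K) (C + D ** K) (P s) + outer (c s) (c s)) \<partial>time_measure T)"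
        by (rule integral_bounded_linear[OF \<psi>(1) i, symmetric])
      also have "\<dots> = (\<integral>s. \<psi> (outer (c s) (c s)) - (\<integral>\<omega>. (norm (Y s \<omega>))\<^sup>2 \<partial>M) \<partial>time_measure T)"
      proof (rule Bochner_Integration.integral_cong[OF refl])
        fix s assume "s \<in> space (time_measure T)"
        then have s: "0 \<le> s" by simp
        show "\<psi> (lyapunov (A + B ** K) (C + D ** K) (P s) + outer (c s) (c s)) = \<psi> (outer (c s) (c s)) - (\<integral>\<omega>. (norm (Y s \<omega>))\<^sup>2 \<partial>M)"
          unfolding linear_add[OF bounded_linear.linear[OF \<psi>(1)]] \<psi>(2)[OF cov(4)[OF s]] cov(3)[OF s] by simp
      qed
      also have "\<dots> = (\<integral>s. \<psi> (outer (c s) (c s)) \<partial>time_measure T) - (\<integral>s. (\<integral>\<omega>. (norm (Y s \<omega>))\<^sup>2 \<partial>M) \<partial>time_measure T)"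
        by (rule Bochner_Integration.integral_diff[OF \<psi>oc Yi])
      finally have "(\<integral>s. (\<integral>\<omega>. (norm (Y s \<omega>))\<^sup>2 \<partial>M) \<partial>time_measure T) \<le> (\<integral>s. \<psi> (outer (c s) (c s)) \<partial>time_measure T)"
        using P0 by simp
      also have "\<dots> \<le> (\<integral>s. q * (l\<^sup>2 * (norm (integral\<^sup>L M (X s)))\<^sup>2) \<partial>time_measure T)"
      proof (rule integral_mono[OF \<psi>oc])
        show "integrable (time_measure T) (\<lambda>s. q * (l\<^sup>2 * (norm (integral\<^sup>L M (X s)))\<^sup>2))"
          using square_integrable_sq[OF square_integrable_continuous[OF linear_ode_continuous[OF d(1)]]] by simp
        fix s
        have "\<psi> (outer (c s) (c s)) \<le> q * (norm (c s))\<^sup>2" using q(2)[of "outer (c s) (c s)"] by (simp add: norm_outer)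
        also have "\<dots> \<le> q * (l * norm (integral\<^sup>L M (X s)))\<^sup>2"
          using q(1) l(2) by (intro mult_left_mono power_mono) (auto simp: c_def)
        finally show "\<psi> (outer (c s) (c s)) \<le> q * (l\<^sup>2 * (norm (integral\<^sup>L M (X s)))\<^sup>2)" by (simp add: power_mult_distrib)
      qed
      also have "\<dots> \<le> q * (l\<^sup>2 * k)" using k[OF T] q(1) by (simp add: mult_left_mono)
      finally show ?thesis .
    qed
    then show "\<exists>d. \<forall>T\<ge>0. (\<integral>s. (\<integral>\<omega>. (norm (X s \<omega> - integral\<^sup>L M (X s)))\<^sup>2 \<partial>M) \<partial>time_measure T) \<le> d"
      unfolding Y_def by blast
  qed
qed

text \<open>With the source gone, the covariance of the fluctuation solves a homogeneous linear
  equation from 0 and vanishes, whatever the gain of the fluctuation; \<open>K = 0\<close> is the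
  simplest choice.\<close>

lemma mf_stabilizable_if_noise_free:
  fixes A A' C C' :: "real^'n^'n" and B B' D D' :: "real^'m^'n"
  assumes C: "C + C' + (D + D') ** K' = 0" and K': "matrix_spectrum (A + A' + (B + B') ** K') \<subseteq> {z. Re z < 0}"
  shows "MF_L2_stabilizable M W A A' C C' B B' D D'"
proof (rule mf_stabilizableI[OF K', where K=0])
  fix x X k
  assume X: "mf_closed_loop M W A A' C C' B B' D D' 0 K' x X"
  define Y where "Y t \<omega> = X t \<omega> - integral\<^sup>L M (X t)" for t \<omega>
  define P where "P t = (\<integral>\<omega>. outer (Y t \<omega>) (Y t \<omega>) \<partial>M)" for t
  let ?f = "lyapunov (A + B ** 0) (C + D ** 0)"
  have o: "outer 0 0 = 0" by (simp add: outer_def vec_eq_iff)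
  note cov = mf_fluctuation_covariance[OF X, folded Y_def, folded P_def, unfolded C matrix_vector_mult_0 o add_0_right]
  note bl = bounded_linear_lyapunov
  have ode: "linear_ode ?f P"
    by (rule linear_ode_from_integral[OF bl _ integrable_bounded_linear[OF bl cov(2)], where ?y0.0=0]) (unfold add_0_left, rule cov(1))
  have P0: "P 0 = 0" using cov(1)[of 0] by (simp add: time_measure_0)
  have "(\<integral>\<omega>. (norm (Y t \<omega>))\<^sup>2 \<partial>M) = 0" if t: "0 \<le> t" for t
    using cov(3)[OF t] linear_ode_zero[OF bl ode P0 t] by (simp add: trace_def)
  then have "(\<integral>s. (\<integral>\<omega>. (norm (Y s \<omega>))\<^sup>2 \<partial>M) \<partial>time_measure T) = 0" for T
    by (subst Bochner_Integration.integral_cong[OF refl, of _ _ "\<lambda>_. 0"]) auto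
  then show "\<exists>d. \<forall>T\<ge>0. (\<integral>s. (\<integral>\<omega>. (norm (X s \<omega> - integral\<^sup>L M (X s)))\<^sup>2 \<partial>M) \<partial>time_measure T) \<le> d"
    unfolding Y_def by (intro exI[of _ 0]) simp
qed

end

theorem corollary4p4:
  fixes M :: "'a measure" and W :: "real \<Rightarrow> 'a \<Rightarrow> real"
    and A A' C C' :: "real^'n^'n" and B B' D D' :: "real^'m^'n"
  assumes "standard_brownian_motion M W"
  shows "(MF_L2_stabilizable M W A A' C C' B B' D D' \<longrightarrow> ode_stabilizable (A + A') (B + B'))
    \<and> (ode_stabilizable (A + A') (B + B') \<and> L2_stabilizable M W A C B D
         \<longrightarrow> MF_L2_stabilizable M W A A' C C' B B' D D')
    \<and> ((\<exists>K' :: real^'n^'m. C + C' + (D + D') ** K' = 0 \<and>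
           matrix_spectrum (A + A' + (B + B') ** K') \<subseteq> {z. Re z < 0})
         \<longrightarrow> MF_L2_stabilizable M W A A' C C' B B' D D')"
proof -
  interpret standard_brownian_motion M W by fact
  show ?thesis
    by (intro conjI impI; (elim conjE exE)?)
      (rule mf_stabilizable_imp_ode_stabilizable mf_stabilizable_if_stabilizable mf_stabilizable_if_noise_free; assumption)+
qed

end
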